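(* Let $s=\sigma+it$ with $\sigma\in[0,1]$ and $|t|>t_0\geq 2\pi$. Let $x,y\geq 1$ with $2\pi xy=|t|$ and $x\leq y$. Let $r_0,c,\lambda_0,d$ be real numbers satisfying: (a) $0<r_0\leq\pi/\sqrt{2}$; (b) $\frac{r_0x}{|t|}\leq c\leq \frac{3\sqrt{2}}{10+4(1-\sigma)/t_0}$; (c) $r_0\leq\lambda_0\leq \frac{c|t|}{x}$; (d) $d\geq \frac{\pi x}{2\lfloor x\rfloor}$. Define (all quantities depending on $\sigma,t,x,y,r_0,c,\lambda_0,d$): $\mathcal{E}_1=2c^2+2c+1$, $\;\mathcal{E}_2= d-c+\frac{x}{|t|}\log{\frac{1-e^{-d|t|/x}}{1-e^{-c|t|/x}}}$, $\;\mathcal{E}_3= \frac{x}{\lfloor x\rfloor\sqrt{\pi |t|}\left(e^{d|t|/x}-1\right)}$, $\;\Phi_1(u)= u-\arctan{\frac{u}{1+u}}$, $\;\Phi_2=\frac{d\lfloor x\rfloor}{x}-\frac{\pi}{2}$, and \[ E_1 = \mathcal{E}_1^{\frac{\sigma-1}{2}}\left(\sqrt{\tfrac{|t|}{\pi}}\,\mathcal{E}_2e^{-|t|\Phi_1(c)}+\mathcal{E}_3e^{-|t|\Phi_2}\right); \] $\mathcal{E}_4= 1-\frac{(1-\sigma+|t|)2\sqrt{2}c}{3|t|\left(1-c\sqrt{2}\right)}$, $\;\mathcal{E}_5=\lambda_0\left(x-\lfloor x\rfloor\right)+\frac{(1-\sigma)^2}{4|t|\mathcal{E}_4}$, \[ \mathcal{E}_6=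 \frac{(1-\sigma)r_0}{2\pi\lfloor y\rfloor} +\frac{r_0\left(xy-\lfloor y\rfloor\lfloor x\rfloor\right)}{\lfloor y\rfloor}+\frac{r_0^2xy\left(1+\frac{1-\sigma}{|t|}\right)\left(\frac{1}{2}+\frac{r_0}{3(2\pi\lfloor y\rfloor-r_0)}\right)}{2\pi\lfloor y\rfloor^2}, \] \[ E_2 = \sqrt{\frac{2}{\mathcal{E}_4}}\left(\frac{1}{1-e^{-r_0/\sqrt{2}}}+\frac{1}{e^{\lambda_0}-1}\right)e^{\mathcal{E}_5}+\frac{r_0}{1-e^{-r_0/\sqrt{2}}}\sqrt{\frac{x}{2y}}\left(1+\frac{1}{y}\right)^{\sigma-1}e^{\mathcal{E}_6}; \] \[ E_3 = c^{\sigma-1}\frac{2-c+\frac{\pi x}{|t|}}{1-e^{-c|t|/x}}\sqrt{\frac{|t|}{\pi}}\,e^{-|t|\Phi_1(-c)}; \] $\Phi_3= \frac{\pi}{2} + \arctan\left(\frac{1}{c}\left(1+\frac{\pi x(1-2\{y\})}{|t|}\right)\right)-\frac{\lfloor x\rfloor}{x}c$ (where $\{y\}=y-\lfloor y\rfloor$), and \[ E_4 = \frac{x\left(1-\frac{\pi x}{|t|}\right)^{\sigma-1}}{\lfloor x\rfloor\left(1-e^{-r_0/\sqrt{2}}\right)\sqrt{\pi |t|}}e^{-|t|\Phi_3}. \] Let $C_2(t)=\exp\left(\frac{1}{12|t|}+\frac{1}{90|t|^3}\right)$ and $E=E(\sigma)= 2^{-\sigma}C_2(t)\left(E_1+E_2+E_3+E_4\right)$;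 write $E(1-\sigma)$ for the same expression with $\sigma$ replaced by $1-\sigma$ throughout. Then \[ \left|R_1\left(s;x,y\right)\right|\leq x^{-\sigma}E, \qquad \left|R_1\left(s;y,x\right)\right|\leq \left(\frac{|t|}{2\pi}\right)^{\frac{1}{2}-\sigma}x^{\sigma-1}F, \] where $F=E$ if $\sigma=1/2$ or $x=y$, and otherwise \[ \frac{F}{E\left(1-\sigma\right)}\leq \begin{cases} 1+\frac{\left|C\left(\sigma,t\right)\right|}{|t|}, & \sigma\in(1/2,1], \\ 1+\frac{\left|C\left(1-\sigma,t\right)\right|}{|t|-\left|C\left(1-\sigma,t\right)\right|}, & \sigma\in[0,1/2). \end{cases} \] Moreover, if $c,d,\lambda_0$ and $r_0$ are fixed, then $E$ is bounded and $E_1,E_3,E_4$ are decreasing to zero as $t\to\infty$.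
   Context: $\zeta(s)$ is the Riemann zeta-function and $\chi(s)=2^s\pi^{s-1}\sin\left(\frac{\pi s}{2}\right)\Gamma(1-s)$. For $a,b\ge1$ with $2\pi ab=|t|$, $R_1(s;a,b)$ is defined by $\zeta(s)=\sum_{n\le a}n^{-s}+\chi(s)\sum_{n\le b}n^{s-1}+R_1(s;a,b)$. Let $\widetilde{\chi}(\sigma+it)= (2\pi/|t|)^{\sigma-1/2}(|t|/(2\pi e))^{-it}e^{\operatorname{sgn}(t)\pi i/4}$; the quantity $C(\sigma,t)$ (for $\sigma+it$ with $t\neq 0$) is defined by $\chi(\sigma+it)=\widetilde{\chi}(\sigma+it)\left(1+C(\sigma,t)/|t|\right)$.
   Formalization: Each bound (and boundedness of E) is stated where the 𝓔₄ inside the E it uses is positive (else E or E(1−σ) is undefined, e.g. σ=1, c=3√2/10); "decreasing" means eventually, for each fixed x, as it can fail when x varies with t. *)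

theory Defs
  imports "HOL-Complex_Analysis.Complex_Analysis"
begin

(* The Riemann zeta function: the analytic continuation of its Dirichlet series to the
   complex plane without 1. The identity theorem makes it unique there; its value at 1 is
   left unspecified. *)
definition zeta :: "complex \<Rightarrow> complex" where
  "zeta = (SOME f. f holomorphic_on (- {1}) \<and>
             (\<forall>s. Re s > 1 \<longrightarrow> (\<lambda>n. of_nat (Suc n) powr (- s)) sums f s))"

definition chi :: "complex \<Rightarrow> complex" where
  "chi s = 2 powr s * of_real pi powr (s - 1) * sin (of_real pi * s / 2) * Gamma (1 - s)"

(* Meant for a, b \<ge> 1 with 2 \<pi> a b = |Im s|. *)
definition R1 :: "complex \<Rightarrow> real \<Rightarrow> real \<Rightarrow> complex" where
  "R1 s a b = zeta s - (\<Sum>n = 1..nat \<lfloor>a\<rfloor>. of_nat n powr (- s))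
                     - chi s * (\<Sum>n = 1..nat \<lfloor>b\<rfloor>. of_nat n powr (s - 1))"

definition chi_tilde :: "real \<Rightarrow> real \<Rightarrow> complex" where
  "chi_tilde \<sigma> t = of_real ((2 * pi / \<bar>t\<bar>) powr (\<sigma> - 1 / 2))
       * of_real (\<bar>t\<bar> / (2 * pi * exp 1)) powr (- \<i> * of_real t)
       * exp (of_real (sgn t) * of_real pi * \<i> / 4)"

(* chi (Complex \<sigma> t) = chi_tilde \<sigma> t * (1 + Cerr \<sigma> t / |t|), solved for Cerr; for t \<noteq> 0 the
   factor chi_tilde \<sigma> t is nonzero. *)
definition Cerr :: "real \<Rightarrow> real \<Rightarrow> complex" where
  "Cerr \<sigma> t = of_real \<bar>t\<bar> * (chi (Complex \<sigma> t) / chi_tilde \<sigma> t - 1)"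

definition calE1 :: "real \<Rightarrow> real" where
  "calE1 c = 2 * c\<^sup>2 + 2 * c + 1"

definition calE2 :: "real \<Rightarrow> real \<Rightarrow> real \<Rightarrow> real \<Rightarrow> real" where
  "calE2 t x c d = d - c
     + x / \<bar>t\<bar> * ln ((1 - exp (- d * \<bar>t\<bar> / x)) / (1 - exp (- c * \<bar>t\<bar> / x)))"

definition calE3 :: "real \<Rightarrow> real \<Rightarrow> real \<Rightarrow> real" where
  "calE3 t x d = x / (of_int \<lfloor>x\<rfloor> * sqrt (pi * \<bar>t\<bar>) * (exp (d * \<bar>t\<bar> / x) - 1))"

(* calE5 and E2 below are meaningful only where calE4 is positive: otherwise the total functions
   sqrt and / give arbitrary values there. *)
definition calE4 :: "real \<Rightarrow> real \<Rightarrow> real \<Rightarrow> real" where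
  "calE4 \<sigma> t c = 1 - (1 - \<sigma> + \<bar>t\<bar>) * 2 * sqrt 2 * c / (3 * \<bar>t\<bar> * (1 - c * sqrt 2))"

definition calE5 :: "real \<Rightarrow> real \<Rightarrow> real \<Rightarrow> real \<Rightarrow> real \<Rightarrow> real" where
  "calE5 \<sigma> t x c l0 = l0 * (x - of_int \<lfloor>x\<rfloor>) + (1 - \<sigma>)\<^sup>2 / (4 * \<bar>t\<bar> * calE4 \<sigma> t c)"

definition calE6 :: "real \<Rightarrow> real \<Rightarrow> real \<Rightarrow> real \<Rightarrow> real \<Rightarrow> real" where
  "calE6 \<sigma> t x y r0 =
     (1 - \<sigma>) * r0 / (2 * pi * of_int \<lfloor>y\<rfloor>)
     + r0 * (x * y - of_int \<lfloor>y\<rfloor> * of_int \<lfloor>x\<rfloor>) / of_int \<lfloor>y\<rfloor>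
     + r0\<^sup>2 * x * y * (1 + (1 - \<sigma>) / \<bar>t\<bar>)
         * (1 / 2 + r0 / (3 * (2 * pi * of_int \<lfloor>y\<rfloor> - r0)))
         / (2 * pi * (of_int \<lfloor>y\<rfloor>)\<^sup>2)"

definition Phi1 :: "real \<Rightarrow> real" where
  "Phi1 u = u - arctan (u / (1 + u))"

definition Phi2 :: "real \<Rightarrow> real \<Rightarrow> real" where
  "Phi2 x d = d * of_int \<lfloor>x\<rfloor> / x - pi / 2"

definition Phi3 :: "real \<Rightarrow> real \<Rightarrow> real \<Rightarrow> real \<Rightarrow> real" where
  "Phi3 t x y c = pi / 2 + arctan (1 / c * (1 + pi * x * (1 - 2 * frac y) / \<bar>t\<bar>))
                  - of_int \<lfloor>x\<rfloor> / x * c"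

definition E1 :: "real \<Rightarrow> real \<Rightarrow> real \<Rightarrow> real \<Rightarrow> real \<Rightarrow> real" where
  "E1 \<sigma> t x c d = calE1 c powr ((\<sigma> - 1) / 2)
     * (sqrt (\<bar>t\<bar> / pi) * calE2 t x c d * exp (- \<bar>t\<bar> * Phi1 c)
        + calE3 t x d * exp (- \<bar>t\<bar> * Phi2 x d))"

definition E2 :: "real \<Rightarrow> real \<Rightarrow> real \<Rightarrow> real \<Rightarrow> real \<Rightarrow> real \<Rightarrow> real \<Rightarrow> real" where
  "E2 \<sigma> t x y r0 c l0 =
     sqrt (2 / calE4 \<sigma> t c) * (1 / (1 - exp (- r0 / sqrt 2)) + 1 / (exp l0 - 1))
       * exp (calE5 \<sigma> t x c l0)
     + r0 / (1 - exp (- r0 / sqrt 2)) * sqrt (x / (2 * y)) * (1 + 1 / y) powr (\<sigma> - 1)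
       * exp (calE6 \<sigma> t x y r0)"

definition E3 :: "real \<Rightarrow> real \<Rightarrow> real \<Rightarrow> real \<Rightarrow> real" where
  "E3 \<sigma> t x c = c powr (\<sigma> - 1) * ((2 - c + pi * x / \<bar>t\<bar>) / (1 - exp (- c * \<bar>t\<bar> / x)))
     * sqrt (\<bar>t\<bar> / pi) * exp (- \<bar>t\<bar> * Phi1 (- c))"

definition E4 :: "real \<Rightarrow> real \<Rightarrow> real \<Rightarrow> real \<Rightarrow> real \<Rightarrow> real \<Rightarrow> real" where
  "E4 \<sigma> t x y r0 c =
     x * (1 - pi * x / \<bar>t\<bar>) powr (\<sigma> - 1)
       / (of_int \<lfloor>x\<rfloor> * (1 - exp (- r0 / sqrt 2)) * sqrt (pi * \<bar>t\<bar>))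
     * exp (- \<bar>t\<bar> * Phi3 t x y c)"

definition C2 :: "real \<Rightarrow> real" where
  "C2 t = exp (1 / (12 * \<bar>t\<bar>) + 1 / (90 * \<bar>t\<bar> ^ 3))"

definition Etotal ::
    "real \<Rightarrow> real \<Rightarrow> real \<Rightarrow> real \<Rightarrow> real \<Rightarrow> real \<Rightarrow> real \<Rightarrow> real \<Rightarrow> real" where
  "Etotal \<sigma> t x y r0 c l0 d = 2 powr (- \<sigma>) * C2 t
     * (E1 \<sigma> t x c d + E2 \<sigma> t x y r0 c l0 + E3 \<sigma> t x c + E4 \<sigma> t x y r0 c)"

definition admissible ::
    "real \<Rightarrow> real \<Rightarrow> real \<Rightarrow> real \<Rightarrow> real \<Rightarrow> real \<Rightarrow> real \<Rightarrow> real \<Rightarrow> real \<Rightarrow> bool" where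
  "admissible \<sigma> t0 r0 c l0 d t x y \<longleftrightarrow>
     \<bar>t\<bar> > t0 \<and> x \<ge> 1 \<and> y \<ge> 1 \<and> 2 * pi * x * y = \<bar>t\<bar> \<and> x \<le> y \<and>
     r0 * x / \<bar>t\<bar> \<le> c \<and> c \<le> 3 * sqrt 2 / (10 + 4 * (1 - \<sigma>) / t0) \<and>
     r0 \<le> l0 \<and> l0 \<le> c * \<bar>t\<bar> / x \<and>
     d \<ge> pi * x / (2 * of_int \<lfloor>x\<rfloor>)"

end

theory Submission
  imports Defs "HOL-Real_Asymp.Real_Asymp" "HOL-Probability.Distributions"
begin

text \<open>
  The proof does not follow the classical one but bounds the remainder directly and compares the
  result with the second summand of the stated error, which alone suffices. For
  \<open>0 < Re s < 1\<close> and \<open>t > 0\<close>, summation by residues at a quarter-integer abscissa \<open>a\<close> close to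
  \<open>y\<close> writes \<open>zeta s\<close> minus the sum over \<open>n \<le> y\<close> as integrals of \<open>z powr (- s)\<close> against
  \<open>1 / (exp (\<plusminus> 2 \<pi> i z) - 1)\<close> along the vertical rays from \<open>a\<close>. The first \<open>\<lfloor>x\<rfloor>\<close> terms of the geometric
  expansion of this kernel, rotated onto the imaginary axis, are Gamma integrals and give the dual
  sum. What is left is an integral over a path from \<open>- i a\<close> through \<open>a\<close> in direction \<open>1 + i\<close>, which
  passes the saddle point \<open>y\<close>; Gaussian integrals bound it. Letting the number of terms grow on the imaginary axis
  gives the functional equation, which together with an explicit Stirling formula transfers the
  estimate to the other remainder. The boundary cases \<open>Re s \<in> {0, 1}\<close> follow by continuity, and
  \<open>t < 0\<close> by complex conjugation.
\<close>


section \<open>The kernels of the contour integrals\<close>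

text \<open>The two kernels decay in opposite half-planes and add up to -1. This is why the part of
  the upper kernel left over by the dual sum recombines with the lower kernel on the segment from -
  i a to a, so that the remainder becomes one integral through the saddle. At a quarter-integer the
  number exp (2 pi i a) is purely imaginary; this keeps the denominator away from 0 along the path,
  with explicit constants (sqrt 2 on one arm, 21/20 on the other), and some a in 1/4 + N or 3/4 + N
  lies within 1/4 of y. The obstacle is numerical. Since t may be close to 2 pi, no error term is
  negligible, and the estimate must stay below the second summand of the stated error for every r0
  up to pi / sqrt 2, with a factor 1.035 set aside for the size of \<open>chi\<close>. Hence the
  split at frac x = 2/5. Below it, the linear decay with rate proportional to 1 - frac x, up to the
  shift a - y, controls the right arm. Above it that rate may degenerate and Gaussian decay takes
  over; its larger constant is paid for by the factor exp (r0 frac x) in the stated error.\<close>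

definition ker :: "real \<Rightarrow> complex \<Rightarrow> complex" where
  "ker e z = 1 / (exp (- (of_real (2 * pi * e) * \<i> * z)) - 1)"

lemma exp_ker_eq_1_iff:
  assumes "e \<in> {1, -1}"
  shows "exp (- (of_real (2 * pi * e) * \<i> * z)) = 1 \<longleftrightarrow> z \<in> \<int>"
proof
  assume "exp (- (of_real (2 * pi * e) * \<i> * z)) = 1"
  then obtain n :: int where n: "Re (- (of_real (2 * pi * e) * \<i> * z)) = 0"
      "Im (- (of_real (2 * pi * e) * \<i> * z)) = of_int (2 * n) * pi"
    unfolding exp_eq_1 by blast
  have "Im z = 0" using n(1) assms by auto
  moreover have "Re z = of_int (if e = 1 then - n else n)"
  proof (cases "e = 1")
    case True
    then have "pi * (- Re z) = pi * of_int n" using n(2) by simp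
    then have "- Re z = of_int n" by (metis mult_left_cancel pi_neq_zero)
    then show ?thesis using True by simp
  next
    case False
    then have "e = -1" using assms by auto
    then have "pi * Re z = pi * of_int n" using n(2) by simp
    then have "Re z = of_int n" by (metis mult_left_cancel pi_neq_zero)
    then show ?thesis using False by simp
  qed
  ultimately show "z \<in> \<int>" by (metis complex_is_Int_iff)
next
  assume "z \<in> \<int>"
  then obtain n where "z = of_int n" by (auto elim: Ints_cases)
  then show "exp (- (of_real (2 * pi * e) * \<i> * z)) = 1"
    unfolding exp_eq_1 using assms by (auto intro: exI[of _ "-n"] exI[of _ n])
qed

text \<open>With w = exp (2 pi i z) this is 1 / (1/w - 1) + 1 / (w - 1) = -1. It trades one kernel
  for the other at the price of the bare power, whose integral is elementary.\<close>

lemma ker_add: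
  assumes "z \<notin> \<int>"
  shows "ker 1 z + ker (-1) z = -1"
proof -
  define w where "w = exp (2 * pi * \<i> * z)"
  have w: "w \<noteq> 1" "w \<noteq> 0" using exp_ker_eq_1_iff[of "-1" z] assms by (auto simp: w_def)
  have "exp (- (of_real (2 * pi * 1) * \<i> * z)) = 1 / w" "exp (- (of_real (2 * pi * (-1)) * \<i> * z)) = w"
    by (simp_all add: w_def exp_minus inverse_eq_divide)
  then have "ker 1 z = 1 / (1 / w - 1)" "ker (-1) z = 1 / (w - 1)"
    unfolding ker_def by presburger+
  moreover have "1 / (1 / w - 1) = w / (1 - w)" using w by (simp add: divide_simps)
  moreover have "w / (1 - w) = - (w / (w - 1))" by (metis minus_diff_eq minus_divide_right)
  moreover have "- (w / (w - 1)) + 1 / (w - 1) = -1" using w by (simp add: divide_simps)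
  ultimately show ?thesis by simp
qed

lemma holomorphic_on_ker:
  assumes "e \<in> {1, -1}" "S \<inter> \<int> = {}"
  shows "ker e holomorphic_on S"
  unfolding ker_def using assms exp_ker_eq_1_iff[OF assms(1)]
  by (intro holomorphic_intros) auto

lemma norm_ker_far:
  assumes "e \<in> {1, -1}" "e * Im z \<ge> 1"
  shows "norm (ker e z) \<le> 2 * exp (- 2 * pi * (e * Im z))"
proof -
  define E where "E = exp (2 * pi * (e * Im z))"
  have "norm (exp (- (of_real (2 * pi * e) * \<i> * z))) = E"
    by (simp add: E_def algebra_simps)
  then have 1: "norm (exp (- (of_real (2 * pi * e) * \<i> * z)) - 1) \<ge> E - 1"
    by (metis norm_one norm_triangle_ineq2)
  have "E \<ge> 1 + 2 * pi * (e * Im z)" unfolding E_def by (rule exp_ge_add_one_self)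
  moreover have "2 * pi * (e * Im z) \<ge> 2 * pi * 1" using assms by (intro mult_left_mono) auto
  ultimately have 2: "E \<ge> 2" using pi_ge_two by linarith
  have "norm (ker e z) \<le> 1 / (E - 1)" unfolding ker_def norm_divide
    using 1 2 by (auto intro!: divide_left_mono mult_pos_pos)
  also have "\<dots> \<le> 2 / E" using 2 by (auto simp: field_simps)
  also have "\<dots> = 2 * exp (- 2 * pi * (e * Im z))" by (simp add: E_def exp_minus divide_inverse)
  finally show ?thesis .
qed

text \<open>Since cos (2 pi a) = 0, the exponential on the line Re z = a is purely imaginary of
  modulus exp (2 pi v), and subtracting 1 cannot make it smaller.\<close>

lemma norm_ker_vertical:
  assumes "e \<in> {1, -1}" "cos (2 * pi * a) = 0" "v \<ge> 0"
  shows "norm (ker e (of_real a + of_real (e * v) * \<i>)) \<le> exp (- 2 * pi * v)"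
proof -
  define z where "z = of_real a + of_real (e * v) * \<i>"
  have s: "\<bar>sin (2 * pi * a)\<bar> = 1" using assms(2) sin_zero_abs_cos_one
    by (metis abs_1 abs_power2 cos_squared_eq diff_0_right diff_add_cancel power2_eq_1_iff sin_squared_eq
       abs_minus_cancel zero_power2)
  have "e = 1 \<or> e = -1" using assms by auto
  then have "\<bar>Im (exp (- (of_real (2 * pi * e) * \<i> * z)) - 1)\<bar> = exp (2 * pi * v)"
    using s by (auto simp: z_def Im_exp abs_mult algebra_simps)
  then have "norm (exp (- (of_real (2 * pi * e) * \<i> * z)) - 1) \<ge> exp (2 * pi * v)"
    by (metis abs_Im_le_cmod)
  then have "norm (ker e z) \<le> 1 / exp (2 * pi * v)" unfolding ker_def norm_divide
    by (auto intro!: divide_left_mono mult_pos_pos)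
  then show ?thesis by (simp add: z_def exp_minus divide_inverse)
qed

section \<open>Powers of z and integrals along rays\<close>

lemma norm_powr_neg_le:
  fixes z s :: complex
  shows "norm (z powr (-s)) \<le> norm z powr (- Re s) * exp (pi * \<bar>Im s\<bar>)"
proof -
  have "Im s * Arg z \<le> \<bar>Im s\<bar> * pi" 
    by (smt (verit) Arg_le_pi mpi_less_Arg abs_mult mult_left_mono abs_ge_self abs_ge_zero abs_le_iff)
  then show ?thesis unfolding norm_powr_complex
    by (intro mult_mono) (auto simp: mult.commute)
qed

lemma norm_powr_neg_half:
  fixes z s :: complex
  assumes "Re z \<ge> 0"
  shows "norm (z powr (-s)) \<le> norm z powr (- Re s) * exp (pi / 2 * \<bar>Im s\<bar>)"
proof -
  have "\<bar>Arg z\<bar> \<le> pi / 2" using assms Arg_Re_nonneg by blast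
  then have "Im s * Arg z \<le> \<bar>Im s\<bar> * (pi / 2)" 
    by (metis abs_ge_self abs_mult abs_ge_zero mult_left_mono order_trans)
  then show ?thesis unfolding norm_powr_complex
    by (intro mult_mono) (auto simp: mult.commute)
qed

lemma contour_integral_linepath_ray:
  fixes p d :: complex and T :: real
  assumes "T > 0" 
  shows "(f has_contour_integral I) (linepath p (p + of_real T * d)) \<longleftrightarrow>
         ((\<lambda>v. f (p + of_real v * d) * d) has_integral I) {0..T}"
proof -
  have "(f has_contour_integral I) (linepath p (p + of_real T * d)) \<longleftrightarrow>
     ((\<lambda>x. f (linepath p (p + of_real T * d) x) * (p + of_real T * d - p)) has_integral I) {0..1}"
    by (rule has_contour_integral_linepath)
  also have "\<dots> \<longleftrightarrow> ((\<lambda>x. T *\<^sub>R (f (p + of_real (T * x) * d) * d)) has_integral I) {0..1}"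
    by (intro has_integral_cong) (auto simp: linepath_def scaleR_conv_of_real algebra_simps)
  also have "\<dots> \<longleftrightarrow> ((\<lambda>x. f (p + of_real (T *\<^sub>R x + 0) * d) * d) has_integral (I /\<^sub>R T)) {0..1}"
    using assms by (subst has_integral_cmul_iff[symmetric, where c = "inverse T"]) auto
  also have "\<dots> \<longleftrightarrow> ((\<lambda>v. f (p + of_real v * d) * d) has_integral I) {0..T}"
    using has_integral_affinity_iff[of T "\<lambda>v. f (p + of_real v * d) * d" 0 I 0 T] assms by simp
  finally show ?thesis .
qed

lemma powr_growth:
  fixes R v :: real
  assumes "R \<ge> 0" "v \<ge> 0"
  shows "(1 + v) powr R * exp (- v) \<le> (2 * R + 1) powr R * exp (1 / 2) * exp (- v / 2)"
proof -
  define K where "K = 2 * R + 1"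
  have K: "K \<ge> 1" using assms by (simp add: K_def)
  \<comment> \<open>The tangent to ln at K; the choice K = 2 R + 1 makes R / K at most 1/2.\<close>
  have "ln ((1 + v) / K) \<le> (1 + v) / K - 1" using K assms by (intro ln_le_minus_one) auto
  then have "ln (1 + v) \<le> ln K + (1 + v) / K" using K assms by (simp add: ln_div)
  then have "R * ln (1 + v) \<le> R * ln K + R * (1 + v) / K"
    using assms(1) by (metis distrib_left mult_left_mono times_divide_eq_right)
  also have "R * (1 + v) / K \<le> (1 + v) / 2" using K assms by (simp add: field_simps K_def)
  finally have "R * ln (1 + v) - v \<le> R * ln K + 1 / 2 - v / 2" by (simp add: field_simps)
  then have "exp (R * ln (1 + v) - v) \<le> exp (R * ln K + 1 / 2 - v / 2)" by simp
  moreover have "exp (R * ln (1 + v) - v) = (1 + v) powr R * exp (- v)" using assms by (simp add: powr_def flip: exp_add)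
  moreover have "exp (R * ln K + 1 / 2 - v / 2) = K powr R * exp (1 / 2) * exp (- v / 2)" using K by (simp add: powr_def flip: exp_add)
  ultimately show ?thesis by (simp add: K_def)
qed

lemma exp_integral_bound:
  fixes f :: "real \<Rightarrow> complex"
  assumes "a \<le> b" "f integrable_on {a..b}" "\<And>v. v \<in> {a..b} \<Longrightarrow> norm (f v) \<le> M * exp (- c * v)" "c > 0" "M \<ge> 0"
  shows "norm (integral {a..b} f) \<le> M / c * exp (- c * a)"
proof -
  have "((\<lambda>v. M * exp (- c * v)) has_integral (- M / c * exp (- c * b) - (- M / c * exp (- c * a)))) {a..b}"
    using assms by (intro fundamental_theorem_of_calculus)
      (auto intro!: derivative_eq_intros simp flip: has_real_derivative_iff_has_vector_derivative)
  then have "norm (integral {a..b} f) \<le> - M / c * exp (- c * b) - (- M / c * exp (- c * a))"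
    using assms by (metis integral_norm_bound_integral has_integral_integrable integral_unique)
  also have "\<dots> \<le> M / c * exp (- c * a)" using assms by simp
  finally show ?thesis .
qed

text \<open>The truncated integrals converge uniformly on discs in s, with an error of order exp (-
  n / 2), so the limit is entire. This is the source of the analytic continuation of zeta.\<close>

lemma ray_limit_entire:
  fixes p d :: complex and k :: "complex \<Rightarrow> complex" and \<delta> C :: real
  assumes "\<delta> > 0" "\<And>v. v \<ge> 0 \<Longrightarrow> norm (p + of_real v * d) \<ge> \<delta>"
    and slot: "\<And>v. v \<ge> 0 \<Longrightarrow> p + of_real v * d \<notin> \<real>\<^sub>\<le>\<^sub>0"
    and contk: "continuous_on ((\<lambda>v. p + of_real v * d) ` {0..}) k"
    and bk: "\<And>v. v \<ge> 0 \<Longrightarrow> norm (k (p + of_real v * d)) \<le> C * exp (- v)"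
  shows "\<exists>U. U holomorphic_on UNIV \<and> (\<forall>s. (\<lambda>n. contour_integral (linepath p (p + of_nat n * d)) (\<lambda>z. z powr (-s) * k z)) \<longlonglongrightarrow> U s)"
proof -
  define g where "g s v = (p + of_real v * d) powr (-s) * k (p + of_real v * d) * d" for s v
  define F where "F n s = integral {0..real n} (g s)" for n s
  have nz: "p + of_real v * d \<noteq> 0" if "v \<ge> 0" for v using assms(1) assms(2)[OF that] by auto
  have contk': "continuous_on {0..b} (\<lambda>v. k (p + of_real v * d))" for b
    by (rule continuous_on_compose2[OF contk]) (auto intro!: continuous_intros)
  have gexp: "g s v = exp (- s * Ln (p + of_real v * d)) * k (p + of_real v * d) * d" if "v \<ge> 0" for s v
    using nz[OF that] by (simp add: g_def powr_def)
  have contLn: "continuous_on (U \<times> {0..b}) (\<lambda>x. Ln (p + of_real (snd x) * d))" for U :: "complex set" and b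
    by (intro continuous_on_Ln continuous_intros) (use slot in \<open>auto simp del: complex_nonpos_Reals_iff\<close>)
  have "continuous_on (U \<times> {0..b}) (\<lambda>x. exp (- fst x * Ln (p + of_real (snd x) * d)) * k (p + of_real (snd x) * d) * d)" for U b
    by (intro continuous_intros contLn continuous_on_compose2[OF contk'[of b], of _ snd]) auto
  then have contg: "continuous_on (U \<times> {0..b}) (\<lambda>(s,v). g s v)" for U b
    by (rule continuous_on_eq) (auto simp: gexp)
  have intg: "g s integrable_on {0..b}" for s b
  proof -
    have "continuous_on {0..b} (\<lambda>v. (\<lambda>(s,v). g s v) (s, v))"
      by (rule continuous_on_compose2[OF contg[of UNIV b]]) (auto intro!: continuous_intros)
    then show ?thesis by (auto intro: integrable_continuous_real)
  qed
  have intg': "g s integrable_on {a..b}" if "a \<ge> 0" for s a b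
    by (rule integrable_subinterval_real[OF intg[of s b]]) (use that in auto)
  have "C * exp (- 0) \<ge> 0" using bk[of 0] norm_ge_zero order_trans by blast
  then have C: "C \<ge> 0" by simp
  \<comment> \<open>Both norm z and 1 / norm z stay below A (1 + v) on the ray, which controls
    \<open>norm z powr (- Re s)\<close> for either sign of Re s.\<close>
  define A where "A = norm p + norm d + 1 + 1 / \<delta>"
  have A: "A > 0" using assms(1) by (auto simp: A_def add_nonneg_pos)
  define M where "M R = A powr R * exp (pi * R) * ((2 * R + 1) powr R * exp (1 / 2)) * C * norm d" for R
  have bound: "norm (g s v) \<le> M R * exp (- (1/2) * v)" if "norm s \<le> R" "v \<ge> 0" for s v R
  proof -
    define z where "z = p + of_real v * d"
    have R: "R \<ge> 0" using that norm_ge_zero order_trans by blast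
    have z: "norm z \<ge> \<delta>" unfolding z_def using assms(2) that by auto
    have "norm z \<le> norm p + v * norm d" unfolding z_def using that by (metis norm_triangle_le norm_mult norm_of_real abs_of_nonneg order_refl)
    also have "\<dots> \<le> A * (1 + v)" using that assms(1) by (auto simp: A_def algebra_simps add_increasing2)
    finally have z1: "norm z \<le> A * (1 + v)" .
    have "1 / norm z \<le> 1 / \<delta>" using z assms(1) by (intro divide_left_mono) (auto intro!: mult_pos_pos)
    also have "1 / \<delta> \<le> A" by (simp add: A_def)
    also have "A \<le> A * (1 + v)" using that A by simp
    finally have z2: "1 / norm z \<le> A * (1 + v)" .
    have zp: "norm z > 0" using z assms(1) by linarith
    have Av: "A * (1 + v) > 0" using A that by auto
    have l: "\<bar>ln (norm z)\<bar> \<le> ln (A * (1 + v))"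
    proof -
      have "ln (norm z) \<le> ln (A * (1 + v))" using z1 zp Av by simp
      moreover have "ln (1 / norm z) \<le> ln (A * (1 + v))" using z2 zp Av ln_le_cancel_iff zero_less_divide_1_iff by blast
      ultimately show ?thesis using zp by (simp add: ln_div)
    qed
    have "norm z powr (- Re s) = exp (- Re s * ln (norm z))" using zp by (simp add: powr_def)
    also have "- Re s * ln (norm z) \<le> R * ln (A * (1 + v))"
    proof -
      have "- Re s * ln (norm z) \<le> \<bar>Re s\<bar> * \<bar>ln (norm z)\<bar>" by (metis abs_ge_self abs_minus_cancel abs_mult)
      also have "\<dots> \<le> R * ln (A * (1 + v))" using l that abs_Re_le_cmod[of s] by (intro mult_mono) auto
      finally show ?thesis .
    qed
    also have "exp (R * ln (A * (1 + v))) = (A * (1 + v)) powr R" using Av by (simp only: powr_def) auto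
    also have "\<dots> = A powr R * (1 + v) powr R" using A that by (simp add: powr_mult)
    finally have b1: "norm z powr (- Re s) \<le> A powr R * (1 + v) powr R" by simp
    have b2: "exp (pi * \<bar>Im s\<bar>) \<le> exp (pi * R)" using that abs_Im_le_cmod[of s] by auto
    have "norm (z powr (-s)) \<le> (A powr R * (1 + v) powr R) * exp (pi * R)"
      using norm_powr_neg_le[of z s] b1 b2 by (smt (verit) exp_gt_zero mult_mono powr_ge_zero)
    then have "norm (g s v) \<le> (A powr R * (1 + v) powr R * exp (pi * R)) * (C * exp (- v)) * norm d"
      unfolding g_def norm_mult z_def[symmetric] using bk[of v] that
      by (intro mult_right_mono mult_mono) (auto simp: z_def)
    also have "\<dots> = (A powr R * exp (pi * R) * C * norm d) * ((1 + v) powr R * exp (- v))" by (simp add: mult_ac)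
    also have "\<dots> \<le> (A powr R * exp (pi * R) * C * norm d) * ((2 * R + 1) powr R * exp (1 / 2) * exp (- v / 2))"
      using C by (intro mult_left_mono powr_growth R that) auto
    also have "\<dots> = M R * exp (- (1/2) * v)" by (simp add: M_def mult_ac)
    finally show ?thesis .
  qed
  have M: "M R \<ge> 0" for R using C by (auto simp: M_def)
  have diff: "norm (F n s - F m s) \<le> 2 * M R * exp (- real m / 2)" if "norm s \<le> R" "m \<le> n" for s R m n
  proof -
    have "F n s = F m s + integral {real m..real n} (g s)" unfolding F_def
      using that by (intro Henstock_Kurzweil_Integration.integral_combine[symmetric] intg) auto
    moreover have "norm (integral {real m..real n} (g s)) \<le> M R / (1/2) * exp (- (1/2) * real m)"
      by (rule exp_integral_bound) (use that intg' bound M in auto)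
    ultimately show ?thesis by simp
  qed
  have tend0: "(\<lambda>m. c * exp (- real m / 2)) \<longlonglongrightarrow> 0" for c :: real
    by real_asymp
  have "Cauchy (\<lambda>n. F n s)" for s
  proof (rule metric_CauchyI)
    fix \<epsilon> :: real assume "\<epsilon> > 0"
    then obtain N where N: "2 * M (norm s) * exp (- real N / 2) < \<epsilon> / 2"
      using order_tendstoD(2)[OF tend0[of "2 * M (norm s)"], of "\<epsilon>/2"] by (auto simp: eventually_sequentially)
    have "dist (F m s) (F n s) < \<epsilon>" if "m \<ge> N" "n \<ge> N" for m n
    proof -
      have "dist (F m s) (F N s) < \<epsilon> / 2" "dist (F n s) (F N s) < \<epsilon> / 2"
        unfolding dist_norm using diff[of s "norm s" N m] diff[of s "norm s" N n] that N by auto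
      then show ?thesis by (metis dist_triangle_half_l)
    qed
    then show "\<exists>N. \<forall>m\<ge>N. \<forall>n\<ge>N. dist (F m s) (F n s) < \<epsilon>" by blast
  qed
  then have conv: "convergent (\<lambda>n. F n s)" for s
    by (rule Cauchy_convergent)
  define U where "U s = lim (\<lambda>n. F n s)" for s
  have U: "(\<lambda>n. F n s) \<longlonglongrightarrow> U s" for s
    unfolding U_def using conv[of s] convergent_LIMSEQ_iff by blast
  have near: "norm (F m s - U s) \<le> 2 * M R * exp (- real m / 2)" if "norm s \<le> R" for s R m
  proof -
    have "(\<lambda>n. norm (F n s - F m s)) \<longlonglongrightarrow> norm (U s - F m s)" by (intro tendsto_intros U)
    then have "norm (U s - F m s) \<le> 2 * M R * exp (- real m / 2)"
      by (rule Lim_bounded[where M = m]) (use diff that in auto)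
    then show ?thesis by (simp add: norm_minus_commute)
  qed
  have "U holomorphic_on UNIV"
  proof (rule holomorphic_uniform_sequence[where f = F])
    show "F n holomorphic_on UNIV" for n
    proof -
      have "(\<lambda>s. integral (cbox 0 (real n)) (g s)) holomorphic_on UNIV"
      proof (rule leibniz_rule_holomorphic)
        show "((\<lambda>s. g s v) has_field_derivative (- Ln (p + of_real v * d) * g s v)) (at s within UNIV)"
          if "v \<in> cbox 0 (real n)" for s v
          using nz[of v] that unfolding g_def
          by (auto intro!: derivative_eq_intros simp: powr_def)
        show "g s integrable_on cbox 0 (real n)" for s using intg by simp
        show "continuous_on (UNIV \<times> cbox 0 (real n)) (\<lambda>(s, v). - Ln (p + of_real v * d) * g s v)"
          using contg[of UNIV "real n"] contLn[of UNIV "real n"] unfolding split_def cbox_interval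
          by (intro continuous_intros) (use slot in \<open>auto simp del: complex_nonpos_Reals_iff\<close>)
      qed auto
      then show ?thesis by (simp add: F_def[abs_def])
    qed
    show "\<exists>d>0. cball s d \<subseteq> UNIV \<and> uniform_limit (cball s d) F U sequentially" for s
    proof (intro exI[of _ 1] conjI)
      define R where "R = norm s + 1"
      have R: "norm w \<le> R" if "w \<in> cball s 1" for w
        using that norm_triangle_sub[of w s] by (auto simp: R_def dist_norm norm_minus_commute)
      show "uniform_limit (cball s 1) F U sequentially"
        unfolding uniform_limit_iff
      proof (intro allI impI)
        fix \<epsilon> :: real assume "\<epsilon> > 0"
        then have "\<forall>\<^sub>F m in sequentially. 2 * M R * exp (- real m / 2) < \<epsilon>"
          using order_tendstoD(2)[OF tend0] by blast
        then show "\<forall>\<^sub>F m in sequentially. \<forall>w\<in>cball s 1. dist (F m w) (U w) < \<epsilon>"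
          by eventually_elim (auto simp: dist_norm[of "F _ _"] simp del: mem_cball intro!: order_le_less_trans[OF near[OF R]])
      qed
    qed auto
  qed auto
  moreover have "(\<lambda>n. contour_integral (linepath p (p + of_nat n * d)) (\<lambda>z. z powr (-s) * k z)) \<longlonglongrightarrow> U s" for s
  proof -
    have "contour_integral (linepath p (p + of_nat n * d)) (\<lambda>z. z powr (-s) * k z) = F n s" for n
    proof (cases "n = 0")
      case False
      have "(g s has_integral F n s) {0..real n}" using intg by (auto simp: F_def)
      then have "((\<lambda>z. z powr (-s) * k z) has_contour_integral F n s) (linepath p (p + of_real (real n) * d))"
        using False by (subst contour_integral_linepath_ray) (auto simp: g_def[abs_def])
      then show ?thesis by (simp add: contour_integral_unique)
    qed (auto simp: F_def)
    then show ?thesis using U by simp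
  qed
  ultimately show ?thesis by blast
qed

section \<open>Contour integral representations of the zeta function\<close>

abbreviation cint :: "complex \<Rightarrow> complex \<Rightarrow> (complex \<Rightarrow> complex) \<Rightarrow> complex" where
  "cint A B f \<equiv> contour_integral (linepath A B) f"

text \<open>Cauchy's theorem on a convex S, with holomorphy understood within S. Later S is often an
  open half-plane together with boundary points, so that a path may end on the boundary.\<close>

lemma cint_triangle:
  assumes "f holomorphic_on S" "convex S" "A \<in> S" "B \<in> S" "C \<in> S"
  shows "cint A B f + cint B C f = cint A C f"
proof -
  have seg: "closed_segment p q \<subseteq> S" if "p \<in> S" "q \<in> S" for p q
    using that assms(2) by (simp add: closed_segment_subset)
  have ci: "f contour_integrable_on (linepath p q)" if "p \<in> S" "q \<in> S" for p q
    using seg[OF that] holomorphic_on_imp_continuous_on[OF assms(1)]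
    by (intro contour_integrable_continuous_linepath) (rule continuous_on_subset)
  have "(f has_contour_integral 0) (linepath A B +++ linepath B C +++ linepath C A)"
    using assms seg by (intro Cauchy_theorem_convex_simple[OF assms(1,2)]) (auto simp: path_image_join)
  then have "cint A B f + (cint B C f + cint C A f) = 0"
    using ci assms by (simp add: contour_integral_unique contour_integrable_joinI flip: contour_integral_join)
  moreover have "cint C A f = - cint A C f"
    by (metis contour_integral_reverse_linepath contour_integrable_continuous_linepath 
        assms(1) assms(3) assms(5) continuous_on_subset holomorphic_on_imp_continuous_on seg)
  ultimately show ?thesis by (simp add: add_eq_0_iff algebra_simps)
qed

text \<open>A contour integral that does not exist has the value 0, in both directions. The norm
  bounds use the same convention.\<close>

lemma cint_reverse: "cint B A f = - cint A B f"
proof (cases "f contour_integrable_on (linepath A B)")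
  case True
  then show ?thesis
    by (metis contour_integral_reversepath reversepath_linepath valid_path_linepath)
next
  case False
  then have "\<not> f contour_integrable_on (linepath B A)"
    by (metis contour_integrable_reversepath reversepath_linepath valid_path_linepath)
  then show ?thesis using False by (simp add: not_integrable_contour_integral)
qed

lemma norm_cint_le:
  assumes "\<And>z. z \<in> closed_segment A B \<Longrightarrow> norm (f z) \<le> K" "K \<ge> 0"
  shows "norm (cint A B f) \<le> K * norm (B - A)"
proof (cases "f contour_integrable_on (linepath A B)")
  case True
  then show ?thesis by (rule contour_integral_bound_linepath) (use assms in auto)
next
  case False
  then show ?thesis using assms by (simp add: not_integrable_contour_integral)
qed

text \<open>Segments of length O(n) at distance about n carry an integrand of size polynomial times
  exp (- n). This discards every closing edge of the contours.\<close>

lemma powr_kernel_segment_tendsto_0: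
  fixes A B :: "nat \<Rightarrow> complex" and L M :: real
  assumes L: "L > 0" "M \<ge> 0"
    and seg: "\<And>n z. n \<ge> 1 \<Longrightarrow> z \<in> closed_segment (A n) (B n) \<Longrightarrow>
               norm z \<ge> 1 \<and> norm z \<le> L * (1 + real n) \<and> norm (k z) \<le> M * exp (- real n)"
    and len: "\<And>n. n \<ge> 1 \<Longrightarrow> norm (B n - A n) \<le> L * (1 + real n)"
  shows "(\<lambda>n. cint (A n) (B n) (\<lambda>z. z powr (-s) * k z)) \<longlonglongrightarrow> 0"
proof -
  define R where "R = \<bar>Re s\<bar> + 1"
  define C where "C = L powr \<bar>Re s\<bar> * exp (pi * \<bar>Im s\<bar>) * M * L"
  have C: "C \<ge> 0" using L by (simp add: C_def)
  define C' where "C' = C * ((2 * R + 1) powr R * exp (1 / 2))"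
  have "norm (cint (A n) (B n) (\<lambda>z. z powr (-s) * k z)) \<le> C' * exp (- real n / 2)" if n: "n \<ge> 1" for n
  proof -
    define K where "K = (L * (1 + real n)) powr \<bar>Re s\<bar> * exp (pi * \<bar>Im s\<bar>) * (M * exp (- real n))"
    have "norm (z powr (-s) * k z) \<le> K" if "z \<in> closed_segment (A n) (B n)" for z
    proof -
      have z: "norm z \<ge> 1" "norm z \<le> L * (1 + real n)" "norm (k z) \<le> M * exp (- real n)" using seg[OF n that] by auto
      have "norm z powr (- Re s) \<le> norm z powr \<bar>Re s\<bar>" using z by (intro powr_mono) auto
      also have "\<dots> \<le> (L * (1 + real n)) powr \<bar>Re s\<bar>" using z by (intro powr_mono2) auto
      finally have "norm (z powr (-s)) \<le> (L * (1 + real n)) powr \<bar>Re s\<bar> * exp (pi * \<bar>Im s\<bar>)"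
        using norm_powr_neg_le[of z s] by (meson exp_ge_zero mult_right_mono order_trans)
      then show ?thesis unfolding norm_mult K_def using z(3) by (intro mult_mono) auto
    qed
    moreover have K: "K \<ge> 0" using L by (auto simp: K_def)
    ultimately have "norm (cint (A n) (B n) (\<lambda>z. z powr (-s) * k z)) \<le> K * norm (B n - A n)"
      by (rule norm_cint_le)
    also have "\<dots> \<le> K * (L * (1 + real n))" using len[OF n] K by (rule mult_left_mono)
    also have "\<dots> = C * ((1 + real n) powr R * exp (- real n))"
      using L by (simp add: K_def C_def R_def powr_mult powr_add)
    also have "\<dots> \<le> C * ((2 * R + 1) powr R * exp (1 / 2) * exp (- real n / 2))"
      using C by (intro mult_left_mono powr_growth) (auto simp: R_def)
    finally show ?thesis by (simp add: C'_def mult.assoc)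
  qed
  then have "\<forall>\<^sub>F n in sequentially. norm (cint (A n) (B n) (\<lambda>z. z powr (-s) * k z)) \<le> C' * exp (- real n / 2)"
    by (auto simp: eventually_sequentially)
  moreover have "(\<lambda>n. C' * exp (- real n / 2)) \<longlonglongrightarrow> 0" by real_asymp
  ultimately show ?thesis by (rule Lim_null_comparison)
qed

section \<open>The Abel-Plana expression for the tail of the series\<close>

definition vint :: "real \<Rightarrow> real \<Rightarrow> complex \<Rightarrow> nat \<Rightarrow> complex" where
  "vint e a s n = cint (of_real a) (of_real a + of_nat n * (of_real e * \<i>)) (\<lambda>z. z powr (-s) * ker e z)"

text \<open>The Abel-Plana formula for the sum of n^(- s) over n > a: the first term is the integral
  of the power from a to infinity, and each ray carries the kernel that decays along it. Limits of
  truncated integrals keep all contours finite.\<close>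

definition Zcont :: "real \<Rightarrow> complex \<Rightarrow> complex" where
  "Zcont a s = of_real a powr (1 - s) / (s - 1) + lim (vint 1 a s) + lim (vint (-1) a s)"

lemma vertical_line_slotted:
  assumes "a > 0" shows "of_real a + of_real v * (of_real e * \<i>) \<notin> \<real>\<^sub>\<le>\<^sub>0"
  using assms by (auto simp: complex_nonpos_Reals_iff)

lemma quarter_notin_Ints:
  assumes "cos (2 * pi * a) = 0" shows "of_real a \<notin> (\<int> :: complex set)" "a \<notin> \<int>"
proof -
  show "a \<notin> \<int>"
  proof
    assume "a \<in> \<int>"
    then obtain n where "a = of_int n" by (auto elim: Ints_cases)
    then show False using assms cos_int_2pin[of n] by (simp add: mult_ac)
  qed
  then show "of_real a \<notin> (\<int> :: complex set)" by (auto simp: complex_is_Int_iff)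
qed

lemma ker_line_holomorphic:
  assumes "e \<in> {1, -1}" "cos (2 * pi * a) = 0"
  shows "continuous_on ((\<lambda>v. of_real a + of_real v * (of_real e * \<i>)) ` {0..}) (ker e)"
proof -
  have "of_real a + of_real v * (of_real e * \<i>) \<notin> (\<int> :: complex set)" for v
    using quarter_notin_Ints(2)[OF assms(2)] by (auto simp: complex_is_Int_iff)
  then show ?thesis
    by (intro holomorphic_on_imp_continuous_on holomorphic_on_ker assms) blast
qed

lemma vint_entire:
  assumes "e \<in> {1, -1}" "cos (2 * pi * a) = 0" "a > 0"
  shows "\<exists>U. U holomorphic_on UNIV \<and> (\<forall>s. vint e a s \<longlonglongrightarrow> U s)"
proof -
  have "\<exists>U. U holomorphic_on UNIV \<and> (\<forall>s. (\<lambda>n. cint (of_real a) (of_real a + of_nat n * (of_real e * \<i>)) (\<lambda>z. z powr (-s) * ker e z)) \<longlonglongrightarrow> U s)"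
  proof (rule ray_limit_entire[where \<delta> = a and C = 1])
    show "a \<le> norm (of_real a + of_real v * (of_real e * \<i>))" for v
      using abs_Re_le_cmod[of "of_real a + of_real v * (of_real e * \<i>)"] assms by simp
    show "norm (ker e (of_real a + of_real v * (of_real e * \<i>))) \<le> 1 * exp (- v)" if "v \<ge> 0" for v
    proof -
      have "1 * v \<le> 2 * pi * v" using that pi_ge_two by (intro mult_right_mono) auto
      moreover have "norm (ker e (of_real a + of_real v * (of_real e * \<i>))) \<le> exp (- 2 * pi * v)"
        using norm_ker_vertical[OF assms(1,2) that] by (simp add: mult_ac)
      ultimately show ?thesis by (simp add: order_trans)
    qed
  qed (use assms vertical_line_slotted ker_line_holomorphic in auto)
  then show ?thesis unfolding vint_def[abs_def] .
qed

lemma vint_tendsto: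
  assumes "e \<in> {1, -1}" "cos (2 * pi * a) = 0" "a > 0"
  shows "vint e a s \<longlonglongrightarrow> lim (vint e a s)"
proof -
  obtain U where "vint e a s \<longlonglongrightarrow> U s" using vint_entire[OF assms] by meson
  then show ?thesis by (simp add: limI)
qed

lemma Zcont_holomorphic:
  assumes "cos (2 * pi * a) = 0" "a > 0"
  shows "Zcont a holomorphic_on (- {1})"
proof -
  obtain U V where "U holomorphic_on UNIV" "\<And>s. vint 1 a s \<longlonglongrightarrow> U s" "V holomorphic_on UNIV" "\<And>s. vint (-1) a s \<longlonglongrightarrow> V s"
    using vint_entire[of 1 a] vint_entire[of "-1" a] assms by auto
  moreover from this have "lim (vint 1 a s) = U s" "lim (vint (-1) a s) = V s" for s
    by (metis limI)+
  then have "Zcont a = (\<lambda>s. of_real a powr (1 - s) / (s - 1) + U s + V s)"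
    by (simp add: Zcont_def fun_eq_iff)
  ultimately show ?thesis using assms
    by (auto intro!: holomorphic_intros elim: holomorphic_on_subset)
qed

text \<open>Uniform in the truncation n and decaying in a, so that \<open>Zcont\<close> tends to 0
  along a = \<alpha> + N when Re s > 1.\<close>

lemma norm_vint_le:
  assumes "e \<in> {1, -1}" "cos (2 * pi * a) = 0" "a > 0" "Re s \<ge> 0"
  shows "norm (vint e a s n) \<le> a powr (- Re s) * exp (pi / 2 * \<bar>Im s\<bar>)"
proof (cases "n = 0")
  case False
  define d where "d = of_real e * \<i>"
  define f where "f z = z powr (-s) * ker e z" for z
  define M where "M = a powr (- Re s) * exp (pi / 2 * \<bar>Im s\<bar>)"
  have d: "norm d = 1" using assms by (auto simp: d_def norm_mult)
  have nz: "of_real a + of_real v * d \<notin> \<real>\<^sub>\<le>\<^sub>0" "of_real a + of_real v * d \<noteq> 0" for v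
    using vertical_line_slotted[OF assms(3), of v e] by (auto simp: d_def)
  have "continuous_on {0..real n} (\<lambda>v. exp (- s * Ln (of_real a + of_real v * d)) * ker e (of_real a + of_real v * d) * d)"
    using nz by (intro continuous_intros continuous_on_compose2[OF ker_line_holomorphic[OF assms(1,2)]]) (auto simp: d_def)
  then have "continuous_on {0..real n} (\<lambda>v. f (of_real a + of_real v * d) * d)"
    by (rule continuous_on_eq) (use nz in \<open>auto simp: f_def powr_def\<close>)
  then have int: "(\<lambda>v. f (of_real a + of_real v * d) * d) integrable_on {0..real n}"
    by (rule integrable_continuous_real)
  then have "((f has_contour_integral (integral {0..real n} (\<lambda>v. f (of_real a + of_real v * d) * d))))
     (linepath (of_real a) (of_real a + of_real (real n) * d))"
    using False by (subst contour_integral_linepath_ray) (auto simp only: integrable_integral of_nat_0_less_iff)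
  then have "vint e a s n = integral {0..real n} (\<lambda>v. f (of_real a + of_real v * d) * d)"
    unfolding vint_def f_def d_def by (simp add: contour_integral_unique)
  also have "norm \<dots> \<le> M / (2 * pi) * exp (- (2 * pi) * 0)"
  proof (rule exp_integral_bound)
    fix v assume v: "v \<in> {0..real n}"
    define z where "z = of_real a + of_real v * d"
    have "norm z \<ge> a" using abs_Re_le_cmod[of z] assms by (simp add: z_def d_def)
    then have "norm z powr (- Re s) \<le> a powr (- Re s)" using assms by (intro powr_mono2') auto
    moreover have "Re z \<ge> 0" using assms by (simp add: z_def d_def)
    ultimately have "norm (z powr (-s)) \<le> M"
      unfolding M_def using norm_powr_neg_half[of z s] by (meson exp_ge_zero mult_right_mono order_trans)
    moreover have "norm (ker e z) \<le> exp (- 2 * pi * v)"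
      using norm_ker_vertical[OF assms(1,2), of v] v by (simp add: z_def d_def mult_ac)
    ultimately show "norm (f (of_real a + of_real v * d) * d) \<le> M * exp (- (2 * pi) * v)"
      unfolding f_def norm_mult z_def[symmetric] d by (auto simp: M_def intro!: mult_mono)
  qed (use int in \<open>auto simp: M_def\<close>)
  also have "\<dots> \<le> M"
  proof -
    have "M / (2 * pi) \<le> M / 1" using pi_ge_two by (intro divide_left_mono) (auto simp: M_def)
    then show ?thesis by simp
  qed
  finally show ?thesis by (simp add: M_def)
qed (auto simp: vint_def)

lemma cos_shift_nat: "cos (2 * pi * (a + real n)) = cos (2 * pi * a)"
  using cos_npi[of "2*n"] sin_npi[of "2*n"] by (simp add: algebra_simps cos_add)


text \<open>The lower kernel has residue 1 / (2 pi i) at every integer, which cancels the factor of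
  the residue theorem; k is the only integer between the vertical edges.\<close>

lemma integral_kernel_rectangle:
  fixes a :: real and k n :: nat
  assumes "a > 0" "a < real k" "real k < a + 1" "n \<ge> 1"
  shows "contour_integral (rectpath (of_real a - of_nat n * \<i>) (of_real a + 1 + of_nat n * \<i>))
           (\<lambda>z. z powr (-s) * ker (-1) z) = of_nat k powr (-s)"
proof -
  define LL where "LL = of_real a - of_nat n * \<i>"
  define UR where "UR = of_real a + 1 + of_nat n * \<i>"
  define f where "f z = z powr (-s) * ker (-1) z" for z
  \<comment> \<open>An open strip around the rectangle whose only integer is k and which, because k
    is at least 1, avoids the cut of the power.\<close>
  define S where "S = {z. real k - 1 < Re z} \<inter> {z. Re z < real k + 1}"
  have "k \<noteq> 0" using assms by (intro notI) auto
  then have k1: "real k - 1 \<ge> 0" by simp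
  have S: "open S" "convex S"
    unfolding S_def by (auto intro!: open_Int open_halfspace_Re_gt open_halfspace_Re_lt convex_Int convex_halfspace_Re_gt convex_halfspace_Re_lt)
  have nI: "z \<notin> \<int>" if "z \<in> S - {of_nat k}" for z
  proof
    assume "z \<in> \<int>"
    then obtain j where j: "z = of_int j" by (auto elim: Ints_cases)
    then have "j = int k" using that by (auto simp: S_def)
    then show False using that j by auto
  qed
  have slot: "z \<notin> \<real>\<^sub>\<le>\<^sub>0" if "z \<in> S" for z
    using that k1 by (auto simp: S_def complex_nonpos_Reals_iff)
  have holP: "(\<lambda>z. z powr (-s)) holomorphic_on S"
    using slot by (intro holomorphic_intros) blast
  have holf: "f holomorphic_on (S - {of_nat k})"
    unfolding f_def using nI
    by (intro holomorphic_intros holomorphic_on_ker) (use slot in blast)+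
  have kS: "of_nat k \<in> S" by (simp add: S_def)
  have box: "of_nat k \<in> box LL UR" using assms by (auto simp: in_box_complex_iff LL_def UR_def)
  have cbox: "cbox LL UR \<subseteq> S" using assms by (auto simp: in_cbox_complex_iff LL_def UR_def S_def)
  have le: "Re LL \<le> Re UR" "Im LL \<le> Im UR" by (auto simp: LL_def UR_def)
  have res: "residue f (of_nat k) = of_nat k powr (-s) / (2 * pi * \<i>)"
  proof (rule residue_simple'[OF S(1) kS holf])
    define g where "g z = exp (2 * pi * \<i> * z)" for z
    have gk: "g (of_nat k) = 1"
      using exp_ker_eq_1_iff[of "-1" "of_nat k"] by (simp add: g_def)
    have "(g has_field_derivative (g (of_nat k) * (2 * pi * \<i>))) (at (of_nat k))"
      unfolding g_def by (auto intro!: derivative_eq_intros)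
    then have "(\<lambda>z. (g z - 1) / (z - of_nat k)) \<midarrow>of_nat k\<rightarrow> 2 * pi * \<i>"
      by (simp add: gk has_field_derivative_iff)
    moreover have "isCont (\<lambda>z. z powr (-s)) (of_nat k :: complex)"
      using holP S(1) kS continuous_on_eq_continuous_at holomorphic_on_imp_continuous_on by blast
    then have "(\<lambda>z. z powr (-s)) \<midarrow>of_nat k\<rightarrow> (of_nat k :: complex) powr (-s)" by (simp add: isCont_def)
    ultimately have "(\<lambda>z. z powr (-s) / ((g z - 1) / (z - of_nat k))) \<midarrow>of_nat k\<rightarrow> of_nat k powr (-s) / (2 * pi * \<i>)"
      by (intro tendsto_divide) auto
    then show "((\<lambda>w. f w * (w - of_nat k)) \<longlongrightarrow> of_nat k powr (-s) / (2 * pi * \<i>)) (at (of_nat k))"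
      by (simp add: f_def ker_def g_def)
  qed
  have "contour_integral (rectpath LL UR) f = 2 * pi * \<i> * (\<Sum>p\<in>{of_nat k}. winding_number (rectpath LL UR) p * residue f p)"
  proof (rule Residue_theorem[OF S(1)])
    show "path_image (rectpath LL UR) \<subseteq> S - {of_nat k}"
      unfolding path_image_rectpath_cbox_minus_box[OF le] using cbox box by auto
    show "\<forall>z. z \<notin> S \<longrightarrow> winding_number (rectpath LL UR) z = 0"
      using cbox winding_number_rectpath_outside[OF le] by blast
  qed (use S holf convex_connected in auto)
  then have "contour_integral (rectpath LL UR) f = of_nat k powr (-s)"
    by (simp add: winding_number_rectpath[OF box] res)
  then show ?thesis unfolding LL_def UR_def f_def[abs_def] .
qed

lemma powr_primitive:
  fixes s :: complex
  assumes "s \<noteq> 1" "z \<notin> \<real>\<^sub>\<le>\<^sub>0"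
  shows "((\<lambda>z. z powr (1 - s) / (1 - s)) has_field_derivative z powr (-s)) (at z within X)"
proof -
  have "((\<lambda>z. z powr (1 - s) / (1 - s)) has_field_derivative (1 - s) * z powr (1 - s - 1) / (1 - s)) (at z within X)"
    by (rule DERIV_cdivide) (use has_field_derivative_powr[OF assms(2)] has_field_derivative_at_within in blast)
  then show ?thesis using assms by simp
qed

lemma cint_powr:
  fixes s :: complex
  assumes "s \<noteq> 1" "closed_segment A B \<inter> \<real>\<^sub>\<le>\<^sub>0 = {}"
  shows "cint A B (\<lambda>z. z powr (-s)) = (B powr (1 - s) - A powr (1 - s)) / (1 - s)"
proof -
  have "((\<lambda>z. z powr (-s)) has_contour_integral
      (pathfinish (linepath A B) powr (1 - s) / (1 - s) - pathstart (linepath A B) powr (1 - s) / (1 - s))) (linepath A B)"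
    by (rule contour_integral_primitive[where S = "closed_segment A B"])
       (use assms in \<open>auto intro!: powr_primitive\<close>)
  then show ?thesis by (simp add: contour_integral_unique diff_divide_distrib)
qed

text \<open>The residue theorem on the rectangle between the abscissae a and a + 1, cut off at
  height n. On the edges above the real axis the lower kernel is replaced by minus the upper kernel
  minus 1. The integrals of the bare power over these edges collapse to the segment from a + 1 to a
  and give the difference of the two elementary terms.\<close>

lemma vint_step:
  fixes a :: real and k n :: nat and s :: complex
  assumes a: "a > 0" "cos (2 * pi * a) = 0" "a < real k" "real k < a + 1" and n: "n \<ge> 1" and s: "s \<noteq> 1"
  shows "of_real a powr (1 - s) / (s - 1) + vint 1 a s n + vint (-1) a s n
       - (of_real (a + 1) powr (1 - s) / (s - 1) + vint 1 (a + 1) s n + vint (-1) (a + 1) s n)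
       = of_nat k powr (-s)
         - cint (of_real a - of_nat n * \<i>) (of_real a + 1 - of_nat n * \<i>) (\<lambda>z. z powr (-s) * ker (-1) z)
         - cint (of_real a + of_nat n * \<i>) (of_real a + 1 + of_nat n * \<i>) (\<lambda>z. z powr (-s) * ker 1 z)"
proof -
  define LL LR UR UL where "LL = of_real a - of_nat n * \<i>" and "LR = of_real a + 1 - of_nat n * \<i>"
     and "UR = of_real a + 1 + of_nat n * \<i>" and "UL = of_real a + of_nat n * \<i>"
  define f1 where "f1 z = z powr (-s) * ker 1 z" for z
  define f where "f z = z powr (-s) * ker (-1) z" for z
  define P where "P z = z powr (-s)" for z :: complex
  have a1: "cos (2 * pi * (a + 1)) = 0" using a cos_shift_nat[of a 1] by simp
  have k1: "k \<ge> 1" using a by (cases k) auto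
  define S where "S = {z :: complex. Re z > 0}"
  have slot: "z \<notin> \<real>\<^sub>\<le>\<^sub>0" if "z \<in> S" for z
    using that by (auto simp: S_def complex_nonpos_Reals_iff)
  have holP: "P holomorphic_on S" unfolding P_def using slot by (intro holomorphic_intros) blast
  have vert: "z \<in> S - \<int>" if "Re z \<in> {a, a + 1} \<or> Re z > 0 \<and> Im z \<noteq> 0" for z
  proof -
    have "of_int i \<noteq> a" "of_int i \<noteq> a + 1" for i
      using quarter_notin_Ints(2)[OF a(2)] quarter_notin_Ints(2)[OF a1] by (metis Ints_of_int)+
    then have "of_int i \<noteq> a" "a \<noteq> of_int i" "of_int i \<noteq> a + 1" "a + 1 \<noteq> of_int i" for i by metis+
    then show ?thesis using that a by (auto simp: S_def complex_is_Int_iff)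
  qed
  have hol: "f holomorphic_on (S - \<int>)" "f1 holomorphic_on (S - \<int>)"
    unfolding f_def f1_def using slot by (intro holomorphic_intros holomorphic_on_ker; blast)+
  note conts = holomorphic_on_imp_continuous_on[OF hol(1)] holomorphic_on_imp_continuous_on[OF hol(2)]
  have segs: "closed_segment p q \<subseteq> S - \<int>" if "(p, q) \<in> {(LL, LR), (LR, UR), (UR, UL), (UL, LL), (of_real (a+1), UR), (UL, of_real a),(LR, of_real (a+1)), (of_real a, LL)}" for p q
  proof
    fix z assume "z \<in> closed_segment p q"
    then obtain u where u: "0 \<le> u" "u \<le> 1" "z = (1 - u) *\<^sub>R p + u *\<^sub>R q" by (auto simp: closed_segment_def)
    have z: "Re z = (1 - u) * Re p + u * Re q" "Im z = (1 - u) * Im p + u * Im q" using u by auto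
    have RI: "Re LL = a" "Im LL = - real n" "Re LR = a + 1" "Im LR = - real n" "Re UR = a + 1" "Im UR = real n" "Re UL = a" "Im UL = real n"
      by (auto simp: LL_def LR_def UR_def UL_def)
    have "(1 - u) * a + u * (a + 1) > 0" "(1 - u) * (a + 1) + u * a > 0" using a u by (auto simp: algebra_simps)
    then have "Re z \<in> {a, a + 1} \<or> Re z > 0 \<and> Im z \<noteq> 0"
      using that unfolding z by (elim insertE emptyE; simp only: prod.inject; elim conjE; hypsubst; use n in \<open>simp add: RI algebra_simps\<close>)
    then show "z \<in> S - \<int>" by (rule vert)
  qed
  have ci: "f contour_integrable_on linepath p q" "f1 contour_integrable_on linepath p q" "P contour_integrable_on linepath p q"
    if "(p, q) \<in> {(LL, LR), (LR, UR), (UR, UL), (UL, LL), (of_real (a+1), UR), (UL, of_real a),(LR, of_real (a+1)), (of_real a, LL)}" for p q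
    using segs[OF that] continuous_on_subset[OF conts(1)] continuous_on_subset[OF conts(2)] continuous_on_subset[OF holomorphic_on_imp_continuous_on[OF holP] subset_trans[OF segs[OF that] Diff_subset]]
    by (auto intro!: contour_integrable_continuous_linepath)
  have e0: "contour_integral (rectpath LL UR) f = cint LL LR f + (cint LR UR f + (cint UR UL f + cint UL LL f))"
  proof -
    have "Complex (Re UR) (Im LL) = LR" "Complex (Re LL) (Im UR) = UL"
      by (auto simp: LL_def LR_def UR_def UL_def complex_eq_iff)
    moreover have "f contour_integrable_on (linepath UR UL +++ linepath UL LL)"
        "f contour_integrable_on (linepath LR UR +++ linepath UR UL +++ linepath UL LL)"
      using ci(1) by (auto intro!: contour_integrable_joinI valid_path_join)
    ultimately show ?thesis using ci(1)[of LL LR] ci(1)[of LR UR] ci(1)[of UR UL] ci(1)[of UL LL]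
      unfolding rectpath_def Let_def by simp
  qed
  have e1: "contour_integral (rectpath LL UR) f = of_nat k powr (-s)"
    using integral_kernel_rectangle[OF a(1,3,4) n] by (simp add: LL_def UR_def f_def[abs_def])
  have e2: "cint LR UR f = cint LR (of_real (a+1)) f + cint (of_real (a+1)) UR f"
    by (intro contour_integral_split_linepath continuous_on_subset[OF conts(1)] segs)
       (auto simp: LR_def UR_def closed_segment_same_Re closed_segment_eq_real_ivl)
  have e3: "cint UL LL f = cint UL (of_real a) f + cint (of_real a) LL f"
    by (intro contour_integral_split_linepath continuous_on_subset[OF conts(1)] segs)
       (auto simp: LL_def UL_def closed_segment_same_Re closed_segment_eq_real_ivl)
  have fP: "cint p q f = - cint p q P - cint p q f1" 
    if "(p, q) \<in> {(UR, UL), (of_real (a+1), UR), (UL, of_real a)}" for p q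
  proof -
    have "f z = - P z - f1 z" if "z \<in> S - \<int>" for z
    proof -
      have "ker (-1) z = -1 - ker 1 z" using ker_add[of z] that by (simp add: eq_diff_eq add.commute)
      then show ?thesis unfolding f_def f1_def P_def by (simp only: right_diff_distrib) simp
    qed
    then have "cint p q f = cint p q (\<lambda>z. - P z - f1 z)"
      using segs[of p q] that by (intro contour_integral_eq) auto
    also have "\<dots> = - cint p q P - cint p q f1"
      using ci[of p q] that by (subst contour_integral_diff) (auto simp: contour_integral_neg contour_integrable_neg)
    finally show ?thesis .
  qed
  have e4: "cint (of_real (a+1)) UR P + cint UR UL P = cint (of_real (a+1)) UL P"
       "cint (of_real (a+1)) UL P + cint UL (of_real a) P = cint (of_real (a+1)) (of_real a) P"
    using a by (intro cint_triangle[OF holP]; auto simp: S_def UR_def UL_def convex_halfspace_Re_gt)+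
  have e5: "cint (of_real (a+1)) (of_real a) P = (of_real a powr (1 - s) - of_real (a+1) powr (1 - s)) / (1 - s)"
  proof -
    have "closed_segment (of_real (a+1)) (of_real a) \<subseteq> S"
      using a by (intro closed_segment_subset) (auto simp: S_def convex_halfspace_Re_gt)
    then show ?thesis unfolding P_def using s slot by (intro cint_powr) blast+
  qed
  have e6: "vint 1 a s n = - cint UL (of_real a) f1" "vint 1 (a+1) s n = cint (of_real (a+1)) UR f1"
       "vint (-1) a s n = cint (of_real a) LL f" "vint (-1) (a+1) s n = - cint LR (of_real (a+1)) f"
    unfolding cint_reverse[of UL] cint_reverse[of LR]
    by (simp_all add: vint_def UL_def UR_def LL_def LR_def f_def[abs_def] f1_def[abs_def])
  define q where "q = (of_real a powr (1 - s) - of_real (a+1) powr (1 - s)) / (s - 1)"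
  have e7: "cint (of_real (a+1)) (of_real a) P = - q"
    unfolding e5 q_def by (metis minus_diff_eq minus_divide_right)
  have fP1: "cint UR UL f = - cint UR UL P - cint UR UL f1"
    and fP2: "cint (of_real (a+1)) UR f = - cint (of_real (a+1)) UR P - cint (of_real (a+1)) UR f1"
    and fP3: "cint UL (of_real a) f = - cint UL (of_real a) P - cint UL (of_real a) f1"
    by (rule fP, simp)+
  have "q + vint 1 a s n + vint (-1) a s n - vint 1 (a+1) s n - vint (-1) (a+1) s n
      = contour_integral (rectpath LL UR) f - cint LL LR f - cint UL UR f1"
    using e2 e3 fP1 fP2 fP3 e4 e7 e6 cint_reverse[of UL UR f1]
    unfolding e0 by algebra
  then show ?thesis
    unfolding e1 LL_def[symmetric] LR_def[symmetric] UL_def[symmetric] UR_def[symmetric] f_def[abs_def, symmetric] f1_def[abs_def, symmetric]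
    by (simp only: q_def diff_divide_distrib algebra_simps)
qed

text \<open>In the limit the horizontal edges vanish, so moving a by 1 costs exactly the term that
  is crossed.\<close>

lemma Zcont_step:
  fixes a :: real and k :: nat and s :: complex
  assumes a: "a > 0" "cos (2 * pi * a) = 0" "a < real k" "real k < a + 1" and s: "s \<noteq> 1"
  shows "Zcont a s = of_nat k powr (-s) + Zcont (a + 1) s"
proof -
  have a1: "cos (2 * pi * (a + 1)) = 0" using a cos_shift_nat[of a 1] by simp
  define L where "L b n = of_real b powr (1 - s) / (s - 1) + vint 1 b s n + vint (-1) b s n" for b n
  have L: "L b \<longlonglongrightarrow> Zcont b s" if "b > 0" "cos (2 * pi * b) = 0" for b
    unfolding L_def[abs_def] Zcont_def using that by (intro tendsto_intros vint_tendsto) auto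
  define E1 where "E1 n = cint (of_real a - of_nat n * \<i>) (of_real a + 1 - of_nat n * \<i>) (\<lambda>z. z powr (-s) * ker (-1) z)" for n
  define E2 where "E2 n = cint (of_real a + of_nat n * \<i>) (of_real a + 1 + of_nat n * \<i>) (\<lambda>z. z powr (-s) * ker 1 z)" for n
  have bd: "norm z \<ge> 1 \<and> norm z \<le> (a + 2) * (1 + real n) \<and> norm (ker e z) \<le> 2 * exp (- real n)"
    if n: "n \<ge> 1" and e: "e \<in> {1, -1}" and z: "z \<in> closed_segment (of_real a + of_real (e * real n) * \<i>) (of_real a + 1 + of_real (e * real n) * \<i>)" for e z and n :: nat
  proof -
    obtain u where u: "0 \<le> u" "u \<le> 1" "z = (1 - u) *\<^sub>R (of_real a + of_real (e * real n) * \<i>) + u *\<^sub>R (of_real a + 1 + of_real (e * real n) * \<i>)"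
      using z by (auto simp: closed_segment_def)
    have z: "Re z = a + u" "Im z = e * real n" unfolding u(3) by (simp_all add: algebra_simps)
    have eI: "e * Im z = real n" using e z by auto
    have "\<bar>Im z\<bar> = real n" using e z by auto
    then have "norm z \<ge> real n" using abs_Im_le_cmod[of z] by simp
    moreover have "norm z \<le> \<bar>Re z\<bar> + \<bar>Im z\<bar>" by (rule cmod_le)
    then have "norm z \<le> a + 1 + real n" using z u a \<open>\<bar>Im z\<bar> = real n\<close> by auto
    moreover have "a + 1 + real n \<le> (a + 2) * (1 + real n)" using a by (simp add: algebra_simps)
    moreover have "norm (ker e z) \<le> 2 * exp (- 2 * pi * (e * Im z))" using norm_ker_far[OF e, of z] n eI by auto
    moreover have "exp (- 2 * pi * (e * Im z)) \<le> exp (- real n)" unfolding eI using pi_ge_two n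
      by (simp add: mult_le_cancel_right1 order_trans[of _ "4 * _"])
    ultimately show ?thesis using n by (smt (verit) of_nat_1 of_nat_le_iff)
  qed
  have "E1 \<longlonglongrightarrow> 0" unfolding E1_def[abs_def]
  proof (rule powr_kernel_segment_tendsto_0[where L = "a + 2" and M = 2])
    fix n :: nat and z assume "n \<ge> 1" "z \<in> closed_segment (of_real a - of_nat n * \<i>) (of_real a + 1 - of_nat n * \<i>)"
    then show "norm z \<ge> 1 \<and> norm z \<le> (a + 2) * (1 + real n) \<and> norm (ker (-1) z) \<le> 2 * exp (- real n)"
      using bd[of n "-1" z] by simp
  qed (use a in \<open>auto simp: algebra_simps\<close>)
  moreover have "E2 \<longlonglongrightarrow> 0" unfolding E2_def[abs_def]
  proof (rule powr_kernel_segment_tendsto_0[where L = "a + 2" and M = 2])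
    fix n :: nat and z assume "n \<ge> 1" "z \<in> closed_segment (of_real a + of_nat n * \<i>) (of_real a + 1 + of_nat n * \<i>)"
    then show "norm z \<ge> 1 \<and> norm z \<le> (a + 2) * (1 + real n) \<and> norm (ker 1 z) \<le> 2 * exp (- real n)"
      using bd[of n 1 z] by simp
  qed (use a in \<open>auto simp: algebra_simps\<close>)
  ultimately have "(\<lambda>n. of_nat k powr (-s) - E1 n - E2 n) \<longlonglongrightarrow> of_nat k powr (-s) - 0 - 0"
    by (intro tendsto_intros)
  moreover have "\<forall>\<^sub>F n in sequentially. L a n - L (a + 1) n = of_nat k powr (-s) - E1 n - E2 n"
    unfolding eventually_sequentially L_def E1_def E2_def using vint_step[OF a _ s] by blast
  ultimately have "(\<lambda>n. L a n - L (a + 1) n) \<longlonglongrightarrow> of_nat k powr (-s)"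
    using tendsto_cong[of "\<lambda>n. L a n - L (a + 1) n" "\<lambda>n. of_nat k powr (-s) - E1 n - E2 n"] by auto
  moreover have "(\<lambda>n. L a n - L (a + 1) n) \<longlonglongrightarrow> Zcont a s - Zcont (a + 1) s"
    using a a1 by (intro tendsto_intros L) auto
  ultimately have "Zcont a s - Zcont (a + 1) s = of_nat k powr (-s)" by (metis LIMSEQ_unique)
  then show ?thesis by (simp add: algebra_simps)
qed

lemma cos_quarter:
  assumes "\<alpha> \<in> {1/4, 3/4}" shows "cos (2 * pi * (\<alpha> + real N)) = 0"
proof -
  have "2 * pi * (1/4) = pi / 2" "2 * pi * (3/4) = 3 / 2 * pi" by simp_all
  then have "cos (2 * pi * (1/4)) = 0" "cos (2 * pi * (3/4)) = 0"
    using cos_pi_half cos_3over2_pi by presburger+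
  then show ?thesis using assms unfolding cos_shift_nat by blast
qed

lemma Zcont_sum:
  assumes "\<alpha> \<in> {1/4, 3/4}" "s \<noteq> 1"
  shows "Zcont \<alpha> s = (\<Sum>n=1..N. of_nat n powr (-s)) + Zcont (\<alpha> + real N) s"
proof (induction N)
  case (Suc N)
  have "Zcont (\<alpha> + real N) s = of_nat (Suc N) powr (-s) + Zcont (\<alpha> + real N + 1) s"
    using assms cos_quarter[OF assms(1), of N] by (intro Zcont_step) auto
  then show ?case using Suc by (simp add: algebra_simps)
qed auto

section \<open>Identification with the zeta-function\<close>

lemma norm_lim_le:
  fixes f :: "nat \<Rightarrow> complex"
  assumes "f \<longlonglongrightarrow> lim f" "\<And>n. norm (f n) \<le> K" shows "norm (lim f) \<le> K"
  using Lim_norm_ubound[OF sequentially_bot assms(1)] assms(2) by (meson always_eventually)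

lemma Zcont_series:
  assumes "\<alpha> \<in> {1/4, 3/4}" "Re s > 1"
  shows "(\<lambda>n. of_nat (Suc n) powr (-s)) sums Zcont \<alpha> s"
proof -
  have s: "s \<noteq> 1" using assms by auto
  define B where "B N = (\<alpha> + real N) powr (1 - Re s) / norm (s - 1) + 2 * ((\<alpha> + real N) powr (- Re s) * exp (pi / 2 * \<bar>Im s\<bar>))" for N
  have bound: "norm (Zcont (\<alpha> + real N) s) \<le> B N" for N
  proof -
    have p: "\<alpha> + real N > 0" using assms by auto
    have "norm (lim (vint e (\<alpha> + real N) s)) \<le> (\<alpha> + real N) powr (- Re s) * exp (pi / 2 * \<bar>Im s\<bar>)" if "e \<in> {1, -1}" for e
      using that assms p cos_quarter[OF assms(1)] by (intro norm_lim_le vint_tendsto norm_vint_le) auto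
    from this[of 1] this[of "-1"] show ?thesis
      unfolding Zcont_def B_def using p
      by (intro order_trans[OF norm_triangle_ineq] order_trans[OF add_mono[OF norm_triangle_ineq order_refl]])
         (auto simp: norm_divide norm_powr_real_powr)
  qed
  have "\<forall>\<^sub>F N in sequentially. norm (Zcont (\<alpha> + real N) s) \<le> B N"
    by (intro always_eventually allI bound)
  moreover have "B \<longlonglongrightarrow> 0"
  proof -
    have "(\<lambda>N. (\<alpha> + real N) powr p) \<longlonglongrightarrow> 0" if "p < 0" for p
      by (rule tendsto_neg_powr[OF that]) (rule filterlim_tendsto_add_at_top[OF tendsto_const filterlim_real_sequentially])
    from this[of "1 - Re s"] this[of "- Re s"] have "B \<longlonglongrightarrow> 0 / norm (s - 1) + 2 * (0 * exp (pi / 2 * \<bar>Im s\<bar>))"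
      unfolding B_def[abs_def] using assms s by (intro tendsto_intros) auto
    then show ?thesis by simp
  qed
  ultimately have "(\<lambda>N. Zcont (\<alpha> + real N) s) \<longlonglongrightarrow> 0"
    by (rule Lim_null_comparison)
  then have "(\<lambda>N. Zcont \<alpha> s - Zcont (\<alpha> + real N) s) \<longlonglongrightarrow> Zcont \<alpha> s - 0" by (intro tendsto_intros)
  moreover have "Zcont \<alpha> s - Zcont (\<alpha> + real N) s = (\<Sum>n<N. of_nat (Suc n) powr (-s))" for N
    using Zcont_sum[OF assms(1) s, of N] by (simp add: sum.atLeast1_atMost_eq)
  ultimately show ?thesis by (simp add: sums_def)
qed

lemma zeta_holomorphic: "zeta holomorphic_on (- {1})"
  and zeta_series: "Re s > 1 \<Longrightarrow> (\<lambda>n. of_nat (Suc n) powr (- s)) sums zeta s"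
proof -
  have "\<exists>f. f holomorphic_on (- {1}) \<and> (\<forall>s. Re s > 1 \<longrightarrow> (\<lambda>n. of_nat (Suc n) powr (- s)) sums f s)"
  \<comment> \<open>All positive integers lie to the right of the abscissa 1/4, so here the
    expression for the tail is the whole Dirichlet series.\<close>
  proof (intro exI[of _ "Zcont (1/4)"] conjI allI impI)
    show "Zcont (1/4) holomorphic_on (- {1})"
      by (rule Zcont_holomorphic) (use cos_quarter[of "1/4" 0] in simp_all)
    show "(\<lambda>n. of_nat (Suc n) powr (- s)) sums Zcont (1/4) s" if "Re s > 1" for s
      by (rule Zcont_series) (use that in auto)
  qed
  from someI_ex[OF this, folded zeta_def]
  have z: "zeta holomorphic_on (- {1})" "\<And>s. Re s > 1 \<Longrightarrow> (\<lambda>n. of_nat (Suc n) powr (- s)) sums zeta s"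
    by simp_all
  show "zeta holomorphic_on (- {1})" by (rule z(1))
  show "(\<lambda>n. of_nat (Suc n) powr (- s)) sums zeta s" if "Re s > 1" using that by (rule z(2))
qed

lemma zeta_eq_Zcont:
  assumes "\<alpha> \<in> {1/4, 3/4}" "s \<noteq> 1"
  shows "zeta s = Zcont \<alpha> s"
proof (rule analytic_continuation_open[where s = "{s. Re s > 1}" and s' = "- {1}" and f = zeta and g = "Zcont \<alpha>"])
  show "zeta s = Zcont \<alpha> s" if "s \<in> {s. Re s > 1}" for s
    using that Zcont_series[OF assms(1)] zeta_series sums_unique2 by blast
  show "{s. Re s > 1} \<noteq> {}" by (auto intro!: exI[of _ 2])
  show "connected (- {1 :: complex})" by (rule connected_punctured_universe) auto
  show "Zcont \<alpha> holomorphic_on (- {1})"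
    using Zcont_holomorphic[of \<alpha>] cos_quarter[OF assms(1), of 0] assms by auto
qed (use assms zeta_holomorphic open_halfspace_Re_gt in auto)

lemma zeta_eq_sum_Zcont:
  assumes "\<alpha> \<in> {1/4, 3/4}" "s \<noteq> 1"
  shows "zeta s = (\<Sum>n=1..N. of_nat n powr (-s)) + Zcont (\<alpha> + real N) s"
  using zeta_eq_Zcont[OF assms] Zcont_sum[OF assms] by simp

section \<open>The factor of the functional equation as a pair of ray integrals\<close>

lemma has_contour_integral_ray:
  fixes p d :: complex and \<alpha> \<beta> :: real
  assumes "\<alpha> < \<beta>"
  shows "(f has_contour_integral I) (linepath (p + of_real \<alpha> * d) (p + of_real \<beta> * d)) \<longleftrightarrow>
         ((\<lambda>v. f (p + of_real v * d) * d) has_integral I) {\<alpha>..\<beta>}"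
proof -
  have "linepath (p + of_real \<alpha> * d) (p + of_real \<beta> * d) = linepath (p + of_real \<alpha> * d) ((p + of_real \<alpha> * d) + of_real (\<beta> - \<alpha>) * d)"
    by (simp add: algebra_simps)
  then have "(f has_contour_integral I) (linepath (p + of_real \<alpha> * d) (p + of_real \<beta> * d)) \<longleftrightarrow>
     ((\<lambda>v. f (p + of_real (1 *\<^sub>R v + \<alpha>) * d) * d) has_integral (I /\<^sub>R 1 ^ DIM(real))) (cbox ((\<alpha> - \<alpha>) /\<^sub>R 1) ((\<beta> - \<alpha>) /\<^sub>R 1))"
    using contour_integral_linepath_ray[of "\<beta> - \<alpha>" f I "p + of_real \<alpha> * d" d] assms
    by (simp add: algebra_simps)
  also have "\<dots> \<longleftrightarrow> ((\<lambda>v. f (p + of_real v * d) * d) has_integral I) (cbox \<alpha> \<beta>)"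
    by (rule has_integral_affinity_iff) simp
  finally show ?thesis by simp
qed

lemma of_real_powr_exp: "t > 0 \<Longrightarrow> of_real t powr w = exp (w * complex_of_real (ln t))"
  by (simp add: powr_def Ln_of_real)

text \<open>Dominated convergence against the full Gamma integral, with both endpoints moving at
  once as they do on the half-axes.\<close>

lemma truncated_Gamma_tendsto:
  fixes \<alpha> \<beta> :: "nat \<Rightarrow> real" and w :: complex
  assumes w: "Re w > 0" and \<alpha>: "\<alpha> \<longlonglongrightarrow> 0" "\<And>n. \<alpha> n > 0" and \<beta>: "filterlim \<beta> at_top sequentially"
  shows "(\<lambda>n. integral {\<alpha> n..\<beta> n} (\<lambda>t. of_real t powr (w - 1) * exp (- of_real t))) \<longlonglongrightarrow> Gamma w"
proof -
  define f where "f t = of_real t powr (w - 1) * exp (- of_real t :: complex)" for t :: real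
  have eq: "(\<lambda>t. of_real t powr (w - 1) / of_real (exp t)) = f"
    by (auto simp: f_def fun_eq_iff exp_minus divide_inverse exp_of_real)
  have abs: "f absolutely_integrable_on {0<..}" and I: "integral {0<..} f = Gamma w"
    using absolutely_integrable_Gamma_integral'[OF w] Gamma_integral_complex'[OF w] unfolding eq
    by (auto intro: integral_unique)
  define fn where "fn n t = (if t \<in> {\<alpha> n..\<beta> n} then f t else 0)" for n t
  have sub: "{\<alpha> n..\<beta> n} \<inter> {0<..} = {\<alpha> n..\<beta> n}" for n using \<alpha>(2)[of n] by auto
  have "(\<lambda>n. integral {0<..} (fn n)) \<longlonglongrightarrow> integral {0<..} f"
  proof (rule dominated_convergence(2))
    have "f absolutely_integrable_on {\<alpha> n..\<beta> n}" for n
      by (rule set_integrable_subset[OF abs]) (use \<alpha>(2)[of n] in auto)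
    then have "f integrable_on {\<alpha> n..\<beta> n}" for n by (rule set_lebesgue_integral_eq_integral(1))
    then show "fn n integrable_on {0<..}" for n
      unfolding fn_def integrable_restrict_Int sub .
    show "(\<lambda>t. norm (f t)) integrable_on {0<..}"
      using abs absolutely_integrable_on_def by blast
    show "norm (fn n t) \<le> norm (f t)" for n t by (simp add: fn_def)
    show "(\<lambda>n. fn n t) \<longlonglongrightarrow> f t" if "t \<in> {0<..}" for t
    proof -
      have "\<forall>\<^sub>F n in sequentially. \<alpha> n < t" using \<alpha>(1) that by (auto dest: order_tendstoD(2))
      moreover have "\<forall>\<^sub>F n in sequentially. \<beta> n \<ge> t" using \<beta> by (simp add: filterlim_at_top)
      ultimately have "\<forall>\<^sub>F n in sequentially. fn n t = f t" by eventually_elim (auto simp: fn_def)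
      then show ?thesis by (simp add: tendsto_eventually)
    qed
  qed
  also have "(\<lambda>n. integral {0<..} (fn n)) = (\<lambda>n. integral {\<alpha> n..\<beta> n} f)"
    unfolding fn_def integral_restrict_Int sub ..
  finally show ?thesis using I by (simp add: f_def[abs_def])
qed

lemma scaled_gamma_integral:
  fixes w :: complex and c \<alpha> \<beta> :: real
  assumes "c > 0" "0 < \<alpha>" "\<alpha> < \<beta>"
  shows "integral {\<alpha>..\<beta>} (\<lambda>t. of_real t powr (w - 1) * exp (- of_real (c * t)))
    = of_real c powr (- w) * integral {c * \<alpha>..c * \<beta>} (\<lambda>t. of_real t powr (w - 1) * exp (- of_real t))"
proof -
  define f where "f t = of_real t powr (w - 1) * exp (- of_real t :: complex)" for t :: real
  define I where "I = integral {c * \<alpha>..c * \<beta>} f"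
  have cpos: "c * \<alpha> > 0" using assms by simp
  have "f integrable_on {c * \<alpha>..c * \<beta>}" 
  proof (rule integrable_continuous_real)
    have "continuous_on {c * \<alpha>..c * \<beta>} (\<lambda>t. exp ((w - 1) * of_real (ln t)) * exp (- of_real t :: complex))"
      using cpos by (intro continuous_intros) auto
    moreover have "exp ((w - 1) * of_real (ln t)) * exp (- of_real t :: complex) = f t" if "t \<in> {c * \<alpha>..c * \<beta>}" for t
    proof -
      have "t > 0" using that cpos by auto
      then show ?thesis by (simp add: f_def of_real_powr_exp)
    qed
    ultimately show "continuous_on {c * \<alpha>..c * \<beta>} f" by (simp cong: continuous_on_cong_simp)
  qed
  then have "(f has_integral I) (cbox (c * \<alpha>) (c * \<beta>))" by (simp add: I_def has_integral_integral)
  then have "((\<lambda>t. f (c *\<^sub>R t + 0)) has_integral (I /\<^sub>R c ^ DIM(real))) (cbox ((c * \<alpha> - 0) /\<^sub>R c) ((c * \<beta> - 0) /\<^sub>R c))"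
    by (rule has_integral_affinity') (use assms in auto)
  then have "((\<lambda>t. f (c * t)) has_integral (I / of_real c)) {\<alpha>..\<beta>}"
    using assms by (simp add: scaleR_conv_of_real field_simps)
  then have h1: "((\<lambda>t. of_real c powr (1 - w) * f (c * t)) has_integral (of_real c powr (1 - w) * (I / of_real c))) {\<alpha>..\<beta>}"
    by (rule has_integral_mult_right)
  have h2: "of_real c powr (1 - w) * f (c * t) = of_real t powr (w - 1) * exp (- of_real (c * t))" if "t \<in> {\<alpha>..\<beta>}" for t
  proof -
    have "of_real (c * t) powr (w - 1) = of_real c powr (w - 1) * of_real t powr (w - 1)"
      using assms that by (simp add: powr_times_real)
    moreover have "of_real c powr (1 - w) * of_real c powr (w - 1) = (1 :: complex)"
      using assms by (simp flip: powr_add)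
    ultimately show ?thesis by (simp add: f_def)
  qed
  have h3: "of_real c powr (1 - w) / of_real c = (of_real c powr (- w) :: complex)"
    using assms powr_diff[of "of_real c :: complex" "1 - w" 1] by simp
  have h4: "of_real c powr (1 - w) * (I / of_real c) = of_real c powr (- w) * I"
    unfolding h3[symmetric] by simp
  have "((\<lambda>t. of_real t powr (w - 1) * exp (- of_real (c * t))) has_integral (of_real c powr (- w) * I)) {\<alpha>..\<beta>}"
    using has_integral_eq[OF h2 h1] unfolding h4 by blast
  then show ?thesis unfolding I_def f_def[abs_def] by (rule integral_unique)
qed

text \<open>On the imaginary half-axis z = e i v the exponential becomes the real decay exp (- c v),
  and what remains is (e i)^(1 - s) times a Gamma integral scaled by c.\<close>

lemma exp_ray_Gamma_tendsto:
  fixes \<alpha> \<beta> :: "nat \<Rightarrow> real" and s :: complex and e c :: real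
  assumes s: "Re s < 1" and \<alpha>: "\<alpha> \<longlonglongrightarrow> 0" "\<And>n. \<alpha> n > 0" and \<beta>: "filterlim \<beta> at_top sequentially" "\<And>n. \<alpha> n < \<beta> n"
    and c: "c > 0" and e: "e \<in> {1, -1}"
  shows "(\<lambda>n. cint (of_real (\<alpha> n) * (of_real e * \<i>)) (of_real (\<beta> n) * (of_real e * \<i>)) (\<lambda>z. z powr (-s) * exp (\<i> * of_real (c * e) * z)))
       \<longlonglongrightarrow> (of_real e * \<i>) powr (1 - s) * of_real c powr (s - 1) * Gamma (1 - s)"
proof -
  define d where "d = of_real e * \<i>"
  have d: "d \<noteq> 0" using e by (auto simp: d_def)
  have "cint (of_real (\<alpha> n) * d) (of_real (\<beta> n) * d) (\<lambda>z. z powr (-s) * exp (\<i> * of_real (c * e) * z))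
      = d powr (1 - s) * (of_real c powr (- (1 - s)) * integral {c * \<alpha> n..c * \<beta> n} (\<lambda>t. of_real t powr ((1 - s) - 1) * exp (- of_real t)))" for n
  proof -
    define I where "I = integral {\<alpha> n..\<beta> n} (\<lambda>t. of_real t powr ((1 - s) - 1) * exp (- of_real (c * t)))"
    have cont: "continuous_on {\<alpha> n..\<beta> n} (\<lambda>t. exp (- s * of_real (ln t)) * exp (- of_real (c * t)))"
      using \<alpha>(2)[of n] by (intro continuous_intros) auto
    have eq: "exp (- s * of_real (ln t)) * exp (- of_real (c * t)) = of_real t powr ((1 - s) - 1) * exp (- of_real (c * t))" if "t \<in> {\<alpha> n..\<beta> n}" for t
    proof -
      have "t > 0" using that \<alpha>(2)[of n] by auto
      then show ?thesis by (simp add: of_real_powr_exp)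
    qed
    have "((\<lambda>t. exp (- s * of_real (ln t)) * exp (- of_real (c * t))) has_integral I) {\<alpha> n..\<beta> n}"
    proof -
      have "I = integral {\<alpha> n..\<beta> n} (\<lambda>t. exp (- s * of_real (ln t)) * exp (- of_real (c * t)))"
        unfolding I_def by (rule integral_cong) (rule eq[symmetric])
      then show ?thesis using integrable_continuous_real[OF cont] by (simp add: has_integral_integral)
    qed
    then have "((\<lambda>t. d powr (1 - s) * (exp (- s * of_real (ln t)) * exp (- of_real (c * t)))) has_integral (d powr (1 - s) * I)) {\<alpha> n..\<beta> n}"
      by (rule has_integral_mult_right)
    moreover have "(\<lambda>z. z powr (-s) * exp (\<i> * of_real (c * e) * z)) (0 + of_real t * d) * d = d powr (1 - s) * (exp (- s * of_real (ln t)) * exp (- of_real (c * t)))"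
      if "t \<in> {\<alpha> n..\<beta> n}" for t
    proof -
      have t: "t > 0" using that \<alpha>(2)[of n] by auto
      have "(of_real t * d) powr (-s) = of_real t powr (-s) * d powr (-s)"
        using t by (intro powr_times_real_left) auto
      moreover have "d powr (-s) * d = d powr (1 - s)" using powr_add[of d "-s" 1] d by (simp add: algebra_simps)
      moreover have "of_real t powr (-s) = exp (- s * of_real (ln t))" using t by (auto simp: powr_def Ln_of_real)
      moreover have "\<i> * of_real (c * e) * (of_real t * d) = - of_real (c * t)"
        using e by (auto simp: d_def algebra_simps)
      ultimately show ?thesis by (simp add: mult_ac)
    qed
    ultimately have "((\<lambda>t. (\<lambda>z. z powr (-s) * exp (\<i> * of_real (c * e) * z)) (0 + of_real t * d) * d) has_integral (d powr (1 - s) * I)) {\<alpha> n..\<beta> n}"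
      by (subst has_integral_cong) auto
    then have "((\<lambda>z. z powr (-s) * exp (\<i> * of_real (c * e) * z)) has_contour_integral (d powr (1 - s) * I)) (linepath (0 + of_real (\<alpha> n) * d) (0 + of_real (\<beta> n) * d))"
      using \<beta>(2)[of n] by (subst has_contour_integral_ray) auto
    then have "cint (of_real (\<alpha> n) * d) (of_real (\<beta> n) * d) (\<lambda>z. z powr (-s) * exp (\<i> * of_real (c * e) * z)) = d powr (1 - s) * I"
      by (simp add: contour_integral_unique)
    also have "I = of_real c powr (- (1 - s)) * integral {c * \<alpha> n..c * \<beta> n} (\<lambda>t. of_real t powr ((1 - s) - 1) * exp (- of_real t))"
      unfolding I_def by (rule scaled_gamma_integral) (use c \<alpha>(2)[of n] \<beta>(2)[of n] in auto)
    finally show ?thesis .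
  qed
  moreover have "(\<lambda>n. d powr (1 - s) * (of_real c powr (- (1 - s)) * integral {c * \<alpha> n..c * \<beta> n} (\<lambda>t. of_real t powr ((1 - s) - 1) * exp (- of_real t))))
      \<longlonglongrightarrow> d powr (1 - s) * (of_real c powr (- (1 - s)) * Gamma (1 - s))"
  proof (intro tendsto_intros truncated_Gamma_tendsto)
    show "(\<lambda>n. c * \<alpha> n) \<longlonglongrightarrow> 0" using tendsto_mult_left[OF \<alpha>(1), of c] by simp
    show "filterlim (\<lambda>n. c * \<beta> n) at_top sequentially"
      by (rule filterlim_tendsto_pos_mult_at_top[OF tendsto_const c \<beta>(1)])
  qed (use s c \<alpha>(2) in auto)
  ultimately show ?thesis unfolding d_def[symmetric] by (simp add: mult.assoc)
qed

text \<open>From i^(1 - s) + (- i)^(1 - s) = 2 sin (pi s / 2) and 2 (2 pi)^(s - 1) = 2^s pi^(s - 1):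
  the contributions of the two half-axes add up to the k-th term of the dual sum.\<close>

lemma chi_eq_rays:
  fixes k :: nat
  assumes "k \<ge> 1"
  shows "(of_real 1 * \<i>) powr (1 - s) * of_real (2 * pi * real k) powr (s - 1) * Gamma (1 - s)
     + (of_real (-1) * \<i>) powr (1 - s) * of_real (2 * pi * real k) powr (s - 1) * Gamma (1 - s)
     = chi s * of_nat k powr (s - 1)"
proof -
  define w where "w = of_real pi * s / 2"
  have E1: "exp (\<i> * of_real (pi / 2)) = \<i>" by (metis cis_conv_exp cis_pi_half)
  have E2: "exp (\<i> * of_real (- (pi / 2))) = - \<i>" by (metis cis_conv_exp cis_minus_pi_half)
  have e1: "\<i> powr (1 - s) = \<i> * exp (- (\<i> * w))" "(- \<i>) powr (1 - s) = - \<i> * exp (\<i> * w)"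
  proof -
    have "\<i> powr (1 - s) = exp (\<i> * of_real (pi / 2) + - (\<i> * w))" by (simp add: powr_def w_def algebra_simps diff_divide_distrib)
    then show "\<i> powr (1 - s) = \<i> * exp (- (\<i> * w))" by (simp only: exp_add E1)
    have "(- \<i>) powr (1 - s) = exp (\<i> * of_real (- (pi / 2)) + \<i> * w)" by (simp add: powr_def w_def algebra_simps diff_divide_distrib)
    then show "(- \<i>) powr (1 - s) = - \<i> * exp (\<i> * w)" by (simp only: exp_add E2)
  qed
  have "\<i> powr (1 - s) + (- \<i>) powr (1 - s) = 2 * sin w"
  proof -
    have "2 * \<i> * sin w = exp (\<i> * w) - exp (- (\<i> * w))" unfolding sin_exp_eq by simp
    then have "\<i> * (2 * sin w) = \<i> * (\<i> powr (1 - s) + (- \<i>) powr (1 - s))"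
      unfolding e1 by (simp add: algebra_simps)
    then show ?thesis by (metis complex_i_not_zero mult_left_cancel)
  qed
  moreover have "of_real (2 * pi * real k) powr (s - 1) = 2 powr (s - 1) * of_real pi powr (s - 1) * of_nat k powr (s - 1)"
    using powr_times_real[of "2 * of_real pi" "of_nat k" "s - 1"] powr_times_real[of 2 "of_real pi" "s - 1"] by simp
  moreover have "(2 :: complex) powr s = 2 * 2 powr (s - 1)"
    using powr_add[of 2 "s - 1" 1] by simp
  moreover have "(of_real 1 * \<i>) powr (1 - s) * of_real (2 * pi * real k) powr (s - 1) * Gamma (1 - s)
     + (of_real (-1) * \<i>) powr (1 - s) * of_real (2 * pi * real k) powr (s - 1) * Gamma (1 - s)
     = (\<i> powr (1 - s) + (- \<i>) powr (1 - s)) * of_real (2 * pi * real k) powr (s - 1) * Gamma (1 - s)"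
    by (simp add: distrib_right)
  ultimately show ?thesis unfolding chi_def w_def[symmetric] by (simp only: mult_ac)
qed

text \<open>A proper convex combination of a boundary point and an interior point is interior, so
  any convex piece of the boundary line may be added to an open half-plane. Such sets carry Cauchy's
  theorem for paths that end at a real point or run on the imaginary axis.\<close>

lemma convex_insert_halfplane:
  fixes a :: complex and f :: "complex \<Rightarrow> real"
  assumes "linear f" "f a \<ge> 0" "A \<subseteq> {z. f z = 0}" "convex A"
  shows "convex ({z. f z > 0} \<union> A)"
proof (rule convexI)
  fix x y and u v :: real
  assume xy: "x \<in> {z. f z > 0} \<union> A" "y \<in> {z. f z > 0} \<union> A" and uv: "u \<ge> 0" "v \<ge> 0" "u + v = 1"
  have f: "f (u *\<^sub>R x + v *\<^sub>R y) = u * f x + v * f y"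
    using assms(1) by (simp add: linear_add linear_scale)
  have nn: "f x \<ge> 0" "f y \<ge> 0" using xy assms(3) by auto
  consider "x \<in> A" "y \<in> A" | "f x > 0 \<or> f y > 0" using xy by auto
  then show "u *\<^sub>R x + v *\<^sub>R y \<in> {z. f z > 0} \<union> A"
  proof cases
    case 1
    then show ?thesis using assms(4) uv by (auto dest: convexD)
  next
    case 2
    show ?thesis
    proof (cases "u * f x + v * f y > 0")
      case False
      then have "u * f x = 0" "v * f y = 0" using nn uv by (smt (verit) mult_nonneg_nonneg)+
      then have "u = 0 \<or> f x = 0" "v = 0 \<or> f y = 0" by auto
      then have "(u = 0 \<and> v = 1) \<or> (u = 1 \<and> v = 0)" using uv 2 by auto
      then show ?thesis using xy by auto
    qed (use f in auto)
  qed
qed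

section \<open>Rotating the vertical rays onto the imaginary axis\<close>

lemma convex_pt_upper: "e \<in> {1, -1} \<Longrightarrow> convex ({z. e * Im z > 0} \<union> {of_real a :: complex})"
  by (rule convex_insert_halfplane[where a = "of_real a"]) (auto simp: linear_iff algebra_simps)

lemma convex_right_pt: "convex ({z. Re z > 0} \<union> {of_real r * (of_real e * \<i>) :: complex})"
  by (rule convex_insert_halfplane[where a = "of_real r * (of_real e * \<i>)"]) (auto simp: linear_iff algebra_simps)

lemma linear_Re: "linear Re" and linear_Im: "linear Im"
  by (simp_all add: bounded_linear_Re bounded_linear_Im bounded_linear.linear)

lemma convex_right_axis: "convex ({z. Re z > 0} \<union> {z :: complex. Re z = 0 \<and> e * Im z > 0})"
proof (rule convex_insert_halfplane[where f = Re and a = 0])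
  have "convex ({z :: complex. 1 \<bullet> z = 0} \<inter> {z. (complex_of_real e * \<i>) \<bullet> z > 0})"
    by (intro convex_Int convex_hyperplane convex_halfspace_gt)
  moreover have "{z :: complex. 1 \<bullet> z = 0} \<inter> {z. (complex_of_real e * \<i>) \<bullet> z > 0} = {z. Re z = 0 \<and> e * Im z > 0}"
    by (auto simp: inner_complex_def)
  ultimately show "convex {z :: complex. Re z = 0 \<and> e * Im z > 0}" by simp
  show "linear Re" by (rule linear_Re)
  show "{z :: complex. Re z = 0 \<and> e * Im z > 0} \<subseteq> {z. Re z = 0}" by blast
qed simp

text \<open>Both routes from a to e i T stay in one open half-plane with a adjoined. The stop at e i
  \<epsilon> keeps them away from the pole of the kernel at 0.\<close>

lemma rotate_vertical:
  assumes "e \<in> {1, -1}" "\<epsilon> > 0" "T > 0" "F holomorphic_on ({z. e * Im z > 0} \<union> {of_real a})"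
  shows "cint (of_real a) (of_real a + of_real T * (of_real e * \<i>)) F
     = cint (of_real a) (of_real \<epsilon> * (of_real e * \<i>)) F + cint (of_real \<epsilon> * (of_real e * \<i>)) (of_real T * (of_real e * \<i>)) F
       + cint (of_real T * (of_real e * \<i>)) (of_real a + of_real T * (of_real e * \<i>)) F"
proof -
  have ee: "e * e = 1" using assms by auto
  have m: "of_real a \<in> {z. e * Im z > 0} \<union> {of_real a}" "of_real a + of_real T * (of_real e * \<i>) \<in> {z. e * Im z > 0} \<union> {of_real a}"
     "of_real \<epsilon> * (of_real e * \<i>) \<in> {z. e * Im z > 0} \<union> {of_real a}" "of_real T * (of_real e * \<i>) \<in> {z. e * Im z > 0} \<union> {of_real a}"
    using assms(1-3) by auto
  have "cint (of_real a) (of_real a + of_real T * (of_real e * \<i>)) F + cint (of_real a + of_real T * (of_real e * \<i>)) (of_real T * (of_real e * \<i>)) F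
      = cint (of_real a) (of_real T * (of_real e * \<i>)) F"
    by (rule cint_triangle[OF assms(4) convex_pt_upper[OF assms(1)] m(1,2,4)])
  moreover have "cint (of_real a) (of_real \<epsilon> * (of_real e * \<i>)) F + cint (of_real \<epsilon> * (of_real e * \<i>)) (of_real T * (of_real e * \<i>)) F
      = cint (of_real a) (of_real T * (of_real e * \<i>)) F"
    by (rule cint_triangle[OF assms(4) convex_pt_upper[OF assms(1)] m(1,3,4)])
  ultimately show ?thesis
    unfolding cint_reverse[of "of_real a + of_real T * (of_real e * \<i>)" "of_real T * (of_real e * \<i>)"] by (simp add: algebra_simps)
qed

lemma holomorphic_powr_ker:
  assumes "e \<in> {1, -1}" "e' \<in> {1, -1}" "a > 0" "cos (2 * pi * a) = 0"
  shows "(\<lambda>z. z powr (-s) * ker e' z) holomorphic_on ({z. e * Im z > 0} \<union> {of_real a})"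
proof -
  have A: "z \<notin> \<real>\<^sub>\<le>\<^sub>0" if "z \<in> {z. e * Im z > 0} \<union> {complex_of_real a}" for z
    using that assms by (auto simp: complex_nonpos_Reals_iff)
  have B: "({z. e * Im z > 0} \<union> {complex_of_real a}) \<inter> \<int> = {}"
    using quarter_notin_Ints[OF assms(4)] by (auto simp: complex_is_Int_iff)
  have "(\<lambda>z. z powr (-s)) holomorphic_on ({z. e * Im z > 0} \<union> {complex_of_real a})"
    by (intro holomorphic_intros A)
  then show ?thesis by (intro holomorphic_on_mult holomorphic_on_ker[OF assms(2) B])
qed

text \<open>Inner radius of the paths. The shift by 20 puts it, already for n = 0, inside the disc
  where \<open>norm_ker_near_0\<close> holds.\<close>

definition eps :: "nat \<Rightarrow> real" where "eps n = 1 / (real n + 20)"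

lemma eps: "eps n > 0" "eps n \<le> 1/20" "eps n < real (Suc n)" "eps \<longlonglongrightarrow> 0" "filterlim (\<lambda>n. real (Suc n)) at_top sequentially"
proof -
  show 1: "eps n > 0" by (simp add: eps_def)
  show 2: "eps n \<le> 1/20" unfolding eps_def by (rule divide_left_mono) auto
  show "eps n < real (Suc n)" using 2 by simp
  show "eps \<longlonglongrightarrow> 0" unfolding eps_def by real_asymp
  show "filterlim (\<lambda>n. real (Suc n)) at_top sequentially" by real_asymp
qed

lemma eps_powr_tendsto_0: "p > 0 \<Longrightarrow> (\<lambda>n. C * eps n powr p) \<longlonglongrightarrow> 0"
proof -
  assume p: "p > 0"
  have "(\<lambda>n. eps n powr p) \<longlonglongrightarrow> 0"
    by (rule tendsto_zero_powrI[OF eps(4) tendsto_const _ p]) (simp add: eps(1) less_imp_le)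
  then show ?thesis by (rule tendsto_mult_right_zero)
qed

lemma top_segment_tendsto_0:
  fixes k :: "complex \<Rightarrow> complex" and b a e M :: real
  assumes "e \<in> {1, -1}" "M \<ge> 0" "\<bar>a\<bar> \<le> L" "\<bar>b\<bar> \<le> L" 
    and k: "\<And>z. e * Im z \<ge> 1 \<Longrightarrow> norm (k z) \<le> M * exp (- (e * Im z))"
  shows "(\<lambda>n. cint (of_real a + of_real (real (Suc n)) * (of_real e * \<i>)) (of_real b + of_real (real (Suc n)) * (of_real e * \<i>)) (\<lambda>z. z powr (-s) * k z)) \<longlonglongrightarrow> 0"
proof (rule powr_kernel_segment_tendsto_0[where L = "2 * L + 2" and M = M])
  have L: "L \<ge> 0" using assms by linarith
  then show "2 * L + 2 > 0" by simp
  show "norm z \<ge> 1 \<and> norm z \<le> (2 * L + 2) * (1 + real n) \<and> norm (k z) \<le> M * exp (- real n)"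
    if n: "n \<ge> 1" and z: "z \<in> closed_segment (of_real a + of_real (real (Suc n)) * (of_real e * \<i>)) (of_real b + of_real (real (Suc n)) * (of_real e * \<i>))" for n z
  proof -
    obtain u where u: "0 \<le> u" "u \<le> 1" "z = (1 - u) *\<^sub>R (of_real a + of_real (real (Suc n)) * (of_real e * \<i>)) + u *\<^sub>R (of_real b + of_real (real (Suc n)) * (of_real e * \<i>))"
      using z by (auto simp: closed_segment_def)
    have z: "Re z = (1 - u) * a + u * b" "Im z = real (Suc n) * e" unfolding u(3) by (simp_all add: algebra_simps)
    have eI: "e * Im z = real (Suc n)" using z assms(1) by auto
    have I: "\<bar>Im z\<bar> = real (Suc n)" using z assms(1) by (auto simp: abs_mult)
    have "\<bar>Re z\<bar> \<le> \<bar>(1 - u) * a\<bar> + \<bar>u * b\<bar>" unfolding z by (rule abs_triangle_ineq)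
    also have "\<dots> \<le> (1 - u) * L + u * L" using u assms by (intro add_mono) (auto simp: abs_mult intro!: mult_left_mono)
    finally have R: "\<bar>Re z\<bar> \<le> L" by (simp add: algebra_simps)
    have "norm z \<le> L + real (Suc n)" using cmod_le[of z] R I by linarith
    also have "\<dots> \<le> (2 * L + 2) * (1 + real n)" using L by (simp add: algebra_simps)
    finally have "norm z \<le> (2 * L + 2) * (1 + real n)" .
    moreover have "norm z \<ge> 1" using abs_Im_le_cmod[of z] I by simp
    moreover have "norm (k z) \<le> M * exp (- real (Suc n))" using k[of z] eI by auto
    moreover have "M * exp (- real (Suc n)) \<le> M * exp (- real n)" using assms(2) by (intro mult_left_mono) auto
    ultimately show ?thesis by linarith
  qed
  show "norm (of_real b + of_real (real (Suc n)) * (of_real e * \<i>) - (of_real a + of_real (real (Suc n)) * (of_real e * \<i>))) \<le> (2 * L + 2) * (1 + real n)" for n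
  proof -
    have "norm (of_real b + of_real (real (Suc n)) * (of_real e * \<i>) - (of_real a + of_real (real (Suc n)) * (of_real e * \<i>))) = \<bar>b - a\<bar>"
      by (simp flip: of_real_diff)
    also have "\<dots> \<le> 2 * L" using assms by linarith
    also have "\<dots> \<le> (2 * L + 2) * (1 + real n)" using L by (simp add: algebra_simps)
    finally show ?thesis .
  qed
qed (use assms in auto)

lemma norm_ker_exp:
  assumes "e \<in> {1, -1}" "e * Im z \<ge> 1"
  shows "norm (ker e z) \<le> 2 * exp (- (e * Im z))"
proof -
  have "1 * (e * Im z) \<le> 2 * pi * (e * Im z)" using assms pi_ge_two by (intro mult_right_mono) auto
  then show ?thesis using norm_ker_far[OF assms] by (simp add: order_trans)
qed

text \<open>A simple pole at 0: for norm w at most 8/25 Taylor gives norm (exp w - 1) \<ge> 47/100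
  norm w, and 47/100 times 2 pi exceeds 1.\<close>

lemma norm_ker_near_0:
  assumes "e \<in> {1, -1}" "norm z \<le> 1/20" "z \<noteq> 0"
  shows "norm (ker e z) \<le> 1 / norm z"
proof -
  define w where "w = - (of_real (2 * pi * e) * \<i> * z)"
  have nw: "norm w = 2 * pi * norm z" using assms(1) by (auto simp: w_def norm_mult)
  also have "\<dots> \<le> 2 * (16/5) * (1/20)" using assms pi_approx by (intro mult_mono) auto
  finally have w: "norm w \<le> (8/25)" by simp
  have "norm (exp w - (\<Sum>k\<le>1. w ^ k / fact k)) \<le> exp \<bar>Re w\<bar> * norm w ^ Suc 1 / fact 1" by (rule Taylor_exp)
  then have 1: "norm (exp w - 1 - w) \<le> exp \<bar>Re w\<bar> * norm w ^ 2" by (simp add: numeral_2_eq_2 diff_diff_eq)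
  have "exp \<bar>Re w\<bar> \<le> exp (8/25)" using w abs_Re_le_cmod[of w] by simp
  also have "exp ((8/25)::real) \<le> 1 + 2 * (8/25)" by (rule real_exp_bound_lemma) auto
  finally have "exp \<bar>Re w\<bar> * norm w ^ 2 \<le> (41/25) * ((8/25) * norm w)"
    unfolding power2_eq_square using w by (intro mult_mono) (auto intro: mult_right_mono)
  with 1 have "norm (exp w - 1 - w) \<le> (53/100) * norm w" using norm_ge_zero[of w] by linarith
  moreover have "norm w \<le> norm (exp w - 1) + norm (exp w - 1 - w)"
    using norm_triangle_ineq4[of "exp w - 1" "exp w - 1 - w"] by simp
  ultimately have "norm (exp w - 1) \<ge> (47/100) * norm w" by linarith
  moreover have "norm z \<le> (47/100) * norm w" unfolding nw using pi_approx assms by (simp add: mult_le_cancel_right1)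
  ultimately have "norm z \<le> norm (exp w - 1)" by linarith
  then show ?thesis unfolding ker_def w_def[symmetric] norm_divide norm_one using assms by (intro divide_left_mono mult_pos_pos) (auto intro: less_le_trans)
qed

text \<open>On the segment norm z lies between eps n / 2 and eps n, and the length is O(eps n), so
  the integral is of order eps n to the power p. It is used with p = - Re s when the kernel
  contributes its pole, and with p = 1 - Re s when only finitely many exponentials are
  present.\<close>

lemma cint_near_0_tendsto:
  fixes e p C :: real
  assumes "e \<in> {1, -1}" "p > 0" "C \<ge> 0"
    and "\<And>z. z \<noteq> 0 \<Longrightarrow> norm z \<le> 1/20 \<Longrightarrow> Re z \<ge> 0 \<Longrightarrow> norm (F z) \<le> C * norm z powr (p - 1)"
  shows "(\<lambda>n. cint (of_real (eps n)) (of_real (eps n) * (of_real e * \<i>)) F) \<longlonglongrightarrow> 0"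
proof -
  have "norm (cint (of_real (eps n)) (of_real (eps n) * (of_real e * \<i>)) F) \<le> (4 * C) * eps n powr p" for n
  proof -
    define \<epsilon> where "\<epsilon> = eps n"
    have \<epsilon>: "\<epsilon> > 0" "\<epsilon> \<le> 1/20" using eps(1)[of n] eps(2)[of n] by (auto simp: \<epsilon>_def)
    have "norm (F z) \<le> 2 * C * \<epsilon> powr (p - 1)" if zseg: "z \<in> closed_segment (of_real \<epsilon>) (of_real \<epsilon> * (of_real e * \<i>))" for z
    proof -
      obtain u where u: "0 \<le> u" "u \<le> 1" "z = (1 - u) *\<^sub>R of_real \<epsilon> + u *\<^sub>R (of_real \<epsilon> * (of_real e * \<i>))"
        using zseg by (auto simp: closed_segment_def)
      have z: "Re z = (1 - u) * \<epsilon>" "Im z = u * \<epsilon> * e" unfolding u(3) by simp_all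
      have I: "\<bar>Im z\<bar> = u * \<epsilon>" using z u \<epsilon> assms(1) by (auto simp: abs_mult)
      have R: "\<bar>Re z\<bar> = (1 - u) * \<epsilon>" using z u \<epsilon> by auto
      have s: "\<bar>Re z\<bar> + \<bar>Im z\<bar> = \<epsilon>" unfolding I R by (simp add: algebra_simps)
      have up: "norm z \<le> \<epsilon>" using cmod_le[of z] s by simp
      have lo: "norm z \<ge> \<epsilon> / 2" using s abs_Re_le_cmod[of z] abs_Im_le_cmod[of z] by linarith
      have "norm z powr (p - 1) \<le> 2 * \<epsilon> powr (p - 1)"
      proof (cases "p \<ge> 1")
        case True
        then have "norm z powr (p - 1) \<le> \<epsilon> powr (p - 1)" using up by (intro powr_mono2) auto
        then show ?thesis by (smt (verit) powr_ge_zero)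
      next
        case False
        then have "norm z powr (p - 1) \<le> (\<epsilon> / 2) powr (p - 1)" using lo \<epsilon> by (intro powr_mono2') auto
        also have "\<dots> = \<epsilon> powr (p - 1) * 2 powr (1 - p)" using \<epsilon> by (simp add: powr_divide powr_diff)
        also have "\<dots> \<le> \<epsilon> powr (p - 1) * 2 powr 1" using assms(2) by (intro mult_left_mono powr_mono) auto
        finally show ?thesis by simp
      qed
      moreover have "norm (F z) \<le> C * norm z powr (p - 1)"
      proof (rule assms(4))
        show "z \<noteq> 0" using lo \<epsilon> by auto
        show "norm z \<le> 1/20" using up \<epsilon> by linarith
        show "Re z \<ge> 0" unfolding z using u \<epsilon> by simp
      qed
      ultimately show ?thesis using assms(3) mult_left_mono[of "norm z powr (p - 1)" "2 * \<epsilon> powr (p - 1)" C] by linarith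
    qed
    then have "norm (cint (of_real \<epsilon>) (of_real \<epsilon> * (of_real e * \<i>)) F) \<le> (2 * C * \<epsilon> powr (p - 1)) * norm (of_real \<epsilon> * (of_real e * \<i>) - of_real \<epsilon> :: complex)"
      using assms(3) by (intro norm_cint_le) auto
    also have "\<dots> \<le> (2 * C * \<epsilon> powr (p - 1)) * (2 * \<epsilon>)"
    proof (rule mult_left_mono)
      have "norm (of_real \<epsilon> * (of_real e * \<i>) :: complex) = \<epsilon>" "norm (of_real \<epsilon> :: complex) = \<epsilon>"
        using \<epsilon> assms(1) by (auto simp: norm_mult)
      then show "norm (of_real \<epsilon> * (of_real e * \<i>) - of_real \<epsilon> :: complex) \<le> 2 * \<epsilon>"
        using norm_triangle_ineq4[of "of_real \<epsilon> * (of_real e * \<i>) :: complex" "of_real \<epsilon>"] by linarith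
    qed (use assms(3) in auto)
    also have "\<dots> = (4 * C) * \<epsilon> powr p"
      using \<epsilon> by (simp add: powr_diff)
    finally show ?thesis by (simp add: \<epsilon>_def)
  qed
  then have "\<forall>\<^sub>F n in sequentially. norm (cint (of_real (eps n)) (of_real (eps n) * (of_real e * \<i>)) F) \<le> (4 * C) * eps n powr p"
    by (intro always_eventually allI)
  then show ?thesis by (rule Lim_null_comparison) (rule eps_powr_tendsto_0[OF assms(2)])
qed

lemma norm_powr_le_exp: "norm (z powr (-s)) \<le> exp (pi * \<bar>Im s\<bar>) * norm z powr (- Re s)"
  using norm_powr_neg_le[of z s] by (simp add: mult.commute)

lemma eps_powr_complex_tendsto_0:
  assumes "e \<in> {1, -1}" "Re s < 1"
  shows "(\<lambda>n. (of_real (eps n) * (of_real e * \<i>)) powr (1 - s)) \<longlonglongrightarrow> 0"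
proof (rule Lim_null_comparison[OF always_eventually])
  show "\<forall>n. norm ((of_real (eps n) * (of_real e * \<i>)) powr (1 - s)) \<le> exp (pi * \<bar>Im (s - 1)\<bar>) * eps n powr (1 - Re s)"
  proof
    fix n
    have "norm (of_real (eps n) * (of_real e * \<i>) :: complex) = eps n" using eps(1)[of n] assms(1) by (auto simp: norm_mult)
    then show "norm ((of_real (eps n) * (of_real e * \<i>)) powr (1 - s)) \<le> exp (pi * \<bar>Im (s - 1)\<bar>) * eps n powr (1 - Re s)"
      using norm_powr_le_exp[of "of_real (eps n) * (of_real e * \<i>)" "s - 1"] by simp
  qed
  show "(\<lambda>n. exp (pi * \<bar>Im (s - 1)\<bar>) * eps n powr (1 - Re s)) \<longlonglongrightarrow> 0"
    by (rule eps_powr_tendsto_0) (use assms in auto)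
qed

section \<open>The functional equation\<close>

abbreviation ax :: "real \<Rightarrow> real \<Rightarrow> complex" where "ax e r \<equiv> of_real r * (of_real e * \<i>)"

lemma cint_add:
  assumes "continuous_on (closed_segment A B) G" "continuous_on (closed_segment A B) H"
    and "\<And>z. z \<in> closed_segment A B \<Longrightarrow> F z = G z + H z"
  shows "cint A B F = cint A B G + cint A B H"
proof -
  have "cint A B F = cint A B (\<lambda>z. G z + H z)"
    using assms(3) by (intro contour_integral_eq) auto
  also have "\<dots> = cint A B G + cint A B H"
    using assms by (intro contour_integral_add contour_integrable_continuous_linepath)
  finally show ?thesis .
qed

lemma hol_cont_segment:
  assumes "f holomorphic_on S" "convex S" "A \<in> S" "B \<in> S"
  shows "continuous_on (closed_segment A B) f"
  by (rule continuous_on_subset[OF holomorphic_on_imp_continuous_on[OF assms(1)] closed_segment_subset[OF assms(3,4,2)]])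

lemma segment_in_convex: "convex S \<Longrightarrow> A \<in> S \<Longrightarrow> B \<in> S \<Longrightarrow> z \<in> closed_segment A B \<Longrightarrow> z \<in> S"
  by (meson closed_segment_subset subsetD)

lemma holomorphic_powr_neg: "(\<And>z. z \<in> S \<Longrightarrow> z \<notin> \<real>\<^sub>\<le>\<^sub>0) \<Longrightarrow> (\<lambda>z. z powr (-s)) holomorphic_on S"
  by (intro holomorphic_intros)

text \<open>With q = exp (2 pi i e z) the kernel is q / (1 - q); these are the first m terms of its
  geometric series, and \<open>kerm\<close> is what is left after them.\<close>

definition geo :: "real \<Rightarrow> nat \<Rightarrow> complex \<Rightarrow> complex" where
  "geo e m z = (\<Sum>k=1..m. exp (\<i> * of_real (2 * pi * real k * e) * z))"

definition kerm :: "real \<Rightarrow> nat \<Rightarrow> complex \<Rightarrow> complex" where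
  "kerm e m z = exp (\<i> * of_real (2 * pi * real m * e) * z) * ker e z"

lemma ker_split:
  assumes "e \<in> {1, -1}" "z \<notin> \<int>"
  shows "ker e z = geo e m z + kerm e m z"
proof (induction m)
  case (Suc m)
  define q where "q = exp (\<i> * of_real (2 * pi * e) * z)"
  have q: "q \<noteq> 0" "q \<noteq> 1"
  proof -
    show "q \<noteq> 0" by (simp add: q_def)
    have "-e \<in> {1,-1}" using assms(1) by auto
    then have "exp (- (of_real (2 * pi * (-e)) * \<i> * z)) \<noteq> 1" using exp_ker_eq_1_iff assms(2) by blast
    then show "q \<noteq> 1" by (simp add: q_def mult_ac)
  qed
  have "exp (- (of_real (2 * pi * e) * \<i> * z)) = 1 / q" by (simp add: q_def exp_minus inverse_eq_divide mult_ac)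
  then have k: "ker e z = 1 / (1 / q - 1)" by (simp add: ker_def)
  have "1 / q - 1 \<noteq> 0" using q by simp
  then have kq: "ker e z = q + q * ker e z" unfolding k using q by (simp add: divide_simps) (simp add: algebra_simps)
  have e: "exp (\<i> * of_real (2 * pi * real (Suc m) * e) * z) = exp (\<i> * of_real (2 * pi * real m * e) * z) * q"
    unfolding q_def exp_add[symmetric] by (simp add: algebra_simps)
  have "kerm e m z = exp (\<i> * of_real (2 * pi * real m * e) * z) * (q + q * ker e z)"
    unfolding kerm_def using kq by simp
  also have "\<dots> = exp (\<i> * of_real (2 * pi * real (Suc m) * e) * z) + kerm e (Suc m) z"
    unfolding kerm_def e by (simp only: distrib_left mult.assoc)
  finally show ?case using Suc by (simp add: geo_def)
qed (simp add: geo_def kerm_def)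

lemma holomorphic_geo: "geo e m holomorphic_on S"
  unfolding geo_def[abs_def] by (intro holomorphic_intros)

lemma holomorphic_kerm: "e \<in> {1, -1} \<Longrightarrow> S \<inter> \<int> = {} \<Longrightarrow> kerm e m holomorphic_on S"
  unfolding kerm_def[abs_def] by (intro holomorphic_intros holomorphic_on_ker)

text \<open>Both rays from 1/4 are turned onto the imaginary axis. Their initial pieces combine by
  \<open>ker_add\<close> into the bare power, whose integral cancels the elementary term of
  \<open>Zcont\<close> up to a boundary value at i eps n. The pole of the kernels at 0 is harmless
  because Re s < 0.\<close>

lemma zeta_axis_limit:
  assumes "Re s < 0"
  shows "(\<lambda>n. cint (ax 1 (eps n)) (ax 1 (real (Suc n))) (\<lambda>z. z powr (-s) * ker 1 z)
            + cint (ax (-1) (eps n)) (ax (-1) (real (Suc n))) (\<lambda>z. z powr (-s) * ker (-1) z)) \<longlonglongrightarrow> zeta s"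
proof -
  define a :: real where "a = 1/4"
  have a: "a > 0" "cos (2 * pi * a) = 0" using cos_quarter[of "1/4" 0] by (simp_all add: a_def)
  have s1: "s \<noteq> 1" using assms by auto
  define F where "F e z = z powr (-s) * ker e z" for e z
  define P where "P z = z powr (-s)" for z :: complex
  define ca where "ca = complex_of_real a"
  have holF: "F e' holomorphic_on ({z. e * Im z > 0} \<union> {ca})" if "e \<in> {1,-1}" "e' \<in> {1,-1}" for e e'
    unfolding F_def ca_def by (rule holomorphic_powr_ker[OF that a])
  define top where "top e n = cint (ax e (real (Suc n))) (ca + ax e (real (Suc n))) (F e)" for e n
  define near where "near e n = cint (of_real (eps n)) (ax e (eps n)) (F (-1))" for e n
  define main where "main e n = cint (ax e (eps n)) (ax e (real (Suc n))) (F e)" for e n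
  have v: "vint e a s (Suc n) = cint ca (ax e (eps n)) (F e) + main e n + top e n" if e: "e \<in> {1,-1}" for e n
    using rotate_vertical[OF e eps(1)[of n] _ holF[OF e e, unfolded ca_def], of "real (Suc n)"]
    by (simp add: vint_def main_def top_def F_def[abs_def] ca_def)
  \<comment> \<open>The lower kernel is brought from 1/4 to both points e i eps n through the strip
    0 < Re z < 1, which has no integers. Up to the two short segments the results agree, so on the
    upper side it can meet the upper kernel.\<close>
  have near: "cint ca (ax e (eps n)) (F (-1)) = cint ca (of_real (eps n)) (F (-1)) + near e n" if e: "e \<in> {1,-1}" for e n
  proof -
    define S where "S = ({z. Re z > 0} \<union> {ax e (eps n)}) \<inter> {z. Re z < 1}"
    have "convex S" unfolding S_def by (intro convex_Int convex_right_pt convex_halfspace_Re_lt)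
    moreover have "F (-1) holomorphic_on S" unfolding F_def
    proof (intro holomorphic_on_mult holomorphic_on_ker holomorphic_powr_neg)
      show "S \<inter> \<int> = {}" using eps(1)[of n] e by (auto simp: S_def complex_is_Int_iff)
      show "z \<notin> \<real>\<^sub>\<le>\<^sub>0" if "z \<in> S" for z
        using that eps(1)[of n] e by (auto simp: S_def complex_nonpos_Reals_iff)
    qed auto
    moreover have "ca \<in> S" "of_real (eps n) \<in> S" "ax e (eps n) \<in> S"
      using a eps(1)[of n] eps(2)[of n] by (auto simp: S_def ca_def a_def)
    ultimately show ?thesis unfolding near_def using cint_triangle by metis
  qed
  have F1: "cint ca (ax 1 (eps n)) (F 1) + cint ca (ax 1 (eps n)) (F (-1)) = - cint ca (ax 1 (eps n)) P" for n
  proof -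
    have cv: "convex ({z. 1 * Im z > 0} \<union> {ca})" unfolding ca_def by (rule convex_pt_upper) simp
    have m: "ca \<in> {z. 1 * Im z > 0} \<union> {ca}" "ax 1 (eps n) \<in> {z. 1 * Im z > 0} \<union> {ca}" using eps(1)[of n] by auto
    have "cint ca (ax 1 (eps n)) (\<lambda>z. - P z) = cint ca (ax 1 (eps n)) (F 1) + cint ca (ax 1 (eps n)) (F (-1))"
    proof (rule cint_add)
      show "continuous_on (closed_segment ca (ax 1 (eps n))) (F 1)" "continuous_on (closed_segment ca (ax 1 (eps n))) (F (-1))"
        by (rule hol_cont_segment[OF holF[of 1] cv m]; simp)+
      show "- P z = F 1 z + F (-1) z" if "z \<in> closed_segment ca (ax 1 (eps n))" for z
      proof -
        have "z \<in> {z. 1 * Im z > 0} \<union> {ca}" by (rule segment_in_convex[OF cv m that])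
        then have "z \<notin> \<int>" using quarter_notin_Ints(1)[OF a(2)] by (auto simp: ca_def complex_is_Int_iff)
        then have "ker 1 z + ker (-1) z = -1" by (rule ker_add)
        then have "P z * (ker 1 z + ker (-1) z) = P z * (-1)" by simp
        then show ?thesis by (simp add: F_def P_def distrib_left)
      qed
    qed
    moreover have "cint ca (ax 1 (eps n)) (\<lambda>z. - P z) = - cint ca (ax 1 (eps n)) P" by (simp add: contour_integral_neg)
    ultimately show ?thesis by simp
  qed
  have Pint: "cint ca (ax 1 (eps n)) P = (ax 1 (eps n) powr (1 - s) - ca powr (1 - s)) / (1 - s)" for n
    unfolding P_def
  proof (rule cint_powr[OF s1])
    have cv: "convex ({z. 1 * Im z > 0} \<union> {ca})" unfolding ca_def by (rule convex_pt_upper) simp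
    have m: "ca \<in> {z. 1 * Im z > 0} \<union> {ca}" "ax 1 (eps n) \<in> {z. 1 * Im z > 0} \<union> {ca}" using eps(1)[of n] by auto
    show "closed_segment ca (ax 1 (eps n)) \<inter> \<real>\<^sub>\<le>\<^sub>0 = {}"
    proof -
      have "z \<notin> \<real>\<^sub>\<le>\<^sub>0" if "z \<in> closed_segment ca (ax 1 (eps n))" for z
        using segment_in_convex[OF cv m that] a by (auto simp: ca_def complex_nonpos_Reals_iff)
      then show ?thesis by blast
    qed
  qed
  define L where "L n = ca powr (1 - s) / (s - 1) + vint 1 a s (Suc n) + vint (-1) a s (Suc n)" for n
  have Lmain: "main 1 n + main (-1) n = L n - ax 1 (eps n) powr (1 - s) / (s - 1) - top 1 n - top (-1) n + near 1 n - near (-1) n" for n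
  proof -
    have q: "(ax 1 (eps n) powr (1 - s) - ca powr (1 - s)) / (1 - s) = ca powr (1 - s) / (s - 1) - ax 1 (eps n) powr (1 - s) / (s - 1)"
      by (metis diff_divide_distrib minus_diff_eq minus_divide_divide)
    show ?thesis unfolding L_def using v[of 1 n] v[of "-1" n] near[of 1 n] near[of "-1" n] F1[of n] Pint[of n, unfolded q] by simp algebra
  qed
  have t1: "L \<longlonglongrightarrow> Zcont a s" unfolding L_def Zcont_def ca_def
    by (intro tendsto_intros LIMSEQ_Suc vint_tendsto a) auto
  have t2: "Zcont a s = zeta s" using zeta_eq_Zcont[of "1/4" s] s1 by (simp add: a_def)
  have t3: "(\<lambda>n. ax 1 (eps n) powr (1 - s) / (s - 1)) \<longlonglongrightarrow> 0 / (s - 1)"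
    using assms s1 by (intro tendsto_intros eps_powr_complex_tendsto_0) auto
  have t4: "top e \<longlonglongrightarrow> 0" if e: "e \<in> {1,-1}" for e
    using top_segment_tendsto_0[OF e, of 2 0 "1/4" "1/4" "ker e" s] norm_ker_exp[OF e]
    unfolding top_def F_def ca_def a_def by simp
  have t5: "near e \<longlonglongrightarrow> 0" if e: "e \<in> {1,-1}" for e
    unfolding near_def
  proof (rule cint_near_0_tendsto[OF e, where p = "- Re s" and C = "exp (pi * \<bar>Im s\<bar>)"])
    fix z :: complex assume z: "z \<noteq> 0" "norm z \<le> 1/20"
    have "norm (F (-1) z) \<le> (exp (pi * \<bar>Im s\<bar>) * norm z powr (- Re s)) * (1 / norm z)"
      unfolding F_def norm_mult using norm_powr_le_exp norm_ker_near_0[of "-1" z] z by (intro mult_mono) auto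
    also have "\<dots> = exp (pi * \<bar>Im s\<bar>) * norm z powr (- Re s - 1)" using z by (simp add: powr_diff)
    finally show "norm (F (-1) z) \<le> exp (pi * \<bar>Im s\<bar>) * norm z powr (- Re s - 1)" .
  qed (use assms in auto)
  have "(\<lambda>n. L n - ax 1 (eps n) powr (1 - s) / (s - 1) - top 1 n - top (-1) n + near 1 n - near (-1) n)
      \<longlonglongrightarrow> zeta s - 0 / (s - 1) - 0 - 0 + 0 - 0"
    by (intro tendsto_add tendsto_diff t1[unfolded t2] t3 t4 t5) simp_all
  then have "(\<lambda>n. main 1 n + main (-1) n) \<longlonglongrightarrow> zeta s" unfolding Lmain by simp
  then show ?thesis unfolding main_def F_def[abs_def] .
qed

lemma real_gamma_bound:
  fixes c p \<alpha> \<beta> :: real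
  assumes "c > 0" "p > 0" "0 < \<alpha>" "\<alpha> < \<beta>"
  shows "integral {\<alpha>..\<beta>} (\<lambda>v. v powr (p - 1) * exp (- c * v)) \<le> c powr (- p) * Gamma p"
    "(\<lambda>v. v powr (p - 1) * exp (- c * v)) integrable_on {\<alpha>..\<beta>}"
proof -
  define f where "f u = u powr (p - 1) / exp u" for u :: real
  have cpos: "c * \<alpha> > 0" using assms by simp
  have G: "(f has_integral Gamma p) {0..}" unfolding f_def[abs_def] by (rule Gamma_integral_real[OF assms(2)])
  have cont: "continuous_on {c * \<alpha>..c * \<beta>} f"
    unfolding f_def using cpos by (intro continuous_intros) auto
  define I where "I = integral {c * \<alpha>..c * \<beta>} f"
  have fI: "(f has_integral I) (cbox (c * \<alpha>) (c * \<beta>))"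
    unfolding I_def using integrable_continuous_real[OF cont] by (simp add: has_integral_integral)
  have "I \<le> Gamma p"
  proof (rule has_integral_subset_le[OF _ fI[unfolded cbox_interval] G])
    show "{c * \<alpha>..c * \<beta>} \<subseteq> {0..}" using cpos by auto
  qed (auto simp: f_def)
  have "((\<lambda>t. f (c *\<^sub>R t + 0)) has_integral (I /\<^sub>R c ^ DIM(real))) (cbox ((c * \<alpha> - 0) /\<^sub>R c) ((c * \<beta> - 0) /\<^sub>R c))"
    by (rule has_integral_affinity'[OF fI]) (use assms in auto)
  then have "((\<lambda>t. f (c * t)) has_integral (I / c)) {\<alpha>..\<beta>}"
    using assms by (simp add: field_simps)
  then have h1: "((\<lambda>t. c powr (1 - p) * f (c * t)) has_integral (c powr (1 - p) * (I / c))) {\<alpha>..\<beta>}"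
    by (rule has_integral_mult_right)
  have h2: "c powr (1 - p) * f (c * t) = t powr (p - 1) * exp (- c * t)" if "t \<in> {\<alpha>..\<beta>}" for t
  proof -
    have "(c * t) powr (p - 1) = c powr (p - 1) * t powr (p - 1)" using assms that by (simp add: powr_mult)
    moreover have "c powr (1 - p) * c powr (p - 1) = 1" using assms by (simp flip: powr_add)
    ultimately show ?thesis by (simp add: f_def exp_minus divide_inverse)
  qed
  have h4: "c powr (1 - p) * (I / c) = c powr (- p) * I"
    using assms by (simp add: powr_diff powr_minus field_simps)
  have h: "((\<lambda>t. t powr (p - 1) * exp (- c * t)) has_integral (c powr (- p) * I)) {\<alpha>..\<beta>}"
    using has_integral_eq[OF h2 h1] unfolding h4 by blast
  then show "(\<lambda>v. v powr (p - 1) * exp (- c * v)) integrable_on {\<alpha>..\<beta>}" by blast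
  have "c powr (- p) * I \<le> c powr (- p) * Gamma p" using \<open>I \<le> Gamma p\<close> by (intro mult_left_mono) auto
  then show "integral {\<alpha>..\<beta>} (\<lambda>v. v powr (p - 1) * exp (- c * v)) \<le> c powr (- p) * Gamma p"
    using integral_unique[OF h] by simp
qed

text \<open>On the axis the kernel is 1 / (exp (2 pi v) - 1), hence at most 1 / v, and the rest
  after K terms is bounded by a real Gamma integral of order K^(Re s). The bound is free of the
  endpoints and vanishes as K grows.\<close>

lemma kerm_axis_bound:
  assumes s: "Re s < 0" and e: "e \<in> {1, -1}" and K: "K \<ge> 1" and ab: "0 < \<alpha>" "\<alpha> < \<beta>"
  shows "norm (cint (ax e \<alpha>) (ax e \<beta>) (\<lambda>z. z powr (-s) * kerm e K z))
       \<le> exp (pi * \<bar>Im s\<bar>) * ((2 * pi * real K) powr Re s * Gamma (- Re s))"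
proof -
  define d where "d = of_real e * \<i>"
  define F where "F z = z powr (-s) * kerm e K z" for z
  define p where "p = - Re s"
  define c where "c = 2 * pi * real K"
  have nd: "norm d = 1" using e by (auto simp: d_def norm_mult)
  have "continuous_on {\<alpha>..\<beta>} (\<lambda>v. F (of_real v * d) * d)"
  proof -
    define S where "S = (\<lambda>v. of_real v * d) ` {\<alpha>..\<beta>}"
    have "F holomorphic_on S" unfolding F_def
    proof (intro holomorphic_on_mult holomorphic_kerm holomorphic_powr_neg e)
      show "S \<inter> \<int> = {}" using ab e by (auto simp: S_def d_def complex_is_Int_iff)
      show "z \<notin> \<real>\<^sub>\<le>\<^sub>0" if "z \<in> S" for z
        using that ab e by (auto simp: S_def d_def complex_nonpos_Reals_iff)
    qed
    then have "continuous_on S F" by (rule holomorphic_on_imp_continuous_on)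
    then have "continuous_on {\<alpha>..\<beta>} (\<lambda>v. F (of_real v * d))"
      by (rule continuous_on_compose2) (auto simp: S_def intro!: continuous_intros)
    then show ?thesis by (intro continuous_intros)
  qed
  then have int: "(\<lambda>v. F (of_real v * d) * d) integrable_on {\<alpha>..\<beta>}" by (rule integrable_continuous_real)
  then have "(F has_contour_integral (integral {\<alpha>..\<beta>} (\<lambda>v. F (of_real v * d) * d))) (linepath (0 + of_real \<alpha> * d) (0 + of_real \<beta> * d))"
    using ab by (subst has_contour_integral_ray) (auto simp only: add_0_left integrable_integral)
  then have "cint (ax e \<alpha>) (ax e \<beta>) F = integral {\<alpha>..\<beta>} (\<lambda>v. F (of_real v * d) * d)"
    by (simp add: contour_integral_unique d_def)
  also have "norm \<dots> \<le> integral {\<alpha>..\<beta>} (\<lambda>v. exp (pi * \<bar>Im s\<bar>) * (v powr (p - 1) * exp (- c * v)))"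
  proof (rule integral_norm_bound_integral[OF int])
    show "(\<lambda>v. exp (pi * \<bar>Im s\<bar>) * (v powr (p - 1) * exp (- c * v))) integrable_on {\<alpha>..\<beta>}"
      using s K ab by (intro integrable_on_mult_right real_gamma_bound(2)) (auto simp: c_def p_def)
    fix v assume "v \<in> {\<alpha>..\<beta>}"
    then have v: "v > 0" using ab by auto
    define z where "z = of_real v * d"
    have nz: "norm z = v" using v nd by (simp add: z_def norm_mult)
    have "norm (z powr (-s)) \<le> exp (pi * \<bar>Im s\<bar>) * v powr p"
      using norm_powr_le_exp[of z s] nz by (simp add: p_def)
    moreover have "norm (exp (\<i> * of_real (2 * pi * real K * e) * z)) = exp (- c * v)"
      using e by (auto simp: z_def d_def c_def algebra_simps)
    moreover have "norm (ker e z) \<le> 1 / v"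
    proof -
      have "- (of_real (2 * pi * e) * \<i> * z) = of_real (2 * pi * v)" using e by (auto simp: z_def d_def algebra_simps)
      then have "ker e z = 1 / (exp (of_real (2 * pi * v)) - 1)" unfolding ker_def by (simp only:)
      also have "\<dots> = of_real (1 / (exp (2 * pi * v) - 1))" by (simp only: exp_of_real of_real_divide of_real_diff of_real_1)
      finally have "ker e z = of_real (1 / (exp (2 * pi * v) - 1))" .
      moreover have "exp (2 * pi * v) - 1 \<ge> v"
      proof -
        have "1 * v \<le> 2 * pi * v" using v pi_ge_two by (intro mult_right_mono) auto
        then show ?thesis using exp_ge_add_one_self[of "2 * pi * v"] by linarith
      qed
      moreover from calculation have "norm (ker e z) = \<bar>1 / (exp (2 * pi * v) - 1)\<bar>" by (simp only: norm_of_real)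
      moreover have "1 / (exp (2 * pi * v) - 1) \<le> 1 / v" using calculation(2) v by (intro frac_le) auto
      ultimately show ?thesis using v by simp
    qed
    ultimately have "norm (F z) \<le> (exp (pi * \<bar>Im s\<bar>) * v powr p) * (exp (- c * v) * (1 / v))"
      unfolding F_def kerm_def norm_mult by (intro mult_mono) auto
    also have "\<dots> = exp (pi * \<bar>Im s\<bar>) * (v powr (p - 1) * exp (- c * v))" using v by (simp add: powr_diff)
    finally show "norm (F (of_real v * d) * d) \<le> exp (pi * \<bar>Im s\<bar>) * (v powr (p - 1) * exp (- c * v))"
      by (simp add: norm_mult nd z_def)
  qed
  also have "\<dots> \<le> exp (pi * \<bar>Im s\<bar>) * (c powr (- p) * Gamma p)"
    unfolding integral_mult_right using s K ab by (intro mult_left_mono real_gamma_bound(1)) (auto simp: c_def p_def)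
  finally show ?thesis by (simp add: F_def[abs_def] c_def p_def)
qed

text \<open>The kernels on the axis are expanded in K terms, each a Gamma integral. First the
  truncation is removed for fixed K, with an error bound independent of it; then K grows and the
  dual sum becomes the Dirichlet series at 1 - s.\<close>

lemma functional_equation_left:
  assumes "Re s < 0"
  shows "zeta s = chi s * zeta (1 - s)"
proof -
  define X where "X e k n = cint (ax e (eps n)) (ax e (real (Suc n))) (\<lambda>z. z powr (-s) * exp (\<i> * of_real (2 * pi * real k * e) * z))" for e k n
  define D where "D e n = cint (ax e (eps n)) (ax e (real (Suc n))) (\<lambda>z. z powr (-s) * ker e z)" for e n
  define B where "B K = exp (pi * \<bar>Im s\<bar>) * ((2 * pi * real K) powr Re s * Gamma (- Re s))" for K
  have D: "norm (D e n - (\<Sum>k=1..K. X e k n)) \<le> B K" if e: "e \<in> {1,-1}" and K: "K \<ge> 1" for e n K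
  proof -
    define S where "S = closed_segment (ax e (eps n)) (ax e (real (Suc n)))"
    have S: "z \<notin> \<int> \<and> z \<notin> \<real>\<^sub>\<le>\<^sub>0" if "z \<in> S" for z
    proof -
      have "z \<in> {z. Re z = 0} \<inter> {z. e * Im z > 0}"
      proof (rule segment_in_convex[OF _ _ _ that[unfolded S_def]])
        have "convex ({z :: complex. 1 \<bullet> z = 0} \<inter> {z. (complex_of_real e * \<i>) \<bullet> z > 0})"
          by (intro convex_Int convex_hyperplane convex_halfspace_gt)
        moreover have "{z :: complex. 1 \<bullet> z = 0} \<inter> {z. (complex_of_real e * \<i>) \<bullet> z > 0} = {z. Re z = 0} \<inter> {z. e * Im z > 0}"
          by (auto simp: inner_complex_def)
        ultimately show "convex ({z. Re z = 0} \<inter> {z. e * Im z > 0})" by simp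
      qed (use e eps(1)[of n] in auto)
      then show ?thesis by (auto simp: complex_is_Int_iff complex_nonpos_Reals_iff)
    qed
    have hP: "(\<lambda>z. z powr (-s)) holomorphic_on S" using S by (intro holomorphic_powr_neg) blast
    have "D e n = cint (ax e (eps n)) (ax e (real (Suc n))) (\<lambda>z. z powr (-s) * geo e K z)
         + cint (ax e (eps n)) (ax e (real (Suc n))) (\<lambda>z. z powr (-s) * kerm e K z)"
      unfolding D_def
    proof (rule cint_add)
      show "z powr (-s) * ker e z = z powr (-s) * geo e K z + z powr (-s) * kerm e K z"
        if "z \<in> closed_segment (ax e (eps n)) (ax e (real (Suc n)))" for z
        using ker_split[OF e, of z K] S[of z] that by (simp add: S_def distrib_left)
      show "continuous_on (closed_segment (ax e (eps n)) (ax e (real (Suc n)))) (\<lambda>z. z powr (-s) * geo e K z)"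
        using hP by (intro holomorphic_on_imp_continuous_on holomorphic_on_mult holomorphic_geo) (simp add: S_def)
      have "S \<inter> \<int> = {}" using S by blast
      then show "continuous_on (closed_segment (ax e (eps n)) (ax e (real (Suc n)))) (\<lambda>z. z powr (-s) * kerm e K z)"
        using hP by (intro holomorphic_on_imp_continuous_on holomorphic_on_mult holomorphic_kerm[OF e]) (simp_all add: S_def)
    qed
    also have "cint (ax e (eps n)) (ax e (real (Suc n))) (\<lambda>z. z powr (-s) * geo e K z) = (\<Sum>k=1..K. X e k n)"
    proof -
      have "cint (ax e (eps n)) (ax e (real (Suc n))) (\<lambda>z. \<Sum>k=1..K. z powr (-s) * exp (\<i> * of_real (2 * pi * real k * e) * z)) = (\<Sum>k=1..K. X e k n)"
        unfolding X_def
        by (intro contour_integral_sum contour_integrable_continuous_linepath holomorphic_on_imp_continuous_on holomorphic_on_mult)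
           (use hP in \<open>auto simp: S_def intro!: holomorphic_intros\<close>)
      then show ?thesis by (simp add: geo_def sum_distrib_left)
    qed
    finally show ?thesis using kerm_axis_bound[OF assms e K eps(1)[of n] eps(3)[of n]] by (simp add: B_def)
  qed
  have X: "(\<lambda>n. X 1 k n + X (-1) k n) \<longlonglongrightarrow> chi s * of_nat k powr (s - 1)" if k: "k \<ge> 1" for k
  proof -
    have "(\<lambda>n. X e k n) \<longlonglongrightarrow> (of_real e * \<i>) powr (1 - s) * of_real (2 * pi * real k) powr (s - 1) * Gamma (1 - s)"
      if "e \<in> {1,-1}" for e
      unfolding X_def using assms k
      by (intro exp_ray_Gamma_tendsto eps(1) eps(3) eps(4) eps(5) that) auto
    from tendsto_add[OF this[of 1] this[of "-1"]] show ?thesis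
      unfolding chi_eq_rays[OF k, symmetric] by simp
  qed
  have main: "norm (zeta s - chi s * (\<Sum>k=1..K. of_nat k powr (s - 1))) \<le> 2 * B K" if K: "K \<ge> 1" for K
  proof (rule Lim_norm_ubound[OF sequentially_bot])
    have "(\<lambda>n. \<Sum>k=1..K. X 1 k n + X (-1) k n) \<longlonglongrightarrow> (\<Sum>k=1..K. chi s * of_nat k powr (s - 1))"
      by (intro tendsto_sum X) auto
    then show "(\<lambda>n. (D 1 n + D (-1) n) - (\<Sum>k=1..K. X 1 k n + X (-1) k n)) \<longlonglongrightarrow> zeta s - chi s * (\<Sum>k=1..K. of_nat k powr (s - 1))"
      unfolding sum_distrib_left using zeta_axis_limit[OF assms] unfolding D_def by (intro tendsto_diff)
    have "norm ((D 1 n + D (-1) n) - (\<Sum>k=1..K. X 1 k n + X (-1) k n)) \<le> 2 * B K" for n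
    proof -
      have "(D 1 n + D (-1) n) - (\<Sum>k=1..K. X 1 k n + X (-1) k n) = (D 1 n - (\<Sum>k=1..K. X 1 k n)) + (D (-1) n - (\<Sum>k=1..K. X (-1) k n))"
        by (simp add: sum.distrib)
      also have "norm \<dots> \<le> B K + B K" by (intro norm_triangle_mono D K) auto
      finally show ?thesis by simp
    qed
    then show "\<forall>\<^sub>F n in sequentially. norm ((D 1 n + D (-1) n) - (\<Sum>k=1..K. X 1 k n + X (-1) k n)) \<le> 2 * B K"
      by (intro always_eventually allI)
  qed
  have "(\<lambda>K. 2 * B (Suc K)) \<longlonglongrightarrow> 2 * (exp (pi * \<bar>Im s\<bar>) * (0 * Gamma (- Re s)))"
  proof -
    have "filterlim (\<lambda>K. 2 * pi * real (Suc K)) at_top sequentially" by real_asymp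
    then have "(\<lambda>K. (2 * pi * real (Suc K)) powr Re s) \<longlonglongrightarrow> 0" using assms by (intro tendsto_neg_powr)
    then show ?thesis unfolding B_def by (intro tendsto_intros)
  qed
  then have B0: "(\<lambda>K. 2 * B (Suc K)) \<longlonglongrightarrow> 0" by simp
  have "(\<lambda>K. zeta s - chi s * (\<Sum>k=1..Suc K. of_nat k powr (s - 1))) \<longlonglongrightarrow> 0"
    by (rule Lim_null_comparison[OF _ B0]) (intro always_eventually allI main, simp)
  moreover have "(\<lambda>K. zeta s - chi s * (\<Sum>k=1..Suc K. of_nat k powr (s - 1))) \<longlonglongrightarrow> zeta s - chi s * zeta (1 - s)"
  proof -
    have "(\<lambda>n. of_nat (Suc n) powr (- (1 - s))) sums zeta (1 - s)" using assms by (intro zeta_series) simp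
    then have "(\<lambda>K. \<Sum>k<K. of_nat (Suc k) powr (s - 1)) \<longlonglongrightarrow> zeta (1 - s)" unfolding sums_def by (simp only: minus_diff_eq)
    from LIMSEQ_Suc[OF this] have "(\<lambda>K. \<Sum>k<Suc K. of_nat (Suc k) powr (s - 1)) \<longlonglongrightarrow> zeta (1 - s)" .
    moreover have "(\<Sum>k<Suc K. of_nat (Suc k) powr (s - 1)) = (\<Sum>k=1..Suc K. of_nat k powr (s - 1))" for K
      unfolding One_nat_def by (rule sum.atLeast1_atMost_eq[symmetric])
    ultimately show ?thesis by (intro tendsto_intros) simp
  qed
  ultimately have "zeta s - chi s * zeta (1 - s) = 0" by (metis LIMSEQ_unique)
  then show ?thesis by simp
qed

text \<open>The upper half-plane is connected and contains neither the point 1 nor a pole of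
  \<open>chi\<close>, so the identity continues to all of it.\<close>

lemma functional_equation:
  assumes "Im s > 0"
  shows "zeta s = chi s * zeta (1 - s)"
proof (rule analytic_continuation_open[where s = "{s. Im s > 0} \<inter> {s. Re s < 0}" and s' = "{s. Im s > 0}" and f = zeta and g = "\<lambda>s. chi s * zeta (1 - s)"])
  show "open ({s. Im s > 0} \<inter> {s. Re s < 0})" by (intro open_Int open_halfspace_Im_gt open_halfspace_Re_lt)
  have "Complex (-1) 1 \<in> {s. Im s > 0} \<inter> {s. Re s < 0}" by simp
  then show "{s. Im s > 0} \<inter> {s. Re s < 0} \<noteq> {}" by blast
  show "connected {s. Im s > 0}" by (intro convex_connected convex_halfspace_Im_gt)
  show "zeta holomorphic_on {s. Im s > 0}" by (rule holomorphic_on_subset[OF zeta_holomorphic]) auto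
  have "zeta \<circ> (\<lambda>s. 1 - s) holomorphic_on {s. Im s > 0}"
    by (rule holomorphic_on_compose_gen[OF _ zeta_holomorphic]) (auto intro!: holomorphic_intros)
  moreover have "1 - s \<notin> \<int>\<^sub>\<le>\<^sub>0" if "Im s > 0" for s using that by (auto elim!: nonpos_Ints_cases simp: complex_eq_iff)
  then have "chi holomorphic_on {s. Im s > 0}"
    unfolding chi_def[abs_def] by (auto intro!: holomorphic_intros)
  ultimately show "(\<lambda>s. chi s * zeta (1 - s)) holomorphic_on {s. Im s > 0}" by (auto intro!: holomorphic_on_mult simp: o_def)
qed (use assms functional_equation_left open_halfspace_Im_gt in auto)

section \<open>The remainder as a contour integral\<close>

text \<open>The bare power, the m geometric terms of the upper kernel and the lower kernel together
  give minus the rest of the upper kernel: three integrals along one segment fuse into one.\<close>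

lemma ker_relation:
  assumes "z \<notin> \<int>"
  shows "1 + geo 1 m z + ker (-1) z = - kerm 1 m z"
proof -
  have "ker (-1) z = -1 - ker 1 z" using ker_add[OF assms] by (simp add: eq_diff_eq add.commute)
  then show ?thesis using ker_split[of 1 z m] assms by simp
qed

lemma cint_add3:
  assumes "continuous_on (closed_segment A B) F" "continuous_on (closed_segment A B) G" "continuous_on (closed_segment A B) H"
    and "\<And>z. z \<in> closed_segment A B \<Longrightarrow> F z + G z + H z = - K z"
  shows "cint A B F + cint A B G + cint A B H = cint B A K"
proof -
  have "cint A B (\<lambda>z. F z + G z + H z) = cint A B F + cint A B G + cint A B H"
    using assms(1-3) cint_add[of A B "\<lambda>z. F z + G z" H "\<lambda>z. F z + G z + H z"] cint_add[of A B F G "\<lambda>z. F z + G z"]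
    by (simp add: continuous_on_add)
  moreover have "cint A B (\<lambda>z. F z + G z + H z) = cint A B (\<lambda>z. - K z)"
    using assms(4) by (intro contour_integral_eq) auto
  moreover have "cint A B (\<lambda>z. - K z) = - cint A B K"
    by (cases "K contour_integrable_on linepath A B")
       (use contour_integral_neg contour_integrable_neg_iff not_integrable_contour_integral in \<open>auto\<close>)
  ultimately show ?thesis using cint_reverse[of B A K] by simp
qed

lemma norm_geo_le_exp: "norm (geo e m z) \<le> (\<Sum>k=1..m. exp (- (2 * pi * real k * e * Im z)))"
  unfolding geo_def by (rule sum_norm_le) simp

lemma norm_geo_upper:
  assumes "Im z \<ge> 1"
  shows "norm (geo 1 m z) \<le> real m * exp (- Im z)"
proof -
  have "exp (- (2 * pi * real k * 1 * Im z)) \<le> exp (- Im z)" if "k \<in> {1..m}" for k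
  proof -
    have "1 * 1 \<le> (2 * pi) * real k" using that pi_ge_two by (intro mult_mono) auto
    then have "1 * Im z \<le> (2 * pi * real k) * Im z" using assms by (intro mult_right_mono) auto
    then show ?thesis by simp
  qed
  then have "(\<Sum>k=1..m. exp (- (2 * pi * real k * 1 * Im z))) \<le> (\<Sum>k=1..m. exp (- Im z))" by (intro sum_mono)
  then show ?thesis using norm_geo_le_exp[of 1 m z] by simp
qed

lemma norm_geo_near_0:
  assumes "e \<in> {1, -1}" "norm z \<le> 1"
  shows "norm (geo e m z) \<le> real m * exp (2 * pi * real m)"
proof -
  have "exp (- (2 * pi * real k * e * Im z)) \<le> exp (2 * pi * real m)" if "k \<in> {1..m}" for k
  proof -
    have "- (2 * pi * real k * e * Im z) \<le> 2 * pi * real k * \<bar>Im z\<bar>" using assms(1) by (auto simp: abs_if mult_le_0_iff)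
    also have "\<dots> \<le> 2 * pi * real m * 1" using that assms(2) abs_Im_le_cmod[of z] by (intro mult_mono) auto
    finally show ?thesis by simp
  qed
  then have "(\<Sum>k=1..m. exp (- (2 * pi * real k * e * Im z))) \<le> (\<Sum>k=1..m. exp (2 * pi * real m))" by (intro sum_mono)
  then show ?thesis using norm_geo_le_exp[of e m z] by simp
qed

text \<open>For t > 0 the power z^(- s) is exponentially small on the negative imaginary axis, where
  the first, second and last terms live. The third and fourth form one straight path through a in
  the direction 1 + i, which is the direction of steepest descent of z^(- s) exp (2 pi i x z) at its
  saddle y.\<close>

definition Jrem :: "complex \<Rightarrow> real \<Rightarrow> nat \<Rightarrow> nat \<Rightarrow> complex" where
  "Jrem s a m n = ax (-1) a powr (1 - s) / (s - 1)
     + cint (ax (-1) a) (ax (-1) (eps n)) (\<lambda>z. z powr (-s) * (geo 1 m z + geo (-1) m z))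
     + cint (ax (-1) a) (of_real a) (\<lambda>z. z powr (-s) * kerm 1 m z)
     + cint (of_real a) (of_real a + of_real (real (Suc n)) * (1 + \<i>)) (\<lambda>z. z powr (-s) * kerm 1 m z)
     + cint (ax (-1) a) (ax (-1) (real (Suc n))) (\<lambda>z. z powr (-s) * kerm (-1) m z)"

text \<open>The m geometric terms of the upper kernel are carried from the ray at a to the upper
  half-axis by the detour a, - i a, - i eps, eps, i eps. The lower kernel is rotated as a whole and
  split only from - i a on. Whatever accumulates on the segment from a to - i a fuses by
  \<open>ker_relation\<close>.\<close>

lemma remainder_limit:
  assumes s: "Re s < 1" "s \<noteq> 1" and \<alpha>: "\<alpha> \<in> {1/4, 3/4}" and a: "a = \<alpha> + real N"
  shows "Jrem s a m \<longlonglongrightarrow> zeta s - (\<Sum>n=1..N. of_nat n powr (-s)) - chi s * (\<Sum>k=1..m. of_nat k powr (s - 1))"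
proof -
  have a0: "a > 0" using \<alpha> a by auto
  have ca: "cos (2 * pi * a) = 0" unfolding a by (rule cos_quarter[OF \<alpha>])
  note ai = quarter_notin_Ints[OF ca]
  define P where "P = (\<lambda>z::complex. z powr (-s))"
  define T where "T = (\<lambda>n. real (Suc n))"
  define A where "A = complex_of_real a"
  have T0: "T n > 0" for n by (simp add: T_def)
  define X where "X e k n = cint (ax e (eps n)) (ax e (T n)) (\<lambda>z. P z * exp (\<i> * of_real (2 * pi * real k * e) * z))" for e k n
  define near where "near e n = cint (of_real (eps n)) (ax e (eps n)) (\<lambda>z. P z * geo 1 m z)" for e n
  define top1 where "top1 n = cint (ax 1 (T n)) (A + ax 1 (T n)) (\<lambda>z. P z * geo 1 m z)" for n
  define top2 where "top2 n = cint (ax (-1) (T n)) (A + ax (-1) (T n)) (\<lambda>z. P z * ker (-1) z)" for n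
  define top3 where "top3 n = cint (A + of_real (T n) * (1 + \<i>)) (A + ax 1 (T n)) (\<lambda>z. P z * kerm 1 m z)" for n
  define V where "V e = {z :: complex. Re z > 0} \<union> {z. Re z = 0 \<and> e * Im z > 0}" for e
  define H where "H e = {z :: complex. e * Im z > 0} \<union> {A}" for e
  have cV: "convex (V e)" for e unfolding V_def by (rule convex_right_axis)
  have cH: "convex (H e)" if "e \<in> {1,-1}" for e unfolding H_def A_def by (rule convex_pt_upper[OF that])
  have PV: "P holomorphic_on V e" if "e \<in> {1,-1}" for e
    unfolding P_def V_def by (rule holomorphic_powr_neg) (use that in \<open>auto simp: complex_nonpos_Reals_iff\<close>)
  have PH: "P holomorphic_on H e" if "e \<in> {1,-1}" for e
    unfolding P_def H_def A_def by (rule holomorphic_powr_neg) (use that a0 in \<open>auto simp: complex_nonpos_Reals_iff\<close>)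
  have HI: "H e \<inter> \<int> = {}" if "e \<in> {1,-1}" for e
    using ai that by (auto simp: H_def A_def complex_is_Int_iff)
  have geoV: "(\<lambda>z. P z * geo e' m z) holomorphic_on V e" if "e \<in> {1,-1}" for e e'
    by (intro holomorphic_on_mult PV that holomorphic_geo)
  have kerH: "(\<lambda>z. P z * ker e' z) holomorphic_on H e" if "e \<in> {1,-1}" "e' \<in> {1,-1}" for e e'
    by (intro holomorphic_on_mult PH that holomorphic_on_ker HI)
  have kermH: "(\<lambda>z. P z * kerm e' m z) holomorphic_on H e" if "e \<in> {1,-1}" "e' \<in> {1,-1}" for e e'
    by (intro holomorphic_on_mult PH that holomorphic_kerm HI)
  have geoH: "(\<lambda>z. P z * geo e' m z) holomorphic_on H e" if "e \<in> {1,-1}" for e e'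
    by (intro holomorphic_on_mult PH that holomorphic_geo)
  have e1: "1 \<in> {1, -1 :: real}" "-1 \<in> {1, -1 :: real}" by auto
  have AV: "A \<in> V e" for e using a0 by (simp add: V_def A_def)
  have AH: "A \<in> H e" for e by (simp add: H_def)
  have axV: "ax e r \<in> V e" if "e \<in> {1,-1}" "r > 0" for e r using that by (auto simp: V_def)
  have axH: "ax e r \<in> H e" if "e \<in> {1,-1}" "r > 0" for e r using that by (auto simp: H_def)
  have epsV: "of_real (eps n) \<in> V e" for n e using eps(1)[of n] by (simp add: V_def)
  have AaxV: "A + ax e r \<in> V e" for e r using a0 by (simp add: V_def A_def)
  have AaxH: "A + ax e r \<in> H e" if "e \<in> {1,-1}" "r > 0" for e r using that by (auto simp: H_def A_def)
  have ATH: "A + of_real (T n) * (1 + \<i>) \<in> H 1" for n using T0[of n] by (simp add: H_def A_def)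
  have axH1: "ax (-1) a \<in> H (-1)" "ax (-1) a \<in> V (-1)" using a0 by (auto simp: H_def V_def)
  have vA: "cint A (A + ax 1 (T n)) (\<lambda>z. P z * geo 1 m z)
      = cint A (ax (-1) a) (\<lambda>z. P z * geo 1 m z) + cint (ax (-1) a) (ax (-1) (eps n)) (\<lambda>z. P z * geo 1 m z)
        - near (-1) n + near 1 n + (\<Sum>k=1..m. X 1 k n) + top1 n" (is "?L = ?R") for n
  proof -
    let ?F = "\<lambda>z. P z * geo 1 m z"
    note tp = cint_triangle[OF geoV[OF e1(1), of 1] cV] and tm = cint_triangle[OF geoV[OF e1(2), of 1] cV]
    note e0 = eps(1)[of n]
    have 1: "cint A (ax 1 (T n)) ?F + top1 n = ?L" unfolding top1_def by (rule tp[OF AV axV[OF e1(1) T0] AaxV])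
    have 2: "cint A (ax 1 (eps n)) ?F + cint (ax 1 (eps n)) (ax 1 (T n)) ?F = cint A (ax 1 (T n)) ?F"
      by (rule tp[OF AV axV[OF e1(1) e0] axV[OF e1(1) T0]])
    have 3: "cint A (of_real (eps n)) ?F + near 1 n = cint A (ax 1 (eps n)) ?F"
      unfolding near_def by (rule tp[OF AV epsV axV[OF e1(1) e0]])
    have 4: "cint A (of_real (eps n)) ?F + near (-1) n = cint A (ax (-1) (eps n)) ?F"
      unfolding near_def by (rule tm[OF AV epsV axV[OF e1(2) e0]])
    have 5: "cint A (ax (-1) a) ?F + cint (ax (-1) a) (ax (-1) (eps n)) ?F = cint A (ax (-1) (eps n)) ?F"
      by (rule tm[OF AV axH1(2) axV[OF e1(2) e0]])
    have 6: "cint (ax 1 (eps n)) (ax 1 (T n)) ?F = (\<Sum>k=1..m. X 1 k n)"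
    proof -
      have "cint (ax 1 (eps n)) (ax 1 (T n)) (\<lambda>z. \<Sum>k=1..m. P z * exp (\<i> * of_real (2 * pi * real k * 1) * z)) = (\<Sum>k=1..m. X 1 k n)"
        unfolding X_def
      proof (rule contour_integral_sum)
        show "(\<lambda>z. P z * exp (\<i> * of_real (2 * pi * real k * 1) * z)) contour_integrable_on linepath (ax 1 (eps n)) (ax 1 (T n))" for k
          by (intro contour_integrable_continuous_linepath hol_cont_segment[OF _ cV axV[OF e1(1) e0] axV[OF e1(1) T0]]) (intro holomorphic_intros PV e1)
      qed simp
      then show ?thesis by (simp add: geo_def sum_distrib_left)
    qed
    have "L = i5 + i6 - n2 + n1 + x + t1"
      if "i1 + t1 = L" "i2 + x = i1" "i3 + n1 = i2" "i3 + n2 = i4" "i5 + i6 = i4" for L i1 i2 i3 i4 i5 i6 n1 n2 x t1 :: complex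
    proof -
      have "i3 = i5 + i6 - n2" using that(4,5) by (simp add: eq_diff_eq)
      then show ?thesis using that(1-3) by auto
    qed
    from this[OF 1 2[unfolded 6] 3 4 5] show ?thesis .
  qed
  have vA2: "cint A (A + ax 1 (T n)) (\<lambda>z. P z * ker 1 z)
     = cint A (A + ax 1 (T n)) (\<lambda>z. P z * geo 1 m z) + cint A (A + of_real (T n) * (1 + \<i>)) (\<lambda>z. P z * kerm 1 m z) + top3 n" for n
  proof -
    have "cint A (A + ax 1 (T n)) (\<lambda>z. P z * ker 1 z)
     = cint A (A + ax 1 (T n)) (\<lambda>z. P z * geo 1 m z) + cint A (A + ax 1 (T n)) (\<lambda>z. P z * kerm 1 m z)"
    proof (rule cint_add)
      show "continuous_on (closed_segment A (A + ax 1 (T n))) (\<lambda>z. P z * geo 1 m z)"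
        by (rule hol_cont_segment[OF geoH[OF e1(1)] cH[OF e1(1)] AH AaxH[OF e1(1) T0]])
      show "continuous_on (closed_segment A (A + ax 1 (T n))) (\<lambda>z. P z * kerm 1 m z)"
        by (rule hol_cont_segment[OF kermH[OF e1(1) e1(1)] cH[OF e1(1)] AH AaxH[OF e1(1) T0]])
      fix z assume "z \<in> closed_segment A (A + ax 1 (T n))"
      then have "z \<in> H 1" by (rule segment_in_convex[OF cH[OF e1(1)] AH AaxH[OF e1(1) T0]])
      then have "z \<notin> \<int>" using HI[OF e1(1)] by blast
      then show "P z * ker 1 z = P z * geo 1 m z + P z * kerm 1 m z" using ker_split[OF e1(1), of z m] by (simp add: distrib_left)
    qed
    moreover have "cint A (A + of_real (T n) * (1 + \<i>)) (\<lambda>z. P z * kerm 1 m z) + top3 n = cint A (A + ax 1 (T n)) (\<lambda>z. P z * kerm 1 m z)"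
      unfolding top3_def by (rule cint_triangle[OF kermH[OF e1(1) e1(1)] cH[OF e1(1)] AH ATH AaxH[OF e1(1) T0]])
    ultimately show ?thesis by simp
  qed
  have vC: "cint A (A + ax (-1) (T n)) (\<lambda>z. P z * ker (-1) z)
     = cint A (ax (-1) a) (\<lambda>z. P z * ker (-1) z) + (\<Sum>k=1..m. X (-1) k n) + cint (ax (-1) a) (ax (-1) (eps n)) (\<lambda>z. P z * geo (-1) m z)
       + cint (ax (-1) a) (ax (-1) (T n)) (\<lambda>z. P z * kerm (-1) m z) + top2 n" (is "?L = ?R") for n
  proof -
    note e0 = eps(1)[of n]
    let ?F = "\<lambda>z. P z * ker (-1) z" and ?G = "\<lambda>z. P z * geo (-1) m z"
    note tm = cint_triangle[OF kerH[OF e1(2) e1(2)] cH[OF e1(2)]]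
    have 1: "cint A (ax (-1) (T n)) ?F + top2 n = ?L" unfolding top2_def by (rule tm[OF AH axH[OF e1(2) T0] AaxH[OF e1(2) T0]])
    have 2: "cint A (ax (-1) a) ?F + cint (ax (-1) a) (ax (-1) (T n)) ?F = cint A (ax (-1) (T n)) ?F"
      by (rule tm[OF AH axH[OF e1(2) a0] axH[OF e1(2) T0]])
    have 3: "cint (ax (-1) a) (ax (-1) (T n)) ?F = cint (ax (-1) a) (ax (-1) (T n)) ?G + cint (ax (-1) a) (ax (-1) (T n)) (\<lambda>z. P z * kerm (-1) m z)"
    proof (rule cint_add)
      show "continuous_on (closed_segment (ax (-1) a) (ax (-1) (T n))) ?G"
        by (rule hol_cont_segment[OF geoH[OF e1(2)] cH[OF e1(2)] axH[OF e1(2) a0] axH[OF e1(2) T0]])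
      show "continuous_on (closed_segment (ax (-1) a) (ax (-1) (T n))) (\<lambda>z. P z * kerm (-1) m z)"
        by (rule hol_cont_segment[OF kermH[OF e1(2) e1(2)] cH[OF e1(2)] axH[OF e1(2) a0] axH[OF e1(2) T0]])
      fix z assume "z \<in> closed_segment (ax (-1) a) (ax (-1) (T n))"
      then have "z \<in> H (-1)" by (rule segment_in_convex[OF cH[OF e1(2)] axH[OF e1(2) a0] axH[OF e1(2) T0]])
      then have "z \<notin> \<int>" using HI[OF e1(2)] by blast
      then show "P z * ker (-1) z = P z * geo (-1) m z + P z * kerm (-1) m z" using ker_split[OF e1(2), of z m] by (simp add: distrib_left)
    qed
    have 4: "cint (ax (-1) a) (ax (-1) (eps n)) ?G + cint (ax (-1) (eps n)) (ax (-1) (T n)) ?G = cint (ax (-1) a) (ax (-1) (T n)) ?G"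
      by (rule cint_triangle[OF geoV[OF e1(2)] cV axV[OF e1(2) a0] axV[OF e1(2) e0] axV[OF e1(2) T0]])
    have 5: "cint (ax (-1) (eps n)) (ax (-1) (T n)) ?G = (\<Sum>k=1..m. X (-1) k n)"
    proof -
      have "cint (ax (-1) (eps n)) (ax (-1) (T n)) (\<lambda>z. \<Sum>k=1..m. P z * exp (\<i> * of_real (2 * pi * real k * (-1)) * z)) = (\<Sum>k=1..m. X (-1) k n)"
        unfolding X_def
      proof (rule contour_integral_sum)
        show "(\<lambda>z. P z * exp (\<i> * of_real (2 * pi * real k * (-1)) * z)) contour_integrable_on linepath (ax (-1) (eps n)) (ax (-1) (T n))" for k
          by (intro contour_integrable_continuous_linepath hol_cont_segment[OF _ cV axV[OF e1(2) e0] axV[OF e1(2) T0]]) (intro holomorphic_intros PV e1)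
      qed simp
      then show ?thesis by (simp add: geo_def sum_distrib_left)
    qed
    have "L = i2 + x + g + h + t"
      if "i1 + t = L" "i2 + i3 = i1" "i3 = i4 + h" "g + x = i4" for L i1 i2 i3 i4 g h x t :: complex
      using that by auto
    from this[OF 1 2 3 4[unfolded 5]] show ?thesis .
  qed
  have vD: "A powr (1 - s) / (s - 1) = ax (-1) a powr (1 - s) / (s - 1) + cint A (ax (-1) a) P"
  proof -
    have "closed_segment A (ax (-1) a) \<inter> \<real>\<^sub>\<le>\<^sub>0 = {}"
    proof -
      have "closed_segment A (ax (-1) a) \<subseteq> V (-1)" using cV AV axV[OF e1(2) a0] by (simp add: closed_segment_subset)
      moreover have "V (-1) \<inter> \<real>\<^sub>\<le>\<^sub>0 = {}" by (auto simp: V_def complex_nonpos_Reals_iff)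
      ultimately show ?thesis by blast
    qed
    from cint_powr[OF s(2) this] have "cint A (ax (-1) a) P = (ax (-1) a powr (1 - s) - A powr (1 - s)) / (1 - s)" by (simp only: P_def)
    also have "\<dots> = (A powr (1 - s) - ax (-1) a powr (1 - s)) / (s - 1)" using s(2) by (simp add: field_simps)
    finally show ?thesis by (simp add: diff_divide_distrib)
  qed
  \<comment> \<open>The pieces on the segment from a to - i a that come from \<open>vD\<close>,
    \<open>vA\<close> and \<open>vC\<close> meet here.\<close>
  have vE: "cint A (ax (-1) a) P + cint A (ax (-1) a) (\<lambda>z. P z * geo 1 m z) + cint A (ax (-1) a) (\<lambda>z. P z * ker (-1) z)
      = cint (ax (-1) a) A (\<lambda>z. P z * kerm 1 m z)"
  proof (rule cint_add3)
    note sg = cH[OF e1(2)] AH axH[OF e1(2) a0]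
    show "continuous_on (closed_segment A (ax (-1) a)) P" by (rule hol_cont_segment[OF PH[OF e1(2)] sg])
    show "continuous_on (closed_segment A (ax (-1) a)) (\<lambda>z. P z * geo 1 m z)" by (rule hol_cont_segment[OF geoH[OF e1(2)] sg])
    show "continuous_on (closed_segment A (ax (-1) a)) (\<lambda>z. P z * ker (-1) z)" by (rule hol_cont_segment[OF kerH[OF e1(2) e1(2)] sg])
    fix z assume "z \<in> closed_segment A (ax (-1) a)"
    then have "z \<in> H (-1)" by (rule segment_in_convex[OF sg])
    then have zi: "z \<notin> \<int>" using HI[OF e1(2)] by blast
    have "P z * (1 + geo 1 m z + ker (-1) z) = P z * (- kerm 1 m z)" unfolding ker_relation[OF zi] ..
    then show "P z + P z * geo 1 m z + P z * ker (-1) z = - (P z * kerm 1 m z)" by (simp add: algebra_simps)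
  qed
  have vF: "cint (ax (-1) a) (ax (-1) (eps n)) (\<lambda>z. P z * (geo 1 m z + geo (-1) m z))
     = cint (ax (-1) a) (ax (-1) (eps n)) (\<lambda>z. P z * geo 1 m z) + cint (ax (-1) a) (ax (-1) (eps n)) (\<lambda>z. P z * geo (-1) m z)" for n
  proof (rule cint_add)
    note sg = cV axV[OF e1(2) a0] axV[OF e1(2) eps(1)[of n]]
    show "continuous_on (closed_segment (ax (-1) a) (ax (-1) (eps n))) (\<lambda>z. P z * geo 1 m z)" by (rule hol_cont_segment[OF geoV[OF e1(2)] sg])
    show "continuous_on (closed_segment (ax (-1) a) (ax (-1) (eps n))) (\<lambda>z. P z * geo (-1) m z)" by (rule hol_cont_segment[OF geoV[OF e1(2)] sg])
  qed (simp add: distrib_left)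
  \<comment> \<open>Everything that converges to the dual sum or to 0; removing it from the
    truncated \<open>Zcont\<close> leaves exactly \<open>Jrem\<close>.\<close>
  define err where "err n = (\<Sum>k=1..m. X 1 k n + X (-1) k n) + (near 1 n - near (-1) n) + top1 n + top2 n + top3 n" for n
  define \<Phi> where "\<Phi> n = A powr (1 - s) / (s - 1) + vint 1 a s (Suc n) + vint (-1) a s (Suc n)" for n
  have main: "Jrem s a m n = \<Phi> n - err n" for n
  proof -
    have v1: "vint 1 a s (Suc n) = cint A (A + ax 1 (T n)) (\<lambda>z. P z * ker 1 z)" by (simp add: vint_def A_def T_def P_def)
    have v2: "vint (-1) a s (Suc n) = cint A (A + ax (-1) (T n)) (\<lambda>z. P z * ker (-1) z)" by (simp add: vint_def A_def T_def P_def)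
    have J: "Jrem s a m n = ax (-1) a powr (1 - s) / (s - 1)
     + cint (ax (-1) a) (ax (-1) (eps n)) (\<lambda>z. P z * (geo 1 m z + geo (-1) m z))
     + cint (ax (-1) a) A (\<lambda>z. P z * kerm 1 m z)
     + cint A (A + of_real (T n) * (1 + \<i>)) (\<lambda>z. P z * kerm 1 m z)
     + cint (ax (-1) a) (ax (-1) (T n)) (\<lambda>z. P z * kerm (-1) m z)"
      unfolding Jrem_def P_def A_def T_def ..
    show ?thesis unfolding \<Phi>_def err_def sum.distrib v1 v2 vA2 vA vC J vF vE[symmetric] vD by (simp add: algebra_simps)
  qed
  have lX: "(\<lambda>n. X 1 k n + X (-1) k n) \<longlonglongrightarrow> chi s * of_nat k powr (s - 1)" if k: "k \<in> {1..m}" for k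
  proof -
    have "(\<lambda>n. X e k n) \<longlonglongrightarrow> (of_real e * \<i>) powr (1 - s) * of_real (2 * pi * real k) powr (s - 1) * Gamma (1 - s)"
      if "e \<in> {1,-1}" for e
      unfolding X_def T_def P_def using s k
      by (intro exp_ray_Gamma_tendsto eps(1) eps(3) eps(4) eps(5) that) auto
    from tendsto_add[OF this[of 1] this[of "-1"]] show ?thesis
      using chi_eq_rays[of k s, symmetric] k by simp
  qed
  have lnear: "near e \<longlonglongrightarrow> 0" if "e \<in> {1,-1}" for e
    unfolding near_def
  proof (rule cint_near_0_tendsto[OF that, where p = "1 - Re s" and C = "exp (pi * \<bar>Im s\<bar>) * (real m * exp (2 * pi * real m))"])
    fix z :: complex assume z: "norm z \<le> 1/20"
    have "norm (P z * geo 1 m z) \<le> (exp (pi * \<bar>Im s\<bar>) * norm z powr (- Re s)) * (real m * exp (2 * pi * real m))"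
      unfolding norm_mult P_def by (intro mult_mono norm_powr_le_exp norm_geo_near_0) (use z in auto)
    then show "norm (P z * geo 1 m z) \<le> exp (pi * \<bar>Im s\<bar>) * (real m * exp (2 * pi * real m)) * norm z powr (1 - Re s - 1)"
      by (simp add: mult_ac)
  qed (use s in auto)
  have ltop1: "top1 \<longlonglongrightarrow> 0"
    unfolding top1_def P_def A_def T_def
    using top_segment_tendsto_0[of 1 "real m" 0 a a "geo 1 m" s] norm_geo_upper[of _ m] a0 by simp
  have ltop2: "top2 \<longlonglongrightarrow> 0"
    unfolding top2_def P_def A_def T_def
    using top_segment_tendsto_0[of "-1" 2 0 a a "ker (-1)" s] norm_ker_exp[of "-1"] a0 by simp
  have ltop3: "top3 \<longlonglongrightarrow> 0"
    unfolding top3_def P_def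
  proof (rule powr_kernel_segment_tendsto_0[where L = "2 * a + 4" and M = 2])
    show "norm z \<ge> 1 \<and> norm z \<le> (2 * a + 4) * (1 + real n) \<and> norm (kerm 1 m z) \<le> 2 * exp (- real n)"
      if n: "n \<ge> 1" and zs: "z \<in> closed_segment (A + of_real (T n) * (1 + \<i>)) (A + ax 1 (T n))" for n z
    proof -
      obtain u where u: "0 \<le> u" "u \<le> 1" "z = (1 - u) *\<^sub>R (A + of_real (T n) * (1 + \<i>)) + u *\<^sub>R (A + ax 1 (T n))"
        using zs by (auto simp: closed_segment_def)
      have z: "Re z = a + (1 - u) * T n" "Im z = T n" unfolding u(3) by (simp_all add: A_def algebra_simps)
      have R: "0 \<le> Re z" "Re z \<le> a + T n" using u T0[of n] a0 unfolding z by (auto simp: mult_le_cancel_right1)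
      have T1: "T n = 1 + real n" by (simp add: T_def)
      have "norm z \<le> a + 2 * T n" using cmod_le[of z] R z T0[of n] by linarith
      also have "\<dots> \<le> (2 * a + 4) * (1 + real n)" using a0 unfolding T1 by (simp add: algebra_simps)
      finally have "norm z \<le> (2 * a + 4) * (1 + real n)" .
      moreover have "norm z \<ge> 1" using abs_Im_le_cmod[of z] z T1 by simp
      moreover have "norm (kerm 1 m z) \<le> 1 * (2 * exp (- real n))"
        unfolding kerm_def norm_mult
      proof (intro mult_mono)
        show "norm (exp (\<i> * of_real (2 * pi * real m * 1) * z)) \<le> 1" using T0[of n] z by simp
        have "norm (ker 1 z) \<le> 2 * exp (- (1 * Im z))" using z T1 by (intro norm_ker_exp) auto
        then show "norm (ker 1 z) \<le> 2 * exp (- real n)" using z T1 by (smt (verit) exp_le_cancel_iff mult_1)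
      qed auto
      ultimately show ?thesis by simp
    qed
    show "norm (A + ax 1 (T n) - (A + of_real (T n) * (1 + \<i>))) \<le> (2 * a + 4) * (1 + real n)" if "n \<ge> 1" for n
    proof -
      have "A + ax 1 (T n) - (A + of_real (T n) * (1 + \<i>)) = - of_real (T n)" by (simp add: algebra_simps)
      then have "norm (A + ax 1 (T n) - (A + of_real (T n) * (1 + \<i>))) = T n" using T0[of n] by (simp only: norm_minus_cancel norm_of_real)
      also have "\<dots> \<le> (2 * a + 4) * (1 + real n)" using a0 by (simp add: T_def algebra_simps)
      finally show ?thesis .
    qed
  qed (use a0 in auto)
  have "err \<longlonglongrightarrow> (\<Sum>k=1..m. chi s * of_nat k powr (s - 1)) + (0 - 0) + 0 + 0 + 0"
    unfolding err_def by (intro tendsto_add tendsto_diff tendsto_sum lX lnear ltop1 ltop2 ltop3 e1)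
  moreover have "\<Phi> \<longlonglongrightarrow> A powr (1 - s) / (s - 1) + lim (vint 1 a s) + lim (vint (-1) a s)"
    unfolding \<Phi>_def by (intro tendsto_add tendsto_const LIMSEQ_Suc vint_tendsto e1 ca a0)
  then have "\<Phi> \<longlonglongrightarrow> Zcont a s" by (simp add: Zcont_def A_def)
  ultimately have "(\<lambda>n. \<Phi> n - err n) \<longlonglongrightarrow> Zcont a s - ((\<Sum>k=1..m. chi s * of_nat k powr (s - 1)) + (0 - 0) + 0 + 0 + 0)"
    by (intro tendsto_diff)
  moreover have "Zcont a s = zeta s - (\<Sum>n=1..N. of_nat n powr (-s))" using zeta_eq_sum_Zcont[OF \<alpha> s(2), of N] a by simp
  ultimately show ?thesis unfolding main[abs_def, symmetric] by (simp add: sum_distrib_left main)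
qed

section \<open>Elementary real inequalities\<close>

lemma pi_gt_157_50: "157/50 < pi" and pi_lt_63_20: "pi < 63/20"
  by (rule less_le_trans[OF _ pi_approx(1)], simp) (rule le_less_trans[OF pi_approx(2)], simp)

lemma half_gaussian_le:
  assumes "A > 0"
  shows "integral {0..T} (\<lambda>w. exp (- A * w\<^sup>2)) \<le> sqrt (pi / A) / 2"
proof -
  have "has_bochner_integral lborel (\<lambda>x::real. indicator {0..} x *\<^sub>R exp (- x\<^sup>2)) (sqrt pi / 2)"
    by (rule gaussian_moment_0)
  from lborel_has_bochner_integral_real_affine_iff[THEN iffD1, of "sqrt A" _ _ 0, OF _ this]
  have "has_bochner_integral lborel (\<lambda>x. indicator {0..} (sqrt A * x) *\<^sub>R exp (- (sqrt A * x)\<^sup>2)) (sqrt pi / 2 /\<^sub>R \<bar>sqrt A\<bar>)"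
    using assms by simp
  moreover have "(\<lambda>x. indicator {0..} (sqrt A * x) *\<^sub>R exp (- (sqrt A * x)\<^sup>2)) = (\<lambda>x. indicator {0..} x *\<^sub>R exp (- A * x\<^sup>2))"
    using assms by (auto simp: indicator_def power_mult_distrib zero_le_mult_iff)
  ultimately have hb: "has_bochner_integral lborel (\<lambda>x. indicator {0..} x *\<^sub>R exp (- A * x\<^sup>2)) (sqrt (pi / A) / 2)"
    using assms by (simp add: real_sqrt_divide field_simps)
  have "((\<lambda>x. indicator {0..} x *\<^sub>R exp (- A * x\<^sup>2)) has_integral (sqrt (pi / A) / 2)) UNIV"
    using has_integral_integral_lborel[OF integrable.intros[OF hb]] unfolding has_bochner_integral_integral_eq[OF hb] .
  moreover have "(\<lambda>x. indicator {0..} x *\<^sub>R exp (- A * x\<^sup>2)) = (\<lambda>x. if x \<in> {0..} then exp (- A * x\<^sup>2) else 0)"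
    by (auto simp: fun_eq_iff)
  ultimately have 1: "((\<lambda>x. exp (- A * x\<^sup>2)) has_integral (sqrt (pi / A) / 2)) {0..}"
    using has_integral_restrict_UNIV[of "{0..}" "\<lambda>x. exp (- A * x\<^sup>2)"] by simp
  have 2: "((\<lambda>w. exp (- A * w\<^sup>2)) has_integral integral {0..T} (\<lambda>w. exp (- A * w\<^sup>2))) {0..T}"
    by (intro integrable_integral integrable_continuous_real continuous_intros)
  show ?thesis by (rule has_integral_subset_le[OF _ 2 1]) auto
qed

text \<open>Completing the square puts the peak at c = B / (2 A). Before c the integrand is at most
  its peak value, beyond c it is half a Gaussian; hence the two summands.\<close>

lemma gaussian_linear_le:
  assumes A: "A > 0" and B: "B \<ge> 0" and T: "T \<ge> 0"
  shows "integral {0..T} (\<lambda>r. exp (B * r - A * r\<^sup>2)) \<le> exp (B\<^sup>2 / (4 * A)) * (sqrt (pi / A) / 2 + B / (2 * A))"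
proof -
  define c where "c = B / (2 * A)"
  define K where "K = exp (B\<^sup>2 / (4 * A))"
  have c: "c \<ge> 0" using A B by (simp add: c_def)
  have sq: "exp (B * r - A * r\<^sup>2) = K * exp (- A * (r - c)\<^sup>2)" for r
  proof -
    have "B * r - A * r\<^sup>2 = B\<^sup>2 / (4 * A) + - A * (r - c)\<^sup>2" using A by (simp add: c_def field_simps power2_eq_square)
    then show ?thesis unfolding K_def exp_add[symmetric] by simp
  qed
  have int: "(\<lambda>r. exp (B * r - A * r\<^sup>2)) integrable_on {a..b}" for a b
    by (intro integrable_continuous_real continuous_intros)
  have "integral {0..T} (\<lambda>r. exp (B * r - A * r\<^sup>2)) \<le> integral {0..c + T} (\<lambda>r. exp (B * r - A * r\<^sup>2))"
    using c by (intro integral_subset_le int) auto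
  also have "\<dots> = integral {0..c} (\<lambda>r. exp (B * r - A * r\<^sup>2)) + integral {c..c + T} (\<lambda>r. exp (B * r - A * r\<^sup>2))"
    using c T by (intro Henstock_Kurzweil_Integration.integral_combine[symmetric] int) auto
  also have "integral {0..c} (\<lambda>r. exp (B * r - A * r\<^sup>2)) \<le> integral {0..c} (\<lambda>r. K)"
    by (intro integral_le int) (use A in \<open>auto simp: sq K_def\<close>)
  also have "integral {0..c} (\<lambda>r. K) = K * c" using c by simp
  also have "integral {c..c + T} (\<lambda>r. exp (B * r - A * r\<^sup>2)) = K * integral {c..c + T} (\<lambda>r. exp (- A * (r - c)\<^sup>2))"
    unfolding sq by simp
  also have "integral {c..c + T} (\<lambda>r. exp (- A * (r - c)\<^sup>2)) = integral {0..T} (\<lambda>r. exp (- A * r\<^sup>2))"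
    using integral_shift[of 0 c T "\<lambda>r. exp (- A * (r - c)\<^sup>2)"] by (simp add: o_def add.commute continuous_intros)
  also have "K * \<dots> \<le> K * (sqrt (pi / A) / 2)"
    by (intro mult_left_mono half_gaussian_le A) (simp add: K_def)
  finally show ?thesis by (simp add: K_def c_def distrib_left add.commute)
qed

section \<open>Taylor bounds and the size of the kernel denominator\<close>

lemma exp_neg_bounds:
  fixes s :: real assumes "s \<ge> 0"
  shows "exp (- s) \<ge> 1 - s + s^2/2 - s^3/6 + s^4/24 - s^5/120"
    "exp (- s) \<ge> 1 - s + s^2/2 - s^3/6" "exp (- s) \<le> 1 - s + s^2/2"
proof -
  obtain t where "exp (- s) = (\<Sum>m<6. (- s) ^ m / fact m) + exp t / fact 6 * (- s) ^ 6"
    using Maclaurin_exp_le[of "- s" 6] by blast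
  moreover have "exp t / fact 6 * (- s) ^ 6 \<ge> 0" by (simp add: power_even_eq)
  ultimately show "exp (- s) \<ge> 1 - s + s^2/2 - s^3/6 + s^4/24 - s^5/120"
    by (simp add: numeral_eq_Suc lessThan_Suc fact_numeral field_simps)
next
  obtain t where "exp (- s) = (\<Sum>m<4. (- s) ^ m / fact m) + exp t / fact 4 * (- s) ^ 4"
    using Maclaurin_exp_le[of "- s" 4] by blast
  moreover have "exp t / fact 4 * (- s) ^ 4 \<ge> 0" by simp
  ultimately show "exp (- s) \<ge> 1 - s + s^2/2 - s^3/6"
    by (simp add: numeral_eq_Suc lessThan_Suc field_simps)
next
  obtain t where "exp (- s) = (\<Sum>m<3. (- s) ^ m / fact m) + exp t / fact 3 * (- s) ^ 3"
    using Maclaurin_exp_le[of "- s" 3] by blast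
  moreover have "exp t / fact 3 * (- s) ^ 3 \<le> 0" using assms by (simp add: power3_eq_cube mult_nonneg_nonneg)
  ultimately show "exp (- s) \<le> 1 - s + s^2/2"
    by (simp add: numeral_eq_Suc lessThan_Suc field_simps)
qed

lemma sin_le_quintic:
  fixes p :: real assumes "p \<ge> 0"
  shows "sin p \<le> p - p^3/6 + p^5/120"
proof -
  have "\<bar>sin p - (\<Sum>m<5. sin_coeff m * p ^ m)\<bar> \<le> inverse (fact 5) * \<bar>p\<bar> ^ 5" by (rule Maclaurin_sin_bound)
  moreover have "(\<Sum>m<5. sin_coeff m * p ^ m) = p - p^3/6"
    by (simp add: lessThan_nat_numeral sin_coeff_def fact_numeral)
  moreover have "inverse (fact 5) = (1/120 :: real)" by (simp add: numeral_eq_Suc)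
  ultimately have "\<bar>sin p - (p - p^3/6)\<bar> \<le> 1/120 * p^5" using assms by simp
  then show ?thesis by linarith
qed

lemma exp_ge_Taylor:
  fixes x :: real assumes "x \<ge> 0"
  shows "exp x \<ge> (\<Sum>m<n. x ^ m / fact m)"
proof -
  obtain t where "exp x = (\<Sum>m<n. x ^ m / fact m) + exp t / fact n * x ^ n"
    using Maclaurin_exp_le[of x n] by blast
  then show ?thesis using assms by simp
qed

lemma exp_ge_cubic: "x \<ge> 0 \<Longrightarrow> exp x \<ge> 1 + x + x^2/2 + x^3/6" for x :: real
  using exp_ge_Taylor[of x 4] by (simp add: numeral_eq_Suc lessThan_Suc algebra_simps)

lemma exp_ge_quartic: "x \<ge> 0 \<Longrightarrow> exp x \<ge> 1 + x + x^2/2 + x^3/6 + x^4/24" for x :: real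
  using exp_ge_Taylor[of x 5] by (simp add: numeral_eq_Suc lessThan_Suc algebra_simps)

lemma exp_neg_le:
  fixes u c K :: real assumes "exp u \<ge> K" "c \<ge> u" "K > 0"
  shows "exp (- c) \<le> 1 / K"
proof -
  have "exp (- c) \<le> exp (- u)" using assms by simp
  also have "\<dots> = 1 / exp u" by (simp add: exp_minus inverse_eq_divide)
  also have "\<dots> \<le> 1 / K" using assms by (intro divide_left_mono mult_pos_pos) auto
  finally show ?thesis .
qed

text \<open>The squared modulus of exp (- 2 pi i z) - 1 on one arm of the path, up to a factor exp
  (2 p) on the right arm. Its minimum, near p = 1.05, is about 0.515, so 1/2 is nearly sharp; it
  yields the constant sqrt 2 for the kernel.\<close>

lemma kernel_bad_side:
  fixes p :: real assumes p: "p \<ge> 0"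
  shows "1 + exp (- (2 * p)) - 2 * exp (- p) * sin p \<ge> 1/2"
proof (cases "p \<ge> 13/10")
  \<comment> \<open>From p = 13/10 on E is at most 29/100, and (1 - E)^2 exceeds 1/2.\<close>
  case True
  define E where "E = exp (- p)"
  have E: "exp (- (2 * p)) = E\<^sup>2" by (simp add: E_def power2_eq_square flip: exp_add)
  have "exp (13/10 :: real) \<ge> 7/2" using exp_ge_cubic[of "13/10"] by (simp add: power2_eq_square power3_eq_cube)
  then have E1: "E \<le> 29/100" using exp_neg_le[of "7/2" "13/10" p] True by (simp add: E_def)
  have "E * sin p \<le> E * 1" by (intro mult_left_mono) (auto simp: E_def)
  moreover have "(29/100 - E) * (171/100 - E) \<ge> 0" using E1 by (intro mult_nonneg_nonneg) auto
  moreover have "(29/100 - E) * (171/100 - E) = 4959/10000 - 2 * E + E * E" by (simp add: field_simps)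
  ultimately show ?thesis unfolding E E_def[symmetric] power2_eq_square by linarith
next
  case False
  define E where "E = exp (- p)"
  have E0: "E > 0" by (simp add: E_def)
  have E: "exp (- (2 * p)) = E\<^sup>2" by (simp add: E_def power2_eq_square flip: exp_add)
  have eE: "exp p * E = 1" by (simp add: E_def flip: exp_add)
  \<comment> \<open>The claim times exp p reads exp p / 2 + exp (- p) \<ge> 2 sin p; both sides are
    replaced by Taylor polynomials.\<close>
  have "exp p / 2 + E \<ge> 3/2 - p/2 + 3/4*p^2 - p^3/12 + p^4/16 - p^5/120"
    using exp_neg_bounds(1)[OF p] exp_ge_quartic[OF p] by (simp add: E_def)
  moreover have "2 * sin p \<le> 2 * p - p^3/3 + p^5/60" using sin_le_quintic[OF p] by simp
  moreover have "3/2 - 5/2 * p + 3/4*p^2 + p^3/4 + p^4/16 - p^5/40 \<ge> 0"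
  proof -
    \<comment> \<open>Expansion about p = 1, next to the minimum; the square at 1/20 absorbs the
      linear term.\<close>
    define q where "q = p - 1"
    have q: "-1 \<le> q" "q \<le> 3/10" using p False by (auto simp: q_def)
    have q1: "\<bar>q\<bar> \<le> 1" using q by auto
    have q2: "\<bar>q\<bar> ^ k \<le> q^2" if "k \<ge> 2" for k using power_decreasing[OF that _ q1] by simp
    have "q^3 \<ge> - (q^2)" "q^4 \<le> q^2" "q^5 \<le> q^2"
      using q2[of 3] q2[of 4] q2[of 5] abs_ge_self[of "q^5"] abs_ge_minus_self[of "q^3"] abs_ge_self[of "q^4"] by (simp_all add: power_abs)
    moreover have "(q - 1/20)^2 \<ge> 0" by simp
    then have "q^2 \<ge> q/10 - 1/400" by (simp add: power2_eq_square algebra_simps)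
    ultimately have "3/80 - q/8 + 13/8*q^2 + q^3/4 - q^4/16 - q^5/40 \<ge> 0" using q by linarith
    also have "3/80 - q/8 + 13/8*q^2 + q^3/4 - q^4/16 - q^5/40 = 3/2 - 5/2 * p + 3/4*p^2 + p^3/4 + p^4/16 - p^5/40"
      unfolding q_def by (simp add: numeral_eq_Suc field_simps)
    finally show ?thesis .
  qed
  ultimately have "exp p / 2 + E - 2 * sin p \<ge> 0" by linarith
  then have "E * (exp p / 2 + E - 2 * sin p) \<ge> 0" using E0 by simp
  also have "E * (exp p / 2 + E - 2 * sin p) = (exp p * E) / 2 + E^2 - 2 * E * sin p" by (simp add: algebra_simps power2_eq_square)
  finally show ?thesis unfolding E eE E_def[symmetric] by simp
qed

text \<open>With this sign of the sine the value drops below 1 only for p > pi, where the factor exp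
  (- pi) keeps the loss below 1/13. The bound is the square of 20/21.\<close>

lemma kernel_good_side:
  fixes p :: real assumes p: "p \<ge> 0"
  shows "1 + exp (- (2 * p)) + 2 * exp (- p) * sin p \<ge> 400/441"
proof (cases "p \<le> pi")
  case True
  then have "exp (- p) * sin p \<ge> 0" using p sin_ge_zero by simp
  then show ?thesis using exp_ge_zero[of "- (2 * p)"] by simp
next
  case False
  define u where "u = p - pi"
  have u: "u > 0" using False by (simp add: u_def)
  have "sin p = - sin u" by (simp add: u_def)
  then have 1: "- sin p \<le> u" using u by (simp add: sin_x_le_x)
  have "exp (3 :: real) \<ge> 13" using exp_ge_cubic[of 3] by (simp add: power2_eq_square power3_eq_cube)
  then have 2: "exp (- pi) \<le> 1/13" using exp_neg_le[of 13 3 pi] pi_gt_157_50 by simp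
  have "(u - 1)^2 \<ge> 0" by simp
  then have "2 * u \<le> 1 + u + u^2/2" using u by (simp add: power2_eq_square algebra_simps)
  also have "\<dots> \<le> exp u" using exp_lower_Taylor_quadratic[of u] u by simp
  finally have "exp (- u) * (2 * u) \<le> exp (- u) * exp u" by (intro mult_left_mono) auto
  then have 3: "exp (- u) * (2 * u) \<le> 1" by (simp flip: exp_add)
  have "exp (- p) * (2 * (- sin p)) \<le> exp (- p) * (2 * u)" using 1 by (intro mult_left_mono) auto
  also have "\<dots> = exp (- pi) * (exp (- u) * (2 * u))" by (simp add: u_def algebra_simps flip: exp_add)
  also have "\<dots> \<le> 1/13 * 1" using 2 3 u by (intro mult_mono) auto
  finally show ?thesis using exp_ge_zero[of "- (2 * p)"] by linarith
qed

text \<open>Up to sign these are the arguments of 1 - r - i r and 1 + q + i q, the points of the two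
  arms divided by a.\<close>

lemma DERIV_angle:
  "r < 1 \<Longrightarrow> ((\<lambda>r. arctan (r / (1 - r))) has_real_derivative 1 / ((1 - r)^2 + r^2)) (at r)"
  "q \<ge> 0 \<Longrightarrow> ((\<lambda>q. arctan (q / (1 + q))) has_real_derivative 1 / ((1 + q)^2 + q^2)) (at q)"
proof -
  assume r: "r < 1"
  have "inverse (1 + (r / (1 - r))\<^sup>2) * (1 / (1 - r)^2) = 1 / ((1 - r)^2 + r^2)"
    using r by (simp add: power_divide inverse_eq_divide add_divide_distrib[symmetric] divide_simps) 
  moreover have "((\<lambda>r. arctan (r / (1 - r))) has_real_derivative inverse (1 + (r / (1 - r))\<^sup>2) * (1 / (1 - r)^2)) (at r)"
    using r by (auto intro!: derivative_eq_intros simp: divide_simps power2_eq_square)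
  ultimately show "((\<lambda>r. arctan (r / (1 - r))) has_real_derivative 1 / ((1 - r)^2 + r^2)) (at r)" by simp
next
  assume q: "q \<ge> 0"
  have "inverse (1 + (q / (1 + q))\<^sup>2) * (1 / (1 + q)^2) = 1 / ((1 + q)^2 + q^2)"
    using q by (simp add: power_divide inverse_eq_divide add_divide_distrib[symmetric] divide_simps) 
  moreover have "((\<lambda>q. arctan (q / (1 + q))) has_real_derivative inverse (1 + (q / (1 + q))\<^sup>2) * (1 / (1 + q)^2)) (at q)"
    using q by (auto intro!: derivative_eq_intros simp: divide_simps power2_eq_square)
  ultimately show "((\<lambda>q. arctan (q / (1 + q))) has_real_derivative 1 / ((1 + q)^2 + q^2)) (at q)" by simp
qed

lemma arctan_ge_cubic:
  assumes "x \<ge> 0" shows "arctan x \<ge> x - x^3/3"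
proof -
  define g where "g x = arctan x - x + x^3/3" for x :: real
  have "g 0 \<le> g x"
  proof (rule DERIV_nonneg_imp_nondecreasing[OF assms])
    fix x :: real
    have "inverse (1 + x^2) - 1 + x^2 \<ge> 0"
    proof -
      have "(1 - x^2) * (1 + x^2) = 1 - x^2 * x^2" by (simp add: algebra_simps)
      also have "\<dots> \<le> 1" by simp
      finally have "1 - x^2 \<le> inverse (1 + x^2)" by (simp add: inverse_eq_divide pos_le_divide_eq add_pos_nonneg)
      then show ?thesis by simp
    qed
    then show "\<exists>y. (g has_real_derivative y) (at x) \<and> 0 \<le> y"
      unfolding g_def by (intro exI[of _ "inverse (1 + x^2) - 1 + x^2"] conjI) (auto intro!: derivative_eq_intros)
  qed
  then show ?thesis by (simp add: g_def)
qed

text \<open>On the left arm the argument of z must beat the growth of \<open>kerm\<close>. The bound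
  r + r^2 produces the Gaussian but fails before r = 1, so lines of slope 1 take over; their
  constants round down arctan (3/2) - 3/5 and arctan 4 - 4/5.\<close>

lemma angle_left:
  shows "0 \<le> r \<Longrightarrow> r \<le> 3/5 \<Longrightarrow> arctan (r / (1 - r)) \<ge> r + r^2"
    "3/5 \<le> r \<Longrightarrow> r < 1 \<Longrightarrow> arctan (r / (1 - r)) \<ge> r + 382/1000"
    "4/5 \<le> r \<Longrightarrow> r < 1 \<Longrightarrow> arctan (r / (1 - r)) \<ge> r + 52/100"
proof -
  have sq: "0 < (1 - r)^2 + r^2" for r :: real by (simp add: sum_power2_gt_zero_iff)
  have half: "arctan (r / (1 - r)) \<ge> r + r^2" if "0 \<le> r" "r \<le> 1/2" for r :: real
  proof -
    define g where "g r = arctan (r / (1 - r)) - r - r^2" for r :: real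
    have "g 0 \<le> g r"
    proof (rule DERIV_nonneg_imp_nondecreasing[OF that(1)])
      fix x :: real assume x: "0 \<le> x" "x \<le> r"
      then have x1: "x \<le> 1/2" using that by linarith
      have "(1 + 2 * x) * ((1 - x)^2 + x^2) = 1 - 2 * (x * x) * (1 - 2 * x)" by (simp add: power2_eq_square algebra_simps)
      also have "\<dots> \<le> 1" using x1 x by simp
      finally have "1 + 2 * x \<le> 1 / ((1 - x)^2 + x^2)" using sq[of x] by (simp add: pos_le_divide_eq)
      moreover have "(g has_real_derivative (1 / ((1 - x)^2 + x^2) - 1 - 2 * x)) (at x)"
        unfolding g_def by (rule DERIV_angle(1) derivative_eq_intros refl | use x1 in \<open>simp\<close>)+
      ultimately show "\<exists>y. (g has_real_derivative y) (at x) \<and> 0 \<le> y" by (intro exI conjI) auto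
    qed
    then show ?thesis by (simp add: g_def)
  qed
  have incr: "arctan (u / (1 - u)) - u \<le> arctan (r / (1 - r)) - r" if "0 \<le> u" "u \<le> r" "r < 1" for u r :: real
  proof -
    define g where "g r = arctan (r / (1 - r)) - r" for r :: real
    have "g u \<le> g r"
    proof (rule DERIV_nonneg_imp_nondecreasing[OF that(2)])
      fix x :: real assume x: "u \<le> x" "x \<le> r"
      have "(1 - x)^2 + x^2 = 1 - 2 * (x * (1 - x))" by (simp add: power2_eq_square algebra_simps)
      also have "\<dots> \<le> 1" using x that by simp
      finally have "1 \<le> 1 / ((1 - x)^2 + x^2)" using sq[of x] by (simp add: pos_le_divide_eq)
      moreover have "(g has_real_derivative (1 / ((1 - x)^2 + x^2) - 1)) (at x)"
        unfolding g_def by (rule DERIV_angle(1) derivative_eq_intros refl | use x that in \<open>simp\<close>)+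
      ultimately show "\<exists>y. (g has_real_derivative y) (at x) \<and> 0 \<le> y" by (intro exI conjI) auto
    qed
    then show ?thesis by (simp add: g_def)
  qed
  have a35: "arctan (3/2) \<ge> 3/5 + 382/1000"
  proof -
    have "arctan 1 + arctan (1/5) = arctan ((1 + 1/5) / (1 - 1 * (1/5)))" by (rule arctan_add) auto
    then have "arctan (3/2) = pi / 4 + arctan (1/5)" by (simp add: arctan_one)
    moreover have "arctan (1/5) \<ge> 1/5 - 1/375" using arctan_ge_cubic[of "1/5"] by (simp add: power3_eq_cube)
    ultimately show ?thesis using pi_gt_157_50 by linarith
  qed
  have a45: "arctan 4 \<ge> 4/5 + 52/100"
  proof -
    have "arctan (1 / 4) = pi / 2 - arctan 4" using arctan_inverse[of 4] by simp
    moreover have "arctan (1/4) \<le> 1/4" by (rule arctan_le_self) simp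
    ultimately show ?thesis using pi_gt_157_50 by linarith
  qed
  show "3/5 \<le> r \<Longrightarrow> r < 1 \<Longrightarrow> arctan (r / (1 - r)) \<ge> r + 382/1000" using incr[of "3/5" r] a35 by simp
  show "4/5 \<le> r \<Longrightarrow> r < 1 \<Longrightarrow> arctan (r / (1 - r)) \<ge> r + 52/100" using incr[of "4/5" r] a45 by simp
  assume r: "0 \<le> r" "r \<le> 3/5"
  show "arctan (r / (1 - r)) \<ge> r + r^2"
  proof (cases "r \<le> 1/2")
    case False
    then have h: "1/2 \<le> r" by simp
    \<comment> \<open>Beyond 1/2 the difference may decrease, but with slope at least - 3/10;
      starting from pi / 4 - 3/4 it stays positive up to 3/5.\<close>
    define g where "g r = arctan (r / (1 - r)) - r - r^2 + 3/10 * r" for r :: real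
    have "g (1/2) \<le> g r"
    proof (rule DERIV_nonneg_imp_nondecreasing[OF h])
      fix x :: real assume x: "1/2 \<le> x" "x \<le> r"
      then have x1: "x \<le> 3/5" using r by linarith
      \<comment> \<open>The chord of the convex denominator over [1/2, 3/5].\<close>
      have "0 \<le> (x - 1/2) * (3/5 - x)" using x x1 by simp
      then have "(1 - x)^2 + x^2 \<le> 2/5 + x/5" by (simp add: power2_eq_square field_simps)
      then have "(7/10 + 2 * x) * ((1 - x)^2 + x^2) \<le> (7/10 + 2 * (3/5)) * (2/5 + (3/5)/5)"
        using x x1 by (intro mult_mono) auto
      then have "(7/10 + 2 * x) * ((1 - x)^2 + x^2) \<le> 1" by simp
      then have "7/10 + 2 * x \<le> 1 / ((1 - x)^2 + x^2)" using sq[of x] by (simp add: pos_le_divide_eq)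
      moreover have "(g has_real_derivative (1 / ((1 - x)^2 + x^2) - 1 - 2 * x + 3/10)) (at x)"
        unfolding g_def by (rule DERIV_angle(1) derivative_eq_intros refl | use x1 in \<open>simp\<close>)+
      ultimately show "\<exists>y. (g has_real_derivative y) (at x) \<and> 0 \<le> y" by (intro exI conjI) auto
    qed
    moreover have "g (1/2) = pi / 4 - 3/5" by (simp add: g_def arctan_one power2_eq_square)
    ultimately show ?thesis using r pi_gt_157_50 by (simp add: g_def)
  qed (use half r in auto)
qed

text \<open>Upper bounds for the argument on the right arm: linear for frac x < 2/5; otherwise
  cubic, hence Gaussian, up to q = 9/20, and a line beyond, whose slope rounds up the derivative 1 /
  2.305 at 9/20.\<close>

lemma angle_right:
  fixes q :: real
  assumes q: "q \<ge> 0"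
  shows "arctan (q / (1 + q)) \<le> q" "arctan (q / (1 + q)) \<le> q - q^2 + 2/3 * q^3"
    "9/20 \<le> q \<Longrightarrow> arctan (q / (1 + q)) \<le> 309/1000 + 434/1000 * (q - 9/20)"
proof -
  have sq: "0 < (1 + x)^2 + x^2" if "x \<ge> 0" for x :: real using that by (simp add: add_pos_nonneg)
  have c: "arctan (q / (1 + q)) \<le> q - q^2 + 2/3 * q^3" if "q \<ge> 0" for q :: real
  proof -
    define g where "g q = q - q^2 + 2/3 * q^3 - arctan (q / (1 + q))" for q :: real
    have "g 0 \<le> g q"
    proof (rule DERIV_nonneg_imp_nondecreasing[OF that])
      fix x :: real assume x: "0 \<le> x"
      have "(1 - 2 * x + 2 * x^2) * ((1 + x)^2 + x^2) = 1 + 4 * (x^2 * x^2)" by (simp add: power2_eq_square algebra_simps)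
      also have "\<dots> \<ge> 1" by simp
      finally have q: "1 / ((1 + x)^2 + x^2) \<le> 1 - 2 * x + 2 * x^2" using sq[OF x] by (simp add: pos_divide_le_eq)
      have p: "((\<lambda>q. q - q^2 + 2/3 * q^3) has_real_derivative (1 - 2 * x + 2 * x^2)) (at x)"
        by (auto intro!: derivative_eq_intros simp: power2_eq_square)
      have "(g has_real_derivative (1 - 2 * x + 2 * x^2 - 1 / ((1 + x)^2 + x^2))) (at x)"
        using DERIV_diff[OF p DERIV_angle(2)[OF x]] by (simp add: g_def[abs_def])
      then show "\<exists>y. (g has_real_derivative y) (at x) \<and> 0 \<le> y" using q by (intro exI conjI) auto
    qed
    then show ?thesis by (simp add: g_def)
  qed
  have "arctan (q / (1 + q)) \<le> q / (1 + q)" using q by (intro arctan_le_self) simp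
  also have "\<dots> \<le> q" using q divide_left_mono[of 1 "1 + q" q] by simp
  finally show "arctan (q / (1 + q)) \<le> q" .
  show "arctan (q / (1 + q)) \<le> q - q^2 + 2/3 * q^3" by (rule c[OF q])
  assume q9: "9/20 \<le> q"
  define g where "g q = 434/1000 * q - arctan (q / (1 + q))" for q :: real
  have "g (9/20) \<le> g q"
  proof (rule DERIV_nonneg_imp_nondecreasing[OF q9])
    fix x :: real assume x: "9/20 \<le> x"
    have "9/20 * (9/20) \<le> x * x" using x by (intro mult_mono) auto
    then have "2305/1000 \<le> (1 + x)^2 + x^2" using x by (simp add: power2_eq_square algebra_simps)
    then have q: "1 / ((1 + x)^2 + x^2) \<le> 1 / (2305/1000)" using sq[of x] x by (intro divide_left_mono) auto
    have p: "((\<lambda>q. 434/1000 * q) has_real_derivative 434/1000) (at x)"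
      by (auto intro!: derivative_eq_intros)
    have "(g has_real_derivative (434/1000 - 1 / ((1 + x)^2 + x^2))) (at x)"
      using DERIV_diff[OF p DERIV_angle(2)[of x]] x by (simp add: g_def[abs_def])
    then show "\<exists>y. (g has_real_derivative y) (at x) \<and> 0 \<le> y" using q by (intro exI conjI) auto
  qed
  then have "434/1000 * (9/20) - arctan ((9/20) / (1 + 9/20)) \<le> 434/1000 * q - arctan (q / (1 + q))" unfolding g_def .
  moreover have "arctan ((9/20) / (1 + 9/20)) \<le> 309/1000" using c[of "9/20"] by (simp add: power2_eq_square power3_eq_cube)
  moreover have "V \<le> 309/1000 + 434/1000 * (q - 9/20)" if "434/1000 * (9/20) - U \<le> 434/1000 * q - V" "U \<le> 309/1000" for U V :: real
    using that by (simp add: field_simps)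
  ultimately show "arctan (q / (1 + q)) \<le> 309/1000 + 434/1000 * (q - 9/20)" by blast
qed

section \<open>Bounds for the kernel on the contour\<close>

lemma sqrt2_bounds: "14142/10000 < sqrt 2" "sqrt 2 < 14143/10000"
  by (rule real_less_rsqrt, simp add: power2_eq_square) (rule real_less_lsqrt, simp_all add: power2_eq_square)


text \<open>The majorant is integrated in the parameter of the ray, whose speed is norm d. If the
  contour integral does not exist it is 0, and I is nonnegative.\<close>

lemma norm_cint_ray_le:
  fixes b :: "real \<Rightarrow> real"
  assumes "\<alpha> < \<beta>" and b: "\<And>r. \<alpha> \<le> r \<Longrightarrow> r \<le> \<beta> \<Longrightarrow> norm (F (p + of_real r * d)) \<le> b r"
    and I: "(b has_integral I) {\<alpha>..\<beta>}"
  shows "norm (cint (p + of_real \<alpha> * d) (p + of_real \<beta> * d) F) \<le> I * norm d"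
proof (cases "F contour_integrable_on linepath (p + of_real \<alpha> * d) (p + of_real \<beta> * d)")
  case True
  then have "(F has_contour_integral cint (p + of_real \<alpha> * d) (p + of_real \<beta> * d) F) (linepath (p + of_real \<alpha> * d) (p + of_real \<beta> * d))"
    by (rule has_contour_integral_integral)
  then have hi: "((\<lambda>v. F (p + of_real v * d) * d) has_integral cint (p + of_real \<alpha> * d) (p + of_real \<beta> * d) F) {\<alpha>..\<beta>}"
    unfolding has_contour_integral_ray[OF assms(1)] .
  have "norm (integral {\<alpha>..\<beta>} (\<lambda>v. F (p + of_real v * d) * d)) \<le> integral {\<alpha>..\<beta>} (\<lambda>v. b v * norm d)"
  proof (rule integral_norm_bound_integral)
    show "(\<lambda>v. F (p + of_real v * d) * d) integrable_on {\<alpha>..\<beta>}" using hi by blast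
    show "(\<lambda>v. b v * norm d) integrable_on {\<alpha>..\<beta>}" using I by (intro integrable_on_mult_left) blast
    show "norm (F (p + of_real v * d) * d) \<le> b v * norm d" if "v \<in> {\<alpha>..\<beta>}" for v
      unfolding norm_mult using that b by (intro mult_right_mono) auto
  qed
  then show ?thesis unfolding integral_unique[OF hi] integral_unique[OF has_integral_mult_left[OF I]] .
next
  case False
  have "0 \<le> I" using b by (intro has_integral_nonneg[OF I]) (meson atLeastAtMost_iff norm_ge_zero order_trans)
  then show ?thesis using False by (simp add: not_integrable_contour_integral)
qed

lemma norm_powr_Complex: "z \<noteq> 0 \<Longrightarrow> norm (z powr (- Complex \<sigma> t)) = norm z powr (- \<sigma>) * exp (t * Arg z)"
  by (simp add: norm_powr_complex)

lemma Arg_lower: "r < 1 \<Longrightarrow> Arg (Complex (1 - r) (- r)) = - arctan (r / (1 - r))"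
  using arg_conv_arctan[of "Complex (1 - r) (- r)"] by (simp add: arctan_minus)

lemma Arg_upper: "q \<ge> 0 \<Longrightarrow> Arg (Complex (1 + q) q) = arctan (q / (1 + q))"
  using arg_conv_arctan[of "Complex (1 + q) q"] by simp

lemma Arg_lower_end: "Arg (Complex 0 (-1)) = - pi / 2"
proof -
  have "Complex 0 (-1) = - \<i>" by (simp add: complex_eq_iff)
  then show ?thesis by simp
qed

lemma Arg_lower_bounds:
  shows "0 \<le> r \<Longrightarrow> r \<le> 3/5 \<Longrightarrow> Arg (Complex (1 - r) (- r)) \<le> - (r + r^2)"
    "3/5 \<le> r \<Longrightarrow> r \<le> 1 \<Longrightarrow> Arg (Complex (1 - r) (- r)) \<le> - (r + 382/1000)"
    "4/5 \<le> r \<Longrightarrow> r \<le> 1 \<Longrightarrow> Arg (Complex (1 - r) (- r)) \<le> - (r + 52/100)"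
proof -
  show "0 \<le> r \<Longrightarrow> r \<le> 3/5 \<Longrightarrow> Arg (Complex (1 - r) (- r)) \<le> - (r + r^2)"
    using angle_left(1)[of r] Arg_lower[of r] by simp
  show "3/5 \<le> r \<Longrightarrow> r \<le> 1 \<Longrightarrow> Arg (Complex (1 - r) (- r)) \<le> - (r + 382/1000)"
    using angle_left(2)[of r] Arg_lower[of r] Arg_lower_end pi_gt_157_50 by (cases "r = 1") auto
  show "4/5 \<le> r \<Longrightarrow> r \<le> 1 \<Longrightarrow> Arg (Complex (1 - r) (- r)) \<le> - (r + 52/100)"
    using angle_left(3)[of r] Arg_lower[of r] Arg_lower_end pi_gt_157_50 by (cases "r = 1") auto
qed

lemma norm_exp_minus_1_sq:
  "(norm (exp (- (of_real (2 * pi * 1) * \<i> * z)) - 1))\<^sup>2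
     = exp (4 * pi * Im z) - 2 * exp (2 * pi * Im z) * cos (2 * pi * Re z) + 1"
proof -
  define E where "E = exp (2 * pi * Im z)"
  have "exp (- (of_real (2 * pi * 1) * \<i> * z)) = Complex (E * cos (2 * pi * Re z)) (- (E * sin (2 * pi * Re z)))"
    by (simp add: E_def exp_eq_polar complex_eq_iff cis.sel Re_exp Im_exp)
  then have "(norm (exp (- (of_real (2 * pi * 1) * \<i> * z)) - 1))\<^sup>2 = (E * cos (2 * pi * Re z) - 1)\<^sup>2 + (E * sin (2 * pi * Re z))\<^sup>2"
    by (simp add: cmod_power2)
  also have "\<dots> = E\<^sup>2 * ((sin (2 * pi * Re z))\<^sup>2 + (cos (2 * pi * Re z))\<^sup>2) - 2 * E * cos (2 * pi * Re z) + 1"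
  proof -
    have "(E * c - 1)\<^sup>2 + (E * d)\<^sup>2 = E\<^sup>2 * (d\<^sup>2 + c\<^sup>2) - 2 * E * c + 1" for c d :: real
      by (simp add: power2_eq_square algebra_simps)
    then show ?thesis .
  qed
  also have "\<dots> = E\<^sup>2 - 2 * E * cos (2 * pi * Re z) + 1" by simp
  also have "E\<^sup>2 = exp (4 * pi * Im z)" by (simp add: E_def power2_eq_square flip: exp_add)
  finally show ?thesis by (simp add: E_def)
qed

lemma norm_ker_le:
  assumes "W > 0" "(norm (exp (- (of_real (2 * pi * 1) * \<i> * z)) - 1))\<^sup>2 \<ge> (1 / W)\<^sup>2"
  shows "norm (ker 1 z) \<le> W"
proof -
  have w: "norm (exp (- (of_real (2 * pi * 1) * \<i> * z)) - 1) \<ge> 1 / W" using assms by (intro power2_le_imp_le[OF assms(2)]) auto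
  have "norm (ker 1 z) = 1 / norm (exp (- (of_real (2 * pi * 1) * \<i> * z)) - 1)" unfolding ker_def norm_divide by simp
  also have "\<dots> \<le> 1 / (1 / W)" using w assms(1) by (intro divide_left_mono mult_pos_pos) (auto intro: less_le_trans)
  finally show ?thesis by simp
qed

text \<open>Bounds for the kernel on the left and on the right arm. As sin (2 pi a) is 1 or -1,
  exactly one of the arms is on the bad side and gets sqrt 2.\<close>

definition Wl :: "real \<Rightarrow> real" where "Wl \<alpha> = (if \<alpha> = 1/4 then sqrt 2 else 21/20)"
definition Wr :: "real \<Rightarrow> real" where "Wr \<alpha> = (if \<alpha> = 1/4 then 21/20 else sqrt 2)"

lemma quarter_trig:
  assumes "\<alpha> \<in> {1/4, 3/4}" "a = \<alpha> + real N"
  shows "cos (2 * pi * a + p) = (if \<alpha> = 1/4 then - sin p else sin p)"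
    "cos (2 * pi * a - p) = (if \<alpha> = 1/4 then sin p else - sin p)"
proof -
  have c: "cos (2 * pi * a) = 0" unfolding assms(2) by (rule cos_quarter[OF assms(1)])
  have "sin (2 * pi * a) = sin (2 * pi * \<alpha> + real N * (2 * pi))" unfolding assms(2) by (simp add: algebra_simps)
  also have "\<dots> = sin (2 * pi * \<alpha>)" 
  proof -
    have "sin (real N * (2 * pi)) = 0" "cos (real N * (2 * pi)) = 1"
      using sin_npi[of "2 * N"] cos_npi[of "2 * N"] by (simp_all add: mult_ac)
    then show ?thesis by (simp add: sin_add)
  qed
  also have "\<dots> = (if \<alpha> = 1/4 then 1 else -1)"
  proof -
    have e: "2 * pi * (1/4) = pi / 2" "2 * pi * (3/4) = 3 / 2 * pi" by simp_all
    consider "\<alpha> = 1/4" | "\<alpha> = 3/4" using assms(1) by blast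
    then show ?thesis
    proof cases
      case 1
      then show ?thesis unfolding 1 e by simp
    next
      case 2
      then show ?thesis unfolding 2 e using sin_3over2_pi by simp
    qed
  qed
  finally have s: "sin (2 * pi * a) = (if \<alpha> = 1/4 then 1 else -1)" .
  show "cos (2 * pi * a + p) = (if \<alpha> = 1/4 then - sin p else sin p)" unfolding cos_add c s by simp
  show "cos (2 * pi * a - p) = (if \<alpha> = 1/4 then sin p else - sin p)" unfolding cos_diff c s by simp
qed

lemma ker_left:
  assumes \<alpha>: "\<alpha> \<in> {1/4, 3/4}" "a = \<alpha> + real N" and r: "r \<ge> 0"
  shows "norm (ker 1 (of_real a * Complex (1 - r) (- r))) \<le> Wl \<alpha>"
proof (rule norm_ker_le)
  define p where "p = 2 * pi * a * r"
  have "a > 0" using \<alpha> by auto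
  then have p: "p \<ge> 0" using r by (simp add: p_def)
  define z where "z = of_real a * Complex (1 - r) (- r)"
  have z: "2 * pi * Re z = 2 * pi * a - p" "2 * pi * Im z = - p" "4 * pi * Im z = - (2 * p)" by (simp_all add: z_def p_def algebra_simps)
  show "(norm (exp (- (of_real (2 * pi * 1) * \<i> * z)) - 1))\<^sup>2 \<ge> (1 / Wl \<alpha>)\<^sup>2"
    unfolding norm_exp_minus_1_sq z quarter_trig(2)[OF \<alpha>] Wl_def
    using kernel_bad_side[OF p] kernel_good_side[OF p] by (auto simp: power2_eq_square)
qed (simp add: Wl_def)

lemma ker_right:
  assumes \<alpha>: "\<alpha> \<in> {1/4, 3/4}" "a = \<alpha> + real N" and q: "q \<ge> 0"
  shows "norm (ker 1 (of_real a * Complex (1 + q) q)) \<le> Wr \<alpha> * exp (- (2 * pi * a * q))"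
proof (rule norm_ker_le)
  define p where "p = 2 * pi * a * q"
  have "a > 0" using \<alpha> by auto
  then have p: "p \<ge> 0" using q by (simp add: p_def)
  define z where "z = of_real a * Complex (1 + q) q"
  have z: "2 * pi * Re z = 2 * pi * a + p" "2 * pi * Im z = p" "4 * pi * Im z = 2 * p" by (simp_all add: z_def p_def algebra_simps)
  have W: "Wr \<alpha> > 0" by (simp add: Wr_def)
  have 1: "exp (2 * p) - 2 * exp p * c + 1 = (exp p)\<^sup>2 * (1 + exp (- (2 * p)) - 2 * exp (- p) * c)" for c
  proof -
    have "exp (- (2 * p)) = 1 / (exp p)\<^sup>2" "exp (- p) = 1 / exp p" "exp (2 * p) = (exp p)\<^sup>2"
      by (simp_all add: exp_minus inverse_eq_divide power2_eq_square flip: exp_add)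
    then show ?thesis by (simp add: field_simps power2_eq_square)
  qed
  have "(1 / Wr \<alpha>)\<^sup>2 \<le> 1 + exp (- (2 * p)) - 2 * exp (- p) * (if \<alpha> = 1/4 then - sin p else sin p)"
    unfolding Wr_def using kernel_bad_side[OF p] kernel_good_side[OF p] by (auto simp: power2_eq_square)
  then have "(exp p)\<^sup>2 * (1 / Wr \<alpha>)\<^sup>2 \<le> exp (2 * p) - 2 * exp p * (if \<alpha> = 1/4 then - sin p else sin p) + 1"
    unfolding 1 by (intro mult_left_mono) auto
  moreover have "(1 / (Wr \<alpha> * exp (- (2 * pi * a * q))))\<^sup>2 = (exp p)\<^sup>2 * (1 / Wr \<alpha>)\<^sup>2"
    using W by (simp add: p_def exp_minus field_simps power2_eq_square)
  ultimately show "(norm (exp (- (of_real (2 * pi * 1) * \<i> * z)) - 1))\<^sup>2 \<ge> (1 / (Wr \<alpha> * exp (- (2 * pi * a * q))))\<^sup>2"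
    unfolding norm_exp_minus_1_sq z quarter_trig(1)[OF \<alpha>] by simp
qed (simp add: Wr_def)

text \<open>Well below the axis exp (- 2 pi i z) has modulus at most 1/52, so the kernel is close to
  -1 whatever Re z is.\<close>

lemma ker_lower:
  assumes "Im z \<le> -3/4"
  shows "norm (ker 1 z) \<le> 102/100"
proof (rule norm_ker_le)
  define E where "E = exp (2 * pi * Im z)"
  have "exp (471/100 :: real) \<ge> 52" using exp_ge_quartic[of "471/100"] by (simp add: numeral_eq_Suc)
  moreover have "3/4 * (2 * pi) \<ge> 471/100" using pi_gt_157_50 by simp
  ultimately have "exp (- (3/4 * (2 * pi))) \<le> 1/52" by (rule exp_neg_le) simp
  moreover have "2 * pi * Im z \<le> 2 * pi * (-3/4)" using assms by (intro mult_left_mono) auto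
  then have "E \<le> exp (- (3/4 * (2 * pi)))" by (simp add: E_def)
  ultimately have E: "E \<le> 1/52" by linarith
  have E0: "E > 0" by (simp add: E_def)
  have "E * cos (2 * pi * Re z) \<le> E * 1" using E0 by (intro mult_left_mono) auto
  moreover have "exp (4 * pi * Im z) = E\<^sup>2" by (simp add: E_def power2_eq_square flip: exp_add)
  ultimately have "(norm (exp (- (of_real (2 * pi * 1) * \<i> * z)) - 1))\<^sup>2 \<ge> E\<^sup>2 - 2 * E + 1"
    unfolding norm_exp_minus_1_sq by (simp add: E_def)
  moreover have "(1 / (102/100))\<^sup>2 \<le> (1 - E)\<^sup>2" using E by (intro power_mono) auto
  then have "(1 / (102/100))\<^sup>2 \<le> E\<^sup>2 - 2 * E + 1" by (simp add: power2_eq_square algebra_simps)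
  ultimately show "(1 / (102/100))\<^sup>2 \<le> (norm (exp (- (of_real (2 * pi * 1) * \<i> * z)) - 1))\<^sup>2" by linarith
qed simp

lemma norm_kerm: "norm (kerm 1 m z) = exp (- (2 * pi * real m * Im z)) * norm (ker 1 z)"
  by (simp add: kerm_def norm_mult)

section \<open>The arc below the real axis\<close>

locale critical =
  fixes \<sigma> t x y :: real
  assumes sig: "0 < \<sigma>" "\<sigma> < 1" and xy: "1 \<le> x" "x \<le> y" and t: "t = 2 * pi * x * y"
begin

text \<open>Chosen so that a lies within 1/4 of the saddle y.\<close>

definition \<alpha> :: real where "\<alpha> = (if frac y < 1/2 then 1/4 else 3/4)"
definition N :: nat where "N = nat \<lfloor>y\<rfloor>"
definition m :: nat where "m = nat \<lfloor>x\<rfloor>"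
definition a :: real where "a = \<alpha> + real N"
definition D :: real where "D = a - y"
definition f :: real where "f = frac x"
definition h :: real where "h = sqrt (x / y)"
text \<open>The natural size of the saddle integral: y^(1 - \<sigma>) from the power and the scale
  y, times the width 1 / sqrt (x y) of the Gaussian relative to y.\<close>

definition M :: real where "M = y powr (1 - \<sigma>) / sqrt (x * y)"
definition P :: "complex \<Rightarrow> complex" where "P z = z powr (- Complex \<sigma> t)"

lemma \<alpha>: "\<alpha> \<in> {1/4, 3/4}" by (simp add: \<alpha>_def)

lemma a_eq: "a = \<alpha> + real N" by (simp add: a_def)

lemma N_eq: "real N = y - frac y" and m_eq: "real m = x - f" and m_pos: "m \<ge> 1"
  using xy by (auto simp: N_def m_def f_def frac_def le_nat_iff)

lemma f_bounds: "0 \<le> f" "f < 1" by (simp_all add: f_def frac_lt_1)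

lemma D_bounds: "-1/4 \<le> D" "D \<le> 1/4"
  using frac_ge_0[of y] frac_lt_1[of y] by (auto simp: D_def a_def N_eq \<alpha>_def)

lemma a_bounds: "a \<ge> 5/4" "a \<le> y + 1/4" "y \<le> a + 1/4" "y \<le> 6/5 * a" "a = y + D"
proof -
  have "N \<ge> 1" using xy by (simp add: N_def le_nat_iff)
  then show 1: "a \<ge> 5/4" using \<alpha> by (auto simp: a_def)
  show "a \<le> y + 1/4" "y \<le> a + 1/4" "a = y + D" using D_bounds by (auto simp: D_def)
  then show "y \<le> 6/5 * a" using 1 by linarith
qed

lemma h_bounds: "0 < h" "h \<le> 1" "h\<^sup>2 = x / y" "x / y \<le> h" "sqrt (x * y) = y * h"
proof -
  show "0 < h" using xy by (simp add: h_def)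
  show "h \<le> 1" using xy by (simp add: h_def)
  show h2: "h\<^sup>2 = x / y" using xy by (simp add: h_def)
  then show "x / y \<le> h" using \<open>0 < h\<close> \<open>h \<le> 1\<close> by (metis mult_left_le power2_eq_square less_imp_le)
  have "(y * h)\<^sup>2 = y\<^sup>2 * (x / y)" unfolding power_mult_distrib h2 ..
  then have "x * y = (y * h)\<^sup>2" using xy by (simp add: power2_eq_square)
  then show "sqrt (x * y) = y * h" using \<open>0 < h\<close> xy by simp
qed

lemma t_ge: "t \<ge> 2 * pi" 
proof -
  have "1 * 1 \<le> x * y" using xy by (intro mult_mono) auto
  then have "2 * pi * 1 \<le> 2 * pi * (x * y)" by (intro mult_left_mono) auto
  then show ?thesis by (simp add: t mult.assoc)
qed

lemma M_pos: "M > 0" using xy by (auto simp: M_def)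

lemma M_y: "y powr (1 - \<sigma>) = M * (y * h)"
  using h_bounds(1) xy unfolding M_def h_bounds(5) by simp

lemma M_h: "y powr (- \<sigma>) = M * h"
proof -
  have "y powr (- \<sigma>) * y = y powr (1 - \<sigma>)" using xy by (simp add: powr_diff powr_minus field_simps)
  then show ?thesis unfolding M_y using xy by simp
qed

text \<open>An upper bound for (a / y)^(1 - \<sigma>): a is below y if D < 0 and otherwise at most y
  + 1/4; it is written through x / y, using x \<ge> 1, to be comparable with h.\<close>

definition \<kappa> :: real where "\<kappa> = (if D < 0 then 1 else 1 + x / y / 4)"

lemma \<kappa>: "1 \<le> \<kappa>" "\<kappa> \<le> 5/4" using xy by (auto simp: \<kappa>_def field_simps)

lemma a_powr_1: "a powr (1 - \<sigma>) \<le> \<kappa> * (M * (y * h))"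
proof (cases "D < 0")
  case True
  then have "a powr (1 - \<sigma>) \<le> y powr (1 - \<sigma>)" using a_bounds sig by (intro powr_mono2) auto
  then show ?thesis using True by (simp add: \<kappa>_def M_y)
next
  case False
  have "a powr (1 - \<sigma>) = y powr (1 - \<sigma>) * (a / y) powr (1 - \<sigma>)"
    using a_bounds xy by (simp add: powr_divide)
  also have "\<dots> \<le> y powr (1 - \<sigma>) * \<kappa>"
  proof (rule mult_left_mono)
    have "(a / y) powr (1 - \<sigma>) \<le> (a / y) powr 1" using False a_bounds xy sig by (intro powr_mono) auto
    also have "(a / y) powr 1 \<le> \<kappa>"
    proof -
      have "a / y = 1 + D / y" using a_bounds(5) xy by (simp add: field_simps)
      moreover have "D / y \<le> (x / 4) / y" using D_bounds xy by (intro divide_right_mono) auto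
      ultimately show ?thesis using False a_bounds xy by (simp add: \<kappa>_def)
    qed
    finally show "(a / y) powr (1 - \<sigma>) \<le> \<kappa>" .
  qed simp
  finally show ?thesis unfolding M_y by (simp only: mult_ac)
qed

text \<open>Generous, as y / a is at most 6/5, but it gives every piece the factor
  \<open>sqrt 2 powr \<sigma>\<close> that the left arm picks up from norm w \<ge> 1 / sqrt
  2.\<close>

lemma a_powr_0: "a powr (- \<sigma>) \<le> sqrt 2 powr \<sigma> * (M * h)"
proof -
  have "a powr (- \<sigma>) = y powr (- \<sigma>) * (y / a) powr \<sigma>"
    using a_bounds xy by (simp add: powr_divide powr_minus inverse_eq_divide)
  also have "\<dots> \<le> y powr (- \<sigma>) * sqrt 2 powr \<sigma>"
  proof (intro mult_left_mono powr_mono2)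
    have "y / a \<le> 6/5" using a_bounds by (simp add: field_simps)
    then show "y / a \<le> sqrt 2" using sqrt2_bounds by linarith
  qed (use sig xy a_bounds in auto)
  finally show ?thesis unfolding M_h by (simp only: mult_ac)
qed

lemma norm_P_scaled:
  assumes w: "norm w \<ge> c" "c > 0"
  shows "norm (P (of_real a * w)) \<le> c powr (- \<sigma>) * a powr (- \<sigma>) * exp (t * Arg w)"
proof -
  have w0: "w \<noteq> 0" using w by auto
  have "norm (P (of_real a * w)) = (a * norm w) powr (- \<sigma>) * exp (t * Arg w)"
    unfolding P_def using norm_powr_Complex[of "of_real a * w" \<sigma> t] w0 a_bounds(1) by (simp add: norm_mult Arg_times_of_real)
  also have "(a * norm w) powr (- \<sigma>) = norm w powr (- \<sigma>) * a powr (- \<sigma>)" using a_bounds(1) by (simp add: powr_mult)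
  also have "norm w powr (- \<sigma>) \<le> c powr (- \<sigma>)" using w sig by (intro powr_mono2') auto
  finally show ?thesis by (simp add: mult_right_mono)
qed

text \<open>Accounts for the shift D of a against the saddle and for \<open>\<kappa>\<close>; the
  numbers are computed at the end of \<open>left_bound\<close>.\<close>

definition left_coeff :: real where "left_coeff = (if D < 0 then 0 else if f < 2/5 then 44/100 else 1/8)"

text \<open>With m = x - f and a = y + D the terms linear in r leave x D - f a. This is at most 0 if
  D < 0, and also if f \<ge> 2/5, because then D \<le> 1/4 < f, while D \<ge> 0 gives x \<le>
  a.\<close>

lemma left_exponent:
  assumes r: "0 \<le> r" "r \<le> 1"
  shows "- (t * (r + r^2)) + 2 * pi * (real m * (a * r)) \<le> 2 * pi * x * (if D < 0 \<or> f \<ge> 2/5 then 0 else D) * r - 2 * pi * x * y * r^2"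
proof -
  have e: "- (t * (r + r^2)) + 2 * pi * (real m * (a * r)) = 2 * pi * (r * (x * D - f * a)) - 2 * pi * x * y * r^2"
    unfolding t m_eq a_bounds(5) by (simp add: algebra_simps)
  have "x * D - f * a \<le> x * (if D < 0 \<or> f \<ge> 2/5 then 0 else D)"
  proof -
    have fa: "0 \<le> f * a" using f_bounds a_bounds by simp
    consider "D < 0" | "D \<ge> 0" "f < 2/5" | "D \<ge> 0" "f \<ge> 2/5" by linarith
    then show ?thesis
    proof cases
      case 1
      then have "x * D \<le> 0" using xy by (simp add: mult_nonneg_nonpos)
      then show ?thesis using 1 fa by simp
    next
      case 2
      then show ?thesis using fa by simp
    next
      case 3
      then have "x * D \<le> a * f" using a_bounds(5) D_bounds xy by (intro mult_mono) auto
      then show ?thesis using 3 by (simp add: mult.commute)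
    qed
  qed
  then have "2 * pi * (r * (x * D - f * a)) \<le> 2 * pi * (r * (x * (if D < 0 \<or> f \<ge> 2/5 then 0 else D)))"
    using r by (intro mult_left_mono) auto
  then show ?thesis unfolding e by (simp add: mult_ac)
qed

lemma ma_le: "real m * (a * r) \<le> x * ((y + 1/4) * r)" if "r \<ge> 0"
  using that a_bounds m_eq f_bounds xy by (intro mult_mono) auto

text \<open>Exponential size of the integrand for r in [3/5, 4/5], and \<open>tail2\<close> the same
  for [4/5, 1]. The constants 382/1000 and 52/100 come from \<open>angle_left\<close>; 1/5 and 1/4
  are r / 4 at the right ends, from a \<le> y + 1/4.\<close>

definition tail1 :: real where "tail1 = exp (2 * pi * x * (1/5 - 382/1000 * y))"
definition tail2 :: real where "tail2 = exp (2 * pi * x * (1/4 - 52/100 * y))"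

text \<open>51/250 is the kernel bound 102/100 times the length 1/5. The factor y is absorbed by exp
  (- (y - 1)), so the worst case is y = 1.\<close>

lemma tails: "51/250 * y * sqrt 2 * (tail1 + tail2) \<le> 152/1000"
proof -
  have gen: "y * exp (2 * pi * x * (u - v * y)) \<le> exp (- (2 * (157/50) * (v - u)))" if "v > u" "u \<ge> 0" "1 \<le> 2 * pi * v" for u v
  proof -
    define w where "w = v * y - u"
    have w: "w = (v - u) + v * (y - 1)" by (simp add: w_def algebra_simps)
    have w0: "w \<ge> 0" unfolding w using that xy by simp
    have "1 * w \<le> x * w" using w0 xy by (intro mult_right_mono) auto
    then have "2 * pi * w \<le> 2 * pi * (x * w)" by simp
    then have "exp (2 * pi * x * (u - v * y)) \<le> exp (- (2 * pi * w))" by (simp add: w_def algebra_simps)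
    also have "\<dots> = exp (- (2 * pi * (v - u))) * exp (- (2 * pi * v * (y - 1)))"
      unfolding w exp_add[symmetric] by (simp add: algebra_simps)
    also have "\<dots> \<le> exp (- (2 * (157/50) * (v - u))) * exp (- (y - 1))"
    proof (intro mult_mono)
      have "2 * (157/50) * (v - u) \<le> 2 * pi * (v - u)" using that pi_gt_157_50 by (intro mult_right_mono) auto
      then show "exp (- (2 * pi * (v - u))) \<le> exp (- (2 * (157/50) * (v - u)))" by simp
      have "1 * (y - 1) \<le> 2 * pi * v * (y - 1)" using that xy by (intro mult_right_mono) auto
      then show "exp (- (2 * pi * v * (y - 1))) \<le> exp (- (y - 1))" by simp
    qed auto
    finally have "y * exp (2 * pi * x * (u - v * y)) \<le> y * (exp (- (2 * (157/50) * (v - u))) * exp (- (y - 1)))"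
      using xy by (intro mult_left_mono) auto
    also have "\<dots> = exp (- (2 * (157/50) * (v - u))) * (y * exp (- (y - 1)))" by simp
    also have "y * exp (- (y - 1)) \<le> exp (y - 1) * exp (- (y - 1))"
      using exp_ge_add_one_self[of "y - 1"] by (intro mult_right_mono) auto
    also have "\<dots> = 1" by (simp flip: exp_add)
    finally show ?thesis by simp
  qed
  have "y * tail1 \<le> exp (- (2 * (157/50) * (382/1000 - 1/5)))"
    unfolding tail1_def using pi_gt_157_50 by (intro gen) auto
  also have "\<dots> \<le> 1 / (311/100)"
  proof (rule exp_neg_le[OF _ order_refl])
    show "311/100 \<le> exp (2 * (157/50) * (382/1000 - 1/5) :: real)"
      using exp_ge_quartic[of "2 * (157/50) * (382/1000 - 1/5)"] by (simp add: numeral_eq_Suc)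
  qed simp
  finally have 1: "y * tail1 \<le> 1 / (311/100)" .
  have "y * tail2 \<le> exp (- (2 * (157/50) * (52/100 - 1/4)))"
    unfolding tail2_def using pi_gt_157_50 by (intro gen) auto
  also have "\<dots> \<le> 1 / (52/10)"
  proof (rule exp_neg_le[OF _ order_refl])
    show "52/10 \<le> exp (2 * (157/50) * (52/100 - 1/4) :: real)"
      using exp_ge_quartic[of "2 * (157/50) * (52/100 - 1/4)"] by (simp add: numeral_eq_Suc)
  qed simp
  finally have 2: "y * tail2 \<le> 1 / (52/10)" .
  have "51/250 * y * sqrt 2 * (tail1 + tail2) = 51/250 * sqrt 2 * (y * tail1 + y * tail2)" by (simp add: algebra_simps)
  also have "\<dots> \<le> 51/250 * (14143/10000) * (1 / (311/100) + 1 / (52/10))"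
    using 1 2 sqrt2_bounds xy by (intro mult_mono add_mono) (auto simp: tail1_def tail2_def)
  also have "\<dots> \<le> 152/1000" by simp
  finally show ?thesis .
qed

text \<open>Half a Gaussian at the saddle plus tails. The scales fit so that sqrt (pi / A) sqrt 2 y
  h = 1, whence the main term 1/2; all corrections are proportional to h.\<close>

lemma left_bound:
  "norm (cint (ax (-1) a) (of_real a) (\<lambda>z. P z * kerm 1 m z)) \<le> sqrt 2 powr \<sigma> * M * (Wl \<alpha> * (1/2 + left_coeff * h) + 19/100 * h)"
proof -
  define d where "d = - of_real a * (1 + \<i>)"
  define F where "F = (\<lambda>z. P z * kerm 1 m z)"
  define A where "A = 2 * pi * x * y"
  define \<delta> where "\<delta> = (if D < 0 \<or> f \<ge> 2/5 then 0 else D)"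
  define B where "B = 2 * pi * x * \<delta>"
  define K where "K = (1 / sqrt 2) powr (- \<sigma>) * a powr (- \<sigma>)"
  define W where "W = Wl \<alpha>"
  have \<delta>: "0 \<le> \<delta>" "\<delta> \<le> 1/4" using D_bounds by (auto simp: \<delta>_def)
  have A0: "A > 0" using xy by (simp add: A_def)
  have B0: "B \<ge> 0" using xy \<delta> by (simp add: B_def)
  have K0: "K \<ge> 0" by (simp add: K_def)
  have W0: "W > 0" by (simp add: W_def Wl_def)
  have path: "of_real a + of_real r * d = of_real a * Complex (1 - r) (- r)" for r
    by (simp add: d_def complex_eq_iff algebra_simps)
  \<comment> \<open>One integrable majorant for all three ranges of r, with the tails restricted to
    their intervals.\<close>
  define b where "b r = K * (W * exp (B * r - A * r\<^sup>2)) + K * (102/100) * (if r \<in> cbox (3/5) (4/5) then tail1 else 0)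
     + K * (102/100) * (if r \<in> cbox (4/5) 1 then tail2 else 0)" for r :: real
  have "norm (cint (of_real a + of_real 0 * d) (of_real a + of_real 1 * d) F)
      \<le> (K * (W * integral {0..1} (\<lambda>r. exp (B * r - A * r\<^sup>2))) + K * (102/100) * (tail1 / 5) + K * (102/100) * (tail2 / 5)) * norm d"
  proof (rule norm_cint_ray_le[where b = b])
    fix r :: real assume r: "0 \<le> r" "r \<le> 1"
    define w where "w = Complex (1 - r) (- r)"
    have nw: "norm w \<ge> 1 / sqrt 2"
    proof -
      have "(norm w)\<^sup>2 = (1 - r)\<^sup>2 + r\<^sup>2" "(1 / sqrt 2)\<^sup>2 = (1/2 :: real)" by (simp_all add: w_def cmod_power2 power_divide)
      moreover have "1/2 \<le> (1 - r)\<^sup>2 + r\<^sup>2"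
        using zero_le_power2[of "2 * r - 1"] by (simp add: power2_eq_square algebra_simps)
      ultimately have "(1 / sqrt 2)\<^sup>2 \<le> (norm w)\<^sup>2" by simp
      then show ?thesis by (rule power2_le_imp_le) simp
    qed
    have nF: "norm (F (of_real a * w)) \<le> K * exp (t * Arg w + 2 * pi * (real m * (a * r))) * norm (ker 1 (of_real a * w))"
    proof -
      have "norm (P (of_real a * w)) \<le> K * exp (t * Arg w)" unfolding K_def using nw by (intro norm_P_scaled) auto
      moreover have "norm (kerm 1 m (of_real a * w)) = exp (2 * pi * (real m * (a * r))) * norm (ker 1 (of_real a * w))"
        unfolding norm_kerm by (simp add: w_def mult_ac)
      ultimately have "norm (F (of_real a * w)) \<le> (K * exp (t * Arg w)) * (exp (2 * pi * (real m * (a * r))) * norm (ker 1 (of_real a * w)))"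
        unfolding F_def norm_mult by (metis mult_right_mono norm_ge_zero)
      then show ?thesis by (simp add: exp_add mult_ac)
    qed
    have t0: "t > 0" using t_ge pi_gt_zero by linarith
    have far: "norm (F (of_real a * w)) \<le> K * (102/100) * exp (2 * pi * x * (r / 4 - c * y))" if rc: "3/5 \<le> r" "Arg w \<le> - (r + c)" for c
    proof -
      \<comment> \<open>As a is at least 5/4, from r = 3/5 on the point lies at depth at least 3/4,
        where \<open>ker_lower\<close> applies.\<close>
      have "3/5 * (5/4) \<le> r * a" using rc a_bounds by (intro mult_mono) auto
      then have k: "norm (ker 1 (of_real a * w)) \<le> 102/100" by (intro ker_lower) (simp add: w_def mult.commute)
      have "t * Arg w \<le> t * (- (r + c))" using rc t0 by (intro mult_left_mono) auto
      then have "t * Arg w \<le> - (t * (r + c))" by (simp only: mult_minus_right)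
      then have "t * Arg w + 2 * pi * (real m * (a * r)) \<le> - (t * (r + c)) + 2 * pi * (x * ((y + 1/4) * r))"
        using mult_left_mono[OF ma_le[OF r(1)], of "2 * pi"] pi_gt_zero by linarith
      also have "\<dots> = 2 * pi * x * (r / 4 - c * y)" unfolding t by (simp add: algebra_simps)
      finally have "exp (t * Arg w + 2 * pi * (real m * (a * r))) \<le> exp (2 * pi * x * (r / 4 - c * y))" by simp
      then have "K * exp (t * Arg w + 2 * pi * (real m * (a * r))) * norm (ker 1 (of_real a * w)) \<le> K * exp (2 * pi * x * (r / 4 - c * y)) * (102/100)"
        using k K0 by (intro mult_mono) auto
      then show ?thesis using nF by (simp add: mult_ac)
    qed
    have pos: "0 \<le> K * (W * exp (B * r - A * r\<^sup>2))" "0 \<le> K * (102/100) * (if r \<in> cbox (3/5) (4/5) then tail1 else 0)"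
      "0 \<le> K * (102/100) * (if r \<in> cbox (4/5) 1 then tail2 else 0)"
      using K0 W0 by (auto simp: tail1_def tail2_def)
    have mono: "exp (2 * pi * x * (r / 4 - c)) \<le> exp (2 * pi * x * (r' / 4 - c))" if "r \<le> r'" for r' c
      using that xy by (auto intro!: mult_left_mono)
    consider "r \<le> 3/5" | "3/5 \<le> r" "r \<le> 4/5" | "4/5 \<le> r" by linarith
    then have "norm (F (of_real a * w)) \<le> b r"
    proof cases
      case 1
      have "t * Arg w \<le> t * (- (r + r^2))" using Arg_lower_bounds(1)[OF r(1) 1] t0 unfolding w_def by (intro mult_left_mono) auto
      then have "t * Arg w \<le> - (t * (r + r^2))" by (simp only: mult_minus_right)
      then have "t * Arg w + 2 * pi * (real m * (a * r)) \<le> B * r - A * r\<^sup>2"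
        using left_exponent[OF r] unfolding B_def A_def \<delta>_def by linarith
      then have "K * exp (t * Arg w + 2 * pi * (real m * (a * r))) * norm (ker 1 (of_real a * w)) \<le> K * exp (B * r - A * r\<^sup>2) * W"
        using K0 ker_left[OF \<alpha> a_eq r(1)] by (intro mult_mono) (auto simp: W_def w_def)
      then have "norm (F (of_real a * w)) \<le> K * (W * exp (B * r - A * r\<^sup>2))" using nF by (simp add: mult_ac)
      then show ?thesis unfolding b_def using pos by linarith
    next
      case 2
      have "norm (F (of_real a * w)) \<le> K * (102/100) * exp (2 * pi * x * (r / 4 - 382/1000 * y))"
        using 2 r Arg_lower_bounds(2)[of r] by (intro far) (auto simp: w_def)
      also have "\<dots> \<le> K * (102/100) * tail1" using K0 mono[of "4/5" "382/1000 * y"] 2 by (intro mult_left_mono) (auto simp: tail1_def)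
      finally show ?thesis unfolding b_def using pos 2 by simp
    next
      case 3
      have "norm (F (of_real a * w)) \<le> K * (102/100) * exp (2 * pi * x * (r / 4 - 52/100 * y))"
        using 3 r Arg_lower_bounds(3)[of r] by (intro far) (auto simp: w_def)
      also have "\<dots> \<le> K * (102/100) * tail2" using K0 mono[of 1 "52/100 * y"] r by (intro mult_left_mono) (auto simp: tail2_def)
      finally show ?thesis unfolding b_def using pos 3 r by simp
    qed
    then show "norm (F (of_real a + of_real r * d)) \<le> b r" unfolding path w_def .
  next
    have i1: "((\<lambda>r. exp (B * r - A * r\<^sup>2)) has_integral integral {0..1} (\<lambda>r. exp (B * r - A * r\<^sup>2))) {0..1}"
      by (intro integrable_integral integrable_continuous_real continuous_intros)
    have c: "((\<lambda>r::real. if r \<in> cbox u v then T else 0) has_integral (v - u) * T) {0..1}" if "0 \<le> u" "u \<le> v" "v \<le> 1" for u v T :: real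
      using has_integral_restrict_closed_subinterval[of "\<lambda>_. T" "(v - u) * T" u v 0 1] has_integral_const_real[of T u v] that by simp
    show "(b has_integral (K * (W * integral {0..1} (\<lambda>r. exp (B * r - A * r\<^sup>2))) + K * (102/100) * (tail1 / 5) + K * (102/100) * (tail2 / 5))) {0..1}"
      unfolding b_def
      by (intro has_integral_add has_integral_mult_right i1) (use c[of "3/5" "4/5" tail1] c[of "4/5" 1 tail2] in simp_all)
  qed simp
  also have "cint (of_real a + of_real 0 * d) (of_real a + of_real 1 * d) F = - cint (ax (-1) a) (of_real a) F"
  proof -
    have "of_real a + of_real 1 * d = ax (-1) a" by (simp add: d_def algebra_simps)
    then show ?thesis using cint_reverse[of "ax (-1) a" "of_real a" F] by simp
  qed
  also have "norm d = sqrt 2 * a"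
  proof -
    have "norm (1 + \<i>) = sqrt 2" by (simp add: cmod_def)
    then show ?thesis using a_bounds(1) by (simp add: d_def norm_mult)
  qed
  finally have main: "norm (cint (ax (-1) a) (of_real a) F)
     \<le> (K * (W * integral {0..1} (\<lambda>r. exp (B * r - A * r\<^sup>2))) + K * (102/100) * (tail1 / 5) + K * (102/100) * (tail2 / 5)) * (sqrt 2 * a)" by simp
  have Ka: "K * a = sqrt 2 powr \<sigma> * a powr (1 - \<sigma>)"
    using a_bounds(1) by (simp add: K_def powr_diff powr_minus powr_divide inverse_eq_divide)
  define G where "G = exp (B\<^sup>2 / (4 * A)) * (1/2 + \<delta> * h / sqrt 2)"
  have gG: "integral {0..1} (\<lambda>r. exp (B * r - A * r\<^sup>2)) * (sqrt 2 * (y * h)) \<le> G"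
  proof -
    have "integral {0..1} (\<lambda>r. exp (B * r - A * r\<^sup>2)) * (sqrt 2 * (y * h)) \<le> exp (B\<^sup>2 / (4 * A)) * (sqrt (pi / A) / 2 + B / (2 * A)) * (sqrt 2 * (y * h))"
      using xy h_bounds(1) by (intro mult_right_mono gaussian_linear_le A0 B0) auto
    also have "\<dots> = exp (B\<^sup>2 / (4 * A)) * (sqrt (pi / A) * (sqrt 2 * (y * h)) / 2 + B / (2 * A) * (sqrt 2 * (y * h)))" by (simp add: algebra_simps)
    finally have g: "integral {0..1} (\<lambda>r. exp (B * r - A * r\<^sup>2)) * (sqrt 2 * (y * h)) \<le> \<dots>" .
    have e1: "sqrt (pi / A) * (sqrt 2 * (y * h)) = 1"
    proof -
      have "pi / A = 1 / (2 * (x * y))" using xy by (simp add: A_def field_simps)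
      then have "sqrt (pi / A) = 1 / (sqrt 2 * (y * h))" by (simp add: real_sqrt_divide real_sqrt_mult h_bounds(5)[unfolded real_sqrt_mult])
      then show ?thesis using xy h_bounds(1) by simp
    qed
    have e2: "B / (2 * A) * (sqrt 2 * (y * h)) = \<delta> * h / sqrt 2"
      using xy by (simp add: A_def B_def field_simps)
    show ?thesis using g unfolding e1 e2 G_def .
  qed
  have main2: "norm (cint (ax (-1) a) (of_real a) F) \<le> sqrt 2 powr \<sigma> * (\<kappa> * M * (W * G + 51/250 * y * sqrt 2 * (tail1 + tail2) * h))"
  proof -
    define Q where "Q = W * (integral {0..1} (\<lambda>r. exp (B * r - A * r\<^sup>2)) * sqrt 2) + 51/250 * sqrt 2 * (tail1 + tail2)"
    have Q0: "Q \<ge> 0" unfolding Q_def using W0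
      by (intro add_nonneg_nonneg mult_nonneg_nonneg integral_nonneg integrable_continuous_real continuous_intros) (auto simp: tail1_def tail2_def)
    have "(K * (W * integral {0..1} (\<lambda>r. exp (B * r - A * r\<^sup>2))) + K * (102/100) * (tail1 / 5) + K * (102/100) * (tail2 / 5)) * (sqrt 2 * a) = K * a * Q"
      by (simp add: Q_def algebra_simps)
    also have "\<dots> = sqrt 2 powr \<sigma> * (a powr (1 - \<sigma>) * Q)" unfolding Ka by simp
    also have "a powr (1 - \<sigma>) * Q \<le> \<kappa> * (M * (y * h)) * Q" using Q0 by (intro mult_right_mono a_powr_1) auto
    also have "\<kappa> * (M * (y * h)) * Q = \<kappa> * M * (W * (integral {0..1} (\<lambda>r. exp (B * r - A * r\<^sup>2)) * (sqrt 2 * (y * h))) + 51/250 * y * sqrt 2 * (tail1 + tail2) * h)"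
      by (simp add: Q_def algebra_simps)
    also have "\<dots> \<le> \<kappa> * M * (W * G + 51/250 * y * sqrt 2 * (tail1 + tail2) * h)"
      using gG W0 M_pos \<kappa> by (intro mult_left_mono add_right_mono) auto
    finally show ?thesis using main by (simp add: mult_left_mono)
  qed
  have tl: "\<kappa> * (51/250 * y * sqrt 2 * (tail1 + tail2) * h) \<le> 19/100 * h"
  proof -
    have "\<kappa> * (51/250 * y * sqrt 2 * (tail1 + tail2)) \<le> 5/4 * (152/1000)"
      using \<kappa> tails xy by (intro mult_mono) (auto simp: tail1_def tail2_def)
    then have "\<kappa> * (51/250 * y * sqrt 2 * (tail1 + tail2)) * h \<le> 19/100 * h" using h_bounds(1) by (intro mult_right_mono) auto
    then show ?thesis by (simp add: mult.assoc)
  qed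
  \<comment> \<open>For \<delta> = 0 only \<open>\<kappa>\<close> adds, at most h / 8. Otherwise
    \<open>\<kappa>\<close>, exp u and the displaced peak together add at most 44/100 h.\<close>
  have GG: "\<kappa> * G \<le> 1/2 + left_coeff * h"
  proof (cases "\<delta> = 0")
    case True
    then have G: "G = 1/2" by (simp add: G_def B_def)
    have "\<kappa> \<le> (if D < 0 then 1 else 1 + h / 4)" using h_bounds(4) by (simp add: \<kappa>_def)
    moreover have "D \<ge> 0 \<Longrightarrow> 1/8 * h \<le> left_coeff * h" using h_bounds(1) by (intro mult_right_mono) (auto simp: left_coeff_def)
    moreover have "D < 0 \<Longrightarrow> left_coeff * h = 0" by (simp add: left_coeff_def)
    ultimately show ?thesis unfolding G by (cases "D < 0") auto
  next
    case False
    then have c: "\<delta> = D" "D > 0" "f < 2/5" by (auto simp: \<delta>_def split: if_splits)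
    define u where "u = B\<^sup>2 / (4 * A)"
    have "u = pi / 2 * \<delta>\<^sup>2 * (x / y)" using xy by (simp add: u_def A_def B_def power2_eq_square field_simps)
    also have "\<dots> \<le> (63/20) / 2 * (1/4)\<^sup>2 * h"
      using \<delta> pi_lt_63_20 h_bounds(4) xy by (intro mult_mono power_mono) auto
    finally have u1: "u \<le> 985/10000 * h" using h_bounds(1) by (simp add: power2_eq_square)
    have u0: "u \<ge> 0" using A0 by (simp add: u_def)
    have u2: "u \<le> 985/10000" using u1 h_bounds(2) by simp
    have "exp u \<le> 1 + u + u\<^sup>2" using u0 u2 by (intro exp_bound) auto
    also have "u\<^sup>2 \<le> 985/10000 * u" unfolding power2_eq_square using u0 u2 by (intro mult_right_mono) auto
    finally have e: "exp u \<le> 1 + 109/1000 * h" using u1 h_bounds(1) by linarith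
    have "\<delta> / sqrt 2 \<le> (1/4) / (14142/10000)" using \<delta> sqrt2_bounds by (intro frac_le) auto
    then have "\<delta> / sqrt 2 * h \<le> (1/4) / (14142/10000) * h" using h_bounds(1) by (intro mult_right_mono) auto
    then have dh: "\<delta> * h / sqrt 2 \<le> 177/1000 * h" using h_bounds(1) by simp
    have hh: "h * h \<le> h" using h_bounds by (simp add: mult_left_le)
    have "G \<le> (1 + 109/1000 * h) * (1/2 + 177/1000 * h)"
      unfolding G_def u_def[symmetric] using e dh h_bounds(1) \<delta> by (intro mult_mono) auto
    also have "\<dots> = 1/2 + 2315/10000 * h + 19293/1000000 * (h * h)" by (simp add: field_simps)
    also have "\<dots> \<le> 1/2 + 251/1000 * h" using hh h_bounds(1) by linarith
    finally have G1: "G \<le> 1/2 + 251/1000 * h" .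
    have "\<kappa> \<le> 1 + h / 4" using h_bounds(4) h_bounds(1) by (simp add: \<kappa>_def)
    then have "\<kappa> * G \<le> (1 + h / 4) * (1/2 + 251/1000 * h)"
      using G1 h_bounds(1) \<delta> by (intro mult_mono) (auto simp: G_def)
    also have "\<dots> = 1/2 + 376/1000 * h + 251/4000 * (h * h)" by (simp add: field_simps)
    also have "\<dots> \<le> 1/2 + 44/100 * h" using hh h_bounds(1) by linarith
    finally show ?thesis using c by (simp add: left_coeff_def)
  qed
  have "\<kappa> * M * (W * G + 51/250 * y * sqrt 2 * (tail1 + tail2) * h) = M * (W * (\<kappa> * G) + \<kappa> * (51/250 * y * sqrt 2 * (tail1 + tail2) * h))"
    by (simp add: algebra_simps)
  also have "\<dots> \<le> M * (W * (1/2 + left_coeff * h) + 19/100 * h)"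
    using GG tl W0 M_pos by (intro mult_left_mono add_mono) auto
  finally have "sqrt 2 powr \<sigma> * (\<kappa> * M * (W * G + 51/250 * y * sqrt 2 * (tail1 + tail2) * h)) \<le> sqrt 2 powr \<sigma> * (M * (W * (1/2 + left_coeff * h) + 19/100 * h))"
    by (rule mult_left_mono) simp
  from order_trans[OF main2 this] show ?thesis by (simp only: F_def W_def mult.assoc)
qed

end

section \<open>The ray above the real axis\<close>

lemma has_integral_exp_neg:
  fixes c :: real
  assumes "c > 0" "u \<le> v"
  shows "((\<lambda>q. exp (- c * q)) has_integral (exp (- c * u) - exp (- c * v)) / c) {u..v}"
proof -
  have "((\<lambda>q. exp (- c * q)) has_integral (- (exp (- c * v) / c) - (- (exp (- c * u) / c)))) {u..v}"
    using assms by (intro fundamental_theorem_of_calculus)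
      (auto intro!: derivative_eq_intros simp flip: has_real_derivative_iff_has_vector_derivative)
  then show ?thesis by (simp add: diff_divide_distrib)
qed

context critical
begin

definition right_coeff :: real where
  "right_coeff = (if D < 0 then 631/1000 else 45/100)"

lemma t_pos: "t > 0" using t_ge pi_gt_zero by linarith

text \<open>The factor x - f + 1 is m + 1: \<open>kerm\<close> contributes m, and the kernel itself
  one more exp (- 2 pi a q).\<close>

lemma norm_integrand_right:
  assumes q: "q \<ge> 0"
  shows "norm (P (of_real a * Complex (1 + q) q) * kerm 1 m (of_real a * Complex (1 + q) q))
     \<le> a powr (- \<sigma>) * (Wr \<alpha> * exp (t * arctan (q / (1 + q)) - 2 * pi * ((x - f + 1) * (a * q))))"
proof -
  define w where "w = Complex (1 + q) q"
  have "1 \<le> norm w" using q abs_Re_le_cmod[of w] by (simp add: w_def)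
  then have "norm (P (of_real a * w)) \<le> 1 powr (- \<sigma>) * a powr (- \<sigma>) * exp (t * Arg w)" by (intro norm_P_scaled) auto
  then have 1: "norm (P (of_real a * w)) \<le> a powr (- \<sigma>) * exp (t * arctan (q / (1 + q)))"
    using Arg_upper[OF q] by (simp add: w_def)
  have "norm (kerm 1 m (of_real a * w)) = exp (- (2 * pi * ((x - f) * (a * q)))) * norm (ker 1 (of_real a * w))"
    unfolding norm_kerm m_eq by (simp add: w_def mult_ac)
  also have "\<dots> \<le> exp (- (2 * pi * ((x - f) * (a * q)))) * (Wr \<alpha> * exp (- (2 * pi * a * q)))"
    unfolding w_def by (intro mult_left_mono ker_right[OF \<alpha> a_eq q]) auto
  also have "\<dots> = Wr \<alpha> * exp (- (2 * pi * ((x - f + 1) * (a * q))))" by (simp add: algebra_simps flip: exp_add)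
  finally have 2: "norm (kerm 1 m (of_real a * w)) \<le> Wr \<alpha> * exp (- (2 * pi * ((x - f + 1) * (a * q))))" .
  have "norm (P (of_real a * w)) * norm (kerm 1 m (of_real a * w))
     \<le> (a powr (- \<sigma>) * exp (t * arctan (q / (1 + q)))) * (Wr \<alpha> * exp (- (2 * pi * ((x - f + 1) * (a * q)))))"
    by (intro mult_mono 1 2) auto
  also have "\<dots> = a powr (- \<sigma>) * (Wr \<alpha> * exp (t * arctan (q / (1 + q)) - 2 * pi * ((x - f + 1) * (a * q))))"
  proof -
    have "exp (X - Y) = exp X * exp (- Y)" for X Y :: real by (simp add: exp_diff exp_minus divide_inverse)
    then show ?thesis by (simp only: mult_ac)
  qed
  finally show ?thesis by (simp add: norm_mult w_def)
qed

lemma Wr_pos: "0 < Wr \<alpha>" and Wl_pos: "0 < Wl \<alpha>" by (simp_all add: Wr_def Wl_def)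

lemma right_path:
  assumes I: "(b has_integral I) {0..\<beta>}" and \<beta>: "\<beta> > 0" and T: "T = \<beta> * a"
    and b: "\<And>q. 0 \<le> q \<Longrightarrow> q \<le> \<beta> \<Longrightarrow> exp (t * arctan (q / (1 + q)) - 2 * pi * ((x - f + 1) * (a * q))) \<le> b q"
  shows "norm (cint (of_real a) (of_real a + of_real T * (1 + \<i>)) (\<lambda>z. P z * kerm 1 m z)) \<le> a powr (- \<sigma>) * (Wr \<alpha> * I) * (sqrt 2 * a)"
proof -
  define d where "d = of_real a * (1 + \<i>)"
  have path: "of_real a + of_real q * d = of_real a * Complex (1 + q) q" for q
    by (simp add: d_def complex_eq_iff algebra_simps)
  have "norm (cint (of_real a + of_real 0 * d) (of_real a + of_real \<beta> * d) (\<lambda>z. P z * kerm 1 m z)) \<le> (a powr (- \<sigma>) * (Wr \<alpha> * I)) * norm d"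
  proof (rule norm_cint_ray_le[where b = "\<lambda>q. a powr (- \<sigma>) * (Wr \<alpha> * b q)"])
    show "norm (P (of_real a + of_real q * d) * kerm 1 m (of_real a + of_real q * d)) \<le> a powr (- \<sigma>) * (Wr \<alpha> * b q)"
      if q: "0 \<le> q" "q \<le> \<beta>" for q
      unfolding path using b[OF q] Wr_pos by (intro order_trans[OF norm_integrand_right[OF q(1)]] mult_left_mono) auto
    show "((\<lambda>q. a powr (- \<sigma>) * (Wr \<alpha> * b q)) has_integral a powr (- \<sigma>) * (Wr \<alpha> * I)) {0..\<beta>}"
      by (intro has_integral_mult_right I)
  qed (use \<beta> in auto)
  moreover have "norm (1 + \<i>) = sqrt 2" by (simp add: cmod_def)
  then have "norm d = sqrt 2 * a" using a_bounds(1) by (simp add: d_def norm_mult)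
  moreover have "of_real a + of_real \<beta> * d = of_real a + of_real T * (1 + \<i>)" by (simp add: d_def T mult_ac)
  ultimately show ?thesis by simp
qed

text \<open>While f < 2/5 the rate 2 pi (x D + (1 - f) a) is positive even for negative D, so arctan
  (q / (1 + q)) \<le> q suffices and the arm contributes only O(h). The number 2253/10000 rounds up
  sqrt 2 / (2 pi).\<close>

lemma right_bound_small:
  assumes f: "f < 2/5" and T: "T > 0"
  shows "norm (cint (of_real a) (of_real a + of_real T * (1 + \<i>)) (\<lambda>z. P z * kerm 1 m z))
     \<le> sqrt 2 powr \<sigma> * M * (Wr \<alpha> * (2253/10000 * (if D < 0 then 1 / (7/10 - f) else 1 + 2 * f) * h))"
proof -
  define c where "c = 2 * pi * (x * D + (1 - f) * a)"
  define g where "g = (1 - f) + x * D / a"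
  have a0: "a > 0" using a_bounds by linarith
  have cg: "c = 2 * pi * (a * g)" using a0 by (simp add: c_def g_def field_simps)
  have g: "g > 0" "1 / g \<le> (if D < 0 then 1 / (7/10 - f) else 1 + 2 * f)"
  proof -
    have "g > 0 \<and> 1 / g \<le> (if D < 0 then 1 / (7/10 - f) else 1 + 2 * f)"
    proof (cases "D < 0")
      case True
      \<comment> \<open>This is where 7/10 comes from: x \<le> y \<le> 6/5 a and - D \<le> 1/4 cost
        at most 3/10 of the rate.\<close>
      have "x * (- D) \<le> (6/5 * a) * (1/4)" using xy a_bounds(4) D_bounds True by (intro mult_mono) auto
      then have "x * D / a \<ge> - (3/10)" using a0 by (simp add: field_simps)
      then have "g \<ge> 7/10 - f" unfolding g_def by linarith
      moreover have "7/10 - f > 0" using f by simp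
      ultimately show ?thesis using True by (auto intro!: divide_left_mono mult_pos_pos)
    next
      case False
      then have "x * D / a \<ge> 0" using a0 xy by simp
      then have g1: "g \<ge> 1 - f" by (simp add: g_def)
      have "1 - f > 0" using f by simp
      then have "1 / g \<le> 1 / (1 - f)" using g1 by (intro divide_left_mono mult_pos_pos) auto
      also have "1 / (1 - f) \<le> 1 + 2 * f"
      proof -
        have "0 \<le> f * (1 - 2 * f)" using f_bounds f by simp
        then show ?thesis using \<open>1 - f > 0\<close> by (simp add: pos_divide_le_eq algebra_simps)
      qed
      finally show ?thesis using False g1 \<open>1 - f > 0\<close> by auto
    qed
    then show "g > 0" "1 / g \<le> (if D < 0 then 1 / (7/10 - f) else 1 + 2 * f)" by auto
  qed
  have c0: "c > 0" using g a0 by (simp add: cg)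
  have "norm (cint (of_real a) (of_real a + of_real T * (1 + \<i>)) (\<lambda>z. P z * kerm 1 m z))
      \<le> a powr (- \<sigma>) * (Wr \<alpha> * ((exp (- c * 0) - exp (- c * (T / a))) / c)) * (sqrt 2 * a)"
  proof (rule right_path[OF has_integral_exp_neg[OF c0]])
    fix q assume q: "0 \<le> q" "q \<le> T / a"
    have "t * arctan (q / (1 + q)) \<le> t * q" using angle_right(1)[OF q(1)] t_pos by (intro mult_left_mono) auto
    also have "t * q - 2 * pi * ((x - f + 1) * (a * q)) = - c * q"
      unfolding t c_def D_def by (simp add: algebra_simps)
    finally show "exp (t * arctan (q / (1 + q)) - 2 * pi * ((x - f + 1) * (a * q))) \<le> exp (- c * q)" by simp
  qed (use T a0 in auto)
  also have "\<dots> \<le> a powr (- \<sigma>) * (Wr \<alpha> * (1 / c)) * (sqrt 2 * a)"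
    using c0 a0 Wr_pos by (intro mult_right_mono mult_left_mono divide_right_mono) auto
  also have "\<dots> = a powr (- \<sigma>) * (Wr \<alpha> * (sqrt 2 / (2 * pi) * (1 / g)))"
    using a0 g by (simp add: cg field_simps)
  also have "\<dots> \<le> (sqrt 2 powr \<sigma> * (M * h)) * (Wr \<alpha> * (2253/10000 * (if D < 0 then 1 / (7/10 - f) else 1 + 2 * f)))"
  proof (intro mult_mono mult_left_mono a_powr_0)
    have "sqrt 2 / (2 * pi) \<le> (14143/10000) / (2 * (314/100))"
      using sqrt2_bounds pi_gt_157_50 by (intro frac_le) auto
    also have "\<dots> \<le> 2253/10000" by simp
    finally show "sqrt 2 / (2 * pi) \<le> 2253/10000" .
    show "1 / g \<le> (if D < 0 then 1 / (7/10 - f) else 1 + 2 * f)" by (rule g(2))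
  qed (use g Wr_pos M_pos h_bounds in auto)
  finally show ?thesis by (simp add: mult_ac)
qed

text \<open>For f near 1 linear decay may be lost, so the quadratic term of the argument is used: at
  least 7/10 q^2 on q \<le> 9/20, hence A is 7/10 of 2 pi x y, and a linear bound beyond. The half
  Gaussian is then sqrt (2 / 1.4) / 2 < 0.5977, no longer of order h.\<close>

lemma right_bound_large:
  assumes f: "f \<ge> 2/5" and T: "T > a"
  shows "norm (cint (of_real a) (of_real a + of_real T * (1 + \<i>)) (\<lambda>z. P z * kerm 1 m z))
     \<le> sqrt 2 powr \<sigma> * M * (Wr \<alpha> * (598/1000 + right_coeff * h))"
proof -
  have a0: "a > 0" using a_bounds by linarith
  define \<delta> where "\<delta> = max 0 (- D)"
  define A where "A = 14/10 * pi * x * y"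
  define B where "B = 2 * pi * x * \<delta>"
  \<comment> \<open>Beyond 9/20, with a \<ge> 8/10 y, the slope left is 8/10 - 434/1000 = 366/1000,
    and the gap at 9/20 is 8/10 times 9/20 minus 309/1000 = 51/1000.\<close>
  define c where "c = 2 * pi * x * (366/1000 * y)"
  define k where "k = 2 * pi * x * (51/1000 * y)"
  define \<beta> where "\<beta> = T / a"
  have \<delta>: "0 \<le> \<delta>" "\<delta> \<le> 1/4" using D_bounds by (auto simp: \<delta>_def)
  have A0: "A > 0" using xy by (simp add: A_def)
  have B0: "B \<ge> 0" using xy \<delta> by (simp add: B_def)
  have c0: "c > 0" using xy by (simp add: c_def)
  have \<beta>: "\<beta> > 1" using T a0 by (simp add: \<beta>_def)
  have a8: "a \<ge> 8/10 * y" 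
  proof (cases "D < 0")
    case True
    then have "a \<ge> 5/4" "y = a - D" using a_bounds by auto
    then show ?thesis using D_bounds by simp
  qed (use a_bounds xy in simp)
  have f1: "0 \<le> 1 - f" using f_bounds by simp
  define g2 where "g2 q = exp (- k - c * (q - 9/20))" for q
  define I where "I = integral {0..\<beta>} (\<lambda>q. exp (B * q - A * q\<^sup>2)) + exp (- k) / c"
  define I2 where "I2 = exp (- k + c * (9/20)) * ((exp (- c * (9/20)) - exp (- c * \<beta>)) / c)"
  have base: "t * arctan (q / (1 + q)) - 2 * pi * ((x - f + 1) * (a * q)) \<le> 2 * pi * x * (y * u - a * q)"
    if "0 \<le> q" "arctan (q / (1 + q)) \<le> u" for q u
  proof -
    have "t * arctan (q / (1 + q)) \<le> t * u" using that t_pos by (intro mult_left_mono) auto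
    moreover have "0 \<le> 2 * pi * ((1 - f) * (a * q))" using f1 a0 that by simp
    moreover have "2 * pi * x * (y * u - a * q) - (t * u - 2 * pi * ((x - f + 1) * (a * q))) = 2 * pi * ((1 - f) * (a * q))"
      unfolding t by (simp add: algebra_simps)
    ultimately show ?thesis by linarith
  qed
  have "norm (cint (of_real a) (of_real a + of_real T * (1 + \<i>)) (\<lambda>z. P z * kerm 1 m z))
      \<le> a powr (- \<sigma>) * (Wr \<alpha> * (integral {0..\<beta>} (\<lambda>q. exp (B * q - A * q\<^sup>2)) + I2)) * (sqrt 2 * a)"
  proof (rule right_path[where \<beta> = \<beta> and b = "\<lambda>q. exp (B * q - A * q\<^sup>2) + (if q \<in> cbox (9/20) \<beta> then g2 q else 0)"])
    have "((\<lambda>q. exp (- k + c * (9/20)) * exp (- c * q)) has_integral I2) {9/20..\<beta>}"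
      unfolding I2_def using \<beta> by (intro has_integral_mult_right has_integral_exp_neg c0) auto
    moreover have "(\<lambda>q. exp (- k + c * (9/20)) * exp (- c * q)) = g2"
      by (auto simp: g2_def fun_eq_iff algebra_simps simp flip: exp_add)
    ultimately have "(g2 has_integral I2) (cbox (9/20) \<beta>)" by simp
    then have "((\<lambda>q. if q \<in> cbox (9/20) \<beta> then g2 q else 0) has_integral I2) (cbox 0 \<beta>)"
      by (rule has_integral_restrict_closed_subinterval) (use \<beta> in auto)
    then show "((\<lambda>q. exp (B * q - A * q\<^sup>2) + (if q \<in> cbox (9/20) \<beta> then g2 q else 0)) has_integral
         integral {0..\<beta>} (\<lambda>q. exp (B * q - A * q\<^sup>2)) + I2) {0..\<beta>}"
      by (intro has_integral_add integrable_integral integrable_continuous_real continuous_intros) simp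
  next
    fix q :: real assume q: "0 \<le> q" "q \<le> \<beta>"
    show "exp (t * arctan (q / (1 + q)) - 2 * pi * ((x - f + 1) * (a * q))) \<le> exp (B * q - A * q\<^sup>2) + (if q \<in> cbox (9/20) \<beta> then g2 q else 0)"
    proof (cases "q \<le> 9/20")
      case True
      have "q * q^2 \<le> 9/20 * q^2" using True by (intro mult_right_mono) auto
      then have "q - q^2 + 2/3 * q^3 \<le> q - 7/10 * q^2" by (simp add: power3_eq_cube power2_eq_square)
      then have "arctan (q / (1 + q)) \<le> q - 7/10 * q^2" using angle_right(2)[OF q(1)] by linarith
      from base[OF q(1) this]
      have "t * arctan (q / (1 + q)) - 2 * pi * ((x - f + 1) * (a * q)) \<le> 2 * pi * x * (- D * q) - A * q^2"
        unfolding a_bounds(5) A_def by (simp add: algebra_simps)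
      also have "2 * pi * x * (- D * q) \<le> 2 * pi * x * (\<delta> * q)"
        using xy q by (intro mult_left_mono mult_right_mono) (auto simp: \<delta>_def)
      finally have "exp (t * arctan (q / (1 + q)) - 2 * pi * ((x - f + 1) * (a * q))) \<le> exp (B * q - A * q\<^sup>2)" by (simp add: B_def mult_ac)
      then show ?thesis by (simp add: g2_def add_increasing2)
    next
      case False
      then have q9: "9/20 \<le> q" by simp
      have "y * (309/1000 + 434/1000 * (q - 9/20)) - a * q \<le> y * (309/1000 + 434/1000 * (q - 9/20)) - 8/10 * y * q"
        using mult_right_mono[OF a8 q(1)] by linarith
      also have "\<dots> = - (51/1000 * y) - 366/1000 * y * (q - 9/20)" by (simp add: field_simps)
      finally have "2 * pi * x * (y * (309/1000 + 434/1000 * (q - 9/20)) - a * q) \<le> 2 * pi * x * (- (51/1000 * y) - 366/1000 * y * (q - 9/20))"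
        using xy by (intro mult_left_mono) auto
      also have "\<dots> = - k - c * (q - 9/20)" by (simp add: k_def c_def field_simps)
      finally have "t * arctan (q / (1 + q)) - 2 * pi * ((x - f + 1) * (a * q)) \<le> - k - c * (q - 9/20)"
        using base[OF q(1) angle_right(3)[OF q(1) q9]] by linarith
      then show ?thesis using q9 q by (simp add: g2_def add_increasing)
    qed
  qed (use \<beta> a0 in \<open>auto simp: \<beta>_def\<close>)
  also have "\<dots> \<le> a powr (- \<sigma>) * (Wr \<alpha> * I) * (sqrt 2 * a)"
  proof (intro mult_right_mono mult_left_mono)
    have "I2 \<le> exp (- k + c * (9/20)) * (exp (- c * (9/20)) / c)" unfolding I2_def using c0 by (intro mult_left_mono divide_right_mono) auto
    also have "\<dots> = exp (- k) / c" by (simp flip: exp_add)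
    finally show "integral {0..\<beta>} (\<lambda>q. exp (B * q - A * q\<^sup>2)) + I2 \<le> I" by (simp add: I_def)
  qed (use Wr_pos a0 in auto)
  also have "\<dots> = a powr (1 - \<sigma>) * (Wr \<alpha> * (I * sqrt 2))" using a0 by (simp add: powr_diff powr_minus field_simps)
  also have "\<dots> \<le> \<kappa> * (M * (y * h)) * (Wr \<alpha> * (I * sqrt 2))"
  proof (intro mult_right_mono a_powr_1)
    have "0 \<le> integral {0..\<beta>} (\<lambda>q. exp (B * q - A * q\<^sup>2))"
      by (intro integral_nonneg integrable_continuous_real continuous_intros) auto
    then show "0 \<le> Wr \<alpha> * (I * sqrt 2)" using Wr_pos c0 by (simp add: I_def)
  qed
  also have "\<dots> = M * (Wr \<alpha> * (\<kappa> * (I * (sqrt 2 * (y * h)))))" by simp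
  finally have main: "norm (cint (of_real a) (of_real a + of_real T * (1 + \<i>)) (\<lambda>z. P z * kerm 1 m z)) \<le> M * (Wr \<alpha> * (\<kappa> * (I * (sqrt 2 * (y * h)))))" .
  have yh: "y * h > 0" using xy h_bounds by simp
  have hh: "h * h \<le> h" using h_bounds by (simp add: mult_left_le)
  define u where "u = B\<^sup>2 / (4 * A)"
  have u: "u \<le> 1411/10000 * h"
  proof -
    have "u = pi / (14/10) * \<delta>\<^sup>2 * (x / y)" using xy by (simp add: u_def A_def B_def power2_eq_square field_simps)
    also have "\<dots> \<le> (63/20) / (14/10) * (1/4)\<^sup>2 * h"
      using \<delta> pi_lt_63_20 h_bounds(4) xy by (intro mult_mono power_mono divide_right_mono) auto
    finally show ?thesis using h_bounds(1) by (simp add: power2_eq_square)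
  qed
  have u0: "u \<ge> 0" using A0 by (simp add: u_def)
  have e: "exp u \<le> 1 + 162/1000 * h"
  proof -
    have u2: "u \<le> 1411/10000" using u h_bounds(2) by simp
    have "exp u \<le> 1 + u + u\<^sup>2" using u0 u2 by (intro exp_bound) auto
    also have "u\<^sup>2 \<le> 1411/10000 * u" unfolding power2_eq_square using u0 u2 by (intro mult_right_mono) auto
    finally show ?thesis using u h_bounds(1) by linarith
  qed
  have gauss: "integral {0..\<beta>} (\<lambda>q. exp (B * q - A * q\<^sup>2)) * (sqrt 2 * (y * h)) \<le> exp u * (5977/10000 + sqrt 2 * (\<delta> / (14/10)) * h)"
  proof -
    have "integral {0..\<beta>} (\<lambda>q. exp (B * q - A * q\<^sup>2)) * (sqrt 2 * (y * h)) \<le> exp u * (sqrt (pi / A) / 2 + B / (2 * A)) * (sqrt 2 * (y * h))"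
      unfolding u_def using yh \<beta> by (intro mult_right_mono gaussian_linear_le A0 B0) auto
    also have "\<dots> = exp u * (sqrt (pi / A) * (sqrt 2 * (y * h)) / 2 + B / (2 * A) * (sqrt 2 * (y * h)))" by (simp add: algebra_simps)
    also have "\<dots> \<le> exp u * (5977/10000 + sqrt 2 * (\<delta> / (14/10)) * h)"
    proof (intro mult_left_mono add_mono)
      have "pi / A = 1 / (14/10) * (1 / (x * y))" using xy by (simp add: A_def field_simps)
      then have "sqrt (pi / A) = sqrt (1 / (14/10)) * (1 / sqrt (x * y))"
        by (simp only: real_sqrt_mult[of "1 / (14/10)"] real_sqrt_divide[of 1 "x * y"] real_sqrt_one)
      then have "sqrt (pi / A) * (y * h) = sqrt (1 / (14/10)) * (1 / (y * h) * (y * h))" unfolding h_bounds(5) by (simp only: mult.assoc)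
      moreover have "1 / (y * h) * (y * h) = 1" using xy h_bounds(1) by simp
      ultimately have "sqrt (pi / A) * (y * h) = sqrt (1 / (14/10))" by (simp only: mult_1_right)
      then have "sqrt (pi / A) * (sqrt 2 * (y * h)) = sqrt (1 / (14/10)) * sqrt 2" by (metis mult.left_commute mult.commute)
      also have "\<dots> = sqrt (2 / (14/10))" by (simp flip: real_sqrt_mult)
      also have "\<dots> \<le> 11954/10000" by (rule real_le_lsqrt) (simp_all add: power2_eq_square)
      finally show "sqrt (pi / A) * (sqrt 2 * (y * h)) / 2 \<le> 5977/10000" by linarith
      show "B / (2 * A) * (sqrt 2 * (y * h)) \<le> sqrt 2 * (\<delta> / (14/10)) * h"
        using xy by (simp add: A_def B_def field_simps)
    qed auto
    finally show ?thesis .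
  qed
  have tail: "exp (- k) / c * (sqrt 2 * (y * h)) \<le> 24/100 * h"
  proof -
    \<comment> \<open>The floor of x is at least 1, so f \<ge> 2/5 forces x \<ge> 7/5; this makes k
      large enough.\<close>
    have "f \<le> x - 1" using xy f_def by (metis frac_def diff_mono floor_mono le_diff_eq m_eq m_pos of_nat_1 of_nat_le_iff add.commute le_diff_eq real_of_nat_ge_one_iff)
    then have x14: "x \<ge> 14/10" using f by simp
    then have y14: "y \<ge> 14/10" using xy by simp
    have "14/10 * (14/10) \<le> x * y" using x14 y14 by (intro mult_mono) auto
    then have "51/1000 * (14/10 * (14/10)) \<le> 51/1000 * (x * y)" by simp
    moreover have "2 * (157/50) \<le> 2 * pi" using pi_gt_157_50 by simp
    ultimately have "2 * (157/50) * (51/1000 * (14/10 * (14/10))) \<le> 2 * pi * (51/1000 * (x * y))"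
      using mult_mono[of "2 * (157/50)" "2 * pi" "51/1000 * (14/10 * (14/10))" "51/1000 * (x * y)"] by simp
    then have k: "627/1000 \<le> k" by (simp add: k_def algebra_simps)
    have "exp (627/1000 :: real) \<ge> 1864/1000" using exp_ge_cubic[of "627/1000"] by (simp add: numeral_eq_Suc)
    from exp_neg_le[OF this k] have ek: "exp (- k) \<le> 537/1000" by simp
    have "exp (- k) / c * (sqrt 2 * (y * h)) = exp (- k) * (sqrt 2 / (2 * pi * x * (366/1000))) * h"
      using xy by (simp add: c_def field_simps)
    also have "\<dots> \<le> 537/1000 * ((14143/10000) / (2 * (157/50) * (14/10) * (366/1000))) * h"
      using ek sqrt2_bounds pi_gt_157_50 x14 h_bounds(1)
      by (intro mult_right_mono mult_mono frac_le) (auto intro!: mult_mono)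
    also have "\<dots> \<le> 24/100 * h" using h_bounds(1) by (intro mult_right_mono) auto
    finally show ?thesis .
  qed
  have "\<kappa> * (I * (sqrt 2 * (y * h))) \<le> 598/1000 + right_coeff * h"
  proof (cases "D < 0")
    case True
    have "sqrt 2 * (\<delta> / (14/10)) \<le> 14143/10000 * ((1/4) / (14/10))" using sqrt2_bounds \<delta> by (intro mult_mono divide_right_mono) auto
    then have "sqrt 2 * (\<delta> / (14/10)) * h \<le> 14143/10000 * ((1/4) / (14/10)) * h" using h_bounds(1) by (intro mult_right_mono) auto
    also have "\<dots> \<le> 2526/10000 * h" using h_bounds(1) by simp
    finally have "5977/10000 + sqrt 2 * (\<delta> / (14/10)) * h \<le> 5977/10000 + 2526/10000 * h" by simp
    then have "exp u * (5977/10000 + sqrt 2 * (\<delta> / (14/10)) * h) \<le> (1 + 162/1000 * h) * (5977/10000 + 2526/10000 * h)"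
      using e h_bounds(1) \<delta> by (intro mult_mono) auto
    also have "\<dots> = 5977/10000 + 1747137/5000000 * h + 102303/2500000 * (h * h)" by (simp add: field_simps)
    also have "\<dots> \<le> 598/1000 + 391/1000 * h" using hh h_bounds(1) by linarith
    finally have "I * (sqrt 2 * (y * h)) \<le> 598/1000 + 631/1000 * h" using gauss tail by (simp add: I_def algebra_simps)
    then show ?thesis using True by (simp add: \<kappa>_def right_coeff_def)
  next
    case False
    then have z: "\<delta> = 0" "u = 0" by (auto simp: \<delta>_def u_def B_def)
    then have J: "I * (sqrt 2 * (y * h)) \<le> 5977/10000 + 24/100 * h" using gauss tail by (simp add: I_def algebra_simps)
    have "0 \<le> I" unfolding I_def using c0
      by (intro add_nonneg_nonneg integral_nonneg integrable_continuous_real continuous_intros) auto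
    then have IY: "0 \<le> I * (sqrt 2 * (y * h))" using xy h_bounds(1) by (intro mult_nonneg_nonneg) auto
    have "\<kappa> \<le> 1 + h / 4" using h_bounds(4) False by (simp add: \<kappa>_def)
    then have "\<kappa> * (I * (sqrt 2 * (y * h))) \<le> (1 + h / 4) * (5977/10000 + 24/100 * h)"
      using J h_bounds(1) \<kappa> IY by (intro mult_mono) auto
    also have "\<dots> = 5977/10000 + 15577/40000 * h + 3/50 * (h * h)" by (simp add: field_simps)
    also have "\<dots> \<le> 598/1000 + 45/100 * h" using hh h_bounds(1) by linarith
    finally show ?thesis using False by (simp add: right_coeff_def)
  qed
  then have "M * (Wr \<alpha> * (\<kappa> * (I * (sqrt 2 * (y * h))))) \<le> M * (Wr \<alpha> * (598/1000 + right_coeff * h))"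
    using M_pos Wr_pos by (intro mult_left_mono) auto
  moreover have "1 * (M * (Wr \<alpha> * (598/1000 + right_coeff * h))) \<le> sqrt 2 powr \<sigma> * (M * (Wr \<alpha> * (598/1000 + right_coeff * h)))"
    using M_pos Wr_pos h_bounds sig by (intro mult_right_mono) (auto simp: right_coeff_def ge_one_powr_ge_zero)
  ultimately show ?thesis using main by (simp add: mult_ac)
qed

end

section \<open>The imaginary axis\<close>

lemma cosh_sum_le:
  fixes E :: real assumes "E \<ge> 202"
  shows "(\<Sum>k=1..m. E ^ k + (1 / E) ^ k) \<le> 101/100 * E ^ m"
proof (induction m)
  case (Suc m)
  have 1: "(1 / E) ^ Suc m \<le> 1" using assms by (intro power_le_one) auto
  have 2: "E ^ m \<ge> 1" using assms by (intro one_le_power) auto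
  have "202 * E ^ m \<le> E * E ^ m" using assms 2 by (intro mult_right_mono) auto
  then have 3: "202 * E ^ m \<le> E ^ Suc m" by simp
  have "(\<Sum>k=1..Suc m. E ^ k + (1 / E) ^ k) = (\<Sum>k=1..m. E ^ k + (1 / E) ^ k) + (E ^ Suc m + (1 / E) ^ Suc m)" by simp
  then show ?case using Suc.IH 1 2 3 by linarith
qed simp

context critical
begin

text \<open>The value of \<open>geo 1 m z + geo (-1) m z\<close> at z = - i v, a sum of terms 2 cosh
  (2 pi k v).\<close>

definition H :: "real \<Rightarrow> real" where "H v = (\<Sum>k=1..m. exp (2 * pi * real k * v) + exp (- (2 * pi * real k * v)))"

text \<open>Since a is at least 5/4, exp (2 pi a) exceeds 202 and the term k = m dominates the
  sum.\<close>

lemma H_a: "1 + 2 * H a \<le> 203/100 * exp (2 * pi * real m * a)" and E_a: "exp (2 * pi * a) \<ge> 202"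
proof -
  define E where "E = exp (2 * pi * a)"
  have "exp (785/100 :: real) \<ge> 202" using exp_ge_quartic[of "785/100"] by (simp add: numeral_eq_Suc)
  moreover have "785/100 \<le> 2 * pi * a"
  proof -
    have "2 * (157/50) * (5/4) \<le> 2 * pi * a" using a_bounds(1) pi_gt_157_50 by (intro mult_mono) auto
    then show ?thesis by simp
  qed
  ultimately have "exp (2 * pi * a) \<ge> 202" using exp_le_cancel_iff order_trans by blast
  then show E: "exp (2 * pi * a) \<ge> 202" .
  have "H a = (\<Sum>k=1..m. E ^ k + (1 / E) ^ k)"
    unfolding H_def E_def by (intro sum.cong refl) (simp add: exp_of_nat_mult[symmetric] power_divide exp_minus inverse_eq_divide mult_ac)
  also have "\<dots> \<le> 101/100 * E ^ m" using E by (intro cosh_sum_le) (simp add: E_def)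
  finally have "H a \<le> 101/100 * E ^ m" .
  moreover have E1: "E \<ge> 202" using E by (simp only: E_def)
  moreover have "E \<le> E ^ m" using power_increasing[of 1 m E] m_pos E1 by simp
  moreover have "E ^ m = exp (2 * pi * real m * a)" by (simp add: E_def exp_of_nat_mult[symmetric] mult_ac)
  ultimately show "1 + 2 * H a \<le> 203/100 * exp (2 * pi * real m * a)" by linarith
qed

lemma Arg_ax: "v > 0 \<Longrightarrow> Arg (ax (-1) v) = - pi / 2"
  using Arg_times_of_real[of v "- \<i>"] by (simp add: Arg_minus_ii)

text \<open>Integration by parts against the antiderivative Q of the power: Q gains a factor 1 / t,
  and its value at - i a meets the elementary term. H is increasing on the segment, so its variation
  is H a - H \<epsilon>, and the contributions add up to C (1 + 2 H a), free of \<epsilon>.\<close>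

lemma middle_bound:
  assumes e: "0 < \<epsilon>" "\<epsilon> < a"
  shows "norm (ax (-1) a powr (1 - Complex \<sigma> t) / (Complex \<sigma> t - 1)
     + cint (ax (-1) a) (ax (-1) \<epsilon>) (\<lambda>z. P z * (geo 1 m z + geo (-1) m z))) \<le> M * (58/1000 * h)"
proof -
  define s where "s = Complex \<sigma> t"
  define Q where "Q z = z powr (1 - s) / (1 - s)" for z
  define S where "S z = geo 1 m z + geo (-1) m z" for z
  define S' where "S' z = (\<Sum>k=1..m. \<i> * of_real (2 * pi * real k) * (exp (\<i> * of_real (2 * pi * real k * 1) * z) - exp (\<i> * of_real (2 * pi * real k * (-1)) * z)))" for z
  define C where "C = a powr (1 - \<sigma>) * exp (- (pi / 2) * t) / t"
  have t0: "t > 0" using t_ge pi_gt_zero by linarith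
  have a0: "a > 0" using e by simp
  have s1: "s \<noteq> 1" "1 - s \<noteq> 0" using t0 by (auto simp: s_def complex_eq_iff)
  have ns: "norm (1 - s) \<ge> t" using abs_Im_le_cmod[of "1 - s"] t0 by (simp add: s_def)
  define U where "U = {z :: complex. Re z > 0} \<union> {z. Re z = 0 \<and> -1 * Im z > 0}"
  have dS: "(S has_field_derivative S' z) (at z within X)" for z X
    unfolding S_def S'_def geo_def
    by (auto intro!: derivative_eq_intros simp: sum.distrib[symmetric] algebra_simps sum_distrib_left sum_subtractf)
  have seg: "closed_segment (ax (-1) a) (ax (-1) \<epsilon>) \<subseteq> U"
    unfolding U_def by (intro closed_segment_subset convex_right_axis) (use e a0 in auto)
  have Un: "z \<notin> \<real>\<^sub>\<le>\<^sub>0" if "z \<in> U" for z using that by (auto simp: U_def complex_nonpos_Reals_iff)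
  have dQ: "(Q has_field_derivative P z) (at z within X)" if "z \<in> U" for z X
    using powr_primitive[OF s1(1) Un[OF that]] has_field_derivative_at_within unfolding Q_def[abs_def] P_def s_def by blast
  have cS': "continuous_on X S'" for X unfolding S'_def by (intro continuous_intros)
  have cQ: "continuous_on (closed_segment (ax (-1) a) (ax (-1) \<epsilon>)) Q"
    using seg dQ by (meson DERIV_continuous_on subsetD)
  have "((\<lambda>z. P z * S z + Q z * S' z) has_contour_integral
      (Q (pathfinish (linepath (ax (-1) a) (ax (-1) \<epsilon>))) * S (pathfinish (linepath (ax (-1) a) (ax (-1) \<epsilon>)))
      - Q (pathstart (linepath (ax (-1) a) (ax (-1) \<epsilon>))) * S (pathstart (linepath (ax (-1) a) (ax (-1) \<epsilon>))))) (linepath (ax (-1) a) (ax (-1) \<epsilon>))"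
    by (rule contour_integral_primitive[where S = "closed_segment (ax (-1) a) (ax (-1) \<epsilon>)"])
       (use seg in \<open>auto intro!: derivative_eq_intros dQ dS\<close>)
  then have 1: "((\<lambda>z. P z * S z + Q z * S' z) has_contour_integral (Q (ax (-1) \<epsilon>) * S (ax (-1) \<epsilon>) - Q (ax (-1) a) * S (ax (-1) a))) (linepath (ax (-1) a) (ax (-1) \<epsilon>))"
    by simp
  have 2: "((\<lambda>z. Q z * S' z) has_contour_integral cint (ax (-1) a) (ax (-1) \<epsilon>) (\<lambda>z. Q z * S' z)) (linepath (ax (-1) a) (ax (-1) \<epsilon>))"
    by (intro has_contour_integral_integral contour_integrable_continuous_linepath continuous_intros cQ cS')
  have "((\<lambda>z. P z * S z) has_contour_integral (Q (ax (-1) \<epsilon>) * S (ax (-1) \<epsilon>) - Q (ax (-1) a) * S (ax (-1) a)) - cint (ax (-1) a) (ax (-1) \<epsilon>) (\<lambda>z. Q z * S' z)) (linepath (ax (-1) a) (ax (-1) \<epsilon>))"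
    using has_contour_integral_diff[OF 1 2] by simp
  then have 3: "cint (ax (-1) a) (ax (-1) \<epsilon>) (\<lambda>z. P z * S z) = Q (ax (-1) \<epsilon>) * S (ax (-1) \<epsilon>) - Q (ax (-1) a) * S (ax (-1) a) - cint (ax (-1) a) (ax (-1) \<epsilon>) (\<lambda>z. Q z * S' z)"
    by (rule contour_integral_unique)
  have 4: "ax (-1) a powr (1 - s) / (s - 1) = - Q (ax (-1) a)" using s1 by (simp add: Q_def field_simps)
  have nQ: "norm (Q (ax (-1) v)) \<le> C" if "0 < v" "v \<le> a" for v
  proof -
    have z0: "ax (-1) v \<noteq> 0" using that by simp
    have "norm (ax (-1) v powr (1 - s)) = norm (ax (-1) v) powr Re (1 - s) * exp (- (Im (1 - s) * Arg (ax (-1) v)))"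
      using norm_powr_complex[of "ax (-1) v" "1 - s"] z0 by simp
    also have "\<dots> = v powr (1 - \<sigma>) * exp (- (pi / 2) * t)" using that unfolding Arg_ax[OF that(1)] by (simp add: s_def norm_mult mult.commute)
    also have "\<dots> \<le> a powr (1 - \<sigma>) * exp (- (pi / 2) * t)" using that sig by (intro mult_right_mono powr_mono2) auto
    finally show ?thesis unfolding Q_def norm_divide C_def using ns t0 by (intro frac_le) auto
  qed
  have C0: "C \<ge> 0" using t0 by (simp add: C_def)
  have ex: "exp (\<i> * of_real (2 * pi * real k * 1) * ax (-1) v) = of_real (exp (2 * pi * real k * v))"
    "exp (\<i> * of_real (2 * pi * real k * (-1)) * ax (-1) v) = of_real (exp (- (2 * pi * real k * v)))" for k v
    unfolding exp_of_real[symmetric] by (simp_all add: algebra_simps)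
  have SH: "S (ax (-1) v) = of_real (H v)" for v
    unfolding S_def geo_def ex H_def by (simp add: sum.distrib)
  have H0: "H v \<ge> 0" for v unfolding H_def by (intro sum_nonneg add_nonneg_nonneg) auto
  define H' where "H' v = (\<Sum>k=1..m. 2 * pi * real k * (exp (2 * pi * real k * v) - exp (- (2 * pi * real k * v))))" for v :: real
  have dH: "(H has_real_derivative H' v) (at v within X)" for v X
    unfolding H_def H'_def by (auto intro!: derivative_eq_intros simp: algebra_simps)
  have nS': "norm (S' (ax (-1) v)) \<le> H' v" if "v \<ge> 0" for v
  proof -
    have "norm (S' (ax (-1) v)) \<le> (\<Sum>k=1..m. norm (\<i> * of_real (2 * pi * real k) * of_real (exp (2 * pi * real k * v) - exp (- (2 * pi * real k * v))) :: complex))"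
      unfolding S'_def ex of_real_diff[symmetric] by (rule norm_sum)
    also have "\<dots> = H' v" unfolding H'_def
    proof (intro sum.cong refl)
      fix k
      have "- (2 * pi * real k * v) \<le> 2 * pi * real k * v" using that by simp
      then have "exp (- (2 * pi * real k * v)) \<le> exp (2 * pi * real k * v)" by simp
      then show "norm (\<i> * of_real (2 * pi * real k) * of_real (exp (2 * pi * real k * v) - exp (- (2 * pi * real k * v))) :: complex) = 2 * pi * real k * (exp (2 * pi * real k * v) - exp (- (2 * pi * real k * v)))"
        unfolding norm_mult norm_of_real by simp
    qed
    finally show ?thesis .
  qed
  have 5: "norm (cint (ax (-1) a) (ax (-1) \<epsilon>) (\<lambda>z. Q z * S' z)) \<le> C * (H a - H \<epsilon>)"
  proof -
    have "norm (cint (0 + of_real \<epsilon> * (of_real (-1) * \<i>)) (0 + of_real a * (of_real (-1) * \<i>)) (\<lambda>z. Q z * S' z)) \<le> (C * (H a - H \<epsilon>)) * norm (of_real (-1) * \<i>)"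
    proof (rule norm_cint_ray_le[where b = "\<lambda>v. C * H' v"])
      show "((\<lambda>v. C * H' v) has_integral C * (H a - H \<epsilon>)) {\<epsilon>..a}"
        using e by (intro has_integral_mult_right fundamental_theorem_of_calculus)
          (auto intro: dH simp flip: has_real_derivative_iff_has_vector_derivative)
      fix v assume v: "\<epsilon> \<le> v" "v \<le> a"
      then have v0: "v > 0" using e by simp
      have "norm (Q (ax (-1) v)) * norm (S' (ax (-1) v)) \<le> C * H' v"
        using C0 v0 by (intro mult_mono nQ nS' v) auto
      then show "norm (Q (0 + of_real v * (of_real (-1) * \<i>)) * S' (0 + of_real v * (of_real (-1) * \<i>))) \<le> C * H' v"
        by (simp only: norm_mult add_0_left)
    qed (use e in auto)
    then show ?thesis using cint_reverse[of "ax (-1) a" "ax (-1) \<epsilon>" "\<lambda>z. Q z * S' z"] by simp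
  qed
  have eq0: "ax (-1) a powr (1 - s) / (s - 1) + cint (ax (-1) a) (ax (-1) \<epsilon>) (\<lambda>z. P z * S z)
      = - (Q (ax (-1) a) * (1 + of_real (H a))) + Q (ax (-1) \<epsilon>) * of_real (H \<epsilon>) - cint (ax (-1) a) (ax (-1) \<epsilon>) (\<lambda>z. Q z * S' z)"
    unfolding 3 4 SH by (simp add: algebra_simps)
  have "norm (ax (-1) a powr (1 - s) / (s - 1) + cint (ax (-1) a) (ax (-1) \<epsilon>) (\<lambda>z. P z * S z))
     \<le> norm (Q (ax (-1) a) * (1 + of_real (H a))) + norm (Q (ax (-1) \<epsilon>) * of_real (H \<epsilon>)) + norm (cint (ax (-1) a) (ax (-1) \<epsilon>) (\<lambda>z. Q z * S' z))"
    unfolding eq0 by (rule order_trans[OF norm_triangle_ineq4 add_right_mono[OF order_trans[OF norm_triangle_ineq]]]) simp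
  also have "\<dots> \<le> C * (1 + H a) + C * H \<epsilon> + C * (H a - H \<epsilon>)"
  proof (intro add_mono 5)
    have "norm (of_real (1 + H a) :: complex) = 1 + H a" using H0[of a] unfolding norm_of_real by simp
    then have "norm (1 + of_real (H a) :: complex) = 1 + H a" by simp
    then show "norm (Q (ax (-1) a) * (1 + of_real (H a))) \<le> C * (1 + H a)"
      unfolding norm_mult using nQ[OF a0] H0[of a] C0 by (intro mult_mono) auto
    show "norm (Q (ax (-1) \<epsilon>) * of_real (H \<epsilon>)) \<le> C * H \<epsilon>"
      unfolding norm_mult norm_of_real using nQ[of \<epsilon>] e H0[of \<epsilon>] C0 by (intro mult_mono) auto
  qed
  also have "\<dots> = C * (1 + 2 * H a)" by (simp add: algebra_simps)
  also have "\<dots> \<le> C * (203/100 * exp (2 * pi * real m * a))" using C0 H_a by (rule mult_left_mono[rotated])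
  also have "\<dots> = a powr (1 - \<sigma>) * (203/100 * exp (2 * pi * (real m * (a * 1)) - (pi / 2) * t) / t)"
  proof -
    have ee: "exp (U - V) = exp U * exp (- V)" for U V :: real by (simp add: exp_diff exp_minus divide_inverse)
    show ?thesis unfolding C_def ee by (simp add: mult_ac)
  qed
  also have "\<dots> \<le> (\<kappa> * (M * (y * h))) * (203/100 * (1/7) / t)"
  proof (intro mult_mono a_powr_1 divide_right_mono)
    \<comment> \<open>The growth m a \<le> x (y + 1/4) against the decay pi t / 2 = pi^2 x y leaves
      pi x ((2 - pi) y + 1/2), below - 2 for x, y \<ge> 1.\<close>
    have "2 * pi * (real m * (a * 1)) \<le> 2 * pi * (x * ((y + 1/4) * 1))" using ma_le[of 1] by (intro mult_left_mono) auto
    then have "2 * pi * (real m * (a * 1)) - (pi / 2) * t \<le> pi * x * ((2 - pi) * y + 1/2)" by (simp add: t algebra_simps)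
    also have "\<dots> \<le> pi * x * (- (64/100))"
    proof (rule mult_left_mono)
      have "(2 - pi) * y \<le> (2 - pi) * 1" using xy pi_gt_157_50 by (intro mult_left_mono_neg) auto
      then have "(2 - pi) * y \<le> 2 - pi" by simp
      moreover have "W + 1/2 \<le> - (64/100)" if "W \<le> 2 - pi" for W using that pi_gt_157_50 by simp
      ultimately show "(2 - pi) * y + 1/2 \<le> - (64/100)" by blast
    qed (use xy in auto)
    also have "\<dots> \<le> - 2"
    proof -
      have "157/50 * 1 \<le> pi * x" using xy pi_gt_157_50 by (intro mult_mono) auto
      then show ?thesis by simp
    qed
    finally have "exp (2 * pi * (real m * (a * 1)) - (pi / 2) * t) \<le> exp (- 2)" by simp
    also have "exp (- 2 :: real) \<le> 1 / 7"
      using exp_neg_le[of 7 2 2] exp_ge_quartic[of 2] by simp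
    finally show "exp (2 * pi * (real m * (a * 1)) - (pi / 2) * t) \<le> 1 / 7" .
  qed (use t0 \<kappa> M_pos h_bounds xy in auto)
  also have "\<dots> \<le> M * (58/1000 * h)"
  proof -
    have "(\<kappa> * (M * (y * h))) * (203/100 * (1/7) / t) = M * h * (\<kappa> * (203/700 / (2 * pi * x)))"
      using xy by (simp add: t field_simps)
    also have "\<dots> \<le> M * h * (5/4 * (203/700 / (2 * (157/50) * 1)))"
      using \<kappa> M_pos h_bounds xy pi_gt_157_50 by (intro mult_left_mono mult_mono divide_left_mono) auto
    also have "\<dots> \<le> M * h * (58/1000)" using M_pos h_bounds by (intro mult_left_mono) auto
    finally show ?thesis by simp
  qed
  finally show ?thesis by (simp add: s_def S_def)
qed

text \<open>The power, through exp (- pi t / 2), and the kernel are both exponentially small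
  here.\<close>

lemma lower_axis_bound:
  assumes T: "T > a"
  shows "norm (cint (ax (-1) a) (ax (-1) T) (\<lambda>z. P z * kerm (-1) m z)) \<le> sqrt 2 powr \<sigma> * M * (1/1000 * h)"
proof -
  have t0: "t > 0" using t_ge pi_gt_zero by linarith
  have a0: "a > 0" using a_bounds by simp
  define K where "K = a powr (- \<sigma>) * exp (- (pi / 2) * t)"
  have "norm (cint (0 + of_real a * (of_real (-1) * \<i>)) (0 + of_real T * (of_real (-1) * \<i>)) (\<lambda>z. P z * kerm (-1) m z))
      \<le> (K * (2 * ((exp (- (2 * pi) * a) - exp (- (2 * pi) * T)) / (2 * pi)))) * norm (of_real (-1) * \<i>)"
  proof (rule norm_cint_ray_le[where b = "\<lambda>v. K * (2 * exp (- (2 * pi) * v))"])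
    show "((\<lambda>v. K * (2 * exp (- (2 * pi) * v))) has_integral K * (2 * ((exp (- (2 * pi) * a) - exp (- (2 * pi) * T)) / (2 * pi)))) {a..T}"
      using T by (intro has_integral_mult_right has_integral_exp_neg) auto
    fix v assume v: "a \<le> v" "v \<le> T"
    then have v1: "v \<ge> 5/4" using a_bounds by simp
    define z where "z = ax (-1) v"
    have nz: "norm z = v" using v1 by (simp add: z_def norm_mult)
    have "norm (P z) = v powr (- \<sigma>) * exp (t * (- pi / 2))"
      unfolding P_def using norm_powr_Complex[of z \<sigma> t] nz v1 Arg_ax[of v] by (auto simp: z_def)
    also have "\<dots> \<le> a powr (- \<sigma>) * exp (t * (- pi / 2))" using v a0 sig by (intro mult_right_mono powr_mono2') auto
    finally have 1: "norm (P z) \<le> K" by (simp add: K_def mult.commute)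
    have "norm (kerm (-1) m z) = exp (- (2 * pi * real m * v)) * norm (ker (-1) z)"
      unfolding kerm_def norm_mult by (simp add: z_def mult_ac)
    also have "\<dots> \<le> 1 * (2 * exp (- 2 * pi * (-1 * Im z)))"
      using v1 by (intro mult_mono norm_ker_far) (auto simp: z_def)
    finally have 2: "norm (kerm (-1) m z) \<le> 2 * exp (- (2 * pi) * v)" by (simp add: z_def)
    have "norm (P z * kerm (-1) m z) \<le> K * (2 * exp (- (2 * pi) * v))"
      unfolding norm_mult using 1 2 by (intro mult_mono) (auto simp: K_def)
    then show "norm (P (0 + of_real v * (of_real (-1) * \<i>)) * kerm (-1) m (0 + of_real v * (of_real (-1) * \<i>))) \<le> K * (2 * exp (- (2 * pi) * v))"
      by (simp add: z_def)
  qed (use T in auto)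
  then have "norm (cint (ax (-1) a) (ax (-1) T) (\<lambda>z. P z * kerm (-1) m z)) \<le> K * (2 * ((exp (- (2 * pi) * a) - exp (- (2 * pi) * T)) / (2 * pi)))" by simp
  also have "\<dots> \<le> K * (1/600)"
  proof (rule mult_left_mono)
    have e: "exp (- (2 * pi) * a) \<le> 1/202" using exp_neg_le[of 202 "2 * pi * a" "2 * pi * a"] E_a by simp
    have "2 * ((exp (- (2 * pi) * a) - exp (- (2 * pi) * T)) / (2 * pi)) = (exp (- (2 * pi) * a) - exp (- (2 * pi) * T)) / pi" by (simp add: field_simps)
    also have "\<dots> \<le> (1/202) / 3" 
    proof (rule frac_le)
      show "exp (- (2 * pi) * a) - exp (- (2 * pi) * T) \<le> 1/202" using e exp_ge_zero[of "- (2 * pi) * T"] by linarith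
    qed (use pi_gt_157_50 in auto)
    also have "\<dots> \<le> 1/600" by simp
    finally show "2 * ((exp (- (2 * pi) * a) - exp (- (2 * pi) * T)) / (2 * pi)) \<le> 1/600" .
  qed (simp add: K_def)
  also have "\<dots> \<le> (sqrt 2 powr \<sigma> * (M * h) * 1) * (1/1000 * 1)"
  proof -
    have "exp (- (pi / 2) * t) \<le> 1/2"
    proof -
      have "exp (1 :: real) \<ge> 2" using exp_ge_add_one_self[of 1] by simp
      moreover have "1 \<le> (pi / 2) * t"
      proof -
        have "1 * 1 \<le> (pi / 2) * t" using t_ge pi_gt_157_50 by (intro mult_mono) auto
        then show ?thesis by simp
      qed
      ultimately show ?thesis using exp_neg_le[of 2 1 "(pi / 2) * t"] by simp
    qed
    then have "K \<le> (sqrt 2 powr \<sigma> * (M * h)) * (1/2)"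
      unfolding K_def using M_pos h_bounds by (intro mult_mono a_powr_0) auto
    moreover have "0 \<le> sqrt 2 powr \<sigma> * (M * h)" using M_pos h_bounds by simp
    ultimately show ?thesis by linarith
  qed
  finally show ?thesis by (simp add: mult_ac)
qed

end

section \<open>The bound for the remainder\<close>

text \<open>An upper envelope for all pieces in units of \<open>sqrt 2 powr \<sigma> * M\<close>.
  The constant 7072/10000 rounds up sqrt 2 / 2, half a Gaussian with the worse kernel constant;
  138/100 covers the Gaussians of both arms. The remaining coefficients collect the corrections of
  order h.\<close>

definition bound_const :: "real \<Rightarrow> real \<Rightarrow> real" where
  "bound_const x y = (if frac x < 2/5 then 7072/10000 + 113/100 * sqrt (x / y) + 65/100 * frac x * sqrt (x / y)
     else 138/100 + 116/100 * sqrt (x / y))"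

context critical
begin

definition right_const :: real where
  "right_const = (if f < 2/5 then 2253/10000 * (if D < 0 then 1 / (7/10 - f) else 1 + 2 * f) * h else 598/1000 + right_coeff * h)"

lemma right_bound:
  assumes "T > a"
  shows "norm (cint (of_real a) (of_real a + of_real T * (1 + \<i>)) (\<lambda>z. P z * kerm 1 m z)) \<le> sqrt 2 powr \<sigma> * M * (Wr \<alpha> * right_const)"
proof (cases "f < 2/5")
  case True
  show ?thesis using right_bound_small[OF True, of T] assms a_bounds True unfolding right_const_def by auto
next
  case False
  show ?thesis using right_bound_large[of T] assms False unfolding right_const_def by auto
qed

text \<open>w1 and w2 are rational majorants of \<open>Wl \<alpha>\<close> and
  \<open>Wr \<alpha>\<close>, one for sqrt 2 and one for 21/20. Each of their two assignments, with
  either sign of D, is a linear check in h and f h.\<close>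

lemma total_const:
  "Wl \<alpha> * (1/2 + left_coeff * h) + 19/100 * h + Wr \<alpha> * right_const + 59/1000 * h \<le> bound_const x y"
proof -
  have h0: "0 \<le> h" "h \<le> 1" using h_bounds by auto
  have lc: "left_coeff \<ge> 0" by (simp add: left_coeff_def)
  have rc: "right_const \<ge> 0" using f_bounds h0 by (auto simp: right_const_def right_coeff_def)
  obtain w1 w2 where w: "Wl \<alpha> \<le> w1" "Wr \<alpha> \<le> w2" "(w1, w2) \<in> {(14143/10000, 21/20), (21/20, 14143/10000)}"
  proof (cases "\<alpha> = 1/4")
    case True
    then show ?thesis using that[of "14143/10000" "21/20"] sqrt2_bounds(2) by (simp add: Wl_def Wr_def)
  next
    case False
    then show ?thesis using that[of "21/20" "14143/10000"] sqrt2_bounds(2) by (simp add: Wl_def Wr_def)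
  qed
  have "Wl \<alpha> * (1/2 + left_coeff * h) \<le> w1 * (1/2 + left_coeff * h)" using w h0 lc by (intro mult_right_mono) auto
  moreover have "Wr \<alpha> * right_const \<le> w2 * right_const" using w rc by (intro mult_right_mono) auto
  moreover have "w1 * (1/2 + left_coeff * h) + 19/100 * h + w2 * right_const + 59/1000 * h \<le> bound_const x y"
  proof (cases "f < 2/5")
    case True
    have bc: "bound_const x y = 7072/10000 + 113/100 * h + 65/100 * (f * h)" using True by (simp add: bound_const_def f_def h_def)
    have fh: "0 \<le> f * h" "f * h \<le> 2/5 * h" using f_bounds h0 True mult_right_mono[of f "2/5" h] by auto
    show ?thesis
    proof (cases "D < 0")
      case D: True
      have "1 / (7/10 - f) \<le> 10/7 + 100/21 * f"
      proof -
        have "0 \<le> f * (2/5 - f)" using f_bounds True by simp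
        then show ?thesis using True by (simp add: pos_divide_le_eq field_simps)
      qed
      then have "1 / (7/10 - f) * h \<le> (10/7 + 100/21 * f) * h" using h0 by (intro mult_right_mono) auto
      then have "2253/10000 * (1 / (7/10 - f) * h) \<le> 2253/10000 * ((10/7 + 100/21 * f) * h)" by (intro mult_left_mono) auto
      moreover have "right_const = 2253/10000 * (1 / (7/10 - f) * h)" using True D by (auto simp: right_const_def)
      moreover have "(10/7 + 100/21 * f) * h = 10/7 * h + 100/21 * (f * h)" by (simp add: algebra_simps)
      ultimately have rcb: "right_const \<le> 2253/10000 * (10/7 * h + 100/21 * (f * h))" by (simp only:)
      have lc0: "left_coeff = 0" using D by (simp add: left_coeff_def)
      consider "w1 = 14143/10000" "w2 = 21/20" | "w1 = 21/20" "w2 = 14143/10000" using w(3) by auto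
      then show ?thesis
      proof cases
        case 1
        have "14143/10000 * (1/2 + 0 * H) + 19/100 * H + 21/20 * r + 59/1000 * H \<le> 7072/10000 + 113/100 * H + 65/100 * g"
          if "r \<le> 2253/10000 * (10/7 * H + 100/21 * g)" "0 \<le> g" "g \<le> 2/5 * H" "0 \<le> H" for r g H :: real
        proof -
          have "r \<le> 2253/7000 * H + 2253/2100 * g" using that(1) by (simp add: distrib_left)
          then have "21/20 * r \<le> 21/20 * (2253/7000 * H + 2253/2100 * g)" by (intro mult_left_mono) auto
          then show ?thesis using that(2-4) by (simp add: field_simps)
        qed
        from this[OF rcb fh h0(1)] show ?thesis unfolding bc lc0 1 .
      next
        case 2
        have "21/20 * (1/2 + 0 * H) + 19/100 * H + 14143/10000 * r + 59/1000 * H \<le> 7072/10000 + 113/100 * H + 65/100 * g"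
          if "r \<le> 2253/10000 * (10/7 * H + 100/21 * g)" "0 \<le> g" "g \<le> 2/5 * H" "0 \<le> H" for r g H :: real
        proof -
          have "r \<le> 2253/7000 * H + 2253/2100 * g" using that(1) by (simp add: distrib_left)
          then have "14143/10000 * r \<le> 14143/10000 * (2253/7000 * H + 2253/2100 * g)" by (intro mult_left_mono) auto
          then show ?thesis using that(2-4) by (simp add: field_simps)
        qed
        from this[OF rcb fh h0(1)] show ?thesis unfolding bc lc0 2 .
      qed
    next
      case D: False
      have "right_const = 2253/10000 * (h + 2 * (f * h))" using True D by (simp add: right_const_def algebra_simps)
      then have rcb: "right_const = 2253/10000 * (h + 2 * (f * h))" .
      have lc0: "left_coeff = 11/25" using D True by (simp add: left_coeff_def)
      consider "w1 = 14143/10000" "w2 = 21/20" | "w1 = 21/20" "w2 = 14143/10000" using w(3) by auto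
      then show ?thesis
      proof cases
        case 1
        have "14143/10000 * (1/2 + 11/25 * H) + 19/100 * H + 21/20 * (2253/10000 * (H + 2 * g)) + 59/1000 * H \<le> 7072/10000 + 113/100 * H + 65/100 * g"
          if "0 \<le> g" "0 \<le> H" for g H :: real
          using that by (simp add: field_simps)
        from this[OF fh(1) h0(1)] show ?thesis unfolding bc lc0 rcb 1 .
      next
        case 2
        have "21/20 * (1/2 + 11/25 * H) + 19/100 * H + 14143/10000 * (2253/10000 * (H + 2 * g)) + 59/1000 * H \<le> 7072/10000 + 113/100 * H + 65/100 * g"
          if "0 \<le> g" "0 \<le> H" for g H :: real
          using that by (simp add: field_simps)
        from this[OF fh(1) h0(1)] show ?thesis unfolding bc lc0 rcb 2 .
      qed
    qed
  next
    case False
    have bc: "bound_const x y = 138/100 + 116/100 * h" using False by (simp add: bound_const_def f_def h_def)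
    consider "w1 = 14143/10000" "w2 = 21/20" | "w1 = 21/20" "w2 = 14143/10000" using w(3) by auto
    note w12 = this
    show ?thesis
    proof (cases "D < 0")
      case D: True
      have lc0: "left_coeff = 0" using D False by (simp add: left_coeff_def)
      have rc0: "right_const = 598/1000 + 631/1000 * h" using D False by (simp add: right_const_def right_coeff_def)
      from w12 show ?thesis
      proof cases
        case 1
        show ?thesis unfolding bc lc0 rc0 1 using h0 by (simp add: field_simps)
      next
        case 2
        show ?thesis unfolding bc lc0 rc0 2 using h0 by (simp add: field_simps)
      qed
    next
      case D: False
      have lc0: "left_coeff = 1/8" using D False by (simp add: left_coeff_def)
      have rc0: "right_const = 598/1000 + 9/20 * h" using D False by (simp add: right_const_def right_coeff_def)
      from w12 show ?thesis
      proof cases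
        case 1
        show ?thesis unfolding bc lc0 rc0 1 using h0 by (simp add: field_simps)
      next
        case 2
        show ?thesis unfolding bc lc0 rc0 2 using h0 by (simp add: field_simps)
      qed
    qed
  qed
  ultimately show ?thesis by linarith
qed

theorem remainder_bound: "norm (R1 (Complex \<sigma> t) y x) \<le> sqrt 2 powr \<sigma> * M * bound_const x y"
proof -
  define s where "s = Complex \<sigma> t"
  have t0: "t > 0" using t_ge pi_gt_zero by linarith
  have s1: "Re s < 1" "s \<noteq> 1" using sig t0 by (auto simp: s_def complex_eq_iff)
  define S where "S = sqrt 2 powr \<sigma>"
  have S1: "S \<ge> 1" unfolding S_def using sig by (intro ge_one_powr_ge_zero) auto
  have "Jrem s a m \<longlonglongrightarrow> R1 s y x"
    using remainder_limit[OF s1 \<alpha> a_eq, of m] by (simp add: R1_def N_def m_def)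
  then have "Jrem s a m \<longlonglongrightarrow> R1 s y x" .
  moreover have "\<forall>\<^sub>F n in sequentially. norm (Jrem s a m n) \<le> S * M * bound_const x y"
  proof -
    obtain n0 :: nat where n0: "real n0 > a" using reals_Archimedean2 by blast
    show ?thesis
    proof (rule eventually_sequentiallyI)
      fix n assume n: "n \<ge> n0"
      have T: "real (Suc n) > a" using n n0 by simp
      have e: "0 < eps n" "eps n < a" using eps(1)[of n] eps(2)[of n] a_bounds by auto
      note b1 = middle_bound[OF e] and b2 = left_bound and b3 = right_bound[OF T] and b4 = lower_axis_bound[OF T]
      have b1': "norm (ax (-1) a powr (1 - s) / (s - 1) + cint (ax (-1) a) (ax (-1) (eps n)) (\<lambda>z. P z * (geo 1 m z + geo (-1) m z))) \<le> S * M * (58/1000 * h)"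
      proof -
        have q: "M * (58/1000 * h) \<le> S * M * (58/1000 * h)"
          using mult_right_mono[of 1 S "M * (58/1000 * h)"] S1 M_pos h_bounds by (simp add: mult.assoc)
        show ?thesis using b1 unfolding s_def by (rule order_trans[OF _ q])
      qed
      have tri: "norm (u + v + p + q + r) \<le> norm (u + v) + norm p + norm q + norm r" for u v p q r :: complex
        by (intro norm_triangle_le add_mono norm_triangle_ineq order_refl)
      have J: "Jrem s a m n = ax (-1) a powr (1 - s) / (s - 1) + cint (ax (-1) a) (ax (-1) (eps n)) (\<lambda>z. P z * (geo 1 m z + geo (-1) m z))
         + cint (ax (-1) a) (of_real a) (\<lambda>z. P z * kerm 1 m z)
         + cint (of_real a) (of_real a + of_real (real (Suc n)) * (1 + \<i>)) (\<lambda>z. P z * kerm 1 m z)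
         + cint (ax (-1) a) (ax (-1) (real (Suc n))) (\<lambda>z. P z * kerm (-1) m z)"
        unfolding Jrem_def P_def s_def ..
      have "norm (Jrem s a m n) \<le> S * M * (58/1000 * h) + S * M * (Wl \<alpha> * (1/2 + left_coeff * h) + 19/100 * h) + S * M * (Wr \<alpha> * right_const) + S * M * (1/1000 * h)"
        unfolding J S_def by (rule order_trans[OF tri]) (intro add_mono b1'[unfolded S_def] b2 b3 b4)
      also have "\<dots> = S * M * (Wl \<alpha> * (1/2 + left_coeff * h) + 19/100 * h + Wr \<alpha> * right_const + 59/1000 * h)" by (simp add: algebra_simps)
      also have "\<dots> \<le> S * M * bound_const x y" using S1 M_pos by (intro mult_left_mono total_const) auto
      finally show "norm (Jrem s a m n) \<le> S * M * bound_const x y" .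
    qed
  qed
  ultimately show ?thesis unfolding s_def S_def by (rule Lim_norm_ubound[OF sequentially_bot])
qed

end

section \<open>Symmetries\<close>

text \<open>Conjugation on both sides preserves holomorphy and the Dirichlet series, so the
  uniqueness of the continuation applies.\<close>

lemma zeta_cnj:
  assumes "s \<noteq> 1"
  shows "zeta (cnj s) = cnj (zeta s)"
proof -
  have "(cnj \<circ> zeta \<circ> cnj) s = zeta s"
  proof (rule analytic_continuation_open[where s = "{s. Re s > 1}" and s' = "- {1}" and f = "cnj \<circ> zeta \<circ> cnj" and g = zeta])
    show "open {s. Re s > 1}" by (rule open_halfspace_Re_gt)
    have "2 \<in> {s :: complex. Re s > 1}" by simp
    then show "{s :: complex. Re s > 1} \<noteq> {}" by blast
    show "connected (- {1 :: complex})" by (rule connected_punctured_universe) simp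
    have "cnj ` (- {1}) = - {1}"
    proof (intro equalityI subsetI)
      fix x :: complex assume "x \<in> - {1}"
      then have "cnj x \<in> - {1}" by auto
      then show "x \<in> cnj ` (- {1})" using image_eqI[of x cnj "cnj x"] by simp
    qed auto
    then show "cnj \<circ> zeta \<circ> cnj holomorphic_on - {1}"
      using zeta_holomorphic by (intro holomorphic_on_compose_cnj_cnj) auto
    fix s :: complex assume s: "s \<in> {s. Re s > 1}"
    have "(\<lambda>n. of_nat (Suc n) powr (- cnj s)) sums zeta (cnj s)" using s by (intro zeta_series) simp
    then have "(\<lambda>n. cnj (of_nat (Suc n) powr (- cnj s))) sums cnj (zeta (cnj s))" by (rule sums_cnj[THEN iffD2])
    moreover have "cnj (of_nat (Suc n) powr (- cnj s)) = of_nat (Suc n) powr (- s)" for n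
      using cnj_powr[of "of_nat (Suc n)" "- cnj s"] by (simp add: complex_cnj_of_nat del: of_nat_Suc) 
    ultimately have "(\<lambda>n. of_nat (Suc n) powr (- s)) sums cnj (zeta (cnj s))" by simp
    moreover have "(\<lambda>n. of_nat (Suc n) powr (- s)) sums zeta s" using s by (intro zeta_series) simp
    ultimately show "(cnj \<circ> zeta \<circ> cnj) s = zeta s" by (simp add: sums_unique2)
  qed (use assms zeta_holomorphic in auto)
  then show ?thesis by (metis comp_apply complex_cnj_cnj)
qed

lemma of_nat_powr_cnj: "of_nat n powr (cnj s) = cnj (of_nat n powr s)"
  by (cases "n = 0") (simp_all add: cnj_powr)

lemma chi_cnj: "chi (cnj s) = cnj (chi s)"
proof -
  have 1: "2 powr cnj s = cnj (2 powr s)" using of_nat_powr_cnj[of 2 s] by simp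
  have 2: "of_real pi powr (cnj s - 1) = cnj (of_real pi powr (s - 1))" by (simp add: cnj_powr)
  have 3: "sin (of_real pi * cnj s / 2) = cnj (sin (of_real pi * s / 2))" by (simp add: cnj_sin)
  have 4: "Gamma (1 - cnj s) = cnj (Gamma (1 - s))" by (simp add: cnj_Gamma)
  show ?thesis unfolding chi_def 1 2 3 4 by simp
qed

lemma R1_cnj:
  assumes "s \<noteq> 1"
  shows "R1 (cnj s) a b = cnj (R1 s a b)"
  unfolding R1_def using zeta_cnj[OF assms] of_nat_powr_cnj[of _ "- s"] of_nat_powr_cnj[of _ "s - 1"]
  by (simp add: chi_cnj)

lemma chi_tilde_cnj: "t \<noteq> 0 \<Longrightarrow> chi_tilde \<sigma> (- t) = cnj (chi_tilde \<sigma> t)"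
  unfolding chi_tilde_def by (simp add: cnj_powr exp_cnj sgn_minus)

lemma norm_Cerr_minus: "t \<noteq> 0 \<Longrightarrow> norm (Cerr \<sigma> (- t)) = norm (Cerr \<sigma> t)"
proof -
  assume t: "t \<noteq> 0"
  have "Complex \<sigma> (- t) = cnj (Complex \<sigma> t)" by (simp add: complex_eq_iff)
  then have "Cerr \<sigma> (- t) = cnj (Cerr \<sigma> t)" unfolding Cerr_def by (simp add: chi_cnj chi_tilde_cnj[OF t])
  then show ?thesis by simp
qed

text \<open>The reflection formula for Gamma against sin (pi s) = 2 sin (pi s / 2) cos (pi s /
  2).\<close>

lemma chi_mult_chi:
  assumes "Im s \<noteq> 0"
  shows "chi s * chi (1 - s) = 1"
proof -
  have ns: "s \<notin> \<int>" "1 - s \<notin> \<int>" using assms by (auto simp: complex_is_Int_iff)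
  have sn: "sin (of_real pi * s) \<noteq> 0" using ns(1) by (auto simp: sin_eq_0 complex_is_Int_iff) 
  have r: "Gamma s * Gamma (1 - s) = of_real pi / sin (of_real pi * s)" by (rule Gamma_reflection_complex)
  have p2: "2 powr s * 2 powr (1 - s) = (2 :: complex)" by (simp flip: powr_add)
  have pp: "of_real pi powr (s - 1) * of_real pi powr (1 - s - 1) = (1 / of_real pi :: complex)"
  proof -
    have "of_real pi powr (s - 1) * of_real pi powr (1 - s - 1) = (of_real pi powr ((s - 1) + (1 - s - 1)) :: complex)"
      by (rule powr_add[symmetric])
    also have "(s - 1) + (1 - s - 1) = -1" by simp
    finally show ?thesis by (simp add: powr_minus inverse_eq_divide)
  qed
  have c: "sin (of_real pi * (1 - s) / 2) = cos (of_real pi * s / 2)"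
    by (simp add: sin_diff algebra_simps diff_divide_distrib sin_of_real cos_of_real)
  have d: "sin (of_real pi * s) = 2 * sin (of_real pi * s / 2) * cos (of_real pi * s / 2)"
    using sin_double[of "of_real pi * s / 2"] by simp
  have "chi s * chi (1 - s) = (2 powr s * 2 powr (1 - s)) * (of_real pi powr (s - 1) * of_real pi powr (1 - s - 1))
     * (sin (of_real pi * s / 2) * sin (of_real pi * (1 - s) / 2)) * (Gamma s * Gamma (1 - s))"
    unfolding chi_def by (simp add: mult_ac)
  also have "\<dots> = 1" unfolding r p2 pp c using sn unfolding d by (simp add: field_simps)
  finally show ?thesis .
qed

text \<open>Replacing s by 1 - s exchanges the roles of the two sums, so a bound for one order of
  the lengths yields one for the other.\<close>

lemma R1_functional:
  assumes "Im s > 0"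
  shows "R1 s a b = chi s * R1 (1 - s) b a"
proof -
  have "chi s * R1 (1 - s) b a = chi s * zeta (1 - s) - chi s * (\<Sum>n = 1..nat \<lfloor>b\<rfloor>. of_nat n powr (s - 1)) - (chi s * chi (1 - s)) * (\<Sum>n = 1..nat \<lfloor>a\<rfloor>. of_nat n powr (- s))"
    unfolding R1_def by (simp add: algebra_simps)
  then show ?thesis using chi_mult_chi[of s] functional_equation[OF assms] assms by (simp add: R1_def)
qed

lemma R1_bound_closed:
  fixes \<sigma> t x y :: real
  assumes "0 \<le> \<sigma>" "\<sigma> \<le> 1" and xy: "1 \<le> x" "x \<le> y" and t: "t = 2 * pi * x * y"
  shows "norm (R1 (Complex \<sigma> t) y x) \<le> sqrt 2 powr \<sigma> * (y powr (1 - \<sigma>) / sqrt (x * y)) * bound_const x y"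
proof -
  define g where "g \<sigma> = sqrt 2 powr \<sigma> * (y powr (1 - \<sigma>) / sqrt (x * y)) * bound_const x y - norm (R1 (Complex \<sigma> t) y x)" for \<sigma>
  have t0: "t > 0" using xy by (simp add: t)
  have ne: "Complex u t \<noteq> 1" for u using t0 by (simp add: complex_eq_iff)
  have "0 \<le> g u" if "u \<in> {0<..<1}" for u
  proof -
    interpret critical u t x y by unfold_locales (use that xy t in auto)
    show ?thesis using remainder_bound by (simp add: g_def M_def)
  qed
  moreover have "continuous_on {0..1} g"
  proof -
    have cC: "continuous_on {0..1} (\<lambda>u. Complex u t)" unfolding Complex_eq by (intro continuous_intros)
    have "continuous_on {0..1} (\<lambda>u. zeta (Complex u t))"
      by (rule continuous_on_compose2[OF holomorphic_on_imp_continuous_on[OF zeta_holomorphic] cC]) (use ne in auto)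
    moreover have "continuous_on {0..1} (\<lambda>u. chi (Complex u t))"
    proof -
      have "1 - s \<notin> \<int>\<^sub>\<le>\<^sub>0" if "Im s > 0" for s using that by (auto elim!: nonpos_Ints_cases simp: complex_eq_iff)
      then have "chi holomorphic_on {s. Im s > 0}"
        unfolding chi_def[abs_def] by (auto intro!: holomorphic_intros)
      then show ?thesis
        by (rule continuous_on_compose2[OF holomorphic_on_imp_continuous_on cC]) (use t0 in auto)
    qed
    moreover have "continuous_on {0..1} (\<lambda>u. \<Sum>n = 1..K. of_nat n powr (- Complex u t))" "continuous_on {0..1} (\<lambda>u. \<Sum>n = 1..K. of_nat n powr (Complex u t - 1))" for K :: nat
      by (intro continuous_intros cC; simp)+
    ultimately show ?thesis unfolding g_def R1_def using xy by (intro continuous_intros) auto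
  qed
  ultimately have "0 \<le> g \<sigma>"
    using continuous_ge_on_closure[of "{0<..<1}" g \<sigma> 0] assms by (simp add: closure_greaterThanLessThan)
  then show ?thesis by (simp add: g_def)
qed

section \<open>Stirling approximation with explicit error\<close>

text \<open>Stirling's main term for log Gamma without its constant. \<open>binet\<close> is the
  increment of \<open>stir\<close> from z to z + 1 minus Ln z, so its sum over z + k is Binet's
  correction.\<close>

definition stir :: "complex \<Rightarrow> complex" where "stir z = (z - 1/2) * Ln z - z"
definition binet :: "complex \<Rightarrow> complex" where "binet z = (z + 1/2) * (Ln (z + 1) - Ln z) - 1"

lemma norm_ge_Im_Re: "Re w \<ge> x \<Longrightarrow> x \<ge> 0 \<Longrightarrow> norm w ^ 2 \<ge> x\<^sup>2 + (Im w)\<^sup>2"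
  by (simp add: cmod_power2 power_mono)

text \<open>Centred at c = z + 1/2 the difference of logarithms is odd in v and the linear part
  cancels: D' = 2 v^2 / (c^2 - v^2). Both c + v and c - v have squared modulus at least r, and 2 v^2
  / r integrates to 1 / (12 r).\<close>

lemma norm_binet_le:
  assumes "Re z \<ge> 0" "Im z \<noteq> 0"
  shows "norm (binet z) \<le> 1 / (12 * ((Re z)\<^sup>2 + (Im z)\<^sup>2))"
proof -
  define c where "c = z + 1/2"
  define r where "r = (Re z)\<^sup>2 + (Im z)\<^sup>2"
  have r: "r > 0" using assms by (auto simp: r_def sum_power2_gt_zero_iff)
  define D where "D v = c * (Ln (c + of_real v) - Ln (c - of_real v)) - 2 * of_real v" for v :: real
  define D' where "D' v = c * (1 / (c + of_real v) + 1 / (c - of_real v)) - 2" for v :: real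
  have slot: "c + of_real v \<notin> \<real>\<^sub>\<le>\<^sub>0" "c - of_real v \<notin> \<real>\<^sub>\<le>\<^sub>0" for v
    using assms by (auto simp: c_def complex_nonpos_Reals_iff)
  have nz: "c + of_real v \<noteq> 0" "c - of_real v \<noteq> 0" for v using slot[of v] by auto
  have "(D has_vector_derivative D' v) (at v within {0..1/2})" for v
    unfolding D_def
  proof (rule has_vector_derivative_real_field[where f = "\<lambda>w. c * (Ln (c + w) - Ln (c - w)) - 2 * w"])
    show "((\<lambda>w. c * (Ln (c + w) - Ln (c - w)) - 2 * w) has_field_derivative D' v) (at (of_real v))"
      unfolding D'_def using slot[of v]
      by (auto intro!: derivative_eq_intros simp: divide_inverse simp del: complex_nonpos_Reals_iff)
  qed
  then have h1: "(D' has_integral (D (1/2) - D 0)) {0..1/2}"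
    by (intro fundamental_theorem_of_calculus) auto
  have h2: "((\<lambda>v. 2 * v\<^sup>2 / r) has_integral ((2/3) * (1/2)^3 / r - (2/3) * 0^3 / r)) {0..1/2}"
    by (intro fundamental_theorem_of_calculus)
      (use r in \<open>auto intro!: derivative_eq_intros simp: power2_eq_square simp flip: has_real_derivative_iff_has_vector_derivative\<close>)
  have h3: "norm (D' v) \<le> 2 * v\<^sup>2 / r" if "v \<in> {0..1/2}" for v
  proof -
    have "D' v = 2 * of_real v ^ 2 / ((c + of_real v) * (c - of_real v))"
      using nz[of v] by (simp add: D'_def divide_simps) (simp add: algebra_simps power2_eq_square)
    moreover have "norm (c + of_real v) ^ 2 \<ge> r" "norm (c - of_real v) ^ 2 \<ge> r"
      using that assms norm_ge_Im_Re[of "Re z" "c + of_real v"] norm_ge_Im_Re[of "Re z" "c - of_real v"] by (auto simp: c_def r_def)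
    then have "(norm (c + of_real v) * norm (c - of_real v)) ^ 2 \<ge> r ^ 2"
      unfolding power_mult_distrib using r by (simp add: power2_eq_square[of r] mult_mono)
    then have "norm (c + of_real v) * norm (c - of_real v) \<ge> r"
      by (rule power2_le_imp_le) auto
    ultimately show ?thesis using that r nz[of v] by (auto simp: norm_mult norm_divide norm_power intro!: divide_left_mono mult_pos_pos)
  qed
  have "norm (D (1/2) - D 0) \<le> (2/3) * (1/2)^3 / r - (2/3) * 0^3 / r"
    using integral_norm_bound_integral[OF has_integral_integrable[OF h1] has_integral_integrable[OF h2] h3]
    unfolding integral_unique[OF h1] integral_unique[OF h2] .
  moreover have "D (1/2) = binet z" by (simp add: D_def binet_def c_def add.commute)
  moreover have "D 0 = 0" by (simp add: D_def)
  moreover have "(2/3) * (1/2)^3 / r - (2/3) * 0^3 / r = 1 / (12 * r)" by (simp add: power3_eq_cube)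
  ultimately show ?thesis by (simp add: r_def)
qed

text \<open>For k \<ge> 1 the sum of 1 / (k^2 + t^2) is compared with increments of arctan (k / t) /
  t by the mean value theorem; k = 0 contributes 1 / t^2.\<close>

lemma sum_binet_bound:
  assumes "Re z \<ge> 0" "t = \<bar>Im z\<bar>" "t > 0"
  shows "(\<Sum>k<n. norm (binet (z + of_nat k))) \<le> (1 / t\<^sup>2 + pi / (2 * t)) / 12"
proof -
  have 1: "norm (binet (z + of_nat k)) \<le> 1 / (12 * (real k ^ 2 + t\<^sup>2))" for k
  proof -
    have "norm (binet (z + of_nat k)) \<le> 1 / (12 * ((Re (z + of_nat k))\<^sup>2 + (Im (z + of_nat k))\<^sup>2))"
      using assms by (intro norm_binet_le) auto
    also have "\<dots> \<le> 1 / (12 * (real k ^ 2 + t\<^sup>2))"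
    proof (intro divide_left_mono mult_left_mono mult_pos_pos)
      have le: "(real k)\<^sup>2 \<le> (Re (z + of_nat k))\<^sup>2" using assms by (intro power_mono) auto
      moreover have "t\<^sup>2 = (Im (z + of_nat k))\<^sup>2" using assms by simp
      moreover have t0: "t\<^sup>2 > 0" using assms by simp
      ultimately show "real k ^ 2 + t\<^sup>2 \<le> (Re (z + of_nat k))\<^sup>2 + (Im (z + of_nat k))\<^sup>2" 
        "0 < (Re (z + of_nat k))\<^sup>2 + (Im (z + of_nat k))\<^sup>2" by (simp_all add: add_nonneg_pos)
      show "0 < real k ^ 2 + t\<^sup>2" using t0 by (simp add: add_nonneg_pos)
    qed auto
    finally show ?thesis .
  qed
  have 2: "1 / (real (Suc k) ^ 2 + t\<^sup>2) \<le> (arctan (real (Suc k) / t) - arctan (real k / t)) / t" for k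
  proof -
    have "real k / t < real (Suc k) / t" using assms by (simp add: divide_strict_right_mono)
    then obtain \<xi> where \<xi>: "real k / t < \<xi>" "\<xi> < real (Suc k) / t"
       "arctan (real (Suc k) / t) - arctan (real k / t) = (real (Suc k) / t - real k / t) * inverse (1 + \<xi>\<^sup>2)"
      using MVT2[of "real k / t" "real (Suc k) / t" arctan "\<lambda>x. inverse (1 + x\<^sup>2)"] DERIV_arctan by blast
    have "0 \<le> real k / t" using assms by simp
    then have "\<xi> ^ 2 \<le> (real (Suc k) / t) ^ 2" using \<xi> by (intro power_mono) auto
    then have "inverse (1 + (real (Suc k) / t)\<^sup>2) \<le> inverse (1 + \<xi>\<^sup>2)"
      by (intro le_imp_inverse_le) (auto intro: add_pos_nonneg)
    then have "(1 / t) * inverse (1 + (real (Suc k) / t)\<^sup>2) \<le> arctan (real (Suc k) / t) - arctan (real k / t)"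
      unfolding \<xi>(3) using assms by (simp add: diff_divide_distrib[symmetric] divide_right_mono)
    then have "(1 / t) * inverse (1 + (real (Suc k) / t)\<^sup>2) / t \<le> (arctan (real (Suc k) / t) - arctan (real k / t)) / t"
      using assms by (intro divide_right_mono) auto
    moreover have "(1 / t) * inverse (1 + (real (Suc k) / t)\<^sup>2) / t = 1 / (real (Suc k) ^ 2 + t\<^sup>2)"
    proof -
      have "1 + (real (Suc k) / t)\<^sup>2 = (real (Suc k) ^ 2 + t\<^sup>2) / t\<^sup>2" using assms(3) by (simp add: field_simps)
      then show ?thesis using assms(3) by (simp add: power2_eq_square)
    qed
    ultimately show ?thesis by simp
  qed
  have 3: "(\<Sum>k<n. 1 / (real k ^ 2 + t\<^sup>2)) \<le> 1 / t\<^sup>2 + arctan (real n / t) / t"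
  proof (induction n)
    case (Suc n)
    show ?case
    proof (cases n)
      case 0
      then show ?thesis using assms by simp
    next
      case (Suc m)
      have "(\<Sum>k<Suc m. 1 / (real k ^ 2 + t\<^sup>2)) \<le> 1 / t\<^sup>2 + arctan (real m / t) / t" for m
      proof (induction m)
        case (Suc m)
        then show ?case using 2[of m] by (simp add: diff_divide_distrib)
      qed (use assms in simp)
      from this[of n] show ?thesis
        using arctan_monotone'[of "real n / t" "real (Suc n) / t"] assms
        by (smt (verit) divide_right_mono of_nat_le_iff le_SucI order_refl)
    qed
  qed (use assms in simp)
  have "(\<Sum>k<n. norm (binet (z + of_nat k))) \<le> (\<Sum>k<n. 1 / (12 * (real k ^ 2 + t\<^sup>2)))"
    by (intro sum_mono 1)
  also have "\<dots> = (\<Sum>k<n. 1 / (real k ^ 2 + t\<^sup>2)) / 12" by (simp add: sum_divide_distrib mult.commute)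
  also have "\<dots> \<le> (1 / t\<^sup>2 + (pi / 2) / t) / 12"
    using 3 arctan_ubound[of "real n / t"] assms by (smt (verit) divide_right_mono)
  finally show ?thesis by simp
qed

lemma exp_stir_step:
  assumes "z \<notin> \<real>\<^sub>\<le>\<^sub>0"
  shows "exp (stir (z + 1)) = z * exp (stir z) * exp (binet z)"
proof -
  have z: "z \<noteq> 0" using assms by auto
  have "stir (z + 1) = Ln z + stir z + binet z" by (simp add: stir_def binet_def algebra_simps)
  then show ?thesis using z by (simp add: exp_add)
qed

text \<open>Gamma against Stirling's main term; along the integers it tends to sqrt (2 pi), the
  constant that \<open>stir\<close> lacks.\<close>

definition Gquot :: "complex \<Rightarrow> complex" where "Gquot z = Gamma z / exp (stir z)"

lemma Gquot_shift:
  assumes "\<And>k. z + of_nat k \<notin> \<real>\<^sub>\<le>\<^sub>0"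
  shows "Gquot (z + of_nat n) = Gquot z * exp (- (\<Sum>k<n. binet (z + of_nat k)))"
proof (induction n)
  case (Suc n)
  have nn: "z + of_nat n \<notin> \<int>\<^sub>\<le>\<^sub>0" using assms[of n] by (meson nonpos_Ints_subset_nonpos_Reals subsetD)
  have n0: "z + of_nat n \<noteq> 0" using assms[of n] by auto
  define p where "p = z + of_nat n"
  have "Gquot (z + of_nat (Suc n)) = Gamma (p + 1) / exp (stir (p + 1))"
    by (simp add: Gquot_def p_def algebra_simps)
  also have "\<dots> = (p * Gamma p) / (p * exp (stir p) * exp (binet p))"
    using exp_stir_step[OF assms[of n]] Gamma_plus1[OF nn] by (simp add: p_def)
  also have "\<dots> = Gquot p * exp (- binet p)"
    using n0 unfolding p_def[symmetric] by (simp add: Gquot_def exp_minus divide_inverse)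
  finally have "Gquot (z + of_nat (Suc n)) = Gquot (z + of_nat n) * exp (- binet (z + of_nat n))"
    by (simp add: p_def)
  then show ?case using Suc by (simp add: mult.assoc flip: exp_add)
qed simp

text \<open>Gauss's product for Gamma compares Gamma (z + n) with Gamma n, and the remaining
  exponent tends to 0 because n Ln (1 + z / n) tends to z. Hence the limit along z + n is the same
  for all z.\<close>

lemma Gquot_ratio_tendsto:
  assumes "z \<notin> \<real>\<^sub>\<le>\<^sub>0"
  shows "(\<lambda>n. Gquot (z + of_nat n) / Gquot (of_nat n)) \<longlonglongrightarrow> 1"
proof -
  have nz: "z \<notin> \<int>\<^sub>\<le>\<^sub>0" using assms by (meson nonpos_Ints_subset_nonpos_Reals subsetD)
  have Gz: "Gamma z \<noteq> 0" using nz by (simp add: Gamma_eq_zero_iff)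
  have "(\<lambda>n. Gamma z / Gamma_series' z n) \<longlonglongrightarrow> Gamma z / Gamma z"
    using Gz by (intro tendsto_intros Gamma_series'_LIMSEQ)
  then have A: "(\<lambda>n. Gamma z / Gamma_series' z n) \<longlonglongrightarrow> 1" using Gz by simp
  have B: "(\<lambda>n. exp (z - (z + of_nat n - 1/2) * Ln (1 + z / of_nat n))) \<longlonglongrightarrow> 1"
  proof -
    have lim0: "(\<lambda>n. norm (z / of_nat n)) \<longlonglongrightarrow> 0"
      using tendsto_mult_right_zero[OF lim_1_over_n, of z] by (auto intro!: tendsto_norm_zero simp: divide_inverse)
    have ev: "\<forall>\<^sub>F n in sequentially. norm (z / of_nat n) < 1/2" using order_tendstoD(2)[OF lim0, of "1/2"] by simp
    define C where "C = norm z ^ 2 * 2 + norm z * 2 * (norm z + 1)"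
    have "\<forall>\<^sub>F n in sequentially. norm (z - (z + of_nat n - 1/2) * Ln (1 + z / of_nat n)) \<le> C / real n"
      using ev eventually_gt_at_top[of 0]
    proof eventually_elim
      case (elim n)
      define w where "w = z / of_nat n"
      have nw: "of_nat n * w = z" using elim by (simp add: w_def)
      have "z - (z + of_nat n - 1/2) * Ln (1 + w) = - of_nat n * (Ln (1 + w) - w) - (z - 1/2) * Ln (1 + w)"
        using nw by (simp add: algebra_simps)
      also have "norm \<dots> \<le> norm (of_nat n * (Ln (1 + w) - w)) + norm ((z - 1/2) * Ln (1 + w))"
        by (metis minus_mult_left norm_minus_cancel norm_triangle_ineq4)
      also have "norm (of_nat n * (Ln (1 + w) - w)) \<le> real n * (2 * norm w ^ 2)"
      proof -
        have w1: "norm w < 1/2" using elim(1) by (simp only: w_def)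
        have "norm (Ln (1 + w) - w) \<le> norm w ^ 2 / (1 - norm w)"
          using Ln_approx_linear[of w] w1 by simp
        also have "\<dots> \<le> norm w ^ 2 / (1/2)" using w1 by (intro divide_left_mono) auto
        finally show ?thesis by (simp add: norm_mult mult_left_mono)
      qed
      also have "norm ((z - 1/2) * Ln (1 + w)) \<le> (norm z + 1) * (2 * norm w)"
        unfolding norm_mult using norm_Ln_le[of w] elim(1)
        by (intro mult_mono order_trans[OF norm_triangle_ineq4]) (auto simp: w_def)
      finally have "norm (z - (z + of_nat n - 1/2) * Ln (1 + w)) \<le> real n * (2 * norm w ^ 2) + (norm z + 1) * (2 * norm w)" by simp
      also have "\<dots> = C / real n" using elim(2) by (simp add: w_def norm_divide C_def field_simps power2_eq_square)
      finally show ?case by (simp add: w_def)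
    qed
    moreover have "(\<lambda>n. C / real n) \<longlonglongrightarrow> 0" by real_asymp
    ultimately have "(\<lambda>n. z - (z + of_nat n - 1/2) * Ln (1 + z / of_nat n)) \<longlonglongrightarrow> 0" by (rule Lim_null_comparison)
    from tendsto_exp[OF this] show ?thesis by simp
  qed
  have ev: "\<forall>\<^sub>F n in sequentially. Gquot (z + of_nat n) / Gquot (of_nat n)
       = (Gamma z / Gamma_series' z n) * exp (z - (z + of_nat n - 1/2) * Ln (1 + z / of_nat n)) "
  proof -
    have "\<forall>\<^sub>F n in sequentially. norm z < real n" 
      using filterlim_real_sequentially by (simp add: filterlim_at_top_dense)
    with eventually_gt_at_top[of 0] show ?thesis
    proof eventually_elim
      case (elim n)
      have n: "real n > 0" using elim by simp
      have p: "pochhammer z n \<noteq> 0" using nz pochhammer_eq_0_imp_nonpos_Int by blast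
      have G1: "Gamma (z + of_nat n) = pochhammer z n * Gamma z" using pochhammer_Gamma[OF nz, of n] Gz by simp
      have G2: "Gamma (of_nat n) = (fact (n - 1) :: complex)" using Gamma_fact[of "n - 1"] elim by (simp add: of_nat_diff)
      have l2: "Ln (of_nat n) = complex_of_real (ln (real n))" using n by (metis Ln_of_real of_real_of_nat_eq)
      have l: "Ln (z + of_nat n) = Ln (1 + z / of_nat n) + of_real (ln (real n))"
      proof -
        have nz1: "1 + z / of_nat n \<noteq> 0"
        proof
          assume "1 + z / of_nat n = 0"
          then have "z = - of_nat n" using elim by (simp add: field_simps add_eq_0_iff)
          then show False using elim by simp
        qed
        have "z + of_nat n = of_real (real n) * (1 + z / of_nat n)" using elim by (simp add: field_simps)
        then show ?thesis using Ln_times_of_real[OF n nz1] l2 by (simp add: add.commute)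
      qed
      have "stir (of_nat n) - stir (z + of_nat n) = - z * of_real (ln (real n)) + (z - (z + of_nat n - 1/2) * Ln (1 + z / of_nat n))"
        unfolding stir_def l l2 by (simp add: algebra_simps)
      then have e: "exp (stir (of_nat n)) / exp (stir (z + of_nat n)) = exp (- (z * of_real (ln (real n)))) * exp (z - (z + of_nat n - 1/2) * Ln (1 + z / of_nat n))"
        by (simp flip: exp_diff exp_add)
      have "Gquot (z + of_nat n) / Gquot (of_nat n) = pochhammer z n * Gamma z / fact (n - 1) * (exp (stir (of_nat n)) / exp (stir (z + of_nat n)))"
        unfolding Gquot_def G1 G2 by (simp add: field_simps)
      also have "\<dots> = (Gamma z / Gamma_series' z n) * exp (z - (z + of_nat n - 1/2) * Ln (1 + z / of_nat n))"
        unfolding e Gamma_series'_def using p by (simp add: exp_minus field_simps)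
      finally show ?case .
    qed
  qed
  have "(\<lambda>n. (Gamma z / Gamma_series' z n) * exp (z - (z + of_nat n - 1/2) * Ln (1 + z / of_nat n))) \<longlonglongrightarrow> 1 * 1"
    by (intro tendsto_mult A B)
  then show ?thesis using tendsto_cong[OF ev] by simp
qed


text \<open>A shift by n multiplies the quotient by exp of minus a convergent sum, and by the ratio
  lemma the limit along z + n is the limit along the integers.\<close>

lemma stirling_aux:
  assumes "Re z \<ge> 0" "Im z \<noteq> 0" and c: "\<And>n. Gquot (of_nat n) = of_real (norm (Gquot (of_nat n)))"
  obtains \<mu> where "(\<lambda>n. Gquot (of_nat n)) \<longlonglongrightarrow> Gquot z * exp (- \<mu>)"
     "norm \<mu> \<le> (1 / \<bar>Im z\<bar>\<^sup>2 + pi / (2 * \<bar>Im z\<bar>)) / 12"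
proof -
  define B where "B = (1 / \<bar>Im z\<bar>\<^sup>2 + pi / (2 * \<bar>Im z\<bar>)) / 12"
  have b: "(\<Sum>k<n. norm (binet (z + of_nat k))) \<le> B" for n
    unfolding B_def by (rule sum_binet_bound) (use assms in auto)
  have sn: "summable (\<lambda>k. norm (binet (z + of_nat k)))"
    by (rule summableI_nonneg_bounded[OF _ b]) simp
  define \<mu> where "\<mu> = (\<Sum>k. binet (z + of_nat k))"
  have sum: "(\<lambda>n. \<Sum>k<n. binet (z + of_nat k)) \<longlonglongrightarrow> \<mu>"
    unfolding \<mu>_def using summable_LIMSEQ[OF summable_norm_cancel[OF sn]] .
  have slot: "z + of_nat k \<notin> \<real>\<^sub>\<le>\<^sub>0" for k using assms by (auto simp: complex_nonpos_Reals_iff)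
  have "norm \<mu> \<le> B"
  proof (rule Lim_norm_ubound[OF sequentially_bot sum])
    show "\<forall>\<^sub>F n in sequentially. norm (\<Sum>k<n. binet (z + of_nat k)) \<le> B"
      by (intro always_eventually allI order_trans[OF norm_sum b])
  qed
  moreover have "(\<lambda>n. Gquot (of_nat n)) \<longlonglongrightarrow> Gquot z * exp (- \<mu>)"
  proof -
    have 1: "(\<lambda>n. Gquot (z + of_nat n)) \<longlonglongrightarrow> Gquot z * exp (- \<mu>)"
      unfolding Gquot_shift[OF slot] by (intro tendsto_intros sum)
    have r: "(\<lambda>n. Gquot (z + of_nat n) / Gquot (of_nat n)) \<longlonglongrightarrow> 1" using Gquot_ratio_tendsto slot[of 0] by simp
    from tendsto_divide[OF 1 r] have "(\<lambda>n. Gquot (z + of_nat n) / (Gquot (z + of_nat n) / Gquot (of_nat n))) \<longlonglongrightarrow> Gquot z * exp (- \<mu>)" by simp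
    moreover have "Gquot (z + of_nat n) \<noteq> 0" for n
    proof -
      have "z + of_nat n \<notin> \<int>\<^sub>\<le>\<^sub>0" using slot[of n] by (meson nonpos_Ints_subset_nonpos_Reals subsetD)
      then show ?thesis by (simp add: Gquot_def Gamma_eq_zero_iff)
    qed
    then have "Gquot (z + of_nat n) / (Gquot (z + of_nat n) / Gquot (of_nat n)) = Gquot (of_nat n)" for n by simp
    ultimately show ?thesis by simp
  qed
  ultimately show ?thesis using that by (simp add: B_def)
qed

lemma Gquot_of_nat_real: "Gquot (of_nat n) = of_real (norm (Gquot (of_nat n)))"
proof (cases "n = 0")
  case False
  then have "Ln (of_nat n) = complex_of_real (ln (real n))" by (metis Ln_of_real of_nat_0_less_iff of_real_of_nat_eq neq0_conv)
  then have "stir (of_nat n) = of_real ((real n - 1/2) * ln (real n) - real n)" by (simp add: stir_def)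
  then have "exp (stir (of_nat n)) = of_real (exp ((real n - 1/2) * ln (real n) - real n))" by (simp only: exp_of_real)
  moreover have "Gamma (of_nat n) = complex_of_real (Gamma (real n))" using Gamma_complex_of_real[of "real n"] by simp
  ultimately have "Gquot (of_nat n) = of_real (Gamma (real n) / exp ((real n - 1/2) * ln (real n) - real n))"
    unfolding Gquot_def by (simp only: of_real_divide)
  moreover have "Gamma (real n) / exp ((real n - 1/2) * ln (real n) - real n) \<ge> 0" using False by simp
  ultimately show ?thesis by (simp only: norm_of_real abs_of_nonneg)
qed (simp add: Gquot_def)

text \<open>On Re z = 1/2 the conjugate of z is 1 - z, so the reflection formula gives the modulus
  of Gamma exactly.\<close>

lemma norm_Gquot_half:
  assumes "t > 0"
  shows "norm (Gquot (Complex (1/2) t)) ^ 2 = 2 * pi / (1 + exp (- 2 * pi * t)) * exp (1 - 2 * t * arctan (1 / (2 * t)))"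
proof -
  define z where "z = Complex (1/2) t"
  have c: "cnj z = 1 - z" by (simp add: z_def complex_eq_iff)
  have "of_real (norm (Gamma z) ^ 2) = Gamma z * cnj (Gamma z)" by (rule complex_norm_square)
  also have "\<dots> = of_real pi / sin (of_real pi * z)" unfolding cnj_Gamma c by (rule Gamma_reflection_complex)
  also have "of_real pi * z = of_real (pi / 2) + \<i> * of_real (pi * t)" by (simp add: z_def complex_eq_iff)
  also have "sin (of_real (pi / 2) + \<i> * of_real (pi * t)) = cos (\<i> * of_real (pi * t) :: complex)"
    unfolding sin_add by (simp flip: sin_of_real cos_of_real)
  also have "\<dots> = of_real ((exp (pi * t) + exp (- (pi * t))) / 2)"
    unfolding cos_exp_eq by (simp flip: exp_of_real)
  finally have G: "norm (Gamma z) ^ 2 = pi / ((exp (pi * t) + exp (- (pi * t))) / 2)"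
    unfolding of_real_divide[symmetric] by (simp only: of_real_eq_iff)
  have Az: "Arg z = pi / 2 - arctan (1 / (2 * t))"
  proof -
    have "Arg z = arctan (t / (1/2))" by (subst arg_conv_arctan) (auto simp: z_def)
    also have "t / (1/2) = 2 * t" by simp
    also have "arctan (2 * t) = pi / 2 - arctan (1 / (2 * t))"
    proof -
      have "arctan (1 / (2 * t)) = pi / 2 - arctan (2 * t)"
        using arctan_inverse[of "2 * t"] assms by (simp add: inverse_eq_divide mult.commute)
      then show ?thesis by linarith
    qed
    finally show ?thesis .
  qed
  have z0: "z \<noteq> 0" by (simp add: z_def complex_eq_iff)
  have "Re (stir z) = - t * Arg z - 1/2"
    using Ln_Arg[OF z0] by (simp add: stir_def z_def)
  then have "norm (exp (stir z)) ^ 2 = exp (2 * (- t * Arg z - 1/2))" by (simp only: norm_exp_eq_Re exp_double)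
  also have "2 * (- t * Arg z - 1/2) = - (pi * t) - (1 - 2 * t * arctan (1 / (2 * t)))" unfolding Az by (simp add: algebra_simps)
  finally have E: "norm (exp (stir z)) ^ 2 = exp (- (pi * t)) / exp (1 - 2 * t * arctan (1 / (2 * t)))" by (simp only: exp_diff)
  have "exp (pi * t) + exp (- (pi * t)) = exp (pi * t) * (1 + exp (- 2 * pi * t))" by (simp add: distrib_left flip: exp_add)
  then show ?thesis unfolding z_def[symmetric] Gquot_def norm_divide power_divide G E
    by (simp add: exp_minus field_simps)
qed

text \<open>The limit L is linked to \<open>Gquot z\<close> for every z with an explicit error. On
  the line Re z = 1/2 the modulus is known and the error vanishes as t grows, which forces L^2 = 2
  pi.\<close>

lemma Gquot_of_nat_tendsto: "(\<lambda>n. Gquot (of_nat n)) \<longlonglongrightarrow> of_real (sqrt (2 * pi))"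
proof -
  obtain L where L: "(\<lambda>n. Gquot (of_nat n)) \<longlonglongrightarrow> L"
  proof (rule stirling_aux[OF _ _ Gquot_of_nat_real])
    show "Re \<i> \<ge> 0" "Im \<i> \<noteq> 0" by auto
  qed
  have "(\<lambda>n. of_real (norm (Gquot (of_nat n))) :: complex) \<longlonglongrightarrow> of_real (norm L)"
    by (intro tendsto_intros L)
  \<comment> \<open>L is a nonnegative real, so its modulus determines it.\<close>
  then have Lr: "L = of_real (norm L)" unfolding Gquot_of_nat_real[symmetric] using L LIMSEQ_unique by blast
  define B where "B t = (1 / \<bar>t\<bar>\<^sup>2 + pi / (2 * \<bar>t\<bar>)) / 12" for t :: real
  define N where "N t = 2 * pi / (1 + exp (- 2 * pi * t)) * exp (1 - 2 * t * arctan (1 / (2 * t)))" for t :: real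
  have bds: "norm L ^ 2 \<le> N t * exp (2 * B t) \<and> N t * exp (- 2 * B t) \<le> norm L ^ 2" if t0: "t > 0" for t
  proof -
    define z where "z = Complex (1/2) t"
    obtain \<mu> where \<mu>: "(\<lambda>n. Gquot (of_nat n)) \<longlonglongrightarrow> Gquot z * exp (- \<mu>)" "norm \<mu> \<le> (1 / \<bar>Im z\<bar>\<^sup>2 + pi / (2 * \<bar>Im z\<bar>)) / 12"
    proof (rule stirling_aux[OF _ _ Gquot_of_nat_real])
      show "Re z \<ge> 0" "Im z \<noteq> 0" using t0 by (auto simp: z_def)
    qed
    have "norm \<mu> \<le> B t" using \<mu>(2) by (simp add: B_def z_def)
    then have "\<bar>Re \<mu>\<bar> \<le> B t" using abs_Re_le_cmod[of \<mu>] by linarith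
    then have e: "exp (- 2 * Re \<mu>) \<le> exp (2 * B t)" "exp (- 2 * B t) \<le> exp (- 2 * Re \<mu>)" by auto
    have "L = Gquot z * exp (- \<mu>)" using L \<mu>(1) LIMSEQ_unique by blast
    then have "norm L ^ 2 = N t * exp (- 2 * Re \<mu>)"
      using norm_Gquot_half[OF t0] by (simp add: norm_mult power_mult_distrib z_def N_def flip: exp_double)
    moreover have "N t \<ge> 0" by (auto simp: N_def add_pos_pos)
    ultimately show ?thesis using e by (simp add: mult_left_mono)
  qed
  have lims: "(\<lambda>n. N (real (Suc n)) * exp (2 * B (real (Suc n)))) \<longlonglongrightarrow> 2 * pi" "(\<lambda>n. N (real (Suc n)) * exp (- 2 * B (real (Suc n)))) \<longlonglongrightarrow> 2 * pi"
  proof -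
    have 1: "(\<lambda>n. exp (- 2 * pi * real (Suc n))) \<longlonglongrightarrow> 0" using pi_gt_zero by real_asymp
    have 2: "(\<lambda>n. 1 - 2 * real (Suc n) * arctan (1 / (2 * real (Suc n)))) \<longlonglongrightarrow> 0" by real_asymp
    have 3: "(\<lambda>n. B (real (Suc n))) \<longlonglongrightarrow> 0" unfolding B_def abs_of_nat by real_asymp
    have 4: "(\<lambda>n. N (real (Suc n))) \<longlonglongrightarrow> 2 * pi / (1 + 0) * exp 0"
      unfolding N_def by (intro tendsto_intros 1 2) simp
    have "(\<lambda>n. N (real (Suc n)) * exp (2 * B (real (Suc n)))) \<longlonglongrightarrow> (2 * pi / (1 + 0) * exp 0) * exp (2 * 0)"
      by (intro tendsto_mult[OF 4] tendsto_exp tendsto_mult[OF tendsto_const 3])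
    then show "(\<lambda>n. N (real (Suc n)) * exp (2 * B (real (Suc n)))) \<longlonglongrightarrow> 2 * pi" by simp
    have "(\<lambda>n. N (real (Suc n)) * exp (- 2 * B (real (Suc n)))) \<longlonglongrightarrow> (2 * pi / (1 + 0) * exp 0) * exp (- 2 * 0)"
      by (intro tendsto_mult[OF 4] tendsto_exp tendsto_mult[OF tendsto_const 3])
    then show "(\<lambda>n. N (real (Suc n)) * exp (- 2 * B (real (Suc n)))) \<longlonglongrightarrow> 2 * pi" by simp
  qed
  have "norm L ^ 2 \<le> 2 * pi" by (rule LIMSEQ_le_const[OF lims(1)]) (use bds in auto)
  moreover have "2 * pi \<le> norm L ^ 2" by (rule LIMSEQ_le_const2[OF lims(2)]) (use bds in auto)
  ultimately have "norm L ^ 2 = 2 * pi" by simp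
  then have "norm L = sqrt (2 * pi)" by (metis norm_ge_zero real_sqrt_unique)
  then show ?thesis using L Lr by simp
qed

theorem stirling:
  assumes "Re z \<ge> 0" "Im z \<noteq> 0"
  obtains \<mu> where "Gamma z = of_real (sqrt (2 * pi)) * exp (stir z + \<mu>)" 
     "norm \<mu> \<le> (1 / \<bar>Im z\<bar>\<^sup>2 + pi / (2 * \<bar>Im z\<bar>)) / 12"
proof -
  obtain \<mu> where \<mu>: "(\<lambda>n. Gquot (of_nat n)) \<longlonglongrightarrow> Gquot z * exp (- \<mu>)" "norm \<mu> \<le> (1 / \<bar>Im z\<bar>\<^sup>2 + pi / (2 * \<bar>Im z\<bar>)) / 12"
    using stirling_aux[OF assms Gquot_of_nat_real] by blast
  have "Gquot z * exp (- \<mu>) = of_real (sqrt (2 * pi))" using \<mu>(1) Gquot_of_nat_tendsto LIMSEQ_unique by blast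
  then have "Gamma z = of_real (sqrt (2 * pi)) * exp (stir z + \<mu>)"
    by (simp add: Gquot_def exp_minus exp_add field_simps)
  then show ?thesis using \<mu>(2) that by blast
qed

section \<open>Stirling's formula for chi\<close>

lemma exp_mult5: "exp a * exp b * (exp c * w) * (exp d * exp e) = exp (a + b + c + d + e) * w" for a b c d e w :: complex
proof -
  have "exp (a + b + c + d + e) = exp a * exp b * exp c * exp d * exp e" unfolding exp_add ..
  then show ?thesis by (simp only: mult.assoc mult.commute[of w] mult.left_commute[of w])
qed

text \<open>The sine supplies exp (- i pi s / 2) (1 - exp (i pi s)) up to a constant, the last
  factor being close to 1 for t > 0. With 1 - s = - i t (1 + w), w = i (1 - \<sigma>) / t, the
  explicit exponents assemble to \<open>chi_tilde\<close>; R collects (1/2 - s) Ln (1 + w) - (1 -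
  \<sigma>) and Binet's correction.\<close>

lemma chi_stirling:
  assumes \<sigma>: "0 \<le> \<sigma>" "\<sigma> \<le> 1" and t: "t \<ge> 2 * pi"
  obtains R where "chi (Complex \<sigma> t) = chi_tilde \<sigma> t * (exp R * (1 - exp (\<i> * of_real pi * Complex \<sigma> t)))"
    "Re R \<le> 1/30" "norm R \<le> 2/5"
proof -
  have tp: "t > 6" using t pi_gt_157_50 by linarith
  define s where "s = Complex \<sigma> t"
  define z where "z = 1 - s"
  define \<beta> where "\<beta> = 1 - \<sigma>"
  have \<beta>: "0 \<le> \<beta>" "\<beta> \<le> 1" using \<sigma> by (auto simp: \<beta>_def)
  have z: "Re z = \<beta>" "Im z = - t" by (auto simp: z_def s_def \<beta>_def)
  obtain \<mu> where \<mu>: "Gamma z = of_real (sqrt (2 * pi)) * exp (stir z + \<mu>)" 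
     "norm \<mu> \<le> (1 / \<bar>Im z\<bar>\<^sup>2 + pi / (2 * \<bar>Im z\<bar>)) / 12"
  proof (rule stirling)
    show "Re z \<ge> 0" "Im z \<noteq> 0" using z \<beta> tp by auto
  qed
  have \<mu>b: "norm \<mu> \<le> 1/40"
  proof -
    have "6 * 6 \<le> t * t" using tp by (intro mult_mono) auto
    then have "36 \<le> t^2" by (simp add: power2_eq_square)
    then have "1 / t^2 \<le> 1 / 36" using tp by (simp add: field_simps)
    moreover have "pi / (2 * t) \<le> 1 / 4" using t tp by (simp add: field_simps)
    ultimately have "(1 / t\<^sup>2 + pi / (2 * t)) / 12 \<le> (1/36 + 1/4) / 12" by (intro divide_right_mono add_mono) auto
    then show ?thesis using \<mu>(2) z tp by simp
  qed
  define w where "w = \<i> * of_real (\<beta> / t)"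
  have nw: "norm w = \<beta> / t" using \<beta> tp by (simp add: w_def norm_mult norm_divide)
  have w6: "norm w \<le> 1/6" unfolding nw using \<beta> tp by (simp add: field_simps)
  have zw: "z = of_real t * (- \<i> * (1 + w))" using tp z by (simp add: w_def complex_eq_iff)
  have nz: "1 + w \<noteq> 0" "- \<i> * (1 + w) \<noteq> 0" by (auto simp: w_def complex_eq_iff)
  have Arg1: "Im (Ln (1 + w)) = arctan (\<beta> / t)"
    using Arg_eq_Im_Ln[OF nz(1)] arg_conv_arctan[of "1 + w"] by (simp add: w_def)
  have Lnz: "Ln z = of_real (ln t) - \<i> * of_real (pi / 2) + Ln (1 + w)"
  proof -
    have "Ln (- \<i> * (1 + w)) = Ln (- \<i>) + Ln (1 + w)"
    proof (rule Ln_times_simple)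
      have "0 \<le> arctan (\<beta> / t)" "arctan (\<beta> / t) < pi / 2" using \<beta> tp arctan_ubound by auto
      moreover have Im1: "Im (Ln (- \<i>)) = - (pi / 2)" by simp
      ultimately show "- pi < Im (Ln (- \<i>)) + Im (Ln (1 + w))" "Im (Ln (- \<i>)) + Im (Ln (1 + w)) \<le> pi"
        using Im1 pi_gt_zero unfolding Arg1 by linarith+
    qed (use nz in auto)
    then show ?thesis unfolding zw using Ln_times_of_real[of t "- \<i> * (1 + w)"] nz tp by (simp add: Ln_of_real)
  qed
  define R where "R = (1/2 - s) * Ln (1 + w) - of_real \<beta> + \<mu>"
  have main: "chi s = chi_tilde \<sigma> t * (exp R * (1 - exp (\<i> * of_real pi * s)))"
  proof -
    define l where "l = complex_of_real (ln 2)"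
    define p where "p = complex_of_real (ln pi)"
    define T where "T = complex_of_real (ln t)"
    define P where "P = complex_of_real pi"
    have c1: "2 powr s = exp (s * l)" by (simp add: powr_def l_def Ln_of_real[of 2, simplified])
    have c2: "of_real pi powr (s - 1) = exp ((s - 1) * p)" by (simp add: powr_def p_def Ln_of_real)
    have c3: "sin (of_real pi * s / 2) = exp (\<i> * P / 2 - l - \<i> * P * s / 2) * (1 - exp (\<i> * of_real pi * s))"
    proof -
      define q where "q = exp (\<i> * P * s / 2)"
      have q0: "q \<noteq> 0" by (simp add: q_def)
      have e1: "exp (\<i> * P / 2) = \<i>" using cis_conv_exp[of "pi / 2"] by (simp add: P_def)
      have e2: "exp l = 2" by (simp add: l_def exp_of_real)
      have "exp (\<i> * P / 2 - l - \<i> * P * s / 2) = exp (\<i> * P / 2) / exp l / q" by (simp only: exp_diff q_def)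
      then have e3: "exp (\<i> * P / 2 - l - \<i> * P * s / 2) = \<i> / 2 / q" unfolding e1 e2 .
      have e4: "exp (\<i> * of_real pi * s) = q * q" unfolding q_def exp_add[symmetric] by (simp add: P_def mult_ac)
      have e5: "exp (\<i> * (of_real pi * s / 2)) = q" by (simp add: q_def P_def mult_ac)
      have e6: "exp (- (\<i> * (of_real pi * s / 2))) = 1 / q" unfolding exp_minus e5 by (simp add: inverse_eq_divide)
      show ?thesis unfolding sin_exp_eq e5 e6 e3 e4 using q0 by (simp add: field_simps)
    qed
    have c4: "of_real (sqrt (2 * pi)) = exp (l / 2 + p / 2)"
    proof -
      have 0: "ln (sqrt (2 * pi)) = ln 2 / 2 + ln pi / 2" by (simp add: ln_sqrt ln_mult add_divide_distrib)
      have "sqrt (2 * pi) = exp (ln (sqrt (2 * pi)))" by (simp add: pi_gt_zero)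
      then have 1: "sqrt (2 * pi) = exp (ln 2 / 2 + ln pi / 2)" unfolding 0 .
      show ?thesis unfolding 1 exp_of_real[symmetric] by (simp add: l_def p_def)
    qed
    have st: "stir z + \<mu> = (1/2 - s) * T - (1/2 - s) * \<i> * P / 2 + \<i> * of_real t + R"
    proof -
      have z1: "z - 1/2 = 1/2 - s" by (simp add: z_def)
      have z2: "z = of_real \<beta> - \<i> * of_real t" using z by (simp add: complex_eq_iff)
      have "stir z = (1/2 - s) * Ln z - (of_real \<beta> - \<i> * of_real t)" unfolding stir_def z1 using z2 by simp
      then show ?thesis unfolding Lnz R_def by (simp add: T_def P_def algebra_simps)
    qed
    have ct: "chi_tilde \<sigma> t = exp ((of_real \<sigma> - 1/2) * (l + p - T) - \<i> * of_real t * (T - l - p - 1) + \<i> * P / 4)"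
    proof -
      have "of_real ((2 * pi / \<bar>t\<bar>) powr (\<sigma> - 1 / 2)) = exp ((of_real \<sigma> - 1/2) * (l + p - T))"
      proof -
        have ll: "ln (2 * pi / t) = ln 2 + ln pi - ln t" using tp by (simp add: ln_div ln_mult)
        have "(2 * pi / \<bar>t\<bar>) powr (\<sigma> - 1 / 2) = exp ((\<sigma> - 1/2) * (ln 2 + ln pi - ln t))"
          unfolding ll[symmetric] using tp by (simp add: powr_def)
        then show ?thesis by (simp add: l_def p_def T_def exp_of_real[symmetric])
      qed
      moreover have "of_real (\<bar>t\<bar> / (2 * pi * exp 1)) powr (- \<i> * of_real t) = exp (- (\<i> * of_real t * (T - l - p - 1)))"
      proof -
        define c where "c = \<bar>t\<bar> / (2 * pi * exp 1)"
        have c0: "c > 0" using tp by (simp add: c_def)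
        have lc: "ln c = ln t - ln 2 - ln pi - 1" using tp by (simp add: c_def ln_div ln_mult)
        have "of_real c powr (- \<i> * of_real t) = exp (- \<i> * of_real t * of_real (ln c))"
          using c0 by (simp add: powr_def Ln_of_real)
        also have "- \<i> * of_real t * of_real (ln c) = - (\<i> * of_real t * (T - l - p - 1))"
          unfolding lc by (simp add: l_def p_def T_def)
        finally show ?thesis unfolding c_def .
      qed
      moreover have "exp (of_real (sgn t) * of_real pi * \<i> / 4) = exp (\<i> * P / 4)" using tp by (simp add: P_def mult.commute)
      ultimately have "chi_tilde \<sigma> t = exp ((of_real \<sigma> - 1/2) * (l + p - T)) * exp (- (\<i> * of_real t * (T - l - p - 1))) * exp (\<i> * P / 4)"
        unfolding chi_tilde_def by (simp only:)
      then show ?thesis by (simp only: exp_add exp_diff exp_minus divide_inverse)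
    qed
    define X where "X = (of_real \<sigma> - 1/2) * (l + p - T) - \<i> * of_real t * (T - l - p - 1) + \<i> * P / 4"
    have e1: "chi s = 2 powr s * of_real pi powr (s - 1) * sin (of_real pi * s / 2) * Gamma z"
      by (simp only: chi_def z_def)
    have e2: "chi s = exp (s * l) * exp ((s - 1) * p) * (exp (\<i> * P / 2 - l - \<i> * P * s / 2) * (1 - exp (\<i> * of_real pi * s))) * (exp (l / 2 + p / 2) * exp (stir z + \<mu>))"
      unfolding e1 c1 c2 c3 \<mu>(1) c4 by (rule refl)
    have e3: "chi s = exp (s * l + (s - 1) * p + (\<i> * P / 2 - l - \<i> * P * s / 2) + (l / 2 + p / 2) + (stir z + \<mu>)) * (1 - exp (\<i> * of_real pi * s))"
      unfolding e2 by (rule exp_mult5)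
    have e4: "s * l + (s - 1) * p + (\<i> * P / 2 - l - \<i> * P * s / 2) + (l / 2 + p / 2) + (stir z + \<mu>) = X + R"
    proof -
      have s: "s = of_real \<sigma> + \<i> * of_real t" unfolding s_def by (rule Complex_eq)
      define l2 p2 T2 P4 where "l2 = l / 2" "p2 = p / 2" "T2 = T / 2" "P4 = P / 4"
      have d: "l = 2 * l2" "p = 2 * p2" "T = 2 * T2" "P = 4 * P4" by (simp_all add: l2_p2_T2_P4_def)
      show ?thesis unfolding st X_def unfolding s unfolding d by (simp add: field_simps)
    qed
    have e5: "chi_tilde \<sigma> t = exp X" unfolding ct X_def by (rule refl)
    show ?thesis unfolding e3 e4 e5 exp_add[of X R] by (rule mult.assoc)
  qed
  have hs: "Re (1/2 - s) = 1/2 - \<sigma>" "Im (1/2 - s) = - t" by (simp_all add: s_def)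
  \<comment> \<open>The bound t arctan (\<beta> / t) \<le> \<beta> cancels - \<beta>; 1/30 covers
    1/144 for the logarithm and 1/40 for \<mu>.\<close>
  have ReR: "Re R \<le> 1/30"
  proof -
    have "Re R = (1/2 - \<sigma>) * ln (norm (1 + w)) + t * arctan (\<beta> / t) - \<beta> + Re \<mu>"
      unfolding R_def using hs nz Arg1 by simp
    moreover have "t * arctan (\<beta> / t) \<le> \<beta>"
      using arctan_le_self[of "\<beta> / t"] \<beta> tp by (simp add: field_simps)
    moreover have "(1/2 - \<sigma>) * ln (norm (1 + w)) \<le> 1/2 * (1/72)"
    proof -
      have "norm (1 + w) = sqrt (1 + (\<beta> / t)\<^sup>2)" by (simp add: w_def cmod_def)
      then have l: "ln (norm (1 + w)) = ln (1 + (\<beta> / t)\<^sup>2) / 2" by (simp add: ln_sqrt add_pos_nonneg)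
      have "ln (1 + (\<beta> / t)\<^sup>2) \<le> (\<beta> / t)\<^sup>2" by (rule ln_add_one_self_le_self) simp
      also have "(\<beta> / t)\<^sup>2 \<le> (1/6)\<^sup>2" using w6 \<beta> tp unfolding nw by (intro power_mono) auto
      finally have "ln (norm (1 + w)) \<le> 1/72" "ln (norm (1 + w)) \<ge> 0" unfolding l by (auto simp: power2_eq_square)
      moreover have "1/2 - \<sigma> \<le> 1/2" using \<sigma> by simp
      ultimately show ?thesis by (meson mult_mono order_trans mult_right_mono mult_left_mono zero_le_divide_1_iff zero_le_numeral)
    qed
    moreover have "Re \<mu> \<le> 1/40" using \<mu>b complex_Re_le_cmod[of \<mu>] by linarith
    ultimately show ?thesis by linarith
  qed
  have nR: "norm R \<le> 2/5"
  proof -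
    \<comment> \<open>(1/2 - s) w equals \<beta> up to a term of order 1 / t, so only the quadratic
      part of the logarithm is multiplied by something of size t.\<close>
    have "R = (1/2 - s) * (Ln (1 + w) - w) + \<i> * of_real ((1/2 - \<sigma>) * \<beta> / t) + \<mu>"
      using tp by (simp add: R_def w_def s_def complex_eq_iff algebra_simps diff_divide_distrib add_divide_distrib)
    also have "norm \<dots> \<le> norm ((1/2 - s) * (Ln (1 + w) - w)) + norm (\<i> * of_real ((1/2 - \<sigma>) * \<beta> / t) :: complex) + norm \<mu>"
      by (intro norm_triangle_mono order_refl)
    also have "norm (\<i> * of_real ((1/2 - \<sigma>) * \<beta> / t) :: complex) \<le> 1/12"
    proof -
      have "\<bar>1/2 - \<sigma>\<bar> \<le> 1/2" using \<sigma> unfolding abs_le_iff by linarith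
      then have "\<bar>1/2 - \<sigma>\<bar> * (\<beta> / t) \<le> (1/2) * (1/6)" using w6 \<beta> tp unfolding nw by (intro mult_mono) auto
      moreover have "norm (\<i> * of_real r :: complex) = \<bar>r\<bar>" for r unfolding norm_mult norm_of_real by simp
      moreover have "\<bar>(1/2 - \<sigma>) * \<beta> / t\<bar> = \<bar>1/2 - \<sigma>\<bar> * (\<beta> / t)" using \<beta> tp by (simp add: abs_mult)
      ultimately show ?thesis by (simp only:)
    qed
    also have "norm ((1/2 - s) * (Ln (1 + w) - w)) \<le> (1/2 + t) * ((6/5) * (1 / t) * (1/6))"
      unfolding norm_mult
    proof (intro mult_mono)
      show "norm (1/2 - s) \<le> 1/2 + t" using cmod_le[of "1/2 - s"] hs \<sigma> tp by auto
      have "norm (Ln (1 + w) - w) \<le> norm w ^ 2 / (1 - norm w)" using Ln_approx_linear[of w] w6 by simp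
      also have "\<dots> \<le> norm w ^ 2 / (5/6)" using w6 by (intro divide_left_mono) auto
      also have "\<dots> = (6/5) * norm w * norm w" by (simp add: power2_eq_square)
      also have "\<dots> \<le> (6/5) * (1 / t) * (1/6)" using w6 \<beta> tp unfolding nw by (intro mult_mono divide_right_mono) auto
      finally show "norm (Ln (1 + w) - w) \<le> (6/5) * (1 / t) * (1/6)" .
    qed (use tp in auto)
    also have "(1/2 + t) * ((6/5) * (1 / t) * (1/6)) \<le> 1/5 + 1/60" using tp by (simp add: field_simps)
    finally show ?thesis using \<mu>b by simp
  qed
  show ?thesis using that[OF main[unfolded s_def] ReR nR] .
qed

section \<open>Comparison with the stated bound\<close>

text \<open>The expansion at 0 is 1/s + 1/2 + s/12 - ...; lowering 1/12 to 3/50 makes the bound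
  valid up to 63/40, which exceeds pi / 2.\<close>

lemma geometric_factor_ge:
  fixes s :: real
  assumes s: "0 < s" "s \<le> 63/40"
  shows "1 / (1 - exp (- s)) \<ge> 1 / s + 1/2 + 3/50 * s"
proof -
  define Q where "Q = 1 - s/2 + s^2/6 - s^3/24 + s^4/120"
  have e: "0 < 1 - exp (- s)" using s by simp
  have u: "1 - exp (- s) \<le> s * Q" using exp_neg_bounds(1)[of s] s
    by (simp add: Q_def numeral_eq_Suc algebra_simps)
  have "(1 + s / 2 + 3 / 50 * s ^ 2) * Q = 1 + s ^ 2 * (7 / 600 * s - 7 / 300 - s ^ 2 / 400 + s ^ 3 / 600 + s ^ 4 / 2000)"
    by (simp add: Q_def numeral_eq_Suc algebra_simps)
  also have "\<dots> \<le> 1"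
  proof -
    have "(s - 63/40)^2 \<ge> 0" by simp
    then have sq: "s^2 \<ge> 63/20 * s - 3969/1600" by (simp add: power2_eq_square field_simps)
    have "s * s \<le> 63/40 * (63/40)" using s by (intro mult_mono) auto
    then have s2: "s^2 \<le> (63/40)^2" by (simp add: power2_eq_square)
    have "s^2 * s \<le> (63/40)^2 * s" using s s2 by (intro mult_right_mono) auto
    then have s3: "s^3 \<le> 3969/1600 * s" by (simp add: numeral_eq_Suc field_simps)
    have "s^2 * s^2 \<le> (63/40)^2 * ((63/40) * s)" using s s2 by (intro mult_mono) (auto simp: power2_eq_square)
    then have s4: "s^4 \<le> 250047/64000 * s" by (simp add: numeral_eq_Suc field_simps)
    have "7/600 * s - 7/300 - s^2/400 + s^3/600 + s^4/2000 \<le> 0"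
      using s s3 s4 sq by linarith
    then show ?thesis by (simp add: mult_nonneg_nonpos)
  qed
  finally have "(1 + s/2 + 3/50 * s^2) * Q \<le> 1" .
  moreover have "(1 / s + 1/2 + 3/50 * s) * (1 - exp (- s)) \<le> (1 / s + 1/2 + 3/50 * s) * (s * Q)"
    using u s by (intro mult_left_mono) auto
  moreover have "(1 / s + 1/2 + 3/50 * s) * (s * Q) = (1 + s/2 + 3/50 * s^2) * Q"
    using s by (simp add: field_simps power2_eq_square)
  ultimately have "(1 / s + 1/2 + 3/50 * s) * (1 - exp (- s)) \<le> 1" by linarith
  then show ?thesis using e by (simp add: pos_le_divide_eq)
qed

section \<open>Reduction of the comparison to linear inequalities\<close>

lemma square_tangent: "s^2 \<ge> 2 * c * s - c^2" for s c :: real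
  using zero_le_power2[of "s - c"] by (simp add: power2_eq_square algebra_simps)

lemma cube_tangent:
  fixes s c :: real assumes "s \<ge> 0" "c \<ge> 0"
  shows "s^3 \<ge> 3 * c^2 * s - 2 * c^3"
proof -
  have "0 \<le> (s - c)^2 * (s + 2 * c)" using assms by simp
  then show ?thesis by (simp add: power2_eq_square power3_eq_cube algebra_simps)
qed

text \<open>The comparison is made affine in h and in v, so that checks at the endpoints
  suffice.\<close>

lemma affine_nonneg:
  fixes h u v :: real
  assumes "0 \<le> h" "h \<le> 1" "u \<ge> 0" "u + v \<ge> 0"
  shows "u + v * h \<ge> 0"
proof -
  have "0 \<le> (1 - h) * u + h * (u + v)" using assms by simp
  then show ?thesis by (simp add: algebra_simps)
qed

text \<open>Multiplication by s turns the lower bound for A into a cubic in s, which tangent lines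
  then settle.\<close>

lemma factor_poly_ge:
  fixes s A a b K :: real
  assumes s: "0 < s" and A: "A \<ge> 1 / s + 1/2 + 3/50 * s"
    and ab: "a \<ge> 0" "b \<ge> 0"
    and pos: "a - (K - b - a/2) * s + (b/2 + 3/50*a) * s^2 + 3/50 * b * s^3 \<ge> 0"
  shows "A * (a + b * s) \<ge> K"
proof -
  have "(1 / s + 1/2 + 3/50 * s) * (a + b * s) - K = (a - (K - b - a/2) * s + (b/2 + 3/50*a) * s^2 + 3/50 * b * s^3) / s"
    using s by (simp add: field_simps power2_eq_square power3_eq_cube)
  also have "\<dots> \<ge> 0" using pos s by simp
  finally have "K \<le> (1 / s + 1/2 + 3/50 * s) * (a + b * s)" by simp
  also have "\<dots> \<le> A * (a + b * s)" using A ab s by (intro mult_right_mono) auto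
  finally show ?thesis .
qed

text \<open>Here s stands for r0 / sqrt 2 and v for 2^(1 - \<sigma>) - 1; (1 + v) F1 and F2 are
  lower bounds for the two summands of \<open>E2\<close> times 2^(- \<sigma>). With v and h each
  reduced to its endpoints, four polynomial inequalities in s remain. The factor 1035/1000 is the
  price of passing through \<open>chi\<close>.\<close>

lemma budget:
  fixes s A h f B0 v F1 F2 :: real
  assumes s: "0 < s" "s \<le> pi / 2" and A: "A = 1 / (1 - exp (- s))" and h: "0 \<le> h" "h \<le> 1" and f: "0 \<le> f" "f < 1"
    and v: "0 \<le> v" "v \<le> 1"
    and F1: "F1 = A * exp (sqrt 2 * s * f) / sqrt 2" and F2: "F2 \<ge> s * A * h / 2 * exp (s^2 * h^2 / (2 * pi))"
    and B: "f < 2/5 \<Longrightarrow> B0 \<le> 7072/10000 + 113/100 * h + 65/100 * f * h" "f \<ge> 2/5 \<Longrightarrow> B0 \<le> 138/100 + 116/100 * h"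
    and B0: "B0 \<ge> 0"
  shows "1035/1000 * ((1 + v/2) * B0) \<le> (1 + v) * F1 + F2"
proof -
  have s1: "s \<le> 63/40" using s pi_lt_63_20 by linarith
  have A1: "A \<ge> 1 / s + 1/2 + 3/50 * s" unfolding A by (rule geometric_factor_ge[OF s(1) s1])
  have Ap: "A > 0" using s by (simp add: A)
  have sA: "s * A \<ge> 1"
  proof -
    have "s * (1 / s) \<le> s * A" using A1 s by (intro mult_left_mono) auto
    then show ?thesis using s by simp
  qed
  have r2: "1 / sqrt 2 \<ge> 7071/10000"
  proof -
    have "sqrt 2 * sqrt 2 = (2::real)" by simp
    then have "1 / sqrt 2 = sqrt 2 / 2" by (simp add: field_simps)
    then show ?thesis using sqrt2_bounds(1) by linarith
  qed
  have F2a: "F2 \<ge> A * (s * h / 2 + 395/10000 * s^3 * (3 * h - 1) / 2)" and F2b: "F2 \<ge> A * (s * h / 2)"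
  proof -
    have sh: "0 \<le> s * A * h / 2" using s Ap h by simp
    have "1 \<le> exp (s^2 * h^2 / (2 * pi))" by simp
    then have "s * A * h / 2 * 1 \<le> s * A * h / 2 * exp (s^2 * h^2 / (2 * pi))" using sh by (intro mult_left_mono) auto
    then show "F2 \<ge> A * (s * h / 2)" using F2 by (simp add: mult_ac)
    have "s^2 * h^2 * (158/1000) \<le> s^2 * h^2 * (1 / (2 * pi))"
      using pi_lt_63_20 by (intro mult_left_mono) (auto simp: field_simps)
    also have "1 + s^2 * h^2 * (1 / (2 * pi)) \<le> exp (s^2 * h^2 / (2 * pi))" using exp_ge_add_one_self[of "s^2 * h^2 / (2 * pi)"] by simp
    finally have "1 + s^2 * h^2 * (158/1000) \<le> exp (s^2 * h^2 / (2 * pi))" by simp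
    then have "s * A * h / 2 * (1 + s^2 * h^2 * (158/1000)) \<le> s * A * h / 2 * exp (s^2 * h^2 / (2 * pi))" using sh by (rule mult_left_mono)
    then have "s * A * h / 2 * (1 + s^2 * h^2 * (158/1000)) \<le> F2" using F2 by linarith
    moreover have "s * A * h / 2 * (1 + s^2 * h^2 * (158/1000)) = A * (s * h / 2 + 79/1000 * s^3 * h^3)"
      by (simp add: power2_eq_square power3_eq_cube algebra_simps)
    \<comment> \<open>The tangent to h^3 at 1/2, which makes the bound affine in h.\<close>
    moreover have "h^3 \<ge> 3/4 * h - 1/4" using cube_tangent[of h "1/2"] h by (simp add: power2_eq_square power3_eq_cube)
    then have "79/1000 * s^3 * h^3 \<ge> 79/1000 * s^3 * (3/4 * h - 1/4)" using s by (intro mult_left_mono) auto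
    then have "A * (s * h / 2 + 79/1000 * s^3 * h^3) \<ge> A * (s * h / 2 + 395/10000 * s^3 * (3 * h - 1) / 2)"
      using Ap by (intro mult_left_mono) (auto simp: algebra_simps)
    ultimately show "F2 \<ge> A * (s * h / 2 + 395/10000 * s^3 * (3 * h - 1) / 2)" by linarith
  qed
  \<comment> \<open>The endpoints v = 0 and v = 1, that is \<sigma> = 1 and \<sigma> = 0.\<close>
  have ends: ?thesis if "1035/1000 * B0 \<le> F1 + F2" "1035/1000 * (3/2 * B0) \<le> 2 * F1 + F2"
  proof -
    have "0 \<le> (F1 + F2 - 1035/1000 * B0) + (F1 - 1035/2000 * B0) * v"
      using v that by (intro affine_nonneg) auto
    then show ?thesis by (simp add: algebra_simps)
  qed
  show ?thesis
  proof (cases "f < 2/5")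
    case True
    have F1': "F1 \<ge> A * (7071/10000 + s * f)"
    proof -
      have "1 + sqrt 2 * s * f \<le> exp (sqrt 2 * s * f)" by (rule exp_ge_add_one_self)
      then have "A * (1 + sqrt 2 * s * f) / sqrt 2 \<le> F1" unfolding F1 using Ap by (intro divide_right_mono mult_left_mono) auto
      moreover have "A * (1 + sqrt 2 * s * f) / sqrt 2 = A * (1 / sqrt 2 + s * f)" by (simp add: field_simps)
      moreover have "A * (1 / sqrt 2 + s * f) \<ge> A * (7071/10000 + s * f)" using Ap r2 by (intro mult_left_mono) auto
      ultimately show ?thesis by linarith
    qed
    \<comment> \<open>This pays for the summand 65/100 f h of the bound.\<close>
    have asf: "A * s * f \<ge> f" using sA f mult_right_mono[of 1 "s * A" f] by (simp add: mult_ac)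
    have fh: "f * h \<le> f" using f h by (simp add: mult_left_le)
    have s3: "s^3 \<le> 2481/1000 * s"
    proof -
      have "s * s \<le> 63/40 * (63/40)" using s s1 by (intro mult_mono) auto
      then have "s * s * s \<le> 2481/1000 * s" using s by (intro mult_right_mono) auto
      then show ?thesis by (simp add: power3_eq_cube)
    qed
    \<comment> \<open>The corners: \<open>e0\<close> is h = 0 and \<open>e1\<close> is h = 1 at v =
      0, \<open>e3\<close> and \<open>e2\<close> are h = 0 and h = 1 at v = 1.\<close>
    have e0: "A * (7071/10000 - 395/20000 * s^3) \<ge> 74/100"
    proof -
      have "7071/10000 - 395/20000 * s^3 \<ge> 629/1000" using s3 s1 by linarith
      moreover have "A \<ge> 122/100"
      proof -
        have "(63/40 - s)^2 \<ge> 0" by simp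
        then have "1 / s \<ge> 80/63 - (40/63)^2 * s" using s by (simp add: field_simps power2_eq_square)
        then show ?thesis using A1 s1 s by (simp add: power2_eq_square)
      qed
      ultimately have "122/100 * (629/1000) \<le> A * (7071/10000 - 395/20000 * s^3)" by (intro mult_mono) auto
      then show ?thesis by simp
    qed
    have e1: "A * (7071/10000 + s/2 + 395/10000 * s^3) \<ge> 1902/1000"
    proof -
      have c: "s^3 \<ge> 432/100 * s - 3456/1000" using cube_tangent[of s "6/5"] s by (simp add: power2_eq_square power3_eq_cube)
      have "A * (57058/100000 + 67064/100000 * s) \<ge> 1902/1000"
      proof (rule factor_poly_ge[OF s(1) A1])
        show "57058/100000 - (1902/1000 - 67064/100000 - 57058/100000/2) * s + (67064/100000/2 + 3/50*(57058/100000)) * s^2 + 3/50 * (67064/100000) * s^3 \<ge> 0"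
          using c square_tangent[of "105/100" s] s s1 by (simp add: power2_eq_square)
      qed auto
      also have "A * (57058/100000 + 67064/100000 * s) \<le> A * (7071/10000 + s/2 + 395/10000 * s^3)"
        using Ap c by (intro mult_left_mono) auto
      finally show ?thesis .
    qed
    have e2: "A * (14142/10000 + s/2 + 395/10000 * s^3) \<ge> 2853/1000"
    proof -
      have c: "s^3 \<ge> 432/100 * s - 3456/1000" using cube_tangent[of s "6/5"] s by (simp add: power2_eq_square power3_eq_cube)
      have c': "s^3 \<ge> 675/100 * s - 675/100" using cube_tangent[of s "3/2"] s by (simp add: power2_eq_square power3_eq_cube)
      have "A * (127768/100000 + 67064/100000 * s) \<ge> 2853/1000"
      proof (rule factor_poly_ge[OF s(1) A1])
        show "127768/100000 - (2853/1000 - 67064/100000 - 127768/100000/2) * s + (67064/100000/2 + 3/50*(127768/100000)) * s^2 + 3/50 * (67064/100000) * s^3 \<ge> 0"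
          using c' square_tangent[of "154/100" s] s s1 by (simp add: power2_eq_square)
      qed auto
      also have "A * (127768/100000 + 67064/100000 * s) \<le> A * (14142/10000 + s/2 + 395/10000 * s^3)"
        using Ap c by (intro mult_left_mono) auto
      finally show ?thesis .
    qed
    have q: "F1 + F2 \<ge> A * (7071/10000 - 395/20000 * s^3) + (A * (7071/10000 + s/2 + 395/10000 * s^3) - A * (7071/10000 - 395/20000 * s^3)) * h + A * s * f"
      using F1' F2a by (simp add: algebra_simps diff_divide_distrib add_divide_distrib)
    have q2: "2 * F1 + F2 \<ge> A * (14142/10000 - 395/20000 * s^3) + (A * (14142/10000 + s/2 + 395/10000 * s^3) - A * (14142/10000 - 395/20000 * s^3)) * h + 2 * (A * s * f)"
      using F1' F2a by (simp add: algebra_simps diff_divide_distrib add_divide_distrib)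
    have e3: "A * (14142/10000 - 395/20000 * s^3) \<ge> 148/100" 
    proof -
      have "A * (14142/10000 - 395/20000 * s^3) = A * (7071/10000 - 395/20000 * s^3) + A * (7071/10000)" by (simp add: algebra_simps)
      moreover have "A * (7071/10000) \<ge> A * (7071/10000 - 395/20000 * s^3)" using Ap s by (intro mult_left_mono) auto
      ultimately show ?thesis using e0 by linarith
    qed
    have b: "B0 \<le> 7072/10000 + 113/100 * h + 65/100 * f" using B(1)[OF True] fh by linarith
    have "0 \<le> (A * (7071/10000 - 395/20000 * s^3) - 1035/1000 * (7072/10000)) + ((A * (7071/10000 + s/2 + 395/10000 * s^3) - A * (7071/10000 - 395/20000 * s^3)) - 1035/1000 * (113/100)) * h"
      using e0 e1 h by (intro affine_nonneg) auto
    moreover have "0 \<le> (A * (14142/10000 - 395/20000 * s^3) - 1035/1000 * (3/2 * (7072/10000))) + ((A * (14142/10000 + s/2 + 395/10000 * s^3) - A * (14142/10000 - 395/20000 * s^3)) - 1035/1000 * (3/2 * (113/100))) * h"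
      using e3 e2 h by (intro affine_nonneg) auto
    ultimately show ?thesis using q q2 b asf f by (intro ends) (simp_all add: algebra_simps)
  next
    case False
    then have f5: "2/5 \<le> f" by simp
    \<comment> \<open>The exponential is taken at the smallest f, namely 2/5, and expanded to second
      order.\<close>
    have F1': "F1 \<ge> A * (7071/10000 + 399/1000 * s + 113/1000 * s^2)"
    proof -
      have "sqrt 2 * s * (2/5) \<le> sqrt 2 * s * f" using f5 s by (intro mult_left_mono) auto
      moreover have "14142/10000 * s \<le> sqrt 2 * s" using sqrt2_bounds s by (intro mult_right_mono) auto
      ultimately have l: "56568/100000 * s \<le> sqrt 2 * s * f" by linarith
      define u where "u = 56568/100000 * s"
      have "1 + u + u^2/2 \<le> exp u" using s by (intro exp_lower_Taylor_quadratic) (simp add: u_def)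
      also have "\<dots> \<le> exp (sqrt 2 * s * f)" using l by (simp add: u_def)
      finally have m: "1 + u + u^2/2 \<le> exp (sqrt 2 * s * f)" .
      have "A * (7071/10000 + 399/1000 * s + 113/1000 * s^2) \<le> A * (7071/10000 * (1 + u + u^2/2))"
      proof (rule mult_left_mono)
        have "7071/10000 * (1 + u + u^2/2) = 7071/10000 + 7071 * 56568/1000000000 * s + 7071/20000 * (56568/100000 * (56568/100000)) * s^2"
          by (simp add: u_def power2_eq_square field_simps)
        then show "7071/10000 + 399/1000 * s + 113/1000 * s^2 \<le> 7071/10000 * (1 + u + u^2/2)"
          using s zero_le_power2[of s] by linarith
      qed (use Ap in simp)
      also have "\<dots> \<le> A * (1 / sqrt 2 * exp (sqrt 2 * s * f))" using Ap m r2 s by (intro mult_left_mono mult_mono) (auto simp: u_def)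
      also have "\<dots> = F1" by (simp add: F1)
      finally show ?thesis .
    qed
    have sq: "s^2 \<ge> 18/10 * s - 81/100" using square_tangent[of "9/10" s] by (simp add: power2_eq_square)
    have cu: "s^3 \<ge> 243/100 * s - 1458/1000" using cube_tangent[of s "9/10"] s by (simp add: power2_eq_square power3_eq_cube)
    have e0: "A * (7071/10000 + 399/1000 * s) \<ge> 1429/1000"
    proof (rule factor_poly_ge[OF s(1) A1])
      show "7071/10000 - (1429/1000 - 399/1000 - 7071/10000/2) * s + (399/1000/2 + 3/50*(7071/10000)) * s^2 + 3/50 * (399/1000) * s^3 \<ge> 0"
        using square_tangent[of "14/10" s] s s1 by (simp add: power2_eq_square)
    qed auto
    have e1: "A * (7071/10000 + 899/1000 * s + 113/1000 * s^2) \<ge> 263/100"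
    proof -
      have "263/100 * s \<le> 7071/10000 + (899/1000 + 7071/20000) * s + (899/2000 + 113/1000 + 3/50 * (7071/10000)) * s^2 + (113/2000 + 3/50 * (899/1000)) * s^3"
        using square_tangent[of "91/100" s] cu s s1 by (simp add: power2_eq_square)
      also have "\<dots> \<le> s * ((1 / s + 1/2 + 3/50 * s) * (7071/10000 + 899/1000 * s + 113/1000 * s^2))"
        using s by (simp add: field_simps power2_eq_square power3_eq_cube)
      also have "\<dots> \<le> s * (A * (7071/10000 + 899/1000 * s + 113/1000 * s^2))"
        using A1 s by (intro mult_left_mono mult_right_mono) (auto intro!: add_nonneg_nonneg)
      finally have "s * (263/100) \<le> s * (A * (7071/10000 + 899/1000 * s + 113/1000 * s^2))" by (simp only: mult.commute)
      then show ?thesis using s(1) by (rule mult_left_le_imp_le)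
    qed
    have e2: "A * (14142/10000 + 798/1000 * s) \<ge> 2858/1000" using e0 by (simp add: algebra_simps)
    have e3: "A * (14142/10000 + 1298/1000 * s + 226/1000 * s^2) \<ge> 3945/1000"
    proof -
      have "A * (14142/10000 + 1298/1000 * s + 226/1000 * s^2) \<ge> A * (7071/10000 + 899/1000 * s + 113/1000 * s^2) + A * (7071/10000 + 399/1000 * s)"
        unfolding distrib_left[symmetric] using Ap s by (intro mult_left_mono) auto
      then show ?thesis using e0 e1 by linarith
    qed
    have q: "F1 + F2 \<ge> A * (7071/10000 + 399/1000 * s + 113/1000 * s^2) + (A * (7071/10000 + 899/1000 * s + 113/1000 * s^2) - A * (7071/10000 + 399/1000 * s + 113/1000 * s^2)) * h"
      using F1' F2b by (simp add: algebra_simps diff_divide_distrib add_divide_distrib)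
    have q2: "2 * F1 + F2 \<ge> A * (14142/10000 + 798/1000 * s + 226/1000 * s^2) + (A * (14142/10000 + 1298/1000 * s + 226/1000 * s^2) - A * (14142/10000 + 798/1000 * s + 226/1000 * s^2)) * h"
      using F1' F2b by (simp add: algebra_simps diff_divide_distrib add_divide_distrib)
    have p2: "A * (113/1000 * s^2) \<ge> 0" "A * (226/1000 * s^2) \<ge> 0" using Ap by auto
    have "0 \<le> (A * (7071/10000 + 399/1000 * s + 113/1000 * s^2) - 1035/1000 * (138/100)) + ((A * (7071/10000 + 899/1000 * s + 113/1000 * s^2) - A * (7071/10000 + 399/1000 * s + 113/1000 * s^2)) - 1035/1000 * (116/100)) * h"
      using e0 e1 h p2 by (intro affine_nonneg) (auto simp: algebra_simps)
    moreover have "0 \<le> (A * (14142/10000 + 798/1000 * s + 226/1000 * s^2) - 1035/1000 * (3/2 * (138/100))) + ((A * (14142/10000 + 1298/1000 * s + 226/1000 * s^2) - A * (14142/10000 + 798/1000 * s + 226/1000 * s^2)) - 1035/1000 * (3/2 * (116/100))) * h"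
      using e2 e3 h p2 by (intro affine_nonneg) (auto simp: algebra_simps)
    ultimately show ?thesis using q q2 B(2)[OF f5] by (intro ends) (simp_all add: algebra_simps)
  qed
qed

section \<open>Monotonicity in t\<close>

text \<open>43/100 rounds up 3 sqrt 2 / 10; it keeps c sqrt 2 below 1 and c in the range of the
  quadratic bound of \<open>angle_left\<close>. The condition on d gives d \<ge> pi / 2 > c.\<close>

lemma admissibleD:
  assumes "admissible \<sigma> t0 r0 c l0 d t x y" "0 \<le> \<sigma>" "\<sigma> \<le> 1" "t0 \<ge> 2 * pi" "0 < r0"
  shows "\<bar>t\<bar> > 6" "x \<ge> 1" "x \<le> y" "\<bar>t\<bar> = 2 * pi * x * y" "0 < c" "c \<le> 3 * sqrt 2 / 10" "c < 43/100" "r0 \<le> l0"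
    "d * of_int \<lfloor>x\<rfloor> / x \<ge> pi / 2" "d \<ge> pi / 2" "d > c" "of_int \<lfloor>x\<rfloor> \<ge> (1::real)" "of_int \<lfloor>x\<rfloor> \<le> x" "x \<le> 2 * of_int \<lfloor>x\<rfloor>"
proof -
  note A = assms(1)[unfolded admissible_def]
  have pi6: "2 * pi > 6" using pi_gt_157_50 by simp
  show t6: "\<bar>t\<bar> > 6" using A assms(4) pi6 by linarith
  show x: "x \<ge> 1" and xy: "x \<le> y" "\<bar>t\<bar> = 2 * pi * x * y" and "r0 \<le> l0" using A by auto
  have "0 < r0 * x / \<bar>t\<bar>" using x t6 assms(5) by simp
  then show c: "0 < c" using A by linarith
  have "10 \<le> 10 + 4 * (1 - \<sigma>) / t0" using assms pi6 by simp
  then have "3 * sqrt 2 / (10 + 4 * (1 - \<sigma>) / t0) \<le> 3 * sqrt 2 / 10" by (intro divide_left_mono mult_pos_pos) auto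
  then show c2: "c \<le> 3 * sqrt 2 / 10" using A by linarith
  then show c3: "c < 43/100" using sqrt2_bounds by linarith
  show f1: "of_int \<lfloor>x\<rfloor> \<ge> (1::real)" using x by simp
  show f2: "of_int \<lfloor>x\<rfloor> \<le> x" by simp
  show "x \<le> 2 * of_int \<lfloor>x\<rfloor>" using f1 by linarith
  have dA: "d \<ge> pi * x / (2 * of_int \<lfloor>x\<rfloor>)" using A by simp
  have "pi / 2 = pi * x / (2 * n) * n / x" if "n \<ge> 1" for n :: real using that x by (simp add: field_simps)
  from this[OF f1] have "pi / 2 = pi * x / (2 * of_int \<lfloor>x\<rfloor>) * of_int \<lfloor>x\<rfloor> / x" .
  also have "\<dots> \<le> d * of_int \<lfloor>x\<rfloor> / x" using dA f1 x by (intro divide_right_mono mult_right_mono) auto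
  finally show d1: "d * of_int \<lfloor>x\<rfloor> / x \<ge> pi / 2" .
  have "pi * of_int \<lfloor>x\<rfloor> / (2 * of_int \<lfloor>x\<rfloor>) \<le> pi * x / (2 * of_int \<lfloor>x\<rfloor>)" using f1 f2 by (intro divide_right_mono mult_left_mono) auto
  moreover have "pi * n / (2 * n) = pi / 2" if "n \<ge> 1" for n :: real using that by simp
  from this[OF f1] have "pi * of_int \<lfloor>x\<rfloor> / (2 * of_int \<lfloor>x\<rfloor>) = pi / 2" .
  ultimately show d2: "d \<ge> pi / 2" using dA by linarith
  then show "d > c" using c3 pi_gt_157_50 by linarith
qed

lemma Phi1_pos: "c > 0 \<Longrightarrow> Phi1 c > 0"
proof -
  assume c: "c > 0"
  have "arctan (c / (1 + c)) \<le> c / (1 + c)" using c by (intro arctan_le_self) simp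
  also have "\<dots> < c / 1" using c by (intro divide_strict_left_mono) auto
  finally show ?thesis by (simp add: Phi1_def)
qed

lemma Phi1_minus_pos: "0 < c \<Longrightarrow> c < 43/100 \<Longrightarrow> Phi1 (- c) > 0"
proof -
  assume c: "0 < c" "c < 43/100"
  then have "arctan (c / (1 - c)) \<ge> c + c^2" using angle_left(1)[of c] by simp
  moreover have "c^2 > 0" using c by simp
  ultimately have "c < arctan (c / (1 - c))" by linarith
  then show ?thesis by (simp add: Phi1_def arctan_minus)
qed

text \<open>By convexity of exp the quotient (exp u - 1) / u does not decrease.\<close>

lemma exp_diff_ratio:
  fixes p q :: real
  assumes "0 < p" "p \<le> q"
  shows "(exp p - 1) * q \<le> (exp q - 1) * p"
proof -
  have "exp ((1 - p / q) *\<^sub>R 0 + (p / q) *\<^sub>R q) \<le> (1 - p / q) * exp 0 + (p / q) * exp q"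
    by (rule convex_onD[OF exp_convex]) (use assms in auto)
  then have "exp p - 1 \<le> (p / q) * (exp q - 1)" using assms by (simp add: algebra_simps)
  then have "(exp p - 1) * q \<le> (p / q) * (exp q - 1) * q" using assms by (intro mult_right_mono) auto
  then show ?thesis using assms by (simp add: mult.commute)
qed

text \<open>The logarithmic derivative in T is d / (exp (d T) - 1) - c / (exp (c T) - 1), which
  \<open>exp_diff_ratio\<close> shows to be at most 0.\<close>

lemma one_minus_exp_ratio_antimono:
  fixes c d u v :: real
  assumes cd: "0 < c" "c \<le> d" and uv: "0 < u" "u \<le> v"
  shows "(1 - exp (- d * v)) / (1 - exp (- c * v)) \<le> (1 - exp (- d * u)) / (1 - exp (- c * u))"
proof -
  define g where "g T = ln (1 - exp (- d * T)) - ln (1 - exp (- c * T))" for T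
  have pos: "1 - exp (- k * T) > 0" if "k > 0" "T > 0" for k T :: real using that by simp
  have "g v \<le> g u"
  proof (rule DERIV_nonpos_imp_nonincreasing[OF uv(2)])
    fix T assume T: "u \<le> T" "T \<le> v"
    then have T0: "T > 0" using uv by simp
    have D: "(g has_real_derivative d * exp (- d * T) / (1 - exp (- d * T)) - c * exp (- c * T) / (1 - exp (- c * T))) (at T)"
    proof -
      have "((\<lambda>T. ln (1 - exp (- k * T))) has_real_derivative 1 / (1 - exp (- k * T)) * (k * exp (- k * T))) (at T)" if "k > 0" for k
      proof (rule DERIV_chain2[where f = ln and g = "\<lambda>T. 1 - exp (- k * T)" and x = T and s = UNIV, OF DERIV_ln_divide[OF pos[OF that T0]]])
        show "((\<lambda>T. 1 - exp (- k * T)) has_real_derivative k * exp (- k * T)) (at T)" by (auto intro!: derivative_eq_intros)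
      qed
      from DERIV_diff[OF this[of d] this[of c]] show ?thesis using cd by (simp add: g_def[abs_def])
    qed
    have e: "k * exp (- k * T) / (1 - exp (- k * T)) = k / (exp (k * T) - 1)" if "k > 0" for k
      using that T0 by (simp add: exp_minus field_simps)
    have "(exp (c * T) - 1) * (d * T) \<le> (exp (d * T) - 1) * (c * T)" using cd T0 by (intro exp_diff_ratio) auto
    then have "(exp (c * T) - 1) * d \<le> (exp (d * T) - 1) * c" using T0 by (simp add: mult.assoc[symmetric])
    moreover have "exp (c * T) - 1 > 0" "exp (d * T) - 1 > 0" using cd T0 by auto
    ultimately have "d / (exp (d * T) - 1) \<le> c / (exp (c * T) - 1)" by (simp add: field_simps)
    then show "\<exists>y. (g has_real_derivative y) (at T) \<and> y \<le> 0" using D e cd by (intro exI conjI) auto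
  qed
  then have "exp (g v) \<le> exp (g u)" by simp
  moreover have "exp (g T) = (1 - exp (- d * T)) / (1 - exp (- c * T))" if "T > 0" for T
    unfolding g_def exp_diff using pos[of _ T] that cd by simp
  ultimately show ?thesis using uv by simp
qed

text \<open>1 / (2 \<phi>) is the point where sqrt t exp (- t \<phi>) has its maximum.\<close>

lemma sqrt_exp_strict_antimono:
  fixes \<phi> t t' :: real
  assumes "\<phi> > 0" "1 / (2 * \<phi>) \<le> t" "t < t'"
  shows "sqrt (t' / pi) * exp (- t' * \<phi>) < sqrt (t / pi) * exp (- t * \<phi>)"
proof -
  have t0: "t > 0" using assms by (meson divide_pos_pos less_le_trans mult_pos_pos zero_less_numeral zero_less_one)
  define u where "u = (t' - t) / t"
  have u: "u > 0" using assms t0 by (simp add: u_def)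
  have t': "t' = t * (1 + u)" using t0 by (simp add: u_def field_simps)
  have "sqrt (1 + u) < exp (u / 2)"
  proof (rule real_less_lsqrt)
    have "1 + u < exp u" using u exp_lower_Taylor_quadratic[of u] by (smt (verit) zero_less_power divide_pos_pos)
    also have "exp u = (exp (u / 2))\<^sup>2" by (simp add: power2_eq_square flip: exp_add)
    finally show "1 + u < (exp (u / 2))\<^sup>2" .
  qed (use u in auto)
  also have "u / 2 \<le> t * u * \<phi>"
  proof -
    have "1 / 2 \<le> t * \<phi>" using assms by (simp add: field_simps)
    then have "1 / 2 * u \<le> t * \<phi> * u" using u by (intro mult_right_mono) auto
    then show ?thesis by (simp add: mult_ac)
  qed
  finally have "sqrt (1 + u) < exp (t * u * \<phi>)" by simp
  then have X: "sqrt (t / pi) * sqrt (1 + u) * exp (- t' * \<phi>) < sqrt (t / pi) * exp (t * u * \<phi>) * exp (- t' * \<phi>)"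
    using t0 by (intro mult_strict_right_mono mult_strict_left_mono) auto
  have Y: "sqrt (t / pi) * sqrt (1 + u) = sqrt (t' / pi)" unfolding t' by (simp flip: real_sqrt_mult)
  have Z: "exp (t * u * \<phi>) * exp (- t' * \<phi>) = exp (- t * \<phi>)" unfolding t' by (simp add: algebra_simps flip: exp_add)
  have W: "sqrt (t / pi) * exp (t * u * \<phi>) * exp (- t' * \<phi>) = sqrt (t / pi) * exp (- t * \<phi>)"
    unfolding Z[symmetric] by (rule mult.assoc)
  show ?thesis using X unfolding Y W .
qed

lemma calE2_pos: "0 < c \<Longrightarrow> c < d \<Longrightarrow> 0 < t \<Longrightarrow> 0 < x \<Longrightarrow> calE2 t x c d > 0"
proof -
  assume a: "0 < c" "c < d" "0 < t" "0 < x"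
  have "exp (- d * t / x) \<le> exp (- c * t / x)" "exp (- c * t / x) < 1" using a by (auto intro!: divide_right_mono)
  then have "1 \<le> (1 - exp (- d * t / x)) / (1 - exp (- c * t / x))" by simp
  then have "0 \<le> x / t * ln ((1 - exp (- d * t / x)) / (1 - exp (- c * t / x)))" using a by (intro mult_nonneg_nonneg ln_ge_zero) auto
  then show ?thesis using a by (simp add: calE2_def)
qed

lemma calE2_antimono:
  assumes "0 < c" "c < d" "0 < t" "t \<le> t'" "0 < x"
  shows "calE2 t' x c d \<le> calE2 t x c d"
proof -
  have r: "(1 - exp (- d * (t' / x))) / (1 - exp (- c * (t' / x))) \<le> (1 - exp (- d * (t / x))) / (1 - exp (- c * (t / x)))"
    using assms by (intro one_minus_exp_ratio_antimono) (auto intro: divide_right_mono)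
  have one: "1 \<le> (1 - exp (- d * (t' / x))) / (1 - exp (- c * (t' / x)))"
  proof -
    have "exp (- d * (t' / x)) \<le> exp (- c * (t' / x))" "exp (- c * (t' / x)) < 1" using assms by (auto intro!: divide_right_mono)
    then show ?thesis by simp
  qed
  have "x / t' * ln ((1 - exp (- d * (t' / x))) / (1 - exp (- c * (t' / x)))) \<le> x / t * ln ((1 - exp (- d * (t / x))) / (1 - exp (- c * (t / x))))"
    using assms r one by (intro mult_mono divide_left_mono ln_mono) auto
  then show ?thesis using assms by (simp add: calE2_def)
qed

lemma calE3_antimono:
  assumes "0 < d" "0 < t" "t < t'" "1 \<le> x"
  shows "calE3 t' x d < calE3 t x d" "0 < calE3 t x d"
proof -
  have f: "(0::real) < of_int \<lfloor>x\<rfloor>" using assms by simp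
  have e: "0 < exp (d * t / x) - 1" using assms by simp
  have "exp (d * t / x) - 1 \<le> exp (d * t' / x) - 1" using assms by (auto intro!: divide_right_mono)
  then have "of_int \<lfloor>x\<rfloor> * sqrt (pi * t) * (exp (d * t / x) - 1) < of_int \<lfloor>x\<rfloor> * sqrt (pi * t') * (exp (d * t' / x) - 1)"
    using assms f e by (intro mult_less_le_imp_less mult_strict_left_mono) auto
  then show "calE3 t' x d < calE3 t x d" unfolding calE3_def using assms f e
    by (simp, intro divide_strict_left_mono mult_pos_pos) auto
  show "0 < calE3 t x d" unfolding calE3_def using assms f e by simp
qed

lemma E1_antimono:
  assumes "0 < c" "c < d" "Phi2 x d \<ge> 0" "1 / (2 * Phi1 c) \<le> t" "t < t'" "1 \<le> x"
  shows "E1 \<sigma> t' x c d < E1 \<sigma> t x c d" "0 \<le> E1 \<sigma> t x c d"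
proof -
  have P: "Phi1 c > 0" by (rule Phi1_pos[OF assms(1)])
  have t0: "t > 0" using assms(4) P by (meson divide_pos_pos less_le_trans mult_pos_pos zero_less_numeral zero_less_one)
  have "calE1 c > 0" using assms(1) by (simp add: calE1_def add_pos_nonneg)
  then have q: "calE1 c powr ((\<sigma> - 1) / 2) > 0" by simp
  have "sqrt (t' / pi) * exp (- t' * Phi1 c) * calE2 t' x c d < sqrt (t / pi) * exp (- t * Phi1 c) * calE2 t x c d"
    using assms t0 by (intro mult_less_le_imp_less sqrt_exp_strict_antimono P calE2_antimono calE2_pos) auto
  moreover have "calE3 t' x d * exp (- t' * Phi2 x d) \<le> calE3 t x d * exp (- t * Phi2 x d)"
    using calE3_antimono[of d t t' x] assms t0 by (intro mult_mono) (auto intro: mult_right_mono)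
  ultimately have "sqrt (t' / pi) * calE2 t' x c d * exp (- t' * Phi1 c) + calE3 t' x d * exp (- t' * Phi2 x d)
      < sqrt (t / pi) * calE2 t x c d * exp (- t * Phi1 c) + calE3 t x d * exp (- t * Phi2 x d)" by (simp add: mult_ac)
  then show "E1 \<sigma> t' x c d < E1 \<sigma> t x c d" unfolding E1_def using q t0 assms(5) by simp
  show "0 \<le> E1 \<sigma> t x c d" unfolding E1_def
    using q t0 calE2_pos[of c d t x] calE3_antimono(2)[of d t t' x] assms by simp
qed

lemma E3_antimono:
  assumes "0 < c" "c < 43/100" "1 / (2 * Phi1 (- c)) \<le> t" "t < t'" "1 \<le> x"
  shows "E3 \<sigma> t' x c < E3 \<sigma> t x c"
proof -
  have P: "Phi1 (- c) > 0" by (rule Phi1_minus_pos[OF assms(1,2)])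
  have t0: "t > 0" using assms(3) P by (meson divide_pos_pos less_le_trans mult_pos_pos zero_less_numeral zero_less_one)
  have e: "exp (- c * t / x) < 1" "exp (- c * t' / x) \<le> exp (- c * t / x)" using assms t0 by (auto intro!: divide_right_mono)
  have "pi * x / t' \<le> pi * x / t" using assms t0 by (intro divide_left_mono) auto
  then have r: "(2 - c + pi * x / t') / (1 - exp (- c * t' / x)) \<le> (2 - c + pi * x / t) / (1 - exp (- c * t / x))"
    using e assms t0 by (intro frac_le) (auto intro!: add_nonneg_nonneg)
  have r0: "0 < (2 - c + pi * x / t') / (1 - exp (- c * t' / x))"
    using e assms t0 by (intro divide_pos_pos add_pos_pos) auto
  have "sqrt (t' / pi) * exp (- t' * Phi1 (- c)) * ((2 - c + pi * x / t') / (1 - exp (- c * t' / x)))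
     < sqrt (t / pi) * exp (- t * Phi1 (- c)) * ((2 - c + pi * x / t) / (1 - exp (- c * t / x)))"
    using assms t0 r r0 by (intro mult_less_le_imp_less sqrt_exp_strict_antimono P) auto
  then have "c powr (\<sigma> - 1) * (sqrt (t' / pi) * exp (- t' * Phi1 (- c)) * ((2 - c + pi * x / t') / (1 - exp (- c * t' / x))))
     < c powr (\<sigma> - 1) * (sqrt (t / pi) * exp (- t * Phi1 (- c)) * ((2 - c + pi * x / t) / (1 - exp (- c * t / x))))"
    using assms by (intro mult_strict_left_mono) auto
  then show ?thesis unfolding E3_def using t0 assms by (simp add: mult_ac)
qed

lemma arctan_ge_ratio: "w \<ge> 0 \<Longrightarrow> w / (1 + w\<^sup>2) \<le> arctan w" for w :: real
proof -
  assume w: "w \<ge> 0"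
  define \<theta> where "\<theta> = arctan w"
  have th: "0 \<le> \<theta>" using w by (simp add: \<theta>_def)
  have "w / (1 + w\<^sup>2) = sin \<theta> * cos \<theta>"
    unfolding \<theta>_def sin_arctan cos_arctan by (simp add: add_nonneg_nonneg)
  also have "\<dots> \<le> sin \<theta> * 1"
  proof (rule mult_left_mono)
    show "0 \<le> sin \<theta>" using th arctan_ubound[of w] pi_gt_zero unfolding \<theta>_def by (intro sin_ge_zero) linarith+
  qed simp
  also have "\<dots> \<le> \<theta>" using sin_x_le_x[OF th] by simp
  finally show ?thesis by (simp add: \<theta>_def)
qed

text \<open>At w = B / t the derivative is arctan w - w / (1 + w^2).\<close>

lemma arctan_scaled_mono:
  fixes B t t' :: real
  assumes "B \<ge> 0" "0 < t" "t \<le> t'"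
  shows "t * arctan (B / t) \<le> t' * arctan (B / t')"
proof (rule DERIV_nonneg_imp_nondecreasing[OF assms(3)])
  fix u assume u: "t \<le> u" "u \<le> t'"
  then have u0: "u > 0" using assms by simp
  have "((\<lambda>t. t * arctan (B / t)) has_real_derivative arctan (B / u) + u * (inverse (1 + (B / u)\<^sup>2) * (- (B / u\<^sup>2)))) (at u)"
    using u0 by (auto intro!: derivative_eq_intros simp: power2_eq_square divide_simps)
  moreover have "u * (inverse (1 + (B / u)\<^sup>2) * (- (B / u\<^sup>2))) = - ((B / u) / (1 + (B / u)\<^sup>2))"
    using u0 by (simp add: inverse_eq_divide power2_eq_square)
  ultimately have "((\<lambda>t. t * arctan (B / t)) has_real_derivative arctan (B / u) + - ((B / u) / (1 + (B / u)\<^sup>2))) (at u)"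
    by (simp only:)
  moreover have "0 \<le> arctan (B / u) + - ((B / u) / (1 + (B / u)\<^sup>2))" using arctan_ge_ratio[of "B / u"] assms u0 by simp
  ultimately show "\<exists>y. ((\<lambda>t. t * arctan (B / t)) has_real_derivative y) (at u) \<and> 0 \<le> y" by blast
qed

text \<open>\<open>Phi3\<close> jumps with frac y, but t + pi x (1 - 2 frac y) = pi x (2 floor y +
  1). Hence t times \<open>Phi3\<close> is t arctan (B / t) plus a positive multiple of t, where B
  depends on y only through its floor and cannot decrease. Here x is fixed and y follows t.\<close>

lemma E4_antimono:
  assumes "0 < c" "c < 43/100" "0 \<le> \<sigma>" "\<sigma> \<le> 1" "0 < r0" and x: "1 \<le> x" and y: "1 \<le> y"
    and t: "t = 2 * pi * x * y" "t' = 2 * pi * x * y'" and tt: "t < t'"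
  shows "E4 \<sigma> t' x y' r0 c < E4 \<sigma> t x y r0 c"
proof -
  define n where "n = (of_int \<lfloor>x\<rfloor> :: real)"
  define A where "A = 1 - exp (- r0 / sqrt 2)"
  have n: "1 \<le> n" "n \<le> x" using x by (auto simp: n_def)
  have A: "A > 0" using assms by (simp add: A_def)
  have "2 * pi * x * 1 \<le> t" unfolding t using x y by (intro mult_left_mono) auto
  moreover have "0 < pi * x" using x by simp
  ultimately have px: "0 < pi * x" "pi * x < t" "0 < t" by linarith+
  have yy: "y < y'" using tt x unfolding t by simp
  have key: "\<tau> * Phi3 \<tau> x v c = \<tau> * arctan ((pi * x * (2 * of_int \<lfloor>v\<rfloor> + 1) / c) / \<tau>) + \<tau> * (pi / 2 - n / x * c)"
    if "\<tau> = 2 * pi * x * v" "\<tau> > 0" for \<tau> v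
  proof -
    have "\<tau> + pi * x * (1 - 2 * frac v) = pi * x * (2 * of_int \<lfloor>v\<rfloor> + 1)"
      unfolding that(1) frac_def by (simp add: algebra_simps)
    moreover have "1 + K / \<tau> = (\<tau> + K) / \<tau>" for K using that(2) by (simp add: add_divide_distrib)
    ultimately have "1 + pi * x * (1 - 2 * frac v) / \<tau> = pi * x * (2 * of_int \<lfloor>v\<rfloor> + 1) / \<tau>" by simp
    then have "1 / c * (1 + pi * x * (1 - 2 * frac v) / \<bar>\<tau>\<bar>) = (pi * x * (2 * of_int \<lfloor>v\<rfloor> + 1) / c) / \<tau>"
      using that(2) by simp
    then show ?thesis unfolding Phi3_def by (simp add: n_def algebra_simps)
  qed
  have ph: "t * Phi3 t x y c \<le> t' * Phi3 t' x y' c"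
  proof -
    define B where "B v = pi * x * (2 * of_int \<lfloor>v\<rfloor> + 1) / c" for v :: real
    have fl: "(0::real) \<le> of_int \<lfloor>y\<rfloor>" "of_int \<lfloor>y\<rfloor> \<le> (of_int \<lfloor>y'\<rfloor> :: real)" using y yy by (auto intro: floor_mono)
    have B: "0 \<le> B y" "B y \<le> B y'" unfolding B_def using fl assms(1) x by (auto intro!: divide_right_mono mult_left_mono)
    have "t * arctan (B y / t) \<le> t' * arctan (B y / t')" using B px tt by (intro arctan_scaled_mono) auto
    also have "\<dots> \<le> t' * arctan (B y' / t')" using B px tt by (intro mult_left_mono) (auto simp: arctan_le_iff intro: divide_right_mono)
    finally have 1: "t * arctan (B y / t) \<le> t' * arctan (B y' / t')" .
    have "n / x * c \<le> 1 * c" using n x assms(1) by (intro mult_right_mono) auto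
    then have "0 \<le> pi / 2 - n / x * c" using assms(2) pi_gt_157_50 by linarith
    then have "t * (pi / 2 - n / x * c) \<le> t' * (pi / 2 - n / x * c)" using tt by (intro mult_right_mono) auto
    then show ?thesis using 1 key[OF t(1)] key[OF t(2)] px tt unfolding B_def by simp
  qed
  have "pi * x / t' \<le> pi * x / t" using px tt by (intro divide_left_mono) auto
  then have p: "(1 - pi * x / t') powr (\<sigma> - 1) \<le> (1 - pi * x / t) powr (\<sigma> - 1)" using px assms by (intro powr_mono2') auto
  have p0: "0 < (1 - pi * x / t) powr (\<sigma> - 1)" "0 < (1 - pi * x / t') powr (\<sigma> - 1)" using px tt by auto
  have s: "1 / sqrt (pi * t') < 1 / sqrt (pi * t)" using px tt by (intro divide_strict_left_mono) auto
  have "1 / sqrt (pi * t') * ((1 - pi * x / t') powr (\<sigma> - 1) * exp (- (t' * Phi3 t' x y' c))) < 1 / sqrt (pi * t) * ((1 - pi * x / t) powr (\<sigma> - 1) * exp (- (t * Phi3 t x y c)))"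
    using s p p0 ph px tt by (intro mult_less_le_imp_less mult_mono) auto
  then have "x / (n * A) * (1 / sqrt (pi * t') * ((1 - pi * x / t') powr (\<sigma> - 1) * exp (- (t' * Phi3 t' x y' c)))) < x / (n * A) * (1 / sqrt (pi * t) * ((1 - pi * x / t) powr (\<sigma> - 1) * exp (- (t * Phi3 t x y c))))"
    using x n A by (intro mult_strict_left_mono) auto
  then show ?thesis unfolding E4_def n_def[symmetric] A_def[symmetric] using px tt by (simp add: mult_ac)
qed

lemma part_decreasing:
  assumes "0 \<le> \<sigma>" "\<sigma> \<le> 1" "t0 \<ge> 2 * pi" "0 < r0"
  shows "\<exists>T. \<forall>t t' y y'.
          T \<le> t \<and> t < t' \<and> admissible \<sigma> t0 r0 c l0 d t x y \<and>
          admissible \<sigma> t0 r0 c l0 d t' x y' \<longrightarrow>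
          E1 \<sigma> t' x c d < E1 \<sigma> t x c d \<and> E3 \<sigma> t' x c < E3 \<sigma> t x c \<and>
          E4 \<sigma> t' x y' r0 c < E4 \<sigma> t x y r0 c"
proof (intro exI allI impI)
  fix t t' y y'
  \<comment> \<open>Unification fixes the threshold here: beyond it the factors sqrt t exp (- t
    \<phi>) of \<open>E1\<close> and \<open>E3\<close> decrease.\<close>
  assume A: "max 1 (max (1 / (2 * Phi1 c)) (1 / (2 * Phi1 (- c)))) \<le> t \<and> t < t' \<and> admissible \<sigma> t0 r0 c l0 d t x y \<and> admissible \<sigma> t0 r0 c l0 d t' x y'"
  then have ad: "admissible \<sigma> t0 r0 c l0 d t x y" "admissible \<sigma> t0 r0 c l0 d t' x y'" by auto
  note D = admissibleD[OF ad(1) assms] and D' = admissibleD[OF ad(2) assms]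
  have "Phi2 x d \<ge> 0" using D(9) by (simp add: Phi2_def)
  then show "E1 \<sigma> t' x c d < E1 \<sigma> t x c d \<and> E3 \<sigma> t' x c < E3 \<sigma> t x c \<and> E4 \<sigma> t' x y' r0 c < E4 \<sigma> t x y r0 c"
    using A D D' assms by (intro conjI E1_antimono E3_antimono E4_antimono) auto
qed

section \<open>Behaviour for large t\<close>

text \<open>Since x \<le> y, x is at most sqrt t, so t / x tends to infinity uniformly in x and
  y.\<close>

lemma admissible_x_le_sqrt:
  assumes "x \<ge> 1" "x \<le> y" "t = 2 * pi * x * y"
  shows "x \<le> sqrt t" "x / t \<le> 1 / sqrt t" "sqrt t \<le> t / x"
proof -
  have "x * x \<le> x * y" using assms by (intro mult_left_mono) auto
  also have "1 * (x * y) \<le> 2 * pi * (x * y)" using assms pi_gt_157_50 by (intro mult_right_mono) auto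
  finally have "x\<^sup>2 \<le> t" using assms by (simp add: power2_eq_square mult.assoc)
  then show x: "x \<le> sqrt t" by (rule real_le_rsqrt)
  have t: "sqrt t > 0" using x assms by linarith
  have tt: "t = sqrt t * sqrt t" using t by simp
  have "x / t \<le> sqrt t / (sqrt t * sqrt t)" unfolding tt[symmetric] using x t by (intro divide_right_mono) auto
  moreover have "w / (w * w) = 1 / w" if "w > 0" for w :: real using that by simp
  from this[OF t] have "sqrt t / (sqrt t * sqrt t) = 1 / sqrt t" .
  ultimately show "x / t \<le> 1 / sqrt t" by (simp only:)
  have "x * sqrt t \<le> sqrt t * sqrt t" using x t by (intro mult_right_mono) auto
  then show "sqrt t \<le> t / x" using assms t tt by (simp add: pos_le_divide_eq mult.commute)
qed

lemma exp_neg_le_half: "k \<ge> 1 \<Longrightarrow> exp (- k) \<le> 1/2" "k \<ge> 1 \<Longrightarrow> 1 \<le> exp k - 1" for k :: real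
proof -
  assume "k \<ge> 1"
  then have "2 \<le> exp k" using exp_ge_add_one_self[of k] by linarith
  then show "exp (- k) \<le> 1/2" "1 \<le> exp k - 1" by (auto simp: exp_minus field_simps)
qed

text \<open>The right sides depend on neither x nor y and tend to 0. The conditions on sqrt t ensure
  c t / x \<ge> 1 and x / t \<le> 1/10.\<close>

lemma E_bounds:
  assumes ad: "admissible \<sigma> t0 r0 c l0 d t x y" and g: "0 \<le> \<sigma>" "\<sigma> \<le> 1" "t0 \<ge> 2 * pi" "0 < r0" 
    and t: "0 < t" and big: "sqrt t * c \<ge> 1" "sqrt t \<ge> 10"
  shows "0 \<le> E1 \<sigma> t x c d" "E1 \<sigma> t x c d \<le> (d + 1) * (sqrt t * exp (- t * Phi1 c)) + 2 / sqrt t"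
    "0 \<le> E3 \<sigma> t x c" "E3 \<sigma> t x c \<le> 6 * c powr (\<sigma> - 1) * (sqrt t * exp (- t * Phi1 (- c)))"
    "0 \<le> E4 \<sigma> t x y r0 c" "E4 \<sigma> t x y r0 c \<le> 4 / (1 - exp (- r0 / sqrt 2)) * (1 / sqrt t)"
proof -
  note D = admissibleD[OF ad g]
  have teq: "t = 2 * pi * x * y" using D(4) t by simp
  note X = admissible_x_le_sqrt[OF D(2,3) teq]
  have s0: "sqrt t > 0" using t by simp
  have cT: "1 \<le> c * t / x"
  proof -
    have "sqrt t * c \<le> t / x * c" using X(3) D(5) by (intro mult_right_mono) auto
    then show ?thesis using big by (simp add: mult.commute)
  qed
  have dT: "1 \<le> d * t / x"
  proof -
    have "c * t / x \<le> d * t / x" using D(11) t D(2) by (intro divide_right_mono mult_right_mono) auto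
    then show ?thesis using cT by linarith
  qed
  have ec: "exp (- c * t / x) \<le> 1/2" using exp_neg_le_half(1)[OF cT] by simp
  have xt: "x / t \<le> 1/10" using X(2) big by (smt (verit) divide_left_mono s0 frac_le)
  have st: "sqrt (t / pi) \<le> sqrt t" using t pi_gt_157_50 by (simp add: field_simps)
  have c1: "0 < calE1 c powr ((\<sigma> - 1) / 2)" "calE1 c powr ((\<sigma> - 1) / 2) \<le> 1"
  proof -
    have "calE1 c \<ge> 1" using D(5) by (simp add: calE1_def)
    then show "0 < calE1 c powr ((\<sigma> - 1) / 2)" "calE1 c powr ((\<sigma> - 1) / 2) \<le> 1"
      using powr_mono[of "(\<sigma> - 1) / 2" 0 "calE1 c"] g by auto
  qed
  have e2: "0 < calE2 t x c d" using calE2_pos D t by simp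
  have e2u: "calE2 t x c d \<le> d + 1"
  proof -
    have r: "0 < (1 - exp (- d * t / x)) / (1 - exp (- c * t / x))"
      using cT dT by (intro divide_pos_pos) auto
    have "(1 - exp (- d * t / x)) / (1 - exp (- c * t / x)) \<le> 1 / (1/2)" using ec by (intro frac_le) auto
    then have l: "ln ((1 - exp (- d * t / x)) / (1 - exp (- c * t / x))) \<le> 1" using ln_le_minus_one[OF r] by simp
    have "x / t * ln ((1 - exp (- d * t / x)) / (1 - exp (- c * t / x))) \<le> x / t * 1" using l t D(2) by (intro mult_left_mono) auto
    moreover have "\<bar>t\<bar> = t" using t by simp
    ultimately show ?thesis unfolding calE2_def using xt D(5) by (simp only:)
  qed
  have e3: "0 \<le> calE3 t x d" "calE3 t x d \<le> 2 / sqrt t"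
  proof -
    have e: "1 \<le> exp (d * t / x) - 1" by (rule exp_neg_le_half(2)[OF dT])
    show "0 \<le> calE3 t x d" using e D t by (simp add: calE3_def)
    have "sqrt t \<le> sqrt (pi * t)" using t pi_gt_157_50 by simp
    then have "of_int \<lfloor>x\<rfloor> * sqrt t * 1 \<le> of_int \<lfloor>x\<rfloor> * sqrt (pi * t) * (exp (d * t / x) - 1)"
      using e D(12) s0 by (intro mult_mono) auto
    then have "calE3 t x d \<le> (2 * of_int \<lfloor>x\<rfloor>) / (of_int \<lfloor>x\<rfloor> * sqrt t * 1)"
      unfolding calE3_def using D(2,12,14) t s0 by (intro frac_le) auto
    then show "calE3 t x d \<le> 2 / sqrt t" using D(12) by simp
  qed
  have p2: "Phi2 x d \<ge> 0" using D(9) by (simp add: Phi2_def)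
  show "0 \<le> E1 \<sigma> t x c d" unfolding E1_def using c1 e2 e3 t by simp
  have "E1 \<sigma> t x c d \<le> 1 * (sqrt t * (d + 1) * exp (- t * Phi1 c) + 2 / sqrt t * 1)"
    unfolding E1_def using c1 e2 e2u e3 st p2 t s0 D(10,5,11)
    by (intro mult_mono add_mono) (auto intro!: add_nonneg_nonneg)
  then show "E1 \<sigma> t x c d \<le> (d + 1) * (sqrt t * exp (- t * Phi1 c)) + 2 / sqrt t" by (simp add: mult_ac)
  have "pi * (x / t) \<le> 63/20 * (1/10)" using xt pi_lt_63_20 D(2) t by (intro mult_mono) auto
  moreover have "pi * x / t = pi * (x / t)" by simp
  ultimately have px: "pi * x / t \<le> 1/2" by linarith
  have px0: "0 < pi * x / t" using D(2) t by simp
  have f: "0 \<le> (2 - c + pi * x / t) / (1 - exp (- c * t / x))" "(2 - c + pi * x / t) / (1 - exp (- c * t / x)) \<le> 6"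
  proof -
    show "0 \<le> (2 - c + pi * x / t) / (1 - exp (- c * t / x))" using ec cT px0 D(7) by (intro divide_nonneg_nonneg) auto
    have u: "2 - c + pi * x / t \<le> 3" using px D(5) by linarith
    have w: "1/2 \<le> 1 - exp (- c * t / x)" using ec by linarith
    have "(2 - c + pi * x / t) / (1 - exp (- c * t / x)) \<le> 3 / (1/2)" by (rule frac_le[OF _ u _ w]) simp_all
    then show "(2 - c + pi * x / t) / (1 - exp (- c * t / x)) \<le> 6" by simp
  qed
  have at: "\<bar>t\<bar> = t" using t by simp
  show "0 \<le> E3 \<sigma> t x c" unfolding E3_def at by (intro mult_nonneg_nonneg f(1)) (use t in simp_all)
  have "E3 \<sigma> t x c \<le> c powr (\<sigma> - 1) * 6 * sqrt t * exp (- t * Phi1 (- c))"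
    unfolding E3_def using f t st s0 by (intro mult_mono) auto
  then show "E3 \<sigma> t x c \<le> 6 * c powr (\<sigma> - 1) * (sqrt t * exp (- t * Phi1 (- c)))" by (simp add: mult_ac)
  define A where "A = 1 - exp (- r0 / sqrt 2)"
  have A: "A > 0" using g by (simp add: A_def)
  show "0 \<le> E4 \<sigma> t x y r0 c" unfolding E4_def A_def[symmetric] using A D(2,12) t by simp
  have p3: "Phi3 t x y c \<ge> 0"
  proof -
    have "- 1 \<le> 1 - 2 * frac y" using frac_lt_1[of y] by simp
    then have "pi * x / t * (- 1) \<le> pi * x / t * (1 - 2 * frac y)" using px0 by (intro mult_left_mono) auto
    then have "0 \<le> 1 + pi * x * (1 - 2 * frac y) / t" using px by simp
    then have "0 \<le> arctan (1 / c * (1 + pi * x * (1 - 2 * frac y) / \<bar>t\<bar>))" using D(5) t by (simp add: zero_le_arctan_iff)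
    moreover have "of_int \<lfloor>x\<rfloor> / x * c \<le> 1 * c" using D(2,5,13) by (intro mult_right_mono) auto
    ultimately show ?thesis using D(7) pi_gt_157_50 unfolding Phi3_def by linarith
  qed
  have "(1 - pi * x / t) powr (\<sigma> - 1) \<le> (1/2) powr (\<sigma> - 1)" using px g by (intro powr_mono2') auto
  also have "\<dots> \<le> (1/2) powr (- 1)" using g by (intro powr_mono') auto
  finally have pw: "(1 - pi * x / t) powr (\<sigma> - 1) \<le> 2" by (simp add: powr_minus)
  have nn: "(of_int \<lfloor>x\<rfloor> :: real) > 0" using D(12) by linarith
  have num: "x * (1 - pi * x / t) powr (\<sigma> - 1) \<le> (2 * of_int \<lfloor>x\<rfloor>) * 2"
    by (rule mult_mono[OF D(14) pw]) (use nn in simp_all)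
  have "sqrt t \<le> sqrt (pi * t)" using t pi_gt_157_50 by simp
  then have den: "of_int \<lfloor>x\<rfloor> * A * sqrt t \<le> of_int \<lfloor>x\<rfloor> * A * sqrt (pi * t)"
    by (rule mult_left_mono) (rule mult_nonneg_nonneg[OF less_imp_le[OF nn] less_imp_le[OF A]])
  have pos: "0 < of_int \<lfloor>x\<rfloor> * A * sqrt t" by (rule mult_pos_pos[OF mult_pos_pos[OF nn A] s0])
  have n4: "0 \<le> (2 * of_int \<lfloor>x\<rfloor>) * (2 :: real)" using nn by linarith
  have ex: "exp (- t * Phi3 t x y c) \<le> 1" using p3 t by simp
  have "x * (1 - pi * x / t) powr (\<sigma> - 1) / (of_int \<lfloor>x\<rfloor> * A * sqrt (pi * t)) * exp (- t * Phi3 t x y c)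
      \<le> (2 * of_int \<lfloor>x\<rfloor>) * 2 / (of_int \<lfloor>x\<rfloor> * A * sqrt t) * 1"
    by (rule mult_mono[OF frac_le[OF n4 num pos den] ex]) (rule divide_nonneg_pos[OF n4 pos], rule exp_ge_zero)
  then have "E4 \<sigma> t x y r0 c \<le> (2 * of_int \<lfloor>x\<rfloor>) * 2 / (of_int \<lfloor>x\<rfloor> * A * sqrt t) * 1"
    unfolding E4_def A_def[symmetric] at .
  also have "\<dots> = 4 / A * (1 / sqrt t)"
  proof -
    have "2 * n * 2 / (n * A * q) * 1 = 4 / A * (1 / q)" if "n > 0" "q > 0" for n q :: real
      using that A by (simp add: field_simps)
    from this[OF nn s0] show ?thesis .
  qed
  finally show "E4 \<sigma> t x y r0 c \<le> 4 / (1 - exp (- r0 / sqrt 2)) * (1 / sqrt t)" by (simp add: A_def)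
qed

lemma part_tendsto_0:
  assumes g: "0 \<le> \<sigma>" "\<sigma> \<le> 1" "t0 \<ge> 2 * pi" "0 < r0" and e: "\<epsilon> > 0"
  shows "\<forall>\<^sub>F t in at_top. \<forall>x y. admissible \<sigma> t0 r0 c l0 d t x y \<longrightarrow>
          \<bar>E1 \<sigma> t x c d\<bar> < \<epsilon> \<and> \<bar>E3 \<sigma> t x c\<bar> < \<epsilon> \<and> \<bar>E4 \<sigma> t x y r0 c\<bar> < \<epsilon>"
proof (cases "0 < c \<and> c < 43/100")
  case False
  then have "\<not> admissible \<sigma> t0 r0 c l0 d t x y" for t x y using admissibleD(5,7)[OF _ g] by blast
  then show ?thesis by simp
next
  case True
  then have c: "0 < c" "c < 43/100" by auto
  define p q where "p = Phi1 c" and "q = Phi1 (- c)"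
  have pq: "p > 0" "q > 0" unfolding p_def q_def using c by (simp_all add: Phi1_pos Phi1_minus_pos)
  have se: "((\<lambda>t. sqrt t * exp (- t * u)) \<longlongrightarrow> 0) at_top" if "u > 0" for u :: real using that by real_asymp
  have si: "((\<lambda>t. 1 / sqrt t) \<longlongrightarrow> (0::real)) at_top" by real_asymp
  have "((\<lambda>t. (d + 1) * (sqrt t * exp (- t * p)) + 2 * (1 / sqrt t)) \<longlongrightarrow> (d + 1) * 0 + 2 * 0) at_top"
    by (intro tendsto_intros se si pq)
  then have 1: "\<forall>\<^sub>F t in at_top. (d + 1) * (sqrt t * exp (- t * p)) + 2 * (1 / sqrt t) < \<epsilon>"
    using e by (intro order_tendstoD) auto
  have "((\<lambda>t. 6 * c powr (\<sigma> - 1) * (sqrt t * exp (- t * q))) \<longlongrightarrow> 6 * c powr (\<sigma> - 1) * 0) at_top"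
    by (intro tendsto_intros se pq)
  then have 2: "\<forall>\<^sub>F t in at_top. 6 * c powr (\<sigma> - 1) * (sqrt t * exp (- t * q)) < \<epsilon>"
    using e by (intro order_tendstoD) auto
  have "((\<lambda>t. 4 / (1 - exp (- r0 / sqrt 2)) * (1 / sqrt t)) \<longlongrightarrow> 4 / (1 - exp (- r0 / sqrt 2)) * 0) at_top"
    by (intro tendsto_intros si)
  then have 3: "\<forall>\<^sub>F t in at_top. 4 / (1 - exp (- r0 / sqrt 2)) * (1 / sqrt t) < \<epsilon>"
    using e by (intro order_tendstoD) auto
  have 4: "\<forall>\<^sub>F t in at_top. sqrt t * c \<ge> 1" "\<forall>\<^sub>F t in at_top. sqrt t \<ge> (10::real)"
    using c by real_asymp+
  from 1 2 3 4 eventually_gt_at_top[of "0::real"] show ?thesis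
  proof eventually_elim
    case (elim t)
    show ?case
    proof (intro allI impI)
      fix x y assume ad: "admissible \<sigma> t0 r0 c l0 d t x y"
      note B = E_bounds[OF ad g elim(6) elim(4) elim(5)]
      show "\<bar>E1 \<sigma> t x c d\<bar> < \<epsilon> \<and> \<bar>E3 \<sigma> t x c\<bar> < \<epsilon> \<and> \<bar>E4 \<sigma> t x y r0 c\<bar> < \<epsilon>"
        using B elim(1-3) unfolding p_def q_def by simp
    qed
  qed
qed

text \<open>e is a lower bound for \<open>calE4\<close> that does not depend on t, and t \<ge> 1 /
  (4 e) keeps the quotient in \<open>calE5\<close> below 1. \<open>calE6\<close> stays bounded
  because x y - floor y floor x is at most 3 floor y.\<close>

lemma E2_bound:
  assumes ad: "admissible \<sigma> t0 r0 c l0 d t x y" and g: "0 \<le> \<sigma>" "\<sigma> \<le> 1" "t0 \<ge> 2 * pi" "0 < r0" "r0 \<le> pi / sqrt 2"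
    and t: "1 \<le> t" and e: "e > 0" "calE4 \<sigma> t c \<ge> e" "1 / (4 * e) \<le> t"
  shows "0 \<le> E2 \<sigma> t x y r0 c l0"
    "E2 \<sigma> t x y r0 c l0 \<le> sqrt (2 / e) * (1 / (1 - exp (- r0 / sqrt 2)) + 1 / (exp l0 - 1)) * exp (l0 + 1)
       + r0 / (1 - exp (- r0 / sqrt 2)) * exp (4 * r0 + r0\<^sup>2 * 4 * 2 * (1/2 + r0) / (2 * pi))"
proof -
  note D = admissibleD[OF ad g(1-4)]
  define A where "A = 1 - exp (- r0 / sqrt 2)"
  have A: "A > 0" using g by (simp add: A_def)
  have l0: "l0 > 0" using D(8) g by simp
  have l: "1 / (exp l0 - 1) > 0" using l0 by simp
  have y1: "y \<ge> 1" using D(2,3) by simp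
  define n where "n = (of_int \<lfloor>y\<rfloor> :: real)"
  define m where "m = (of_int \<lfloor>x\<rfloor> :: real)"
  have n: "1 \<le> n" "n \<le> y" "y \<le> n + 1" using y1 unfolding n_def by (simp, simp, linarith)
  have m: "1 \<le> m" "m \<le> n" "x \<le> m + 1" using D(2,3) unfolding n_def m_def by (simp, simp add: floor_mono, linarith)
  have r3: "r0 < 3"
  proof -
    have "pi / sqrt 2 \<le> (63/20) / (14142/10000)" using pi_lt_63_20 sqrt2_bounds by (intro frac_le) auto
    also have "\<dots> < 3" by simp
    finally show ?thesis using g by linarith
  qed
  show "0 \<le> E2 \<sigma> t x y r0 c l0" unfolding E2_def A_def[symmetric] using A l e g D(2) y1 by simp
  have s1: "0 \<le> 1 - \<sigma>" "1 - \<sigma> \<le> 1" using g by auto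
  have e5: "calE5 \<sigma> t x c l0 \<le> l0 + 1"
  proof -
    have "l0 * (x - of_int \<lfloor>x\<rfloor>) \<le> l0 * 1" using l0 by (intro mult_left_mono) linarith+
    moreover have "(1 - \<sigma>)\<^sup>2 / (4 * \<bar>t\<bar> * calE4 \<sigma> t c) \<le> 1"
    proof -
      have "1 \<le> 4 * t * e" using e t by (simp add: field_simps)
      also have "4 * t * e \<le> 4 * t * calE4 \<sigma> t c" using e t by (intro mult_left_mono) auto
      finally have q: "1 \<le> 4 * \<bar>t\<bar> * calE4 \<sigma> t c" using t by simp
      have "(1 - \<sigma>)\<^sup>2 \<le> 1" using s1 by (simp add: power_le_one)
      then show ?thesis using q by (simp add: divide_le_eq_1)
    qed
    ultimately show ?thesis by (simp add: calE5_def)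
  qed
  have e6: "calE6 \<sigma> t x y r0 \<le> 4 * r0 + r0\<^sup>2 * 4 * 2 * (1/2 + r0) / (2 * pi)"
  proof -
    have "(1 - \<sigma>) * r0 / (2 * pi * n) \<le> 1 * r0 / 1"
      using s1 g n pi_gt_157_50 mult_mono[of 1 "2 * pi" 1 n] by (intro frac_le mult_mono) auto
    moreover have "r0 * (x * y - n * m) / n \<le> r0 * 3"
    proof -
      have "x * y \<le> (m + 1) * (n + 1)" using m n D(2) y1 by (intro mult_mono) auto
      then have "x * y - n * m \<le> 3 * n" using m n by (simp add: algebra_simps)
      then have "r0 * (x * y - n * m) / n \<le> r0 * (3 * n) / n" using g n by (intro divide_right_mono mult_left_mono) auto
      then show ?thesis using n by simp
    qed
    moreover have "r0\<^sup>2 * x * y * (1 + (1 - \<sigma>) / \<bar>t\<bar>) * (1 / 2 + r0 / (3 * (2 * pi * n - r0))) / (2 * pi * n\<^sup>2) \<le> r0\<^sup>2 * 4 * 2 * (1/2 + r0) / (2 * pi)"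
    proof -
      have "x \<le> 2 * n" "y \<le> 2 * n" using D(3) n by auto
      then have "x * y \<le> (2 * n) * (2 * n)" using D(2) y1 by (intro mult_mono) auto
      then have xy: "r0\<^sup>2 * (x * y) \<le> r0\<^sup>2 * (4 * n\<^sup>2)" by (intro mult_left_mono) (auto simp: power2_eq_square)
      have a: "1 + (1 - \<sigma>) / \<bar>t\<bar> \<le> 2" "0 \<le> 1 + (1 - \<sigma>) / \<bar>t\<bar>" using s1 t by auto
      have "2 * (157/50) * 1 \<le> 2 * pi * n" using n pi_gt_157_50 by (intro mult_mono) auto
      then have q: "1 \<le> 3 * (2 * pi * n - r0)" using r3 by simp
      have b: "r0 / (3 * (2 * pi * n - r0)) \<le> r0" "0 \<le> r0 / (3 * (2 * pi * n - r0))"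
        using frac_le[of r0 r0 1 "3 * (2 * pi * n - r0)"] q g by auto
      have "r0\<^sup>2 * (x * y) * (1 + (1 - \<sigma>) / \<bar>t\<bar>) \<le> r0\<^sup>2 * (4 * n\<^sup>2) * 2"
        by (rule mult_mono[OF xy a(1)]) (use a in auto)
      then have "r0\<^sup>2 * (x * y) * (1 + (1 - \<sigma>) / \<bar>t\<bar>) * (1 / 2 + r0 / (3 * (2 * pi * n - r0))) \<le> r0\<^sup>2 * (4 * n\<^sup>2) * 2 * (1/2 + r0)"
        by (rule mult_mono) (use b in auto)
      then have "r0\<^sup>2 * (x * y) * (1 + (1 - \<sigma>) / \<bar>t\<bar>) * (1 / 2 + r0 / (3 * (2 * pi * n - r0))) / (2 * pi * n\<^sup>2) \<le> r0\<^sup>2 * (4 * n\<^sup>2) * 2 * (1/2 + r0) / (2 * pi * n\<^sup>2)"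
        using n by (intro divide_right_mono) auto
      also have "\<dots> = r0\<^sup>2 * 4 * 2 * (1/2 + r0) / (2 * pi)" using n by simp
      finally show ?thesis by (simp add: mult.assoc)
    qed
    ultimately show ?thesis unfolding calE6_def n_def[symmetric] m_def[symmetric] by simp
  qed
  have "sqrt (2 / calE4 \<sigma> t c) * (1 / A + 1 / (exp l0 - 1)) * exp (calE5 \<sigma> t x c l0) \<le> sqrt (2 / e) * (1 / A + 1 / (exp l0 - 1)) * exp (l0 + 1)"
    using e e5 A l by (intro mult_mono) (auto intro!: divide_left_mono)
  moreover have "r0 / A * sqrt (x / (2 * y)) * (1 + 1 / y) powr (\<sigma> - 1) * exp (calE6 \<sigma> t x y r0) \<le> r0 / A * 1 * 1 * exp (4 * r0 + r0\<^sup>2 * 4 * 2 * (1/2 + r0) / (2 * pi))"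
  proof (intro mult_mono)
    show "sqrt (x / (2 * y)) \<le> 1" using D(2,3) y1 by simp
    have "(1 + 1 / y) powr (\<sigma> - 1) \<le> (1 + 1 / y) powr 0" using g y1 by (intro powr_mono) auto
    moreover have "1 + 1 / y > 0" using y1 by (intro add_pos_pos) auto
    ultimately show "(1 + 1 / y) powr (\<sigma> - 1) \<le> 1" by simp
  qed (use e6 A g D(2) y1 in auto)
  ultimately show "E2 \<sigma> t x y r0 c l0 \<le> sqrt (2 / e) * (1 / (1 - exp (- r0 / sqrt 2)) + 1 / (exp l0 - 1)) * exp (l0 + 1)
       + r0 / (1 - exp (- r0 / sqrt 2)) * exp (4 * r0 + r0\<^sup>2 * 4 * 2 * (1/2 + r0) / (2 * pi))"
    unfolding E2_def A_def[symmetric] by simp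
qed

lemma part_bounded:
  assumes g: "0 \<le> \<sigma>" "\<sigma> \<le> 1" "t0 \<ge> 2 * pi" "0 < r0" "r0 \<le> pi / sqrt 2"
  shows "\<exists>B. \<forall>\<^sub>F t in at_top. \<forall>x y. admissible \<sigma> t0 r0 c l0 d t x y \<and> calE4 \<sigma> t c > 0 \<longrightarrow> \<bar>Etotal \<sigma> t x y r0 c l0 d\<bar> \<le> B"
proof -
  \<comment> \<open>The limit of \<open>calE4\<close> as t grows. For admissible c it is also an
    upper bound, so if e \<le> 0 the condition \<open>calE4 \<sigma> t c > 0\<close> is never
    met.\<close>
  define e where "e = 1 - 2 * sqrt 2 * c / (3 * (1 - c * sqrt 2))"
  define k where "k = 2 * sqrt 2 * c / (3 * (1 - c * sqrt 2))"
  have E4: "calE4 \<sigma> t c = 1 - (1 + (1 - \<sigma>) / t) * k" if "t > 0" for t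
    using that by (simp add: calE4_def k_def field_simps)
  show ?thesis
  proof (cases "0 < c \<and> c < 43/100 \<and> e > 0")
    case False
    have nn: "\<not> (admissible \<sigma> t0 r0 c l0 d t x y \<and> calE4 \<sigma> t c > 0)" if t: "t > 0" for t x y
    proof
      assume ad: "admissible \<sigma> t0 r0 c l0 d t x y \<and> calE4 \<sigma> t c > 0"
      then have c: "0 < c" "c < 43/100" using admissibleD(5,7)[OF _ g(1-4)] by blast+
      have "c * sqrt 2 \<le> 43/100 * (14143/10000)" using c sqrt2_bounds by (intro mult_mono) auto
      then have "k > 0" using c by (simp add: k_def)
      then have "1 * k \<le> (1 + (1 - \<sigma>) / t) * k" using g t by (intro mult_right_mono) auto
      then have "calE4 \<sigma> t c \<le> e" using E4[OF t] by (simp add: e_def k_def)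
      then show False using ad c False by auto
    qed
    have "\<forall>\<^sub>F t in at_top. \<forall>x y. admissible \<sigma> t0 r0 c l0 d t x y \<and> calE4 \<sigma> t c > 0 \<longrightarrow> \<bar>Etotal \<sigma> t x y r0 c l0 d\<bar> \<le> 0"
      by (rule eventually_mono[OF eventually_gt_at_top[of "0::real"]]) (use nn in blast)
    then show ?thesis by blast
  next
    case True
    define K where "K = sqrt (2 / (e / 2)) * (1 / (1 - exp (- r0 / sqrt 2)) + 1 / (exp l0 - 1)) * exp (l0 + 1)
       + r0 / (1 - exp (- r0 / sqrt 2)) * exp (4 * r0 + r0\<^sup>2 * 4 * 2 * (1/2 + r0) / (2 * pi))"
    have "((\<lambda>t. 1 - (1 + (1 - \<sigma>) / t) * k) \<longlongrightarrow> 1 - (1 + 0) * k) at_top" 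
    proof (intro tendsto_intros)
      show "((\<lambda>t. (1 - \<sigma>) / t) \<longlongrightarrow> 0) at_top" by real_asymp
    qed
    moreover have "e / 2 < 1 - (1 + 0) * k" using True by (simp add: e_def k_def)
    ultimately have 1: "\<forall>\<^sub>F t in at_top. e / 2 < 1 - (1 + (1 - \<sigma>) / t) * k" by (rule order_tendstoD)
    have 2: "\<forall>\<^sub>F t in at_top. sqrt t * c \<ge> 1" "\<forall>\<^sub>F t in at_top. sqrt t \<ge> (10::real)"
      using True by real_asymp+
    note 3 = part_tendsto_0[OF g(1-4) zero_less_one, of c l0 d]
    have "\<forall>\<^sub>F t in at_top. \<forall>x y. admissible \<sigma> t0 r0 c l0 d t x y \<and> calE4 \<sigma> t c > 0 \<longrightarrow> \<bar>Etotal \<sigma> t x y r0 c l0 d\<bar> \<le> exp 1 * (3 + K)"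
      using 1 2 3 eventually_ge_at_top[of "1::real"] eventually_ge_at_top[of "1 / (4 * (e / 2))"]
    proof eventually_elim
      case (elim t)
      show ?case
      proof (intro allI impI)
        fix x y assume "admissible \<sigma> t0 r0 c l0 d t x y \<and> calE4 \<sigma> t c > 0"
        then have ad: "admissible \<sigma> t0 r0 c l0 d t x y" by simp
        have t0: "t > 0" using elim(5) by simp
        have "calE4 \<sigma> t c \<ge> e / 2" using E4[OF t0] elim(1) by simp
        then have E2: "0 \<le> E2 \<sigma> t x y r0 c l0" "E2 \<sigma> t x y r0 c l0 \<le> K"
          unfolding K_def using E2_bound[OF ad g elim(5), of "e / 2"] True elim(6) by auto
        have E134: "E1 \<sigma> t x c d < 1" "E3 \<sigma> t x c < 1" "E4 \<sigma> t x y r0 c < 1" using elim(4) ad by fastforce+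
        note E0 = E_bounds(1,3,5)[OF ad g(1-4) t0 elim(2,3)]
        have C: "C2 t \<le> exp 1" "0 < C2 t"
        proof -
          have "1 / (12 * t) \<le> 1 / 12" using elim(5) by (simp add: field_simps)
          moreover have "1 \<le> t ^ 3" using elim(5) by (intro one_le_power) auto
          then have "1 / (90 * t ^ 3) \<le> 1 / 90" using frac_le[of 1 1 90 "90 * t ^ 3"] by simp
          ultimately have "1 / (12 * t) + 1 / (90 * t ^ 3) \<le> 1" by linarith
          then show "C2 t \<le> exp 1" using t0 by (simp add: C2_def)
        qed (simp add: C2_def)
        have p: "2 powr (- \<sigma>) \<le> 1" "0 < 2 powr (- \<sigma>)" using powr_mono[of "- \<sigma>" 0 2] g by auto
        define S where "S = E1 \<sigma> t x c d + E2 \<sigma> t x y r0 c l0 + E3 \<sigma> t x c + E4 \<sigma> t x y r0 c"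
        have S: "0 \<le> S" "S \<le> 3 + K" using E0 E134 E2 by (auto simp: S_def)
        have "2 powr (- \<sigma>) * C2 t * S \<le> 1 * exp 1 * (3 + K)" using p C S by (intro mult_mono) auto
        moreover have "0 \<le> 2 powr (- \<sigma>) * C2 t * S" using p C S by simp
        ultimately show "\<bar>Etotal \<sigma> t x y r0 c l0 d\<bar> \<le> exp 1 * (3 + K)" by (simp add: Etotal_def S_def)
      qed
    qed
    then show ?thesis by blast
  qed
qed

section \<open>The main theorem\<close>

text \<open>The modulus of \<open>chi_tilde\<close> is (2 pi / t)^(\<sigma> - 1/2), so only exp R (1
  - exp (i pi s)) has to be estimated. The second bound keeps the denominator t - norm
  \<open>Cerr\<close> positive.\<close>

lemma chi_estimates:
  assumes \<sigma>: "0 \<le> \<sigma>" "\<sigma> \<le> 1" and t: "t \<ge> 2 * pi"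
  shows "norm (chi (Complex \<sigma> t)) \<le> 1035/1000 * (2 * pi / t) powr (\<sigma> - 1/2)" "norm (Cerr \<sigma> t) < t"
proof -
  have t6: "t > 6" using t pi_gt_157_50 by linarith
  obtain R where R: "chi (Complex \<sigma> t) = chi_tilde \<sigma> t * (exp R * (1 - exp (\<i> * of_real pi * Complex \<sigma> t)))"
    "Re R \<le> 1/30" "norm R \<le> 2/5" using chi_stirling[OF \<sigma> t] by metis
  define E where "E = exp (\<i> * of_real pi * Complex \<sigma> t)"
  have nE: "norm E \<le> 1/2000"
  proof -
    have "157/50 * (2 * (157/50)) \<le> pi * t" using t pi_gt_157_50 by (intro mult_mono) auto
    then have pt: "9 + 9 \<le> pi * t" by simp
    have "exp (9 :: real) \<ge> 50" using exp_ge_quartic[of 9] by (simp add: numeral_eq_Suc)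
    then have "50 * 50 \<le> exp (9::real) * exp 9" by (intro mult_mono) auto
    also have "\<dots> \<le> exp (pi * t)" using pt by (simp flip: exp_add)
    finally have "2000 \<le> exp (pi * t)" by simp
    moreover have "norm E = 1 / exp (pi * t)" by (simp add: E_def exp_minus inverse_eq_divide)
    ultimately show ?thesis by (simp add: divide_le_eq)
  qed
  have nt: "norm (chi_tilde \<sigma> t) = (2 * pi / t) powr (\<sigma> - 1/2)"
  proof -
    have "norm (of_real (\<bar>t\<bar> / (2 * pi * exp 1)) powr (- \<i> * of_real t) :: complex) = 1"
    proof -
      have "norm (of_real r powr (- \<i> * of_real t) :: complex) = 1" if "r > 0" for r
        using norm_powr_complex[of "of_real r" "- \<i> * of_real t"] that by (simp add: Arg_of_real)
      moreover have "\<bar>t\<bar> / (2 * pi * exp 1) > 0" using t6 by simp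
      ultimately show ?thesis by blast
    qed
    moreover have "norm (exp (of_real (sgn t) * of_real pi * \<i> / 4) :: complex) = 1" by simp
    moreover have "norm (of_real ((2 * pi / \<bar>t\<bar>) powr (\<sigma> - 1 / 2)) :: complex) = (2 * pi / t) powr (\<sigma> - 1/2)"
      using t6 by (simp only: norm_of_real) simp
    ultimately show ?thesis unfolding chi_tilde_def norm_mult by simp
  qed
  have eR: "norm (exp R) \<le> 10345/10000"
  proof -
    have "norm (exp R) \<le> exp (1/30)" using R(2) by simp
    also have "exp (1/30 :: real) \<le> 1 + 1/30 + (1/30)^2" by (rule exp_bound) auto
    finally show ?thesis by (simp add: power2_eq_square)
  qed
  have n1: "norm (1 - E) \<le> 1 + 1/2000" using norm_triangle_ineq4[of 1 E] nE by simp
  have "norm (exp R * (1 - E)) \<le> 10345/10000 * (1 + 1/2000)" unfolding norm_mult using eR n1 by (intro mult_mono) auto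
  then have "norm (exp R * (1 - E)) \<le> 1035/1000 + 1/10000" by simp
  \<comment> \<open>The quadratic bound for exp (1/30) just misses 1035/1000; exp (- 1/30) \<ge>
    (59/60)^2 is slightly sharper.\<close>
  have q: "norm (exp R * (1 - E)) \<le> 1035/1000"
  proof -
    have "exp (1/30 :: real) * exp (- (1/30)) = 1" by (simp flip: exp_add)
    moreover have "exp (- (1/30) :: real) \<ge> 29/30" using exp_ge_add_one_self[of "- (1/30) :: real"] by simp
    moreover have "exp (- (1/60) :: real) \<ge> 59/60" using exp_ge_add_one_self[of "- (1/60) :: real"] by simp
    then have "59/60 * (59/60) \<le> exp (- (1/60) :: real) * exp (- (1/60))" by (intro mult_mono) auto
    then have "3481/3600 \<le> exp (- (1/30) :: real)" by (simp flip: exp_add)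
    then have "exp (1/30 :: real) \<le> 1 / (3481/3600)" using exp_minus[of "1/30 :: real"] by (simp add: field_simps)
    then have "exp (1/30 :: real) \<le> 1 / (3481/3600)" .
    moreover have "exp (1/30 :: real) \<le> 10342/10000"
      using calculation by simp
    ultimately have "exp (1/30 :: real) \<le> 10342/10000" by simp
    then have "norm (exp R) \<le> 10342/10000" using R(2) by (smt (verit) exp_le_cancel_iff norm_exp_eq_Re)
    then have "norm (exp R * (1 - E)) \<le> 10342/10000 * (1 + 1/2000)" unfolding norm_mult using n1 by (intro mult_mono) auto
    then show ?thesis by simp
  qed
  have "norm (chi (Complex \<sigma> t)) = (2 * pi / t) powr (\<sigma> - 1/2) * norm (exp R * (1 - E))"
    unfolding R(1) E_def[symmetric] by (simp only: norm_mult nt)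
  also have "\<dots> \<le> (2 * pi / t) powr (\<sigma> - 1/2) * (1035/1000)" using q by (intro mult_left_mono) auto
  finally show "norm (chi (Complex \<sigma> t)) \<le> 1035/1000 * (2 * pi / t) powr (\<sigma> - 1/2)" by (simp add: mult.commute)
  have ct0: "chi_tilde \<sigma> t \<noteq> 0" using nt t6 by (metis norm_zero powr_eq_0_iff divide_pos_pos less_irrefl mult_pos_pos pi_gt_zero zero_less_numeral order_less_trans)
  have "norm (exp R - (\<Sum>k\<le>0. R ^ k / fact k)) \<le> exp \<bar>Re R\<bar> * norm R ^ Suc 0 / fact 0" by (rule Taylor_exp)
  then have "norm (exp R - 1) \<le> exp \<bar>Re R\<bar> * norm R" by simp
  also have "\<dots> \<le> (156/100) * (2/5)"
  proof (intro mult_mono)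
    have "exp \<bar>Re R\<bar> \<le> exp (2/5)" using R(3) abs_Re_le_cmod[of R] by simp
    also have "exp (2/5 :: real) \<le> 1 + 2/5 + (2/5)^2" by (rule exp_bound) auto
    finally show "exp \<bar>Re R\<bar> \<le> 156/100" by (simp add: power2_eq_square)
  qed (use R in auto)
  finally have r1: "norm (exp R - 1) \<le> 624/1000" by simp
  have "norm (exp R * (1 - E) - 1) \<le> norm (exp R - 1) + norm (exp R * E)"
    using norm_triangle_ineq4[of "exp R - 1" "exp R * E"] by (simp add: algebra_simps)
  also have "norm (exp R * E) \<le> 10345/10000 * (1/2000)" unfolding norm_mult using eR nE by (intro mult_mono) auto
  finally have l: "norm (exp R * (1 - E) - 1) < 1" using r1 by simp
  have "chi (Complex \<sigma> t) / chi_tilde \<sigma> t - 1 = exp R * (1 - E) - 1" using ct0 unfolding R(1) E_def[symmetric] by simp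
  then have "norm (Cerr \<sigma> t) = t * norm (exp R * (1 - E) - 1)" using t6 by (simp add: Cerr_def norm_mult)
  also have "\<dots> < t * 1" using l t6 by (intro mult_strict_left_mono) auto
  finally show "norm (Cerr \<sigma> t) < t" by simp
qed

lemma norm_Cerr_less:
  assumes "0 \<le> \<sigma>" "\<sigma> \<le> 1" "\<bar>t\<bar> \<ge> 2 * pi"
  shows "norm (Cerr \<sigma> t) < \<bar>t\<bar>"
proof (cases "t \<ge> 0")
  case True
  then show ?thesis using chi_estimates(2)[OF assms(1,2), of t] assms by simp
next
  case False
  then show ?thesis using chi_estimates(2)[OF assms(1,2), of "- t"] norm_Cerr_minus[of t \<sigma>] assms by simp
qed

text \<open>With w = \<open>sqrt 2 powr \<tau>\<close> the first claim is (w - 1)^2 \<ge> 0; it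
  makes the comparison affine in v = 2^\<tau> - 1.\<close>

lemma powr_le_linear:
  fixes \<tau> :: real assumes "0 \<le> \<tau>" "\<tau> \<le> 1"
  shows "sqrt 2 powr \<tau> \<le> 1 + (2 powr \<tau> - 1) / 2" "1 \<le> 2 powr \<tau>" "2 powr \<tau> \<le> 2"
proof -
  have "(sqrt 2 powr \<tau>) ^ 2 = (sqrt 2 * sqrt 2) powr \<tau>" by (simp add: power2_eq_square powr_mult del: real_sqrt_mult_self)
  then have q: "(sqrt 2 powr \<tau>) ^ 2 = 2 powr \<tau>" by simp
  have "0 \<le> (sqrt 2 powr \<tau> - 1)^2" by simp
  then have "0 \<le> (sqrt 2 powr \<tau>)^2 - 2 * sqrt 2 powr \<tau> + 1" by (simp add: power2_diff)
  moreover have "w \<le> 1 + (W - 1) / 2" if "0 \<le> w^2 - 2 * w + 1" "w^2 = W" for w W :: real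
    using that by (simp add: field_simps)
  ultimately show "sqrt 2 powr \<tau> \<le> 1 + (2 powr \<tau> - 1) / 2" using q by blast
  show "1 \<le> 2 powr \<tau>" using assms by (intro ge_one_powr_ge_zero) auto
  show "2 powr \<tau> \<le> 2" using powr_mono[of \<tau> 1 2] assms by simp
qed

text \<open>Admissibility is taken at \<sigma>' and the conclusion at \<sigma>, since the swapped
  remainder is compared with \<open>Etotal (1 - \<sigma>)\<close>. In \<open>E2\<close>,
  \<open>calE4\<close> \<le> 1 gives the factor sqrt 2, r0 \<le> l0 gives exp (r0 frac x), and y
  \<ge> 1 gives (1 + 1/y)^(\<sigma> - 1) \<ge> 2^(\<sigma> - 1); the other three summands are
  nonnegative.\<close>

lemma Etotal_lower:
  assumes ad: "admissible \<sigma>' t0 r0 c l0 d t x y" and g: "0 \<le> \<sigma>'" "\<sigma>' \<le> 1" "t0 \<ge> 2 * pi" "0 < r0" "r0 \<le> pi / sqrt 2"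
    and ad': "0 < calE4 \<sigma> t c" and \<sigma>: "0 \<le> \<sigma>" "\<sigma> \<le> 1"
  shows "1035/1000 * (sqrt 2 powr (1 - \<sigma>) * bound_const x y) \<le> Etotal \<sigma> t x y r0 c l0 d"
proof -
  note D = admissibleD[OF ad g(1-4)]
  define s where "s = r0 / sqrt 2"
  define A where "A = 1 / (1 - exp (- s))"
  define h where "h = sqrt (x / y)"
  define f where "f = frac x"
  define v where "v = 2 powr (1 - \<sigma>) - 1"
  define X where "X = 1 / (exp l0 - 1)"
  have r2: "sqrt 2 * sqrt 2 = (2 :: real)" by simp
  have rs: "r0 = sqrt 2 * s" by (simp add: s_def)
  have s: "0 < s" "s \<le> pi / 2"
  proof -
    show "0 < s" using g by (simp add: s_def)
    have "r0 / sqrt 2 \<le> (pi / sqrt 2) / sqrt 2" using g by (intro divide_right_mono) auto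
    then show "s \<le> pi / 2" by (simp add: s_def)
  qed
  have A0: "A > 0" using s by (simp add: A_def)
  have y1: "y \<ge> 1" using D(2,3) by simp
  have h: "0 \<le> h" "h \<le> 1" "h^2 = x / y" using D(2,3) by (simp_all add: h_def)
  have f: "0 \<le> f" "f < 1" by (simp_all add: f_def frac_lt_1)
  have l0: "l0 > 0" using D(8) g by simp
  have X: "X \<ge> 0" using l0 by (simp add: X_def)
  note pw = powr_le_linear[of "1 - \<sigma>"]
  have v: "0 \<le> v" "v \<le> 1" using pw \<sigma> by (simp_all add: v_def)
  define F1 where "F1 = A * exp (sqrt 2 * s * f) / sqrt 2"
  define F2 where "F2 = s * A * h / 2 * exp (s^2 * h^2 / (2 * pi))"
  have b0: "bound_const x y \<ge> 0" unfolding bound_const_def using D(2,3) frac_ge_0[of x] by (auto intro!: add_nonneg_nonneg mult_nonneg_nonneg)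
  have "1035/1000 * ((1 + v/2) * bound_const x y) \<le> (1 + v) * F1 + F2"
    by (rule budget[OF s A_def h(1,2) f v F1_def _ _ _ b0]) (auto simp: F2_def bound_const_def h_def f_def)
  moreover have "1035/1000 * (sqrt 2 powr (1 - \<sigma>) * bound_const x y) \<le> 1035/1000 * ((1 + v/2) * bound_const x y)"
    using pw(1) \<sigma> b0 by (intro mult_left_mono mult_right_mono) (auto simp: v_def)
  moreover have "(1 + v) * F1 + F2 \<le> Etotal \<sigma> t x y r0 c l0 d"
  proof -
    define n where "n = (of_int \<lfloor>y\<rfloor> :: real)"
    have n: "1 \<le> n" "n \<le> y" using y1 by (simp_all add: n_def)
    have t6: "\<bar>t\<bar> > 6" by (rule D(1))
    have E1: "0 \<le> E1 \<sigma> t x c d"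
    proof -
      have "0 < calE2 \<bar>t\<bar> x c d" using calE2_pos[of c d "\<bar>t\<bar>" x] D t6 by simp
      then have "0 \<le> calE2 t x c d" by (simp add: calE2_def)
      moreover have "0 \<le> calE3 t x d" using D t6 by (simp add: calE3_def)
      ultimately show ?thesis by (simp add: E1_def)
    qed
    have E3: "0 \<le> E3 \<sigma> t x c"
    proof -
      have f0: "0 \<le> (2 - c + pi * x / \<bar>t\<bar>) / (1 - exp (- c * \<bar>t\<bar> / x))" using D t6 by (intro divide_nonneg_nonneg add_nonneg_nonneg) auto
      show ?thesis unfolding E3_def by (rule mult_nonneg_nonneg[OF mult_nonneg_nonneg[OF mult_nonneg_nonneg[OF _ f0]]]) auto
    qed
    have A': "1 - exp (- r0 / sqrt 2) = 1 / A" by (simp add: A_def s_def)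
    have E4: "0 \<le> E4 \<sigma> t x y r0 c" unfolding E4_def A' using D A0 by simp
    have c2: "1 \<le> C2 t" by (simp add: C2_def)
    have p: "0 < 2 powr (- \<sigma>)" by simp
    have e4: "0 < calE4 \<sigma> t c" "calE4 \<sigma> t c \<le> 1"
    proof -
      have "c * sqrt 2 \<le> 43/100 * (14143/10000)" using D(5,7) sqrt2_bounds by (intro mult_mono) auto
      then have "0 \<le> (1 - \<sigma> + \<bar>t\<bar>) * 2 * sqrt 2 * c / (3 * \<bar>t\<bar> * (1 - c * sqrt 2))" using \<sigma> D(5) t6 by (intro divide_nonneg_nonneg mult_nonneg_nonneg) auto
      then show "calE4 \<sigma> t c \<le> 1" by (simp add: calE4_def)
    qed (rule ad')
    have first: "sqrt 2 * A * exp (sqrt 2 * s * f) \<le> sqrt (2 / calE4 \<sigma> t c) * (1 / (1 - exp (- r0 / sqrt 2)) + 1 / (exp l0 - 1)) * exp (calE5 \<sigma> t x c l0)"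
    proof -
      have "sqrt 2 \<le> sqrt (2 / calE4 \<sigma> t c)" using e4 by (simp add: field_simps)
      moreover have "sqrt 2 * s * f \<le> calE5 \<sigma> t x c l0"
      proof -
        have "r0 * f \<le> l0 * f" using D(8) f by (intro mult_right_mono) auto
        moreover have "0 \<le> (1 - \<sigma>)\<^sup>2 / (4 * \<bar>t\<bar> * calE4 \<sigma> t c)" using e4 by simp
        ultimately show ?thesis by (simp add: calE5_def rs[symmetric] f_def frac_def)
      qed
      ultimately show ?thesis unfolding A' X_def[symmetric] using A0 X e4 by (intro mult_mono) auto
    qed
    \<comment> \<open>The last summand of \<open>calE6\<close> with floor y replaced by y and its
      bracket by 1/2; r0^2 = 2 s^2.\<close>
    have e6: "s^2 * h^2 / (2 * pi) \<le> calE6 \<sigma> t x y r0"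
    proof -
      have "2 * (157/50) * 1 \<le> 2 * pi * n" using n pi_gt_157_50 by (intro mult_mono) auto
      moreover have "r0 \<le> 3"
      proof -
        have "pi / sqrt 2 \<le> (63/20) / (14142/10000)" using pi_lt_63_20 sqrt2_bounds by (intro frac_le) auto
        also have "\<dots> \<le> 3" by simp
        finally show ?thesis using g by linarith
      qed
      ultimately have q: "0 \<le> r0 / (3 * (2 * pi * n - r0))" using g by (intro divide_nonneg_nonneg) auto
      have "s^2 * h^2 / (2 * pi) = 2 * s^2 * x * y * 1 * (1/2) / (2 * pi * y^2)" unfolding h(3) using y1 by (simp add: power2_eq_square field_simps)
      also have "\<dots> \<le> r0\<^sup>2 * x * y * (1 + (1 - \<sigma>) / \<bar>t\<bar>) * (1 / 2 + r0 / (3 * (2 * pi * n - r0))) / (2 * pi * n\<^sup>2)"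
      proof (intro frac_le mult_mono)
        show "2 * s^2 \<le> r0\<^sup>2" by (simp add: rs power_mult_distrib)
        show "1 \<le> 1 + (1 - \<sigma>) / \<bar>t\<bar>" using \<sigma> by simp
        show "1 / 2 \<le> 1 / 2 + r0 / (3 * (2 * pi * n - r0))" using q by simp
        show "n\<^sup>2 \<le> y\<^sup>2" using n by (intro power_mono) auto
      qed (use D(2) y1 n q \<sigma> in auto)
      also have "\<dots> \<le> calE6 \<sigma> t x y r0"
      proof -
        have "0 \<le> (1 - \<sigma>) * r0 / (2 * pi * n)" using \<sigma> g n by simp
        moreover have "n * of_int \<lfloor>x\<rfloor> \<le> y * x" using n D(2,12,13) by (intro mult_mono) auto
        then have "0 \<le> r0 * (x * y - n * of_int \<lfloor>x\<rfloor>) / n" using g n by (simp add: mult.commute)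
        ultimately show ?thesis unfolding calE6_def n_def[symmetric] by simp
      qed
      finally show ?thesis .
    qed
    have pp: "2 powr (- \<sigma>) * sqrt 2 = 2 powr (1 - \<sigma>) / sqrt 2" 
      using r2 by (simp add: powr_diff powr_minus field_simps)
    have term1: "(1 + v) * F1 = 2 powr (- \<sigma>) * (sqrt 2 * A * exp (sqrt 2 * s * f))"
    proof -
      have "2 powr (- \<sigma>) * (sqrt 2 * A * exp (sqrt 2 * s * f)) = (2 powr (- \<sigma>) * sqrt 2) * (A * exp (sqrt 2 * s * f))" by simp
      also have "\<dots> = (1 + v) * F1" unfolding pp by (simp add: F1_def v_def)
      finally show ?thesis by simp
    qed
    have term2: "F2 \<le> 2 powr (- \<sigma>) * (r0 / (1 - exp (- r0 / sqrt 2)) * sqrt (x / (2 * y)) * (1 + 1 / y) powr (\<sigma> - 1) * exp (calE6 \<sigma> t x y r0))"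
    proof -
      have h2: "sqrt (x / (2 * y)) = h / sqrt 2"
      proof -
        have "x / (2 * y) = (x / y) / 2" by simp
        then show ?thesis unfolding h_def by (simp only: real_sqrt_divide)
      qed
      have "0 < 1 + 1 / y" using y1 by (intro add_pos_pos) auto
      then have "2 powr (\<sigma> - 1) \<le> (1 + 1 / y) powr (\<sigma> - 1)" using y1 \<sigma> by (intro powr_mono2') auto
      then have "2 powr (- \<sigma>) * 2 powr (\<sigma> - 1) \<le> 2 powr (- \<sigma>) * (1 + 1 / y) powr (\<sigma> - 1)" by (intro mult_left_mono) auto
      moreover have "2 powr (- \<sigma>) * 2 powr (\<sigma> - 1) = (1/2 :: real)"
      proof -
        have "2 powr (- \<sigma>) * 2 powr (\<sigma> - 1) = (2::real) powr (- \<sigma> + (\<sigma> - 1))" by (rule powr_add[symmetric])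
        also have "- \<sigma> + (\<sigma> - 1) = - 1" by simp
        finally show ?thesis by (simp add: powr_minus)
      qed
      ultimately have k: "1/2 \<le> 2 powr (- \<sigma>) * (1 + 1 / y) powr (\<sigma> - 1)" by simp
      have "F2 = (1/2) * ((s * A * h) * exp (s^2 * h^2 / (2 * pi)))" by (simp add: F2_def)
      also have "\<dots> \<le> (2 powr (- \<sigma>) * (1 + 1 / y) powr (\<sigma> - 1)) * ((s * A * h) * exp (calE6 \<sigma> t x y r0))"
        using k e6 s A0 h by (intro mult_mono mult_left_mono) auto
      also have "\<dots> = 2 powr (- \<sigma>) * (r0 / (1 - exp (- r0 / sqrt 2)) * sqrt (x / (2 * y)) * (1 + 1 / y) powr (\<sigma> - 1) * exp (calE6 \<sigma> t x y r0))"
      proof -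
        have e: "A = 1 / (1 - exp (- r0 / sqrt 2))" by (simp add: A_def s_def)
        have q: "r0 / (1 - exp (- r0 / sqrt 2)) * (h / sqrt 2) = s * A * h" unfolding e s_def
          by (simp only: times_divide_eq_right times_divide_eq_left divide_divide_eq_left mult_ac mult_1_left mult_1_right)
        show ?thesis unfolding h2 q[symmetric] by (simp only: mult_ac)
      qed
      finally show ?thesis .
    qed
    have "(1 + v) * F1 + F2 \<le> 2 powr (- \<sigma>) * E2 \<sigma> t x y r0 c l0"
      unfolding E2_def distrib_left[of "2 powr (- \<sigma>)"] term1
      by (rule add_mono[OF mult_left_mono[OF first] term2]) simp
    also have "\<dots> \<le> 2 powr (- \<sigma>) * (E1 \<sigma> t x c d + E2 \<sigma> t x y r0 c l0 + E3 \<sigma> t x c + E4 \<sigma> t x y r0 c)"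
      using E1 E3 E4 p by (intro mult_left_mono) auto
    also have "\<dots> \<le> C2 t * (2 powr (- \<sigma>) * (E1 \<sigma> t x c d + E2 \<sigma> t x y r0 c l0 + E3 \<sigma> t x c + E4 \<sigma> t x y r0 c))"
    proof -
      have "0 \<le> 2 powr (- \<sigma>) * E2 \<sigma> t x y r0 c l0"
        using \<open>(1 + v) * F1 + F2 \<le> 2 powr (- \<sigma>) * E2 \<sigma> t x y r0 c l0\<close> v A0 s h by (auto simp: F1_def F2_def intro: order_trans[rotated])
      then have "0 \<le> E2 \<sigma> t x y r0 c l0" using p by (simp add: zero_le_mult_iff)
      then have "0 \<le> 2 powr (- \<sigma>) * (E1 \<sigma> t x c d + E2 \<sigma> t x y r0 c l0 + E3 \<sigma> t x c + E4 \<sigma> t x y r0 c)" using E1 E3 E4 p by simp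
      from mult_right_mono[OF c2 this] show ?thesis by simp
    qed
    finally show ?thesis by (simp add: Etotal_def mult_ac)
  qed
  ultimately show ?thesis by linarith
qed

section \<open>Bounds for the two remainders\<close>

lemma bound_const_pos: "x \<ge> 1 \<Longrightarrow> x \<le> y \<Longrightarrow> bound_const x y > 0"
  unfolding bound_const_def using frac_ge_0[of x] by (auto intro!: add_pos_nonneg add_nonneg_nonneg mult_nonneg_nonneg)

lemma norm_R1_abs:
  assumes "t \<noteq> 0"
  shows "norm (R1 (Complex \<sigma> t) u v) = norm (R1 (Complex \<sigma> \<bar>t\<bar>) u v)"
proof (cases "t \<ge> 0")
  case False
  have "Complex \<sigma> t = cnj (Complex \<sigma> (- t))" by (simp add: complex_eq_iff)
  moreover have "Complex \<sigma> (- t) \<noteq> 1" using assms by (simp add: complex_eq_iff)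
  ultimately show ?thesis using R1_cnj[of "Complex \<sigma> (- t)" u v] False by simp
qed simp

lemma R1_swapped_bound:
  assumes \<sigma>: "0 \<le> \<sigma>" "\<sigma> \<le> 1" and xy: "1 \<le> x" "x \<le> y" and t: "\<bar>t\<bar> = 2 * pi * x * y"
  shows "norm (R1 (Complex \<sigma> t) y x) \<le> (\<bar>t\<bar> / (2 * pi)) powr (1 / 2 - \<sigma>) * x powr (\<sigma> - 1) * (sqrt 2 powr \<sigma> * bound_const x y)"
proof -
  have t0: "t \<noteq> 0" using t xy by auto
  have e: "\<bar>t\<bar> / (2 * pi) = x * y" using t by simp
  have "(x * y) powr (1 / 2 - \<sigma>) * x powr (\<sigma> - 1) = y powr (1 - \<sigma>) / sqrt (x * y)"
  proof -
    have 1: "(x * y) powr (1 / 2 - \<sigma>) = x powr (1 / 2 - \<sigma>) * y powr (1 / 2 - \<sigma>)" by (rule powr_mult)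
    have 2: "x powr (1 / 2 - \<sigma>) * x powr (\<sigma> - 1) = x powr (- (1 / 2))" by (simp flip: powr_add)
    have 3: "y powr (1 / 2 - \<sigma>) = y powr (1 - \<sigma>) * y powr (- (1 / 2))" by (simp flip: powr_add)
    have 4: "sqrt (x * y) = x powr (1 / 2) * y powr (1 / 2)" using xy by (simp add: powr_half_sqrt real_sqrt_mult)
    have "(x * y) powr (1 / 2 - \<sigma>) * x powr (\<sigma> - 1) = (x powr (1 / 2 - \<sigma>) * x powr (\<sigma> - 1)) * y powr (1 / 2 - \<sigma>)"
      unfolding 1 by (simp only: mult_ac)
    also have "\<dots> = y powr (1 - \<sigma>) / (x powr (1 / 2) * y powr (1 / 2))"
      unfolding 2 unfolding 3 powr_minus by (simp add: field_simps)
    finally show ?thesis unfolding 4 .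
  qed
  then show ?thesis using R1_bound_closed[OF \<sigma> xy t] norm_R1_abs[OF t0, of \<sigma> y x] unfolding e by (simp add: mult_ac)
qed

text \<open>The functional equation leads to the swapped remainder at 1 - \<sigma>; the powers of t
  / (2 pi) in the bounds for \<open>chi\<close> and for that remainder are reciprocal.\<close>

lemma R1_direct_bound:
  assumes \<sigma>: "0 \<le> \<sigma>" "\<sigma> \<le> 1" and xy: "1 \<le> x" "x \<le> y" and t: "\<bar>t\<bar> = 2 * pi * x * y"
  shows "norm (R1 (Complex \<sigma> t) x y) \<le> x powr (- \<sigma>) * (1035/1000 * (sqrt 2 powr (1 - \<sigma>) * bound_const x y))"
proof -
  define u where "u = \<bar>t\<bar>"
  have "1 * 1 \<le> x * y" using xy by (intro mult_mono) auto
  then have "2 * pi * 1 \<le> 2 * pi * (x * y)" by (intro mult_left_mono) auto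
  then have u2: "u \<ge> 2 * pi" using t by (simp add: u_def mult.assoc)
  then have u0: "u > 0" using pi_gt_zero by linarith
  have t0: "t \<noteq> 0" using u0 by (simp add: u_def)
  have "norm (R1 (Complex \<sigma> t) x y) = norm (R1 (Complex \<sigma> u) x y)" unfolding u_def by (rule norm_R1_abs[OF t0])
  also have "\<dots> = norm (chi (Complex \<sigma> u)) * norm (R1 (1 - Complex \<sigma> u) y x)"
    using R1_functional[of "Complex \<sigma> u" x y] u0 by (simp add: norm_mult)
  also have "1 - Complex \<sigma> u = Complex (1 - \<sigma>) (- u)" by (simp add: complex_eq_iff)
  finally have eq: "norm (R1 (Complex \<sigma> t) x y) = norm (chi (Complex \<sigma> u)) * norm (R1 (Complex (1 - \<sigma>) (- u)) y x)" .
  have A: "norm (R1 (Complex (1 - \<sigma>) (- u)) y x) \<le> (u / (2 * pi)) powr (1 / 2 - (1 - \<sigma>)) * x powr (1 - \<sigma> - 1) * (sqrt 2 powr (1 - \<sigma>) * bound_const x y)"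
    using R1_swapped_bound[of "1 - \<sigma>" x y "- u"] \<sigma> xy t u0 by (simp add: u_def)
  have "norm (R1 (Complex \<sigma> t) x y) \<le> (1035/1000 * (2 * pi / u) powr (\<sigma> - 1/2)) * ((u / (2 * pi)) powr (1 / 2 - (1 - \<sigma>)) * x powr (1 - \<sigma> - 1) * (sqrt 2 powr (1 - \<sigma>) * bound_const x y))"
    unfolding eq using chi_estimates(1)[OF \<sigma> u2] A by (intro mult_mono) auto
  also have "\<dots> = ((2 * pi / u) powr (\<sigma> - 1/2) * (u / (2 * pi)) powr (1 / 2 - (1 - \<sigma>))) * (x powr (- \<sigma>) * (1035/1000 * (sqrt 2 powr (1 - \<sigma>) * bound_const x y)))"
    by (simp add: mult_ac)
  also have "(2 * pi / u) powr (\<sigma> - 1/2) * (u / (2 * pi)) powr (1 / 2 - (1 - \<sigma>)) = 1"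
  proof -
    have "(2 * pi / u) powr (\<sigma> - 1/2) * (u / (2 * pi)) powr (\<sigma> - 1/2) = ((2 * pi / u) * (u / (2 * pi))) powr (\<sigma> - 1/2)" by (rule powr_mult[symmetric])
    also have "(2 * pi / u) * (u / (2 * pi)) = 1" using u0 by simp
    finally show ?thesis by simp
  qed
  finally show ?thesis by simp
qed

text \<open>For \<sigma> = 1 and c = 3 sqrt 2 / 10 the value of \<open>calE4\<close> is 0, and
  \<open>admissible\<close> bounds c through \<sigma> rather than 1 - \<sigma>. Each estimate
  therefore carries positivity of \<open>calE4\<close> at the abscissa where its E is evaluated. In
  the monotonicity clause x is fixed and y follows from t.\<close>

theorem theorem6:
  fixes \<sigma> t0 r0 c l0 d :: real
  assumes "0 \<le> \<sigma>" "\<sigma> \<le> 1" "t0 \<ge> 2 * pi" "0 < r0" "r0 \<le> pi / sqrt 2"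
  shows
    "(\<forall>t x y. admissible \<sigma> t0 r0 c l0 d t x y \<longrightarrow>
        (calE4 \<sigma> t c > 0 \<longrightarrow>
           norm (R1 (Complex \<sigma> t) x y) \<le> x powr (- \<sigma>) * Etotal \<sigma> t x y r0 c l0 d) \<and>
        ((if \<sigma> = 1 / 2 \<or> x = y then calE4 \<sigma> t c > 0 else calE4 (1 - \<sigma>) t c > 0) \<longrightarrow>
           (\<exists>F. norm (R1 (Complex \<sigma> t) y x)
                  \<le> (\<bar>t\<bar> / (2 * pi)) powr (1 / 2 - \<sigma>) * x powr (\<sigma> - 1) * F \<and>
                (if \<sigma> = 1 / 2 \<or> x = y then F = Etotal \<sigma> t x y r0 c l0 d
                 else F / Etotal (1 - \<sigma>) t x y r0 c l0 d \<le>
                   (if \<sigma> > 1 / 2 then 1 + norm (Cerr \<sigma> t) / \<bar>t\<bar>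
                    else 1 + norm (Cerr (1 - \<sigma>) t) / (\<bar>t\<bar> - norm (Cerr (1 - \<sigma>) t)))))))
     \<and> (\<exists>B. \<forall>\<^sub>F t in at_top. \<forall>x y.
          admissible \<sigma> t0 r0 c l0 d t x y \<and> calE4 \<sigma> t c > 0 \<longrightarrow>
          \<bar>Etotal \<sigma> t x y r0 c l0 d\<bar> \<le> B)
     \<and> (\<forall>\<epsilon>>0. \<forall>\<^sub>F t in at_top. \<forall>x y.
          admissible \<sigma> t0 r0 c l0 d t x y \<longrightarrow>
          \<bar>E1 \<sigma> t x c d\<bar> < \<epsilon> \<and> \<bar>E3 \<sigma> t x c\<bar> < \<epsilon> \<and> \<bar>E4 \<sigma> t x y r0 c\<bar> < \<epsilon>)
     \<and> (\<forall>x. \<exists>T. \<forall>t t' y y'.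
          T \<le> t \<and> t < t' \<and> admissible \<sigma> t0 r0 c l0 d t x y \<and>
          admissible \<sigma> t0 r0 c l0 d t' x y' \<longrightarrow>
          E1 \<sigma> t' x c d < E1 \<sigma> t x c d \<and> E3 \<sigma> t' x c < E3 \<sigma> t x c \<and>
          E4 \<sigma> t' x y' r0 c < E4 \<sigma> t x y r0 c)"
proof (intro conjI)
  show "\<forall>t x y. admissible \<sigma> t0 r0 c l0 d t x y \<longrightarrow>
        (calE4 \<sigma> t c > 0 \<longrightarrow>
           norm (R1 (Complex \<sigma> t) x y) \<le> x powr (- \<sigma>) * Etotal \<sigma> t x y r0 c l0 d) \<and>
        ((if \<sigma> = 1 / 2 \<or> x = y then calE4 \<sigma> t c > 0 else calE4 (1 - \<sigma>) t c > 0) \<longrightarrow>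
           (\<exists>F. norm (R1 (Complex \<sigma> t) y x)
                  \<le> (\<bar>t\<bar> / (2 * pi)) powr (1 / 2 - \<sigma>) * x powr (\<sigma> - 1) * F \<and>
                (if \<sigma> = 1 / 2 \<or> x = y then F = Etotal \<sigma> t x y r0 c l0 d
                 else F / Etotal (1 - \<sigma>) t x y r0 c l0 d \<le>
                   (if \<sigma> > 1 / 2 then 1 + norm (Cerr \<sigma> t) / \<bar>t\<bar>
                    else 1 + norm (Cerr (1 - \<sigma>) t) / (\<bar>t\<bar> - norm (Cerr (1 - \<sigma>) t))))))"
  proof (intro allI impI)
    fix t x y
    assume ad: "admissible \<sigma> t0 r0 c l0 d t x y"
    note D = admissibleD[OF ad assms(1-4)]
    note low = Etotal_lower[OF ad assms]
    have t2: "\<bar>t\<bar> \<ge> 2 * pi" using ad assms(3) by (simp add: admissible_def)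
    have direct: "norm (R1 (Complex \<sigma> t) x y) \<le> x powr (- \<sigma>) * Etotal \<sigma> t x y r0 c l0 d" if "calE4 \<sigma> t c > 0"
    proof -
      have "x powr (- \<sigma>) * (1035/1000 * (sqrt 2 powr (1 - \<sigma>) * bound_const x y)) \<le> x powr (- \<sigma>) * Etotal \<sigma> t x y r0 c l0 d"
        using low[OF that assms(1,2)] by (intro mult_left_mono) auto
      then show ?thesis using R1_direct_bound[OF assms(1,2) D(2,3,4)] by linarith
    qed
    have swapped: "norm (R1 (Complex \<sigma> t) y x) \<le> (\<bar>t\<bar> / (2 * pi)) powr (1 / 2 - \<sigma>) * x powr (\<sigma> - 1) * Etotal (1 - \<sigma>) t x y r0 c l0 d"
      and pos: "Etotal (1 - \<sigma>) t x y r0 c l0 d > 0" if "calE4 (1 - \<sigma>) t c > 0"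
    proof -
      define b where "b = sqrt 2 powr \<sigma> * bound_const x y"
      have b: "b > 0" using bound_const_pos[OF D(2,3)] by (simp add: b_def)
      have "1035/1000 * b \<le> Etotal (1 - \<sigma>) t x y r0 c l0 d" using low[OF that] assms(1,2) by (simp add: b_def)
      then have E: "b \<le> Etotal (1 - \<sigma>) t x y r0 c l0 d" using b by linarith
      then show "Etotal (1 - \<sigma>) t x y r0 c l0 d > 0" using b by linarith
      have "(\<bar>t\<bar> / (2 * pi)) powr (1 / 2 - \<sigma>) * x powr (\<sigma> - 1) * b \<le> (\<bar>t\<bar> / (2 * pi)) powr (1 / 2 - \<sigma>) * x powr (\<sigma> - 1) * Etotal (1 - \<sigma>) t x y r0 c l0 d"
        using E by (intro mult_left_mono) auto
      then show "norm (R1 (Complex \<sigma> t) y x) \<le> (\<bar>t\<bar> / (2 * pi)) powr (1 / 2 - \<sigma>) * x powr (\<sigma> - 1) * Etotal (1 - \<sigma>) t x y r0 c l0 d"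
        using R1_swapped_bound[OF assms(1,2) D(2,3,4)] by (simp add: b_def)
    qed
    have c1: "norm (Cerr \<sigma> t) < \<bar>t\<bar>" "norm (Cerr (1 - \<sigma>) t) < \<bar>t\<bar>" using norm_Cerr_less[of _ t] assms t2 by auto
    have "\<exists>F. norm (R1 (Complex \<sigma> t) y x) \<le> (\<bar>t\<bar> / (2 * pi)) powr (1 / 2 - \<sigma>) * x powr (\<sigma> - 1) * F \<and>
                (if \<sigma> = 1 / 2 \<or> x = y then F = Etotal \<sigma> t x y r0 c l0 d
                 else F / Etotal (1 - \<sigma>) t x y r0 c l0 d \<le>
                   (if \<sigma> > 1 / 2 then 1 + norm (Cerr \<sigma> t) / \<bar>t\<bar>
                    else 1 + norm (Cerr (1 - \<sigma>) t) / (\<bar>t\<bar> - norm (Cerr (1 - \<sigma>) t))))"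
      if c: "if \<sigma> = 1 / 2 \<or> x = y then calE4 \<sigma> t c > 0 else calE4 (1 - \<sigma>) t c > 0"
    proof -
      consider "\<sigma> = 1/2" | "\<sigma> \<noteq> 1/2" "x = y" | "\<sigma> \<noteq> 1/2" "x \<noteq> y" by blast
      then show ?thesis
      proof cases
        case 1
        then have e: "1 - \<sigma> = \<sigma>" by simp
        have c': "calE4 \<sigma> t c > 0" using c unfolding 1 by simp
        show ?thesis
        proof (intro exI conjI)
          show "norm (R1 (Complex \<sigma> t) y x) \<le> (\<bar>t\<bar> / (2 * pi)) powr (1 / 2 - \<sigma>) * x powr (\<sigma> - 1) * Etotal \<sigma> t x y r0 c l0 d"
            by (rule swapped[unfolded e, OF c'])
        qed (use 1 in simp)
      next
        case 2
        \<comment> \<open>For x = y the two remainders coincide, and by t / (2 pi) = x^2 so do the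
          prefactors.\<close>
        have "(\<bar>t\<bar> / (2 * pi)) powr (1 / 2 - \<sigma>) * x powr (\<sigma> - 1) = x powr (- \<sigma>)"
        proof -
          have "\<bar>t\<bar> / (2 * pi) = x * x" using D(4) 2 by simp
          then have "(\<bar>t\<bar> / (2 * pi)) powr (1 / 2 - \<sigma>) = x powr (1 / 2 - \<sigma>) * x powr (1 / 2 - \<sigma>)" using D(2) by (simp add: powr_mult)
          then have "(\<bar>t\<bar> / (2 * pi)) powr (1 / 2 - \<sigma>) * x powr (\<sigma> - 1) = x powr ((1 / 2 - \<sigma>) + (1 / 2 - \<sigma>) + (\<sigma> - 1))" by (simp only: powr_add)
          then show ?thesis by (simp add: algebra_simps)
        qed
        then show ?thesis using direct c 2 by auto
      next
        case 3
        then have c4: "calE4 (1 - \<sigma>) t c > 0" using c by simp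
        \<comment> \<open>The witness is E (1 - \<sigma>) itself: its ratio is 1, and the permitted
          ratio is at least 1 because norm \<open>Cerr\<close> stays below the modulus of t.\<close>
        have "Etotal (1 - \<sigma>) t x y r0 c l0 d / Etotal (1 - \<sigma>) t x y r0 c l0 d = 1" using pos[OF c4] by simp
        moreover have "1 \<le> (if \<sigma> > 1 / 2 then 1 + norm (Cerr \<sigma> t) / \<bar>t\<bar> else 1 + norm (Cerr (1 - \<sigma>) t) / (\<bar>t\<bar> - norm (Cerr (1 - \<sigma>) t)))"
          using c1 by simp
        ultimately show ?thesis using swapped[OF c4] 3 by (intro exI[of _ "Etotal (1 - \<sigma>) t x y r0 c l0 d"]) auto
      qed
    qed
    then show "(calE4 \<sigma> t c > 0 \<longrightarrow>
           norm (R1 (Complex \<sigma> t) x y) \<le> x powr (- \<sigma>) * Etotal \<sigma> t x y r0 c l0 d) \<and>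
        ((if \<sigma> = 1 / 2 \<or> x = y then calE4 \<sigma> t c > 0 else calE4 (1 - \<sigma>) t c > 0) \<longrightarrow>
           (\<exists>F. norm (R1 (Complex \<sigma> t) y x)
                  \<le> (\<bar>t\<bar> / (2 * pi)) powr (1 / 2 - \<sigma>) * x powr (\<sigma> - 1) * F \<and>
                (if \<sigma> = 1 / 2 \<or> x = y then F = Etotal \<sigma> t x y r0 c l0 d
                 else F / Etotal (1 - \<sigma>) t x y r0 c l0 d \<le>
                   (if \<sigma> > 1 / 2 then 1 + norm (Cerr \<sigma> t) / \<bar>t\<bar>
                    else 1 + norm (Cerr (1 - \<sigma>) t) / (\<bar>t\<bar> - norm (Cerr (1 - \<sigma>) t))))))"
      using direct by blast
  qed
qed (use part_bounded[OF assms] part_tendsto_0[OF assms(1-4)] part_decreasing[OF assms(1-4)] in blast)+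

end
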